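(* Let $\Omega\subset\mathbb{R}^3$ be a periodicity box and $\nu>0$. There exist positive constants $c_8,c_9,c_{10},c_{11}$, depending only on $\Omega$ and $\nu$ (and not on $u_0$, $f$ or $T$), such that the following holds. Let $u_0\in V_1$ and let $u$ be the strong solution of the 3D Navier--Stokes equations with initial datum $u(0)=u_0$ and force $f$. (i) Let $0<T<\infty$. If $f\in V_0$ (a time-independent force) and $$c_{8}\,T\,\|f\|^{2}+c_{9}\,\|u(0)\|^{2}+\arctan\left(\|u(0)\|_{1}^{2}\right)<\frac{\pi}{2},$$ then $u$ exists on the whole interval $[0,T]$ and remains regular there, i.e. it is a strong solution on $[0,T]$. (ii) Let $0<T\le\infty$. If $f\in L^{2}(0,T;V_0)$ and $$c_{10}\int_{0}^{T}\|f(s)\|^{2}\,ds+c_{11}\,\|u(0)\|^{2}+\arctan\left(\|u(0)\|_{1}^{2}\right)<\frac{\pi}{2},$$ then $u$ exists on the whole time interval and remains regular, i.e. it is a strong solution on $[0,T']$ for every finite $T'\le T$; in particular, $T=\infty$ is allowed, and in that case $u$ is a global strong solution.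
   Context: $\Omega$ is a periodicity box in $\mathbb{R}^3$ and $\nu>0$ is the viscosity. $H^m_{per}(\Omega)$ is the Sobolev space of periodic functions with inner product $(u,v)=\sum_{|\beta|\le m}(D^\beta u,D^\beta v)_{L^2(\Omega)}$ and associated norm $\|u\|_m=\left(\sum_{|\beta|\le m}\|D^\beta u\|_{L^2(\Omega)}^2\right)^{1/2}$. $\|\cdot\|$ denotes the $L^2(\Omega)$ norm. $V_m$ is the completion, in the $H^m_{per}$ norm, of the smooth, divergence-free, periodic, zero-average vector fields on $\Omega$. $P$ is the $L^2$-orthogonal projection onto $V_0$, and $A=-P\Delta$ is the Stokes operator. The Navier--Stokes equations are $$\partial_t u-\nu\Delta u+u\cdot\nabla u=f,\qquad \operatorname{div}u=0,\qquad u(x,0)=u_0(x),$$ with periodic boundary conditions, the equation being understood after projection by $P$, that is, $\partial_t u+\nu Au+P(u\cdot\nabla u)=f$ (equivalently, modulo a pressure gradient). For finite $T>0$, a strong solution on $[0,T]$ is a solution $u\in L^\infty(0,T;V_1)\cap L^2(0,T;V_2)$. For $u_0\in V_1$ a unique strong solution exists at least on some short time interval. "The strong solution $u$" means this solution, continued as long as it remains a strong solution. *)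

theory Defs
  imports "HOL-Analysis.Analysis"
begin

text \<open>
  The periodicity box with side lengths \<^term>\<open>L $ i\<close> is \<^term>\<open>cbox 0 L\<close>. Elements of Lebesgue and
  Sobolev spaces are represented by everywhere defined functions that are everywhere periodic;
  they are identified when equal almost everywhere.
\<close>

type_synonym vfield = "real^3 \<Rightarrow> real^3"

abbreviation box_measure :: "real^3 \<Rightarrow> (real^3) measure" where
  "box_measure L \<equiv> lebesgue_on (cbox 0 L)"

definition periodic :: "real^3 \<Rightarrow> (real^3 \<Rightarrow> 'b) \<Rightarrow> bool" where
  "periodic L u \<longleftrightarrow> (\<forall>x i. u (x + L $ i *\<^sub>R axis i 1) = u x)"

subsection \<open>Classical derivatives and smooth fields\<close>

definition partial :: "3 \<Rightarrow> (real^3 \<Rightarrow> 'b::real_normed_vector) \<Rightarrow> real^3 \<Rightarrow> 'b" where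
  "partial i \<phi> x = frechet_derivative \<phi> (at x) (axis i 1)"

definition smooth :: "(real^3 \<Rightarrow> 'b::real_normed_vector) \<Rightarrow> bool" where
  "smooth \<phi> \<longleftrightarrow> (\<forall>is. foldr partial is \<phi> differentiable_on UNIV)"

definition mi_order :: "nat^3 \<Rightarrow> nat" where
  "mi_order \<beta> = (\<Sum>i\<in>UNIV. \<beta> $ i)"

definition multi_partial :: "nat^3 \<Rightarrow> (real^3 \<Rightarrow> 'b::real_normed_vector) \<Rightarrow> real^3 \<Rightarrow> 'b" where
  "multi_partial \<beta> \<phi> =
     (partial 1 ^^ (\<beta> $ 1)) ((partial 2 ^^ (\<beta> $ 2)) ((partial 3 ^^ (\<beta> $ 3)) \<phi>))"

definition divergence :: "vfield \<Rightarrow> real^3 \<Rightarrow> real" where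
  "divergence \<phi> x = (\<Sum>i\<in>UNIV. partial i \<phi> x $ i)"

definition smooth_solenoidal :: "real^3 \<Rightarrow> vfield set" where
  "smooth_solenoidal L =
     {\<phi>. smooth \<phi> \<and> periodic L \<phi> \<and> (\<forall>x. divergence \<phi> x = 0) \<and> (LINT x|box_measure L. \<phi> x) = 0}"

subsection \<open>Lebesgue and Sobolev spaces of periodic fields\<close>

definition L2_per :: "real^3 \<Rightarrow> vfield set" where
  "L2_per L = {u. periodic L u \<and> u \<in> borel_measurable (box_measure L) \<and>
                  integrable (box_measure L) (\<lambda>x. (norm (u x))\<^sup>2)}"

definition L2_inner :: "real^3 \<Rightarrow> vfield \<Rightarrow> vfield \<Rightarrow> real" where
  "L2_inner L u v = (LINT x|box_measure L. u x \<bullet> v x)"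

definition L2_norm :: "real^3 \<Rightarrow> vfield \<Rightarrow> real" where
  "L2_norm L u = sqrt (L2_inner L u u)"

definition is_weak_derivative :: "real^3 \<Rightarrow> nat^3 \<Rightarrow> vfield \<Rightarrow> vfield \<Rightarrow> bool" where
  "is_weak_derivative L \<beta> u g \<longleftrightarrow> g \<in> L2_per L \<and>
     (\<forall>\<phi> :: real^3 \<Rightarrow> real. smooth \<phi> \<longrightarrow> periodic L \<phi> \<longrightarrow>
        (LINT x|box_measure L. multi_partial \<beta> \<phi> x *\<^sub>R u x) =
        (-1) ^ mi_order \<beta> *\<^sub>R (LINT x|box_measure L. \<phi> x *\<^sub>R g x))"

definition sobolev_per :: "real^3 \<Rightarrow> nat \<Rightarrow> vfield set" where
  "sobolev_per L m = {u \<in> L2_per L. \<forall>\<beta>. mi_order \<beta> \<le> m \<longrightarrow> (\<exists>g. is_weak_derivative L \<beta> u g)}"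

text \<open>Weak derivatives are unique up to a null set; the choice of representative is immaterial.\<close>

definition weak_derivative :: "real^3 \<Rightarrow> nat^3 \<Rightarrow> vfield \<Rightarrow> vfield" where
  "weak_derivative L \<beta> u = (SOME g. is_weak_derivative L \<beta> u g)"

text \<open>The next definition is meaningful only on \<^term>\<open>sobolev_per L m\<close>.\<close>

definition sobolev_norm :: "real^3 \<Rightarrow> nat \<Rightarrow> vfield \<Rightarrow> real" where
  "sobolev_norm L m u = sqrt (\<Sum>\<beta> | mi_order \<beta> \<le> m. (L2_norm L (weak_derivative L \<beta> u))\<^sup>2)"

text \<open>The completion is realised as the closure in the complete space \<^term>\<open>sobolev_per L m\<close>.\<close>

definition V_space :: "real^3 \<Rightarrow> nat \<Rightarrow> vfield set" where
  "V_space L m = {u \<in> sobolev_per L m. \<exists>\<phi>. (\<forall>n. \<phi> n \<in> smooth_solenoidal L) \<and>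
                    (\<lambda>n::nat. sobolev_norm L m (\<lambda>x. u x - \<phi> n x)) \<longlonglongrightarrow> 0}"

subsection \<open>Stokes operator and nonlinear term\<close>

text \<open>The orthogonal projection of \<^term>\<open>u \<in> L2_per L\<close> is determined up to a null set.\<close>

definition leray_proj :: "real^3 \<Rightarrow> vfield \<Rightarrow> vfield" where
  "leray_proj L u =
     (SOME w. w \<in> V_space L 0 \<and> (\<forall>v\<in>V_space L 0. L2_inner L (\<lambda>x. u x - w x) v = 0))"

definition laplacian :: "real^3 \<Rightarrow> vfield \<Rightarrow> vfield" where
  "laplacian L u x = (\<Sum>i\<in>UNIV. weak_derivative L (axis i 2) u x)"

definition stokes :: "real^3 \<Rightarrow> vfield \<Rightarrow> vfield" where
  "stokes L u x = - leray_proj L (laplacian L u) x"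

definition advection :: "real^3 \<Rightarrow> vfield \<Rightarrow> vfield \<Rightarrow> vfield" where
  "advection L u v x = (\<Sum>i\<in>UNIV. u x $ i *\<^sub>R weak_derivative L (axis i 1) v x)"

subsection \<open>Bochner spaces over a time interval\<close>

text \<open>Strong (Bochner) measurability: a.e. limit of simple functions in the norm of the target.\<close>

definition bochner_measurable ::
    "real^3 \<Rightarrow> nat \<Rightarrow> real set \<Rightarrow> (real \<Rightarrow> vfield) \<Rightarrow> bool" where
  "bochner_measurable L m I u \<longleftrightarrow> (AE t in lebesgue_on I. u t \<in> V_space L m) \<and>
     (\<exists>s. (\<forall>n. simple_function (lebesgue_on I) (s n) \<and> (\<forall>t\<in>I. s n t \<in> V_space L m)) \<and>
          (AE t in lebesgue_on I.
             (\<lambda>n::nat. sobolev_norm L m (\<lambda>x. u t x - s n t x)) \<longlonglongrightarrow> 0))"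

definition L2_time :: "real^3 \<Rightarrow> nat \<Rightarrow> real set \<Rightarrow> (real \<Rightarrow> vfield) set" where
  "L2_time L m I = {u. bochner_measurable L m I u \<and>
                       integrable (lebesgue_on I) (\<lambda>t. (sobolev_norm L m (u t))\<^sup>2)}"

definition Linf_time :: "real^3 \<Rightarrow> nat \<Rightarrow> real set \<Rightarrow> (real \<Rightarrow> vfield) set" where
  "Linf_time L m I = {u. bochner_measurable L m I u \<and>
                         (\<exists>C. AE t in lebesgue_on I. sobolev_norm L m (u t) \<le> C)}"

subsection \<open>Strong solutions\<close>

text \<open>
  \<^term>\<open>g\<close> is the time derivative of \<^term>\<open>u\<close> in \<^term>\<open>L2_time L 0 {0..T}\<close>, and \<^term>\<open>u\<close> is the
  representative that is continuous in time with values in \<^term>\<open>V_space L 0\<close>: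
  \<open>u(t) = u(0) + \<integral>\<^sub>0\<^sup>t g(s) ds\<close> for every \<open>t\<close>. The \<open>V\<^sub>0\<close>-valued integral is expressed by
  testing against elements of \<open>V\<^sub>0\<close>.
\<close>

definition has_time_derivative ::
    "real^3 \<Rightarrow> real \<Rightarrow> (real \<Rightarrow> vfield) \<Rightarrow> (real \<Rightarrow> vfield) \<Rightarrow> bool" where
  "has_time_derivative L T u g \<longleftrightarrow> g \<in> L2_time L 0 {0..T} \<and>
     (\<forall>t\<in>{0..T}. u t \<in> V_space L 0 \<and>
        (\<forall>v\<in>V_space L 0.
           L2_inner L (u t) v = L2_inner L (u 0) v + (LINT s|lebesgue_on {0..t}. L2_inner L (g s) v)))"

definition strong_solution ::
    "real^3 \<Rightarrow> real \<Rightarrow> (real \<Rightarrow> vfield) \<Rightarrow> vfield \<Rightarrow> real \<Rightarrow> (real \<Rightarrow> vfield) \<Rightarrow> bool" where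
  "strong_solution L \<nu> f u\<^sub>0 T u \<longleftrightarrow>
     u \<in> Linf_time L 1 {0..T} \<and> u \<in> L2_time L 2 {0..T} \<and>
     (AE x in box_measure L. u 0 x = u\<^sub>0 x) \<and>
     (\<exists>u'. has_time_derivative L T u u' \<and>
        (AE t in lebesgue_on {0..T}. AE x in box_measure L.
           u' t x + \<nu> *\<^sub>R stokes L (u t) x + leray_proj L (advection L (u t) (u t)) x = f t x))"

text \<open>
  ``The'' strong solution exists up to time \<^term>\<open>T\<close> and is \<^term>\<open>u\<close>: it is a strong solution on
  \<^term>\<open>{0..T}\<close>, and any strong solution on a shorter interval (such as the local one) is its
  restriction.
\<close>

definition the_strong_solution ::
    "real^3 \<Rightarrow> real \<Rightarrow> (real \<Rightarrow> vfield) \<Rightarrow> vfield \<Rightarrow> real \<Rightarrow> (real \<Rightarrow> vfield) \<Rightarrow> bool" where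
  "the_strong_solution L \<nu> f u\<^sub>0 T u \<longleftrightarrow> strong_solution L \<nu> f u\<^sub>0 T u \<and>
     (\<forall>S v. 0 < S \<and> S \<le> T \<and> strong_solution L \<nu> f u\<^sub>0 S v \<longrightarrow>
        (\<forall>t\<in>{0..S}. AE x in box_measure L. v t x = u t x))"

definition time_interval :: "ereal \<Rightarrow> real set" where
  "time_interval T = {t. 0 \<le> t \<and> ereal t \<le> T}"

end

theory Submission
  imports Defs
begin

text \<open>
  On the Fourier side the equation reads \<open>u\<^sub>k' + \<nu> |q|\<^sup>2 u\<^sub>k + PB(u, u)\<^sub>k = F\<^sub>k\<close>, where \<open>q\<close> is the wave vector
  of the mode \<open>k\<close>. For a parameter \<open>\<theta> > 0\<close> put \<open>w\<^sub>k = \<theta> + |q|\<^sup>2 / \<theta>\<close>, so that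
  \<open>\<Sum>w\<^sub>k |u\<^sub>k|\<^sup>2 = \<theta> \<parallel>u\<parallel>\<^sup>2 + \<parallel>\<nabla>u\<parallel>\<^sup>2 / \<theta>\<close>. Since \<open>\<Sum>1 / (w\<^sub>k |q|\<^sup>2)\<close> is bounded uniformly
  in \<open>\<theta>\<close>, the Wiener norm \<open>\<Sum>|u\<^sub>k|\<close> obeys an Agmon inequality with a constant independent of
  \<open>\<theta>\<close>, and the Duhamel map is a contraction on small balls of the norm
  \<open>\<Sum>w\<^sub>k (sup\<^sub>t |u\<^sub>k|\<^sup>2 + |q|\<^sup>2 \<integral>|u\<^sub>k|\<^sup>2)\<close> whose radius does not depend on \<open>\<theta>\<close>. The free
  evolution is small in that norm for a suitable \<open>\<theta>\<close> as soon as
  \<open>D (D + \<parallel>u\<^sub>0\<parallel>\<^sub>1\<^sup>2 + 1)\<close> is small, where \<open>D = \<parallel>u\<^sub>0\<parallel>\<^sup>2 + \<integral>\<parallel>f\<parallel>\<^sup>2\<close>. This is what the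
  hypothesis \<open>C D < \<pi>/2 - arctan y\<close> with \<open>y = \<parallel>u\<^sub>0\<parallel>\<^sub>1\<^sup>2\<close> gives for large \<open>C\<close>, because
  \<open>\<pi>/2 - arctan y = arctan (1/y) \<le> 1/y\<close>. So the solution is obtained globally, without
  continuation of a local one. Any other strong solution agrees with it by a Gronwall argument for
  the coefficients.
\<close>

subsection \<open>Fourier modes of the periodicity box\<close>

text \<open>The hypothesis lets \<open>y\<close> be large as long as \<open>D\<close> is of order
  \<open>1 / y\<close>. No fixed norm of first order is then small, only the product of the
  \<open>L^2\<close> norm with the gradient norm; the two terms of the weight turn this product into
  a quadratic norm, at the price that every constant has to be free of \<theta>. Taking the supremum
  over time inside the sum over modes reduces the linear theory to scalar estimates for the kernel
  \<open>exp (- c * (t - s))\<close> and avoids continuity in time of field-valued functions. The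
  force is extended by 0 outside its interval and the equation is solved on the whole half line, so
  that one field serves every finite horizon and an infinite one is no special case. The statement
  speaks through closures, chosen representatives, weak derivatives and Bochner measurability; each
  of these is first translated into a condition on coefficients. The solution is found as a family
  of coefficients and has to be translated back: fields are chosen time by time, and their
  measurability in time is recovered from the coefficients.\<close>

locale torus =
  fixes L :: "real^3"
  assumes L_pos: "\<And>i. 0 < L $ i"
begin

abbreviation \<Omega> :: "(real^3) set" where "\<Omega> \<equiv> cbox 0 L"
abbreviation \<mu> :: "(real^3) measure" where "\<mu> \<equiv> box_measure L"

definition vol :: real where "vol = measure lebesgue \<Omega>"
definition wave :: "int^3 \<Rightarrow> real^3" where "wave k = (\<chi> i. 2 * pi * of_int (k $ i) / L $ i)"
definition expo :: "int^3 \<Rightarrow> real^3 \<Rightarrow> complex" where "expo k x = cis (wave k \<bullet> x)"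
text \<open>Normalised so that \<open>expo k\<close> has coefficient 1 at \<open>k\<close>; the
  price is a factor \<open>vol\<close> in every Parseval identity.\<close>

definition coef :: "(real^3 \<Rightarrow> complex) \<Rightarrow> int^3 \<Rightarrow> complex" where
  "coef f k = (LINT x|\<mu>. expo (-k) x * f x) / of_real vol"

lemma finite_measure_mu: "finite_measure \<mu>"
  by (rule finite_measure_lebesgue_on) (simp add: lmeasurable_cbox)

lemma vol_pos: "0 < vol"
proof -
  have "0 < measure lborel \<Omega>"
    by (rule content_pos_lt) (auto simp: Basis_vec_def inner_axis L_pos)
  then show ?thesis by (simp add: vol_def)
qed

lemma measure_mu: "measure \<mu> (space \<mu>) = vol"
  by (simp add: vol_def measure_restrict_space)

lemma wave_add: "wave (j + k) = wave j + wave k"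
  by (simp add: wave_def vec_eq_iff add_divide_distrib diff_divide_distrib ring_distribs)
lemma wave_minus: "wave (- k) = - wave k"
  by (simp add: wave_def vec_eq_iff)
lemma wave_0 [simp]: "wave 0 = 0"
  by (simp add: wave_def vec_eq_iff)
lemma wave_eq_0_iff [simp]: "wave k = 0 \<longleftrightarrow> k = 0"
proof -
  have "L $ i \<noteq> 0" for i using L_pos[of i] by simp
  then show ?thesis by (simp add: wave_def vec_eq_iff)
qed

lemma expo_add: "expo (j + k) x = expo j x * expo k x"
  by (simp add: expo_def wave_add inner_left_distrib cis_mult)
lemma expo_minus: "expo (- k) x = cnj (expo k x)"
  by (simp add: expo_def wave_minus cis_cnj)
lemma expo_0 [simp]: "expo 0 x = 1"
  by (simp add: expo_def)
lemma norm_expo [simp]: "cmod (expo k x) = 1"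
  by (simp add: expo_def)
lemma continuous_expo [continuous_intros]: "continuous_on S (expo k)"
  unfolding expo_def[abs_def] by (intro continuous_intros continuous_on_cis)
lemma expo_borel [measurable]: "expo k \<in> borel_measurable \<mu>"
  by (rule continuous_imp_measurable_on_sets_lebesgue[OF continuous_expo]) simp

lemma expo_periodic: "periodic L (expo k)"
proof -
  have "wave k \<bullet> (x + L $ i *\<^sub>R axis i 1) = wave k \<bullet> x + 2 * pi * of_int (k $ i)" for x i
    using L_pos[of i] by (simp add: inner_add_right inner_axis wave_def)
  then show ?thesis
    by (simp add: periodic_def expo_def flip: cis_mult)
qed

text \<open>The shifted box leaves the original one through the face where the \<open>i\<close>-th
  coordinate is \<open>L $ i\<close>. Periodicity moves the protruding slab back by one period,
  where it fills the gap left at the opposite face.\<close>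

lemma integral_translate_periodic:
  fixes \<phi> :: "real^3 \<Rightarrow> 'b::euclidean_space"
  assumes per: "periodic L \<phi>" and cont: "continuous_on UNIV \<phi>" and h: "0 \<le> h" "h \<le> L $ i"
  shows "integral \<Omega> (\<lambda>x. \<phi> (x + h *\<^sub>R axis i 1)) = integral \<Omega> \<phi>"
proof -
  let ?e = "axis i 1 :: real^3"
  have Bas: "?e \<in> Basis" by (simp add: axis_in_Basis_iff)
  have ion: "\<phi> integrable_on (cbox a b)" for a b
    by (rule integrable_continuous) (rule continuous_on_subset[OF cont], simp)
  have mem: "\<And>j. (x::real^3) \<bullet> ?e = x $ i" for x by (simp add: inner_axis)
  have lo: "cbox a b \<inter> {x. x \<bullet> ?e \<le> c} = cbox a (\<chi> j. if j = i then min (b $ i) c else b $ j)"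
    and hi: "cbox a b \<inter> {x. x \<bullet> ?e \<ge> c} = cbox (\<chi> j. if j = i then max (a $ i) c else a $ j) b" for a b c
    by (simp_all only: mem interval_split_cart[unfolded interval_cbox_cart])
  have vec: "axis i 1 $ j = (if j = i then 1 else 0 :: real)" for j
    by (simp add: axis_def)
  have "integral \<Omega> (\<lambda>x. \<phi> (x + h *\<^sub>R ?e)) = integral (cbox (h *\<^sub>R ?e) (L + h *\<^sub>R ?e)) \<phi>"
    using integral_shift_cbox[of "h *\<^sub>R ?e" "h *\<^sub>R ?e" "L + h *\<^sub>R ?e" \<phi>] by simp
  also have "\<dots> = integral (cbox (h *\<^sub>R ?e) (L + h *\<^sub>R ?e) \<inter> {x. x \<bullet> ?e \<le> L $ i}) \<phi>
                 + integral (cbox (h *\<^sub>R ?e) (L + h *\<^sub>R ?e) \<inter> {x. x \<bullet> ?e \<ge> L $ i}) \<phi>"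
    by (rule integral_split[OF ion Bas])
  also have "cbox (h *\<^sub>R ?e) (L + h *\<^sub>R ?e) \<inter> {x. x \<bullet> ?e \<le> L $ i} = cbox (h *\<^sub>R ?e) L"
    unfolding lo using h by (intro arg_cong2[where f=cbox]) (auto simp: vec_eq_iff vec)
  also have "cbox (h *\<^sub>R ?e) (L + h *\<^sub>R ?e) \<inter> {x. x \<bullet> ?e \<ge> L $ i} = cbox (L $ i *\<^sub>R ?e) (L + h *\<^sub>R ?e)"
    unfolding hi using h by (intro arg_cong2[where f=cbox]) (auto simp: vec_eq_iff vec)
  also have "integral (cbox (L $ i *\<^sub>R ?e) (L + h *\<^sub>R ?e)) \<phi> = integral (cbox 0 (L + h *\<^sub>R ?e - L $ i *\<^sub>R ?e)) \<phi>"
    using integral_shift_cbox[of "L $ i *\<^sub>R ?e" "L $ i *\<^sub>R ?e" "L + h *\<^sub>R ?e" \<phi>] per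
    by (simp add: periodic_def)
  finally have 1: "integral \<Omega> (\<lambda>x. \<phi> (x + h *\<^sub>R ?e)) =
      integral (cbox (h *\<^sub>R ?e) L) \<phi> + integral (cbox 0 (L + h *\<^sub>R ?e - L $ i *\<^sub>R ?e)) \<phi>" .
  have "integral \<Omega> \<phi> = integral (\<Omega> \<inter> {x. x \<bullet> ?e \<le> h}) \<phi> + integral (\<Omega> \<inter> {x. x \<bullet> ?e \<ge> h}) \<phi>"
    by (rule integral_split[OF ion Bas])
  also have "\<Omega> \<inter> {x. x \<bullet> ?e \<ge> h} = cbox (h *\<^sub>R ?e) L"
    unfolding hi using h by (intro arg_cong2[where f=cbox]) (auto simp: vec_eq_iff vec)
  also have "\<Omega> \<inter> {x. x \<bullet> ?e \<le> h} = cbox 0 (L + h *\<^sub>R ?e - L $ i *\<^sub>R ?e)"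
    unfolding lo using h by (intro arg_cong2[where f=cbox]) (auto simp: vec_eq_iff vec)
  finally show ?thesis by (metis 1 add.commute)
qed

lemma partial_line_derivative:
  fixes \<phi> :: "real^3 \<Rightarrow> 'b::real_normed_vector"
  assumes "\<phi> differentiable (at (x + h *\<^sub>R axis i 1))"
  shows "((\<lambda>h. \<phi> (x + h *\<^sub>R axis i 1)) has_vector_derivative partial i \<phi> (x + h *\<^sub>R axis i 1)) (at h within S)"
proof -
  let ?D = "frechet_derivative \<phi> (at (x + h *\<^sub>R axis i 1))"
  have D: "(\<phi> has_derivative ?D) (at (x + h *\<^sub>R axis i 1))"
    using assms by (simp add: frechet_derivative_works)
  have "((\<lambda>h. x + h *\<^sub>R axis i 1) has_derivative (\<lambda>d. d *\<^sub>R axis i 1)) (at h within S)"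
    by (auto intro!: derivative_eq_intros)
  from has_derivative_compose[OF this D]
  have "((\<lambda>h. \<phi> (x + h *\<^sub>R axis i 1)) has_derivative (\<lambda>d. ?D (d *\<^sub>R axis i 1))) (at h within S)" .
  moreover have "?D (d *\<^sub>R axis i 1) = d *\<^sub>R ?D (axis i 1)" for d
    using has_derivative_bounded_linear[OF D] by (simp add: bounded_linear.linear linear_cmul)
  ultimately show ?thesis by (simp add: has_vector_derivative_def partial_def)
qed

text \<open>The integral of \<phi> over the shifted box does not depend on the shift, so its
  derivative at 0 vanishes; by the Leibniz rule this derivative is the integral of
  \<open>partial i \<phi>\<close>. It stands in for integration by parts on the torus.\<close>

lemma integral_partial_periodic:
  fixes \<phi> :: "real^3 \<Rightarrow> 'b::euclidean_space"
  assumes per: "periodic L \<phi>" and diff: "\<phi> differentiable_on UNIV"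
    and cont: "continuous_on UNIV (partial i \<phi>)"
  shows "(LINT x|\<mu>. partial i \<phi> x) = 0"
proof -
  let ?e = "axis i 1 :: real^3"
  define F where "F h = integral \<Omega> (\<lambda>x. \<phi> (x + h *\<^sub>R ?e))" for h
  have cphi: "continuous_on UNIV \<phi>" using diff by (rule differentiable_imp_continuous_on)
  have d: "\<phi> differentiable (at x)" for x using diff by (simp add: differentiable_on_def)
  \<comment> \<open>The derivative is one-sided, since translation invariance is only available for
    shifts between 0 and one period.\<close>
  have der: "((\<lambda>h. integral \<Omega> (\<lambda>x. \<phi> (x + h *\<^sub>R ?e))) has_vector_derivative
       integral \<Omega> (\<lambda>x. partial i \<phi> (x + 0 *\<^sub>R ?e))) (at 0 within {0..L $ i})"
  proof (rule leibniz_rule_vector_derivative)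
    show "((\<lambda>h. \<phi> (t + h *\<^sub>R ?e)) has_vector_derivative partial i \<phi> (t + h *\<^sub>R ?e)) (at h within {0..L $ i})" for h t
      by (rule partial_line_derivative[OF d])
    show "(\<lambda>x. \<phi> (x + h *\<^sub>R ?e)) integrable_on \<Omega>" for h
      by (intro integrable_continuous continuous_on_compose2[OF cphi] continuous_intros) auto
    show "continuous_on ({0..L $ i} \<times> \<Omega>) (\<lambda>(h, t). partial i \<phi> (t + h *\<^sub>R ?e))"
      unfolding case_prod_beta by (intro continuous_on_compose2[OF cont] continuous_intros) auto
  qed (use L_pos[of i] in auto)
  have Fh: "F h = F 0" if "h \<in> {0..L $ i}" for h
    unfolding F_def using integral_translate_periodic[OF per cphi, of h i] that by auto
  have "(F has_vector_derivative 0) (at 0 within {0..L $ i})"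
    by (rule has_vector_derivative_transform[OF _ Fh has_vector_derivative_const])
      (use L_pos[of i] in auto)
  with der have "integral \<Omega> (partial i \<phi>) = 0"
    using vector_derivative_unique_within_closed_interval[of 0 "L $ i" 0 F "integral \<Omega> (partial i \<phi>)" 0] L_pos[of i]
    unfolding F_def[abs_def] box_real by simp
  moreover have "integrable \<mu> (partial i \<phi>)"
    by (rule continuous_imp_integrable[OF continuous_on_subset[OF cont]]) simp
  ultimately show ?thesis by (simp add: lebesgue_integral_eq_integral)
qed

lemma expo_has_derivative:
  "(expo k has_derivative (\<lambda>h. \<i> * of_real (wave k \<bullet> h) * expo k x)) (at x)"
proof -
  have "((\<lambda>x. \<i> * of_real (wave k \<bullet> x)) has_derivative (\<lambda>h. \<i> * of_real (wave k \<bullet> h))) (at x)"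
    by (intro bounded_linear.has_derivative[OF bounded_linear_mult_right]
        bounded_linear.has_derivative[OF bounded_linear_of_real] has_derivative_inner_right has_derivative_ident)
  from has_derivative_compose[OF this DERIV_exp[unfolded has_field_derivative_def]]
  have "((\<lambda>x. exp (\<i> * of_real (wave k \<bullet> x))) has_derivative
      (\<lambda>h. \<i> * of_real (wave k \<bullet> h) * exp (\<i> * of_real (wave k \<bullet> x)))) (at x)"
    by (simp add: mult.commute)
  then show ?thesis by (simp add: expo_def[abs_def] cis_conv_exp)
qed

lemma partial_eqI: "(\<phi> has_derivative D) (at x) \<Longrightarrow> partial i \<phi> x = D (axis i 1)"
  using frechet_derivative_at[of \<phi> D x] by (simp add: partial_def)

lemma partial_expo: "partial i (expo k) x = \<i> * of_real (wave k $ i) * expo k x"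
  by (simp add: partial_eqI[OF expo_has_derivative] inner_axis)

lemma expo_differentiable: "expo k differentiable_on UNIV"
  using expo_has_derivative by (auto simp: differentiable_on_def differentiable_def intro: has_derivative_at_withinI)

text \<open>For \<open>k \<noteq> 0\<close> some component of the wave vector is nonzero, so
  \<open>expo k\<close> is a multiple of one of its own partial derivatives.\<close>

lemma integral_expo: "(LINT x|\<mu>. expo k x) = (if k = 0 then of_real vol else 0)"
proof (cases "k = 0")
  case True
  then show ?thesis using measure_mu by (simp add: scaleR_conv_of_real)
next
  case False
  then obtain i where i: "wave k $ i \<noteq> 0" by (metis wave_eq_0_iff vec_eq_iff zero_index)
  have "partial i (expo k) = (\<lambda>x. \<i> * of_real (wave k $ i) * expo k x)" by (rule ext) (rule partial_expo)
  moreover from this have "(LINT x|\<mu>. partial i (expo k) x) = 0"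
    by (intro integral_partial_periodic expo_periodic expo_differentiable) (auto intro!: continuous_intros)
  ultimately show ?thesis using i False by simp
qed

end

subsection \<open>Density of trigonometric polynomials\<close>

context torus begin

inductive trigp :: "(real^3 \<Rightarrow> complex) \<Rightarrow> bool" where
  mono: "trigp (\<lambda>x. c * expo k x)"
| add: "trigp f \<Longrightarrow> trigp g \<Longrightarrow> trigp (\<lambda>x. f x + g x)"

lemma trigp_mult:
  assumes "trigp f" "trigp g" shows "trigp (\<lambda>x. f x * g x)"
proof -
  have 1: "trigp (\<lambda>x. c * expo k x * g x)" if "trigp g" for c k g
    using that
  proof induct
    case (mono d j)
    have "(\<lambda>x. c * expo k x * (d * expo j x)) = (\<lambda>x. (c * d) * expo (k + j) x)"
      by (simp add: expo_add mult_ac)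
    then show ?case by (metis trigp.mono)
  next
    case (add f g)
    then show ?case by (simp add: distrib_left trigp.add)
  qed
  from assms(1) show ?thesis
  proof induct
    case (mono c k)
    then show ?case using 1[OF assms(2)] .
  next
    case (add f h)
    then show ?case by (simp add: distrib_right trigp.add)
  qed
qed

lemma trigp_const: "trigp (\<lambda>x. c)"
  using trigp.mono[of c 0] by simp

text \<open>
  Embeds the torus in a Euclidean space, so that trigonometric polynomials become restrictions of
  polynomial functions and Stone--Weierstrass applies.
\<close>

definition tmap :: "real^3 \<Rightarrow> complex^3" where "tmap x = (\<chi> i. expo (axis i 1) x)"

text \<open>A real-linear function of the torus coordinates combines real and imaginary parts of the
  \<open>expo (axis i 1)\<close>, hence exponentials with \<open>k\<close> and \<open>-k\<close>;
  sums and products stay within trigonometric polynomials.\<close>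

lemma trigp_polynomial:
  assumes "real_polynomial_function p"
  shows "trigp (\<lambda>x. of_real (p (tmap x)))"
  using assms
proof induct
  case (linear h)
  interpret h: bounded_linear h by fact
  have comp: "trigp (\<lambda>x. of_real (Re (expo k x) * a + Im (expo k x) * b))" for k a b
  proof -
    have "(\<lambda>x. of_real (Re (expo k x) * a + Im (expo k x) * b)) =
        (\<lambda>x. (of_real a - \<i> * of_real b) / 2 * expo k x + (of_real a + \<i> * of_real b) / 2 * expo (-k) x)"
      by (rule ext) (simp add: expo_minus complex_eq_iff field_simps)
    then show ?thesis by (simp only:) (intro trigp.intros)
  qed
  have z: "(\<Sum>i\<in>UNIV. Re (z $ i) *\<^sub>R axis i 1 + Im (z $ i) *\<^sub>R axis i \<i>) = z" for z :: "complex^3"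
    by (simp add: vec_eq_iff forall_3 sum_3 axis_def complex_eq_iff)
  have "h (\<Sum>i\<in>UNIV. Re (z $ i) *\<^sub>R axis i 1 + Im (z $ i) *\<^sub>R axis i \<i>) =
      (\<Sum>i\<in>UNIV. Re (z $ i) * h (axis i 1) + Im (z $ i) * h (axis i \<i>))" for z
    by (simp add: h.sum h.add h.scaleR)
  then have hz: "h z = (\<Sum>i\<in>UNIV. Re (z $ i) * h (axis i 1) + Im (z $ i) * h (axis i \<i>))" for z
    unfolding z .
  have "(\<lambda>x. complex_of_real (h (tmap x))) =
     (\<lambda>x. of_real (Re (expo (axis 1 1) x) * h (axis 1 1) + Im (expo (axis 1 1) x) * h (axis 1 \<i>))
     + of_real (Re (expo (axis 2 1) x) * h (axis 2 1) + Im (expo (axis 2 1) x) * h (axis 2 \<i>))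
     + of_real (Re (expo (axis 3 1) x) * h (axis 3 1) + Im (expo (axis 3 1) x) * h (axis 3 \<i>)))"
    by (rule ext, subst hz) (simp add: sum_3 tmap_def)
  then show ?case by (simp only:) (intro trigp.add comp)
next
  case (const c)
  show ?case by (rule trigp_const)
next
  case (add f g)
  then show ?case by (simp add: trigp.add)
next
  case (mult f g)
  then show ?case by (simp add: trigp_mult)
qed

section \<open>Functions whose Fourier coefficients all vanish\<close>

lemma integrable_expo_mult:
  assumes "integrable \<mu> f" shows "integrable \<mu> (\<lambda>x. expo k x * f x)"
proof -
  have [measurable]: "f \<in> borel_measurable \<mu>" using assms by auto
  show ?thesis by (rule Bochner_Integration.integrable_bound[OF assms]) (auto simp: norm_mult)
qed

lemma integral_trigp_mult_eq_0:
  assumes f: "integrable \<mu> f" and 0: "\<And>k. coef f k = 0" and "trigp g"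
  shows "integrable \<mu> (\<lambda>x. g x * f x) \<and> (LINT x|\<mu>. g x * f x) = 0"
  using assms(3)
proof induct
  case (mono c k)
  have "(LINT x|\<mu>. expo k x * f x) = 0"
    using 0[of "-k"] vol_pos by (simp add: coef_def)
  then show ?case using integrable_expo_mult[OF f, of k] by (simp add: mult.assoc)
next
  case (add g h)
  then show ?case by (simp add: distrib_right)
qed

lemma continuous_tmap: "continuous_on S tmap"
  unfolding tmap_def by (intro continuous_intros)

lemma norm_tmap: "norm (tmap x) \<le> 3"
proof -
  have "norm (tmap x) \<le> (\<Sum>i\<in>UNIV. norm (tmap x $ i))"
    unfolding norm_vec_def by (rule L2_set_le_sum) simp
  then show ?thesis by (simp add: tmap_def)
qed

text \<open>Orthogonality to trigonometric polynomials extends to every continuous function of the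
  torus coordinates: a uniform error \<open>e\<close> on the ball of radius 3, which contains the
  image of \<open>tmap\<close>, costs at most \<open>e\<close> times the \<open>L^1\<close> norm of
  \<open>f\<close>.\<close>

lemma integral_tmap_mult_eq_0:
  fixes G :: "complex^3 \<Rightarrow> real"
  assumes f: "integrable \<mu> f" and 0: "\<And>k. coef f k = 0" and G: "continuous_on UNIV G"
  shows "(LINT x|\<mu>. of_real (G (tmap x)) * f x) = 0"
proof -
  have [measurable]: "f \<in> borel_measurable \<mu>" using f by auto
  let ?S = "cball (0::complex^3) 3"
  let ?N = "LINT x|\<mu>. cmod (f x)"
  have [measurable]: "(\<lambda>x. G (tmap x)) \<in> borel_measurable \<mu>"
    by (rule continuous_imp_measurable_on_sets_lebesgue)
      (auto intro: continuous_on_compose2[OF G continuous_tmap])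
  have "compact (G ` ?S)" using G by (intro compact_continuous_image continuous_on_subset[OF G]) auto
  then obtain M where M: "\<And>z. z \<in> ?S \<Longrightarrow> \<bar>G z\<bar> \<le> M"
    using compact_imp_bounded bounded_iff by (metis image_eqI real_norm_def)
  have intG: "integrable \<mu> (\<lambda>x. of_real (G (tmap x)) * f x)"
    using M norm_tmap by (intro Bochner_Integration.integrable_bound[OF integrable_mult_right[OF f, of M]])
      (force simp: norm_mult intro!: mult_right_mono order_trans[OF _ abs_ge_self])+
  have "cmod (LINT x|\<mu>. of_real (G (tmap x)) * f x) \<le> e * ?N" if "e > 0" for e
  proof -
    obtain p where p: "real_polynomial_function p" "\<And>z. z \<in> ?S \<Longrightarrow> \<bar>G z - p z\<bar> < e"
      by (rule Stone_Weierstrass_real_polynomial_function[of ?S G e])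
        (use that \<open>e > 0\<close> continuous_on_subset[OF G] in auto)
    note P = integral_trigp_mult_eq_0[OF f 0 trigp_polynomial[OF p(1)]]
    have "(LINT x|\<mu>. of_real (G (tmap x)) * f x) = (LINT x|\<mu>. of_real (G (tmap x)) * f x - of_real (p (tmap x)) * f x)"
      using P intG by simp
    also have "cmod \<dots> \<le> (LINT x|\<mu>. e * cmod (f x))"
    proof (rule order_trans[OF integral_norm_bound integral_mono])
      show "integrable \<mu> (\<lambda>x. cmod (of_real (G (tmap x)) * f x - of_real (p (tmap x)) * f x))"
        using P intG by simp
      show "integrable \<mu> (\<lambda>x. e * cmod (f x))" using f by simp
      fix x
      have "cmod (of_real (G (tmap x)) * f x - of_real (p (tmap x)) * f x) = \<bar>G (tmap x) - p (tmap x)\<bar> * cmod (f x)"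
        by (simp flip: left_diff_distrib of_real_diff add: norm_mult)
      also have "\<dots> \<le> e * cmod (f x)"
        using p(2)[of "tmap x"] norm_tmap[of x] by (intro mult_right_mono) auto
      finally show "cmod (of_real (G (tmap x)) * f x - of_real (p (tmap x)) * f x) \<le> e * cmod (f x)" .
    qed
    finally show ?thesis by simp
  qed
  note * = this
  have N0: "0 \<le> ?N" by simp
  have "cmod (LINT x|\<mu>. of_real (G (tmap x)) * f x) \<le> 0"
  proof (rule field_le_epsilon)
    fix e :: real assume "0 < e"
    then have "cmod (LINT x|\<mu>. of_real (G (tmap x)) * f x) \<le> e / (?N + 1) * ?N"
      using N0 by (intro *) (simp add: add_nonneg_pos)
    also have "e / (N + 1) * N \<le> e" if "0 \<le> N" for N :: real
      using that \<open>0 < e\<close> by (simp add: field_simps)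
    then have "e / (?N + 1) * ?N \<le> e" using N0 .
    finally show "cmod (LINT x|\<mu>. of_real (G (tmap x)) * f x) \<le> 0 + e" by simp
  qed
  then show ?thesis by simp
qed

text \<open>Opposite faces have the same image, so one of the points has to be interior. The
  coordinates then differ by less than a period and by a multiple of it.\<close>

lemma tmap_inj:
  assumes "x \<in> \<Omega>" "y \<in> box 0 L" "tmap x = tmap y" shows "x = y"
proof (rule vec_eq_iff[THEN iffD2, rule_format])
  fix i
  have L: "0 < L $ i" by (rule L_pos)
  have "wave (axis i 1) = (2 * pi / L $ i) *\<^sub>R axis i 1"
    by (simp add: wave_def vec_eq_iff axis_def)
  then have "wave (axis i 1) \<bullet> z = 2 * pi * z $ i / L $ i" for z
    by (simp add: inner_axis')
  then have "cis (2 * pi * x $ i / L $ i) = cis (2 * pi * y $ i / L $ i)"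
    using arg_cong[OF assms(3), of "\<lambda>z. z $ i"] by (simp add: tmap_def expo_def)
  then obtain n :: int where n: "2 * pi * x $ i / L $ i = 2 * pi * y $ i / L $ i + 2 * pi * n"
    using sin_cos_eq_iff by (metis cis.sel)
  then have "2 * pi * (x $ i / L $ i) = 2 * pi * (y $ i / L $ i + n)" by (simp add: algebra_simps)
  then have "x $ i / L $ i = y $ i / L $ i + n" unfolding mult_cancel_left by simp
  then have eq: "x $ i - y $ i = n * L $ i" using L by (simp add: field_simps)
  have "0 \<le> x $ i" "x $ i \<le> L $ i" "0 < y $ i" "y $ i < L $ i"
    using assms by (auto simp: mem_box_cart)
  then have "\<bar>n * L $ i\<bar> < L $ i" unfolding eq[symmetric] by linarith
  then have "n = 0" using L by (simp add: abs_mult)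
  then show "x $ i = y $ i" using eq by simp
qed

text \<open>The cut-offs \<open>G n\<close> are continuous on the torus and converge to the
  indicator of the image of \<open>B\<close>. As \<open>B\<close> avoids the faces,
  \<open>tmap_inj\<close> shows that this indicator pulls back to the one of
  \<open>B\<close>.\<close>

lemma integral_compact_eq_0:
  assumes f: "integrable \<mu> f" and 0: "\<And>k. coef f k = 0" and B: "compact B" "B \<subseteq> box 0 L"
  shows "(LINT x|\<mu>. indicator B x * f x) = 0"
proof (cases "B = {}")
  case False
  have [measurable]: "f \<in> borel_measurable \<mu>" using f by auto
  have [measurable]: "B \<in> sets \<mu>" using B box_subset_cbox[of 0 L]
    by (auto simp: sets_restrict_space_iff lmeasurable_compact fmeasurableD)
  define K where "K = tmap ` B"
  have K: "closed K" "K \<noteq> {}"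
    using B False unfolding K_def
    by (auto intro!: compact_imp_closed compact_continuous_image continuous_tmap)
  define G where "G n w = max 0 (1 - real n * infdist w K)" for n w
  have G: "continuous_on UNIV (G n)" for n unfolding G_def by (intro continuous_intros)
  have [measurable]: "(\<lambda>x. G n (tmap x)) \<in> borel_measurable \<mu>" for n
    by (rule continuous_imp_measurable_on_sets_lebesgue)
      (auto intro: continuous_on_compose2[OF G continuous_tmap])
  have G1: "\<bar>G n w\<bar> \<le> 1" for n w using infdist_nonneg[of w K] by (auto simp: G_def)
  have lim: "(\<lambda>n. of_real (G n (tmap x)) * f x) \<longlonglongrightarrow> indicator B x * f x" if "x \<in> \<Omega>" for x
  proof (cases "x \<in> B")
    case True
    then have "infdist (tmap x) K = 0" by (simp add: K_def)
    then show ?thesis using True by (simp add: G_def)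
  next
    case False
    then have "tmap x \<notin> K" using tmap_inj[OF that] B by (auto simp: K_def)
    then have pos: "infdist (tmap x) K > 0" using K
      by (metis in_closed_iff_infdist_zero infdist_nonneg less_eq_real_def)
    obtain N where N: "1 < real N * infdist (tmap x) K"
      using reals_Archimedean3[OF pos] by blast
    have "G n (tmap x) = 0" if "n \<ge> N" for n
    proof -
      have "real N * infdist (tmap x) K \<le> real n * infdist (tmap x) K"
        using that pos by (intro mult_right_mono) auto
      then show ?thesis using N by (simp add: G_def)
    qed
    then have "eventually (\<lambda>n. of_real (G n (tmap x)) * f x = indicator B x * f x) sequentially"
      using False by (auto simp: eventually_sequentially)
    then show ?thesis by (rule tendsto_eventually)
  qed
  have "(\<lambda>n. LINT x|\<mu>. of_real (G n (tmap x)) * f x) \<longlonglongrightarrow> (LINT x|\<mu>. indicator B x * f x)"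
  proof (rule integral_dominated_convergence[where w="\<lambda>x. cmod (f x)"])
    show "AE x in \<mu>. (\<lambda>n. of_real (G n (tmap x)) * f x) \<longlonglongrightarrow> indicator B x * f x"
      using lim by (intro AE_I2) simp
    show "AE x in \<mu>. cmod (of_real (G n (tmap x)) * f x) \<le> cmod (f x)" for n
      using G1[of n] by (intro AE_I2) (auto simp: norm_mult intro: mult_left_le_one_le)
  qed (use f in auto)
  then show ?thesis
    unfolding integral_tmap_mult_eq_0[OF f 0 G] by (simp add: LIMSEQ_const_iff)
qed simp

text \<open>If \<open>g\<close> were positive on a set of positive measure, inner regularity would
  give a compact subset of positive measure inside the open box, over which the integral of
  \<open>g\<close> could not be 0. The faces form a null set.\<close>

lemma AE_nonpos_of_integral_compact:
  fixes g :: "real^3 \<Rightarrow> real"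
  assumes g: "integrable \<mu> g" and B: "\<And>B. compact B \<Longrightarrow> B \<subseteq> box 0 L \<Longrightarrow> (LINT x|\<mu>. indicator B x * g x) = 0"
  shows "AE x in \<mu>. g x \<le> 0"
proof -
  have [measurable]: "g \<in> borel_measurable \<mu>" using g by auto
  define S where "S = {x \<in> box 0 L. g x > 0}"
  have "{x \<in> space \<mu>. g x > 0} \<in> sets \<mu>" by measurable
  then have "{x \<in> \<Omega>. g x > 0} \<in> sets lebesgue"
    by (simp add: sets_restrict_space_iff)
  then have "{x \<in> \<Omega>. g x > 0} \<inter> box 0 L \<in> sets lebesgue" by (intro sets.Int) auto
  also have "{x \<in> \<Omega>. g x > 0} \<inter> box 0 L = S" using box_subset_cbox by (auto simp: S_def)
  finally have S: "S \<in> sets lebesgue" .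
  have "emeasure lebesgue S = 0"
  proof (rule ccontr)
    assume ne: "emeasure lebesgue S \<noteq> 0"
    have fin: "S \<in> lmeasurable" using S by (rule bounded_set_imp_lmeasurable[rotated])
       (auto intro: bounded_subset[OF bounded_box] simp: S_def)
    then have "measure lebesgue S > 0" using ne
      by (metis emeasure_eq_measure2 measure_nonneg less_eq_real_def ennreal_0)
    then obtain T where T: "closed T" "T \<subseteq> S" "S - T \<in> lmeasurable" "emeasure lebesgue (S - T) < ennreal (measure lebesgue S)"
      using sets_lebesgue_inner_closed[OF S] by metis
    have cT: "compact T" "T \<subseteq> box 0 L" using T
      by (auto simp: compact_eq_bounded_closed S_def intro: bounded_subset[OF bounded_box])
    have Tm: "T \<in> sets lebesgue" using cT by (simp add: lmeasurable_compact fmeasurableD)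
    have Tmu[measurable]: "T \<in> sets \<mu>" using cT Tm box_subset_cbox
      by (auto simp: sets_restrict_space_iff)
    have "integrable \<mu> (\<lambda>x. indicator T x * g x)" using g by (simp add: integrable_real_mult_indicator mult.commute)
    moreover have "AE x in \<mu>. 0 \<le> indicator T x * g x" using T by (intro AE_I2) (auto simp: indicator_def S_def)
    ultimately have "AE x in \<mu>. indicator T x * g x = 0"
      using B[OF cT] integral_nonneg_eq_0_iff_AE by blast
    then have "AE x in \<mu>. x \<notin> T"
    proof eventually_elim
      case (elim x)
      then show ?case using T(2) by (auto simp: indicator_def S_def)
    qed
    then have "AE x in lebesgue. x \<in> \<Omega> \<longrightarrow> x \<notin> T" by (simp add: AE_restrict_space_iff)
    then have "AE x in lebesgue. x \<notin> T"
    proof eventually_elim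
      case (elim x)
      then show ?case using cT box_subset_cbox[of 0 L] by auto
    qed
    then have "emeasure lebesgue T = 0" using Tm by (simp add: AE_iff_measurable[OF _ refl])
    moreover have "emeasure lebesgue S = emeasure lebesgue (S - T) + emeasure lebesgue T"
    proof -
      have "emeasure lebesgue (S - T) + emeasure lebesgue T = emeasure lebesgue ((S - T) \<union> T)"
        by (rule plus_emeasure) (use S Tm in auto)
      moreover have "(S - T) \<union> T = S" using T(2) by auto
      ultimately show ?thesis by (simp only:)
    qed
    ultimately show False using T(4) fin by (simp add: emeasure_eq_measure2)
  qed
  then have "S \<in> null_sets lebesgue" using S by auto
  then have "AE x in lebesgue. x \<notin> S" by (rule AE_not_in)
  moreover have "AE x in lebesgue. x \<notin> \<Omega> - box 0 L"
    by (rule AE_not_in) (use negligible_frontier_interval in \<open>simp add: negligible_iff_null_sets\<close>)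
  ultimately have "AE x in lebesgue. x \<in> \<Omega> \<longrightarrow> g x \<le> 0"
    by eventually_elim (auto simp: S_def)
  then show ?thesis by (simp add: AE_restrict_space_iff)
qed

text \<open>Completeness of the exponentials in \<open>L^1\<close>, obtained by applying the sign
  lemma to the real part, the imaginary part and their negatives.\<close>

lemma coef_eq_0_imp_AE_0:
  assumes f: "integrable \<mu> f" and 0: "\<And>k. coef f k = 0"
  shows "AE x in \<mu>. f x = 0"
proof -
  have [measurable]: "f \<in> borel_measurable \<mu>" using f by auto
  have ind: "integrable \<mu> (\<lambda>x. indicator B x * f x)" if "compact B" "B \<subseteq> box 0 L" for B
  proof -
    have "B \<in> sets \<mu>" using that box_subset_cbox[of 0 L]
      by (auto simp: sets_restrict_space_iff lmeasurable_compact fmeasurableD)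
    then have "integrable \<mu> (\<lambda>x. indicator B x *\<^sub>R f x)" using f by (rule integrable_mult_indicator)
    then show ?thesis by (simp add: scaleR_conv_of_real of_real_indicator)
  qed
  have re: "(LINT x|\<mu>. indicator B x * Re (f x)) = 0" and im: "(LINT x|\<mu>. indicator B x * Im (f x)) = 0"
    if B: "compact B" "B \<subseteq> box 0 L" for B
  proof -
    have "(\<lambda>x. Re (indicator B x * f x)) = (\<lambda>x. indicator B x * Re (f x))"
      "(\<lambda>x. Im (indicator B x * f x)) = (\<lambda>x. indicator B x * Im (f x))"
      by (auto simp: indicator_def)
    then show "(LINT x|\<mu>. indicator B x * Re (f x)) = 0" "(LINT x|\<mu>. indicator B x * Im (f x)) = 0"
      using integral_Re[OF ind[OF B]] integral_Im[OF ind[OF B]] integral_compact_eq_0[OF f 0 B] by auto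
  qed
  have "AE x in \<mu>. Re (f x) \<le> 0"
    by (rule AE_nonpos_of_integral_compact) (use f re in auto)
  moreover have "AE x in \<mu>. Im (f x) \<le> 0"
    by (rule AE_nonpos_of_integral_compact) (use f im in auto)
  moreover have "AE x in \<mu>. - Re (f x) \<le> 0"
    by (rule AE_nonpos_of_integral_compact) (use f re in auto)
  moreover have "AE x in \<mu>. - Im (f x) \<le> 0"
    by (rule AE_nonpos_of_integral_compact) (use f im in auto)
  ultimately show ?thesis by eventually_elim (simp add: complex_eq_iff)
qed

end

text \<open>Series over modes are integrals for the counting measure, so that dominated convergence,
  Fatou, Fubini and the integral form of Cauchy-Schwarz apply to them directly.\<close>

abbreviation modes :: "(int^3) measure" where "modes \<equiv> count_space UNIV"

subsection \<open>Parseval and Riesz--Fischer\<close>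

text \<open>The exhaustion of the lattice is symmetric under negation, so that partial sums of
  coefficients with \<open>c (-k) = cnj (c k)\<close> are real.\<close>

definition cube :: "nat \<Rightarrow> (int^3) set" where "cube n = {k. \<forall>i. \<bar>k $ i\<bar> \<le> int n}"

lemma finite_cube [simp]: "finite (cube n)"
proof -
  have "cube n \<subseteq> (\<lambda>f. \<chi> i. f i) ` (UNIV \<rightarrow>\<^sub>E {- int n..int n})"
  proof
    fix k assume "k \<in> cube n"
    then have "k = (\<chi> i. (\<lambda>i. k $ i) i)" "(\<lambda>i. k $ i) \<in> UNIV \<rightarrow>\<^sub>E {- int n..int n}"
      by (auto simp: cube_def abs_le_iff) (smt (verit))+
    then show "k \<in> (\<lambda>f. \<chi> i. f i) ` (UNIV \<rightarrow>\<^sub>E {- int n..int n})" by blast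
  qed
  then show ?thesis by (rule finite_subset) (intro finite_imageI finite_PiE, auto)
qed

lemma cube_mono: "m \<le> n \<Longrightarrow> cube m \<subseteq> cube n"
  by (auto simp: cube_def intro: order_trans[of _ "int m"])

lemma uminus_cube [simp]: "- k \<in> cube n \<longleftrightarrow> k \<in> cube n"
  by (simp add: cube_def)

lemma eventually_in_cube: "eventually (\<lambda>n. k \<in> cube n) sequentially"
proof -
  have "\<bar>k $ i\<bar> \<le> int n" if "n \<ge> nat (\<Sum>i\<in>UNIV. \<bar>k $ i\<bar>)" for n i
    using that member_le_sum[of i UNIV "\<lambda>i. \<bar>k $ i\<bar>"] by auto
  then show ?thesis by (auto simp: cube_def eventually_sequentially)
qed

lemma sum_cube_tendsto:
  fixes g :: "int^3 \<Rightarrow> 'b::{banach,second_countable_topology}"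
  assumes "integrable modes g"
  shows "(\<lambda>n. \<Sum>k\<in>cube n. g k) \<longlonglongrightarrow> (LINT k|modes. g k)"
proof -
  have "(\<lambda>n. LINT k|modes. indicator (cube n) k *\<^sub>R g k) \<longlonglongrightarrow> (LINT k|modes. g k)"
  proof (rule integral_dominated_convergence[where w="\<lambda>k. norm (g k)"])
    show "AE k in modes. (\<lambda>n. indicator (cube n) k *\<^sub>R g k) \<longlonglongrightarrow> g k"
    proof (rule AE_I2)
      fix k
      show "(\<lambda>n. indicator (cube n) k *\<^sub>R g k) \<longlonglongrightarrow> g k"
        by (rule tendsto_eventually) (use eventually_in_cube[of k] in eventually_elim, simp)
    qed
  qed (use assms in \<open>auto simp: indicator_def\<close>)
  moreover have "(LINT k|modes. indicator (cube n) k *\<^sub>R g k) = (\<Sum>k\<in>cube n. g k)" for n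
    by (subst lebesgue_integral_count_space_finite_support)
      (auto simp: indicator_def if_distrib[of "\<lambda>c. c *\<^sub>R _"] sum.If_cases intro!: sum.mono_neutral_cong_left
        elim!: finite_subset[OF _ finite_cube[of n], rotated])
  ultimately show ?thesis by simp
qed

lemma nn_integral_modes_SUP: "(\<integral>\<^sup>+k. g k \<partial>modes) = (SUP n. \<Sum>k\<in>cube n. g k)"
proof -
  have "(SUP n. g k * indicator (cube n) k) = g k" for k
  proof (rule antisym)
    obtain n where "k \<in> cube n" using eventually_in_cube[of k] by (auto simp: eventually_sequentially)
    then show "g k \<le> (SUP n. g k * indicator (cube n) k)" by (intro SUP_upper2[of n]) auto
  qed (auto intro!: SUP_least simp: indicator_def)
  then have "(\<integral>\<^sup>+k. g k \<partial>modes) = (\<integral>\<^sup>+k. (SUP n. g k * indicator (cube n) k) \<partial>modes)" by simp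
  also have "\<dots> = (SUP n. \<integral>\<^sup>+k. g k * indicator (cube n) k \<partial>modes)"
  proof (rule nn_integral_monotone_convergence_SUP)
    show "incseq (\<lambda>n k. g k * indicator (cube n) k)"
      using cube_mono by (auto simp: incseq_def le_fun_def indicator_def)
  qed auto
  also have "(\<lambda>n. \<integral>\<^sup>+k. g k * indicator (cube n) k \<partial>modes) = (\<lambda>n. \<Sum>k\<in>cube n. g k)"
    by (rule ext, subst nn_integral_count_space_indicator[symmetric]) (auto simp: nn_integral_count_space_finite)
  finally show ?thesis .
qed

lemma integrable_modesI:
  fixes g :: "int^3 \<Rightarrow> real"
  assumes "\<And>k. 0 \<le> g k" "\<And>n. (\<Sum>k\<in>cube n. g k) \<le> B"
  shows "integrable modes g"
proof (rule integrableI_bounded)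
  have "(\<integral>\<^sup>+k. ennreal (norm (g k)) \<partial>modes) \<le> ennreal B"
    unfolding nn_integral_modes_SUP using assms by (auto intro!: SUP_least simp: sum_ennreal ennreal_leI)
  then show "(\<integral>\<^sup>+k. ennreal (norm (g k)) \<partial>modes) < \<infinity>" by (rule le_less_trans) simp
qed simp

context torus begin

section \<open>Square-integrable functions and their coefficients\<close>

lemma borel_measurable_cnj [measurable (raw)]: "f \<in> borel_measurable M \<Longrightarrow> (\<lambda>x. cnj (f x)) \<in> borel_measurable M"
  by (rule measurable_compose[where N=borel]) (auto intro!: borel_measurable_continuous_onI continuous_intros)

definition L2c :: "(real^3 \<Rightarrow> complex) \<Rightarrow> bool" where
  "L2c f \<longleftrightarrow> f \<in> borel_measurable \<mu> \<and> integrable \<mu> (\<lambda>x. (cmod (f x))\<^sup>2)"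

lemma L2c_measurable [measurable_dest]: "L2c f \<Longrightarrow> f \<in> borel_measurable \<mu>"
  by (simp add: L2c_def)

lemma L2c_square_integrable: "L2c f \<Longrightarrow> integrable \<mu> (\<lambda>x. (cmod (f x))\<^sup>2)"
  by (simp add: L2c_def)

lemma L2c_mult_integrable:
  assumes "L2c f" "L2c g" shows "integrable \<mu> (\<lambda>x. f x * g x)"
proof -
  note [measurable] = assms[THEN L2c_measurable]
  show ?thesis
  proof (rule Bochner_Integration.integrable_bound)
    show "integrable \<mu> (\<lambda>x. (cmod (f x))\<^sup>2 + (cmod (g x))\<^sup>2)"
      using assms by (simp add: L2c_def)
    have "cmod (f x * g x) \<le> (cmod (f x))\<^sup>2 + (cmod (g x))\<^sup>2" for x
    proof -
      have "0 \<le> (cmod (f x) - cmod (g x))\<^sup>2 + (cmod (f x))\<^sup>2 + (cmod (g x))\<^sup>2" by simp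
      then show ?thesis by (simp add: norm_mult power2_diff)
    qed
    then show "AE x in \<mu>. cmod (f x * g x) \<le> norm ((cmod (f x))\<^sup>2 + (cmod (g x))\<^sup>2)"
      by (intro AE_I2) simp
  qed measurable
qed

lemma L2c_bounded:
  assumes [measurable]: "f \<in> borel_measurable \<mu>" and "\<And>x. cmod (f x) \<le> B"
  shows "L2c f"
  unfolding L2c_def
proof
  have "(cmod (f x))\<^sup>2 \<le> B\<^sup>2" for x using assms(2)[of x] by (intro power_mono) auto
  then show "integrable \<mu> (\<lambda>x. (cmod (f x))\<^sup>2)"
    by (intro finite_measure.integrable_const_bound[OF finite_measure_mu, where B="B\<^sup>2"]) auto
qed fact

lemma L2c_const [simp]: "L2c (\<lambda>x. c)"
  by (rule L2c_bounded[where B="cmod c"]) auto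
lemma L2c_expo [simp]: "L2c (expo k)"
  by (rule L2c_bounded[where B=1]) auto

lemma L2c_integrable: "L2c f \<Longrightarrow> integrable \<mu> f"
  using L2c_mult_integrable[of f "\<lambda>x. 1"] by simp

lemma L2c_add [intro]:
  assumes "L2c f" "L2c g" shows "L2c (\<lambda>x. f x + g x)"
proof -
  note [measurable] = assms[THEN L2c_measurable]
  have "integrable \<mu> (\<lambda>x. (cmod (f x + g x))\<^sup>2)"
  proof (rule Bochner_Integration.integrable_bound)
    show "integrable \<mu> (\<lambda>x. 2 * (cmod (f x))\<^sup>2 + 2 * (cmod (g x))\<^sup>2)"
      using assms by (simp add: L2c_def)
    have "(cmod (f x + g x))\<^sup>2 \<le> 2 * (cmod (f x))\<^sup>2 + 2 * (cmod (g x))\<^sup>2" for x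
    proof -
      have "(cmod (f x + g x))\<^sup>2 \<le> (cmod (f x) + cmod (g x))\<^sup>2"
        by (intro power_mono norm_triangle_ineq) simp
      also have "\<dots> \<le> 2 * (cmod (f x))\<^sup>2 + 2 * (cmod (g x))\<^sup>2"
        using zero_le_power2[of "cmod (f x) - cmod (g x)"] by (simp add: power2_sum power2_diff)
      finally show ?thesis .
    qed
    then show "AE x in \<mu>. norm ((cmod (f x + g x))\<^sup>2) \<le> norm (2 * (cmod (f x))\<^sup>2 + 2 * (cmod (g x))\<^sup>2)"
      by (intro AE_I2) simp
  qed measurable
  then show ?thesis by (simp add: L2c_def)
qed

lemma L2c_cmult [intro]: "L2c f \<Longrightarrow> L2c (\<lambda>x. c * f x)"
  by (auto simp: L2c_def norm_mult power_mult_distrib)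
lemma L2c_cnj [intro]: "L2c f \<Longrightarrow> L2c (\<lambda>x. cnj (f x))"
  by (auto simp: L2c_def)
lemma L2c_expo_mult [intro]: "L2c f \<Longrightarrow> L2c (\<lambda>x. expo k x * f x)"
  by (auto simp: L2c_def norm_mult)
lemma L2c_diff [intro]: "L2c f \<Longrightarrow> L2c g \<Longrightarrow> L2c (\<lambda>x. f x - g x)"
  using L2c_add[of f "\<lambda>x. (-1) * g x"] L2c_cmult[of g "-1"] by simp
lemma L2c_sum [intro]: "(\<And>i. i \<in> F \<Longrightarrow> L2c (f i)) \<Longrightarrow> L2c (\<lambda>x. \<Sum>i\<in>F. f i x)"
  by (induct F rule: infinite_finite_induct) auto

lemma coef_add: "integrable \<mu> f \<Longrightarrow> integrable \<mu> g \<Longrightarrow> coef (\<lambda>x. f x + g x) k = coef f k + coef g k"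
  using integrable_expo_mult[of f "-k"] integrable_expo_mult[of g "-k"]
  by (simp add: coef_def distrib_left add_divide_distrib)
lemma coef_cmult: "coef (\<lambda>x. c * f x) k = c * coef f k"
proof -
  have "(\<lambda>x. expo (-k) x * (c * f x)) = (\<lambda>x. c * (expo (-k) x * f x))" by (simp add: mult_ac)
  then show ?thesis by (simp add: coef_def)
qed
lemma coef_diff: "integrable \<mu> f \<Longrightarrow> integrable \<mu> g \<Longrightarrow> coef (\<lambda>x. f x - g x) k = coef f k - coef g k"
  using integrable_expo_mult[of f "-k"] integrable_expo_mult[of g "-k"]
  by (simp add: coef_def right_diff_distrib diff_divide_distrib)
lemma coef_cnj: "coef (\<lambda>x. cnj (f x)) k = cnj (coef f (-k))"
proof -
  have "(\<lambda>x. expo (-k) x * cnj (f x)) = (\<lambda>x. cnj (expo k x * f x))" by (simp add: expo_minus)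
  then have "coef (\<lambda>x. cnj (f x)) k = cnj (LINT x|\<mu>. expo k x * f x) / of_real vol"
    unfolding coef_def by (simp only:)
      (subst integral_bounded_linear'[OF bounded_linear_cnj bounded_linear_cnj], auto)
  then show ?thesis by (simp add: coef_def)
qed
lemma coef_cong_AE:
  assumes "AE x in \<mu>. f x = g x" "f \<in> borel_measurable \<mu>" "g \<in> borel_measurable \<mu>"
  shows "coef f k = coef g k"
proof -
  note [measurable] = assms(2,3)
  have "(LINT x|\<mu>. expo (-k) x * f x) = (LINT x|\<mu>. expo (-k) x * g x)"
    using assms by (intro integral_cong_AE) auto
  then show ?thesis by (simp add: coef_def)
qed
lemma coef_expo_mult: "coef (\<lambda>x. expo j x * f x) k = coef f (k - j)"
proof -
  have "(\<lambda>x. expo (-k) x * (expo j x * f x)) = (\<lambda>x. expo (-(k - j)) x * f x)"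
    using expo_add[of "-k" j] by (simp flip: mult.assoc)
  then show ?thesis by (simp add: coef_def)
qed
lemma coef_expo: "coef (expo j) k = (if k = j then 1 else 0)"
proof -
  have "(\<lambda>x. expo (-k) x * expo j x) = expo (j - k)"
    using expo_add[of "-k" j] by (simp add: fun_eq_iff)
  then show ?thesis using vol_pos by (simp add: coef_def integral_expo)
qed

lemma AE_eq_of_coef_eq:
  assumes "L2c f" "L2c g" "\<And>k. coef f k = coef g k"
  shows "AE x in \<mu>. f x = g x"
proof -
  have "AE x in \<mu>. f x - g x = 0"
    using assms by (intro coef_eq_0_imp_AE_0) (auto intro!: L2c_integrable L2c_diff simp: coef_diff[OF L2c_integrable L2c_integrable])
  then show ?thesis by eventually_elim simp
qed

definition tsum :: "(int^3) set \<Rightarrow> (int^3 \<Rightarrow> complex) \<Rightarrow> real^3 \<Rightarrow> complex" where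
  "tsum F c x = (\<Sum>k\<in>F. c k * expo k x)"

lemma L2c_tsum [simp, intro]: "L2c (tsum F c)"
  unfolding tsum_def by (intro L2c_sum L2c_cmult L2c_expo)

lemma coef_tsum: "finite F \<Longrightarrow> coef (tsum F c) k = (if k \<in> F then c k else 0)"
proof (induct F rule: finite_induct)
  case empty
  then show ?case by (simp add: tsum_def coef_def)
next
  case (insert j F)
  then have "tsum (insert j F) c = (\<lambda>x. c j * expo j x + tsum F c x)" by (simp add: tsum_def fun_eq_iff)
  then show ?case using insert
    by (simp add: coef_add L2c_integrable L2c_cmult coef_cmult coef_expo)
qed

lemma integral_cnj_tsum_mult:
  assumes "L2c f" "finite F"
  shows "(LINT x|\<mu>. cnj (tsum F c x) * f x) = of_real vol * (\<Sum>k\<in>F. cnj (c k) * coef f k)"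
proof -
  have "(\<lambda>x. cnj (tsum F c x) * f x) = (\<lambda>x. \<Sum>k\<in>F. cnj (c k) * (expo (-k) x * f x))"
    by (simp add: tsum_def sum_distrib_right expo_minus mult.assoc)
  then have "(LINT x|\<mu>. cnj (tsum F c x) * f x) = (\<Sum>k\<in>F. cnj (c k) * (LINT x|\<mu>. expo (-k) x * f x))"
    using integrable_expo_mult[OF L2c_integrable[OF assms(1)]] by simp
  also have "\<dots> = of_real vol * (\<Sum>k\<in>F. cnj (c k) * coef f k)"
    using vol_pos by (simp add: coef_def sum_distrib_left)
  finally show ?thesis .
qed

text \<open>Completing the square mode by mode. With \<open>c = coef f\<close> this is Bessel's
  inequality, with \<open>f = 0\<close> the norm of a trigonometric polynomial, and for the limit in
  \<open>riesz_fischer\<close> it yields the norm identity.\<close>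

lemma integral_square_minus_tsum:
  assumes f: "L2c f" and F: "finite F"
  shows "(LINT x|\<mu>. (cmod (f x - tsum F c x))\<^sup>2) =
    (LINT x|\<mu>. (cmod (f x))\<^sup>2) - vol * (\<Sum>k\<in>F. (cmod (coef f k))\<^sup>2) + vol * (\<Sum>k\<in>F. (cmod (coef f k - c k))\<^sup>2)"
proof -
  let ?S = "tsum F c"
  have i1: "integrable \<mu> (\<lambda>x. cnj (?S x) * f x)" and i2: "integrable \<mu> (\<lambda>x. cnj (?S x) * ?S x)"
    using f by (auto intro!: L2c_mult_integrable)
  define a b where ab: "a = (\<lambda>x. cnj (?S x) * f x)" "b = (\<lambda>x. cnj (?S x) * ?S x)"
  have eq: "(\<lambda>x. (cmod (f x - ?S x))\<^sup>2) = (\<lambda>x. (cmod (f x))\<^sup>2 - 2 * Re (a x) + Re (b x))"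
    unfolding ab by (rule ext, simp add: cmod_power2) (simp add: power2_eq_square algebra_simps)
  have "(LINT x|\<mu>. (cmod (f x - ?S x))\<^sup>2) = (LINT x|\<mu>. (cmod (f x))\<^sup>2) - 2 * Re (LINT x|\<mu>. a x) + Re (LINT x|\<mu>. b x)"
    unfolding eq using L2c_square_integrable[OF f] i1 i2 unfolding ab[symmetric] by simp
  also have "\<dots> = (LINT x|\<mu>. (cmod (f x))\<^sup>2) - 2 * Re (LINT x|\<mu>. cnj (?S x) * f x) + Re (LINT x|\<mu>. cnj (?S x) * ?S x)"
    unfolding ab ..
  also have "\<dots> = (LINT x|\<mu>. (cmod (f x))\<^sup>2) - vol * (\<Sum>k\<in>F. 2 * Re (cnj (c k) * coef f k) - Re (cnj (c k) * c k))"
    unfolding integral_cnj_tsum_mult[OF f F] integral_cnj_tsum_mult[OF L2c_tsum F]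
    using F by (simp add: coef_tsum sum_subtractf sum_distrib_left sum.distrib algebra_simps)
  also have "(\<lambda>k. 2 * Re (cnj (c k) * coef f k) - Re (cnj (c k) * c k)) =
      (\<lambda>k. (cmod (coef f k))\<^sup>2 - (cmod (coef f k - c k))\<^sup>2)"
    by (rule ext, simp add: cmod_power2) (simp add: power2_eq_square algebra_simps)
  finally show ?thesis by (simp add: sum_subtractf algebra_simps)
qed

lemma bessel:
  assumes f: "L2c f" and F: "finite F"
  shows "vol * (\<Sum>k\<in>F. (cmod (coef f k))\<^sup>2) \<le> (LINT x|\<mu>. (cmod (f x))\<^sup>2)"
proof -
  have "0 \<le> (LINT x|\<mu>. (cmod (f x - tsum F (coef f) x))\<^sup>2)" by simp
  then show ?thesis unfolding integral_square_minus_tsum[OF f F] by simp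
qed

text \<open>The variance of \<open>cmod f\<close> is nonnegative. This passes the Cauchy property of
  partial sums from \<open>L^2\<close> to \<open>L^1\<close>, where a subsequence is Cauchy almost
  everywhere.\<close>

lemma L1_le_L2:
  assumes f: "L2c f"
  shows "(LINT x|\<mu>. cmod (f x))\<^sup>2 \<le> vol * (LINT x|\<mu>. (cmod (f x))\<^sup>2)"
proof -
  let ?m = "(LINT x|\<mu>. cmod (f x)) / vol"
  have i: "integrable \<mu> (\<lambda>x. cmod (f x))" using L2c_integrable[OF f] by simp
  interpret finite_measure \<mu> by (rule finite_measure_mu)
  have "0 \<le> (LINT x|\<mu>. (cmod (f x) - ?m)\<^sup>2)" by simp
  also have "(\<lambda>x. (cmod (f x) - ?m)\<^sup>2) = (\<lambda>x. (cmod (f x))\<^sup>2 - (2 * ?m) * cmod (f x) + ?m\<^sup>2)"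
    by (simp add: power2_diff algebra_simps)
  also have "(LINT x|\<mu>. (cmod (f x))\<^sup>2 - (2 * ?m) * cmod (f x) + ?m\<^sup>2) =
     (LINT x|\<mu>. (cmod (f x))\<^sup>2) - 2 * ?m * (LINT x|\<mu>. cmod (f x)) + vol * ?m\<^sup>2"
    using L2c_square_integrable[OF f] i measure_mu by simp
  finally show ?thesis using vol_pos by (simp add: field_simps power2_eq_square)
qed

lemma cmod_coef_square_le:
  assumes f: "L2c f" shows "vol * (cmod (coef f k))\<^sup>2 \<le> (LINT x|\<mu>. (cmod (f x))\<^sup>2)"
  using bessel[OF f, of "{k}"] by simp


lemma tsum_diff_mono: "finite B \<Longrightarrow> A \<subseteq> B \<Longrightarrow> tsum B c x - tsum A c x = tsum (B - A) c x"
  by (simp add: tsum_def sum_diff)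

lemma integral_square_tsum:
  assumes "finite F" shows "(LINT x|\<mu>. (cmod (tsum F c x))\<^sup>2) = vol * (\<Sum>k\<in>F. (cmod (c k))\<^sup>2)"
  using integral_square_minus_tsum[OF L2c_const[of 0] assms, of c] by (simp add: coef_def)

text \<open>A subsequence of the partial sums over cubes converges almost everywhere, and Fatou's
  lemma bounds the square distance of the limit to each partial sum by the tail of the series.
  Periodicity, reality and the bound by the sum of the coefficients are asserted at every point,
  because fields are everywhere defined functions.\<close>

lemma riesz_fischer:
  assumes c: "integrable modes (\<lambda>k. (cmod (c k))\<^sup>2)"
  obtains w where "L2c w" "\<And>k. coef w k = c k" "periodic L w"
    "(LINT x|\<mu>. (cmod (w x))\<^sup>2) = vol * (LINT k|modes. (cmod (c k))\<^sup>2)"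
    "(\<And>k. c (-k) = cnj (c k)) \<Longrightarrow> (\<And>x. w x \<in> \<real>)"
    "\<And>B x. (\<And>F. finite F \<Longrightarrow> (\<Sum>k\<in>F. cmod (c k)) \<le> B) \<Longrightarrow> cmod (w x) \<le> B"
proof -
  let ?g = "\<lambda>k. (cmod (c k))\<^sup>2"
  define S where "S n = tsum (cube n) c" for n
  define s where "s n = (\<Sum>k\<in>cube n. ?g k)" for n
  define I where "I = (LINT k|modes. ?g k)"
  have s_lim: "s \<longlonglongrightarrow> I" unfolding s_def[abs_def] I_def by (rule sum_cube_tendsto[OF c])
  have s_mono: "s m \<le> s n" if "m \<le> n" for m n
    unfolding s_def using that by (intro sum_mono2) (auto dest: cube_mono)
  have s_le: "s n \<le> I" for n using s_lim s_mono by (intro incseq_le) (auto simp: incseq_def)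
  have LS[simp]: "L2c (S n)" for n by (simp add: S_def)
  note [measurable] = LS[THEN L2c_measurable]
  have dist: "(LINT x|\<mu>. (cmod (S n x - S m x))\<^sup>2) = vol * (s n - s m)" if "m \<le> n" for m n
  proof -
    have "S n x - S m x = tsum (cube n - cube m) c x" for x
      unfolding S_def using cube_mono[OF that] by (simp add: tsum_diff_mono)
    moreover have "(\<Sum>k\<in>cube n - cube m. ?g k) = s n - s m"
      unfolding s_def using cube_mono[OF that] by (simp add: sum_diff)
    ultimately show ?thesis using integral_square_tsum[of "cube n - cube m" c] by simp
  qed
  have dist1: "(LINT x|\<mu>. cmod (S n x - S m x))\<^sup>2 \<le> vol\<^sup>2 * \<bar>s n - s m\<bar>" for m n
  proof -
    have "(LINT x|\<mu>. cmod (S n x - S m x))\<^sup>2 \<le> vol * (LINT x|\<mu>. (cmod (S n x - S m x))\<^sup>2)"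
      by (rule L1_le_L2) auto
    also have "(LINT x|\<mu>. (cmod (S n x - S m x))\<^sup>2) = vol * \<bar>s n - s m\<bar>"
    proof (cases "m \<le> n")
      case True
      then show ?thesis using dist s_mono by simp
    next
      case False
      then show ?thesis using dist[of n m] s_mono[of n m] by (simp add: norm_minus_commute)
    qed
    finally show ?thesis by (simp add: power2_eq_square mult.assoc)
  qed
  have "\<exists>N. \<forall>i\<ge>N. \<forall>j\<ge>N. (LINT x|\<mu>. norm (S i x - S j x)) < e" if "e > 0" for e
  proof -
    have "e\<^sup>2 / vol\<^sup>2 > 0" using that vol_pos by simp
    moreover have "Cauchy s" using s_lim by (rule LIMSEQ_imp_Cauchy)
    ultimately obtain N where N: "\<And>i j. i \<ge> N \<Longrightarrow> j \<ge> N \<Longrightarrow> \<bar>s i - s j\<bar> < e\<^sup>2 / vol\<^sup>2"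
      by (force simp: Cauchy_def dist_real_def)
    have "(LINT x|\<mu>. norm (S i x - S j x)) < e" if "i \<ge> N" "j \<ge> N" for i j
    proof -
      have "(LINT x|\<mu>. norm (S i x - S j x))\<^sup>2 \<le> vol\<^sup>2 * \<bar>s i - s j\<bar>" by (rule dist1)
      also have "\<dots> < e\<^sup>2" using N[OF that] vol_pos by (simp add: field_simps)
      finally show ?thesis using \<open>e > 0\<close> by (simp add: power_less_imp_less_base)
    qed
    then show ?thesis by blast
  qed
  then obtain r where r: "strict_mono r" and ae: "AE x in \<mu>. Cauchy (\<lambda>i. S (r i) x)"
    by (rule cauchy_L1_AE_cauchy_subseq[of \<mu> S, rotated]) (auto intro: L2c_integrable)
  \<comment> \<open>The partial sums are periodic, so convergence at a point depends only on its
    class modulo periods; the value 0 elsewhere therefore keeps \<open>w\<close> periodic, real and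
    bounded at every point.\<close>
  define w where "w x = (if Cauchy (\<lambda>i. S (r i) x) then lim (\<lambda>i. S (r i) x) else 0)" for x
  have w_lim: "(\<lambda>i. S (r i) x) \<longlonglongrightarrow> w x" if "Cauchy (\<lambda>i. S (r i) x)" for x
    using that by (simp add: w_def Cauchy_convergent convergent_LIMSEQ_iff[symmetric])
  have [measurable]: "w \<in> borel_measurable \<mu>" unfolding w_def[abs_def] by measurable
  have err: "(\<integral>\<^sup>+x. ennreal ((cmod (w x - S n x))\<^sup>2) \<partial>\<mu>) \<le> ennreal (vol * (I - s n))" for n
  proof -
    have "(\<integral>\<^sup>+x. ennreal ((cmod (w x - S n x))\<^sup>2) \<partial>\<mu>) = (\<integral>\<^sup>+x. liminf (\<lambda>i. ennreal ((cmod (S (r i) x - S n x))\<^sup>2)) \<partial>\<mu>)"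
    proof (rule nn_integral_cong_AE)
      show "AE x in \<mu>. ennreal ((cmod (w x - S n x))\<^sup>2) = liminf (\<lambda>i. ennreal ((cmod (S (r i) x - S n x))\<^sup>2))"
        using ae
      proof eventually_elim
        case (elim x)
        have "(\<lambda>i. ennreal ((cmod (S (r i) x - S n x))\<^sup>2)) \<longlonglongrightarrow> ennreal ((cmod (w x - S n x))\<^sup>2)"
          by (intro tendsto_ennrealI tendsto_intros w_lim[OF elim])
        then show ?case by (intro lim_imp_Liminf[symmetric]) auto
      qed
    qed
    also have "\<dots> \<le> liminf (\<lambda>i. \<integral>\<^sup>+x. ennreal ((cmod (S (r i) x - S n x))\<^sup>2) \<partial>\<mu>)"
      by (rule nn_integral_liminf) measurable
    also have "\<dots> \<le> ennreal (vol * (I - s n))"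
    proof (rule Liminf_le)
      show "eventually (\<lambda>i. (\<integral>\<^sup>+x. ennreal ((cmod (S (r i) x - S n x))\<^sup>2) \<partial>\<mu>) \<le> ennreal (vol * (I - s n))) sequentially"
        using eventually_ge_at_top[of n]
      proof eventually_elim
        case (elim i)
        then have "n \<le> r i" using seq_suble[OF r, of i] by simp
        moreover have "L2c (\<lambda>x. S (r i) x - S n x)" by auto
        ultimately have "(\<integral>\<^sup>+x. ennreal ((cmod (S (r i) x - S n x))\<^sup>2) \<partial>\<mu>) = ennreal (vol * (s (r i) - s n))"
          by (subst nn_integral_eq_integral) (auto simp: L2c_def dist)
        also have "\<dots> \<le> ennreal (vol * (I - s n))"
          using s_le[of "r i"] vol_pos by (intro ennreal_leI mult_left_mono) auto
        finally show ?case .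
      qed
    qed simp
    finally show ?thesis .
  qed
  have Lws: "L2c (\<lambda>x. w x - S n x)" for n
    unfolding L2c_def using err[of n] by (auto intro!: integrableI_bounded simp: le_less_trans)
  have Lw: "L2c w" using L2c_add[OF Lws[of 0] LS[of 0]] by simp
  have err2: "(LINT x|\<mu>. (cmod (w x - S n x))\<^sup>2) \<le> vol * (I - s n)" for n
  proof -
    have "ennreal (LINT x|\<mu>. (cmod (w x - S n x))\<^sup>2) \<le> ennreal (vol * (I - s n))"
      using err[of n] Lws[of n] by (subst nn_integral_eq_integral[symmetric]) (auto simp: L2c_def)
    then show ?thesis using vol_pos s_le[of n] by (simp add: ennreal_le_iff2) (smt (verit) mult_nonneg_nonneg)
  qed
  have "(\<lambda>n. vol * (I - s n)) \<longlonglongrightarrow> vol * (I - I)" by (intro tendsto_intros s_lim)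
  then have lim0: "(\<lambda>n. vol * (I - s n)) \<longlonglongrightarrow> 0" by simp
  have coefw: "coef w k = c k" for k
  proof -
    have "eventually (\<lambda>n. vol * (cmod (coef w k - c k))\<^sup>2 \<le> vol * (I - s n)) sequentially"
      using eventually_in_cube[of k]
    proof eventually_elim
      case (elim n)
      have "coef (\<lambda>x. w x - S n x) k = coef w k - c k"
        using elim Lw by (simp add: coef_diff L2c_integrable) (simp add: S_def coef_tsum)
      then show ?case using cmod_coef_square_le[OF Lws[of n], of k] err2[of n] by simp
    qed
    from tendsto_lowerbound[OF lim0 this] have "vol * (cmod (coef w k - c k))\<^sup>2 \<le> 0" by simp
    then have "(cmod (coef w k - c k))\<^sup>2 \<le> 0" using vol_pos by (simp add: mult_le_0_iff)
    then show ?thesis by simp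
  qed
  have normw: "(LINT x|\<mu>. (cmod (w x))\<^sup>2) = vol * I"
  proof (rule LIMSEQ_unique)
    have "(LINT x|\<mu>. (cmod (w x - S n x))\<^sup>2) = (LINT x|\<mu>. (cmod (w x))\<^sup>2) - vol * s n" for n
      unfolding S_def using integral_square_minus_tsum[OF Lw finite_cube[of n], of c] by (simp add: coefw s_def)
    then have *: "(LINT x|\<mu>. (cmod (w x))\<^sup>2) - vol * s n = (LINT x|\<mu>. (cmod (w x - S n x))\<^sup>2)" for n by simp
    have "(\<lambda>n. (LINT x|\<mu>. (cmod (w x))\<^sup>2) - vol * s n) \<longlonglongrightarrow> 0"
      unfolding * by (rule tendsto_sandwich[OF _ _ tendsto_const lim0]) (auto intro!: always_eventually err2)
    then have "(\<lambda>n. vol * s n + ((LINT x|\<mu>. (cmod (w x))\<^sup>2) - vol * s n)) \<longlonglongrightarrow> vol * I + 0"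
      by (intro tendsto_intros s_lim)
    then show "(\<lambda>n. vol * I) \<longlonglongrightarrow> vol * I" "(\<lambda>n. vol * I) \<longlonglongrightarrow> (LINT x|\<mu>. (cmod (w x))\<^sup>2)"
      by (simp_all add: LIMSEQ_const_iff)
  qed
  have per: "periodic L w"
  proof -
    have "S n (x + L $ i *\<^sub>R axis i 1) = S n x" for n x i
      using expo_periodic by (simp add: S_def tsum_def periodic_def)
    then show ?thesis by (simp add: periodic_def w_def)
  qed
  have real: "w x \<in> \<real>" if "\<And>k. c (-k) = cnj (c k)" for x
  proof -
    have "cnj (S n x) = S n x" for n
    proof -
      have "cnj (S n x) = (\<Sum>k\<in>cube n. c (-k) * expo (-k) x)"
        by (simp add: S_def tsum_def that expo_minus)
      also have "\<dots> = S n x" unfolding S_def tsum_def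
        by (rule sum.reindex_bij_witness[of _ uminus uminus]) auto
      finally show ?thesis .
    qed
    then have "Im (S n x) = 0" for n by (metis complex_cnj_cancel_iff Reals_cnj_iff complex_is_Real_iff)
    then have "Im (w x) = 0" if "Cauchy (\<lambda>i. S (r i) x)"
      using tendsto_Im[OF w_lim[OF that]] by (simp add: LIMSEQ_const_iff)
    then show ?thesis by (cases "Cauchy (\<lambda>i. S (r i) x)") (auto simp: complex_is_Real_iff w_def)
  qed
  have bound: "cmod (w x) \<le> B" if B: "\<And>F. finite F \<Longrightarrow> (\<Sum>k\<in>F. cmod (c k)) \<le> B" for B x
  proof (cases "Cauchy (\<lambda>i. S (r i) x)")
    case True
    have "cmod (S n x) \<le> B" for n
      unfolding S_def tsum_def by (rule order_trans[OF norm_sum]) (simp add: norm_mult B)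
    then show ?thesis by (intro tendsto_upperbound[OF tendsto_norm[OF w_lim[OF True]]]) auto
  next
    case False
    then show ?thesis using B[of "{}"] by (simp add: w_def)
  qed
  show thesis
    by (rule that[of w, OF Lw coefw per]) (use normw real bound in \<open>auto simp: I_def\<close>)
qed


text \<open>The function rebuilt by \<open>riesz_fischer\<close> from the coefficients of
  \<open>f\<close> has the same coefficients, hence equals \<open>f\<close> almost everywhere, and
  its norm is known.\<close>

lemma parseval:
  assumes f: "L2c f"
  shows "integrable modes (\<lambda>k. (cmod (coef f k))\<^sup>2)"
    and "(LINT x|\<mu>. (cmod (f x))\<^sup>2) = vol * (LINT k|modes. (cmod (coef f k))\<^sup>2)"
proof -
  have "(\<Sum>k\<in>cube n. (cmod (coef f k))\<^sup>2) \<le> (LINT x|\<mu>. (cmod (f x))\<^sup>2) / vol" for n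
    using bessel[OF f finite_cube[of n]] vol_pos by (simp add: field_simps)
  then show i: "integrable modes (\<lambda>k. (cmod (coef f k))\<^sup>2)"
    by (intro integrable_modesI) auto
  obtain w where w: "L2c w" "\<And>k. coef w k = coef f k"
      "(LINT x|\<mu>. (cmod (w x))\<^sup>2) = vol * (LINT k|modes. (cmod (coef f k))\<^sup>2)"
    by (rule riesz_fischer[OF i]) (rule that)
  have "AE x in \<mu>. f x = w x" using f w by (intro AE_eq_of_coef_eq) auto
  moreover note [measurable] = L2c_measurable[OF f] L2c_measurable[OF w(1)]
  ultimately have "(LINT x|\<mu>. (cmod (f x))\<^sup>2) = (LINT x|\<mu>. (cmod (w x))\<^sup>2)"
    by (intro integral_cong_AE) auto
  then show "(LINT x|\<mu>. (cmod (f x))\<^sup>2) = vol * (LINT k|modes. (cmod (coef f k))\<^sup>2)" using w by simp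
qed

text \<open>Polarisation gives the real part; applied to \<open>- \<i> * f\<close> it gives the
  imaginary part.\<close>

lemma parseval_inner:
  assumes f: "L2c f" and g: "L2c g"
  shows "integrable modes (\<lambda>k. coef f k * cnj (coef g k))"
    and "(LINT x|\<mu>. f x * cnj (g x)) = of_real vol * (LINT k|modes. coef f k * cnj (coef g k))"
proof -
  have polar: "Re (a * cnj b) = ((cmod (a + b))\<^sup>2 - (cmod a)\<^sup>2 - (cmod b)\<^sup>2) / 2" for a b
    by (simp add: cmod_power2) (simp add: power2_eq_square algebra_simps)
  have re: "integrable modes (\<lambda>k. Re (coef f k * cnj (coef g k)))
      \<and> (LINT x|\<mu>. Re (f x * cnj (g x))) = vol * (LINT k|modes. Re (coef f k * cnj (coef g k)))"
    if f: "L2c f" for f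
  proof -
    have fg: "L2c (\<lambda>x. f x + g x)" using f g by auto
    have i: "integrable modes (\<lambda>k. (cmod (coef f k + coef g k))\<^sup>2)"
      and fg2: "(LINT x|\<mu>. (cmod (f x + g x))\<^sup>2) = vol * (LINT k|modes. (cmod (coef f k + coef g k))\<^sup>2)"
      using parseval[OF fg] unfolding coef_add[OF L2c_integrable[OF f] L2c_integrable[OF g]] by auto
    have "(LINT x|\<mu>. Re (f x * cnj (g x))) =
        ((LINT x|\<mu>. (cmod (f x + g x))\<^sup>2) - (LINT x|\<mu>. (cmod (f x))\<^sup>2) - (LINT x|\<mu>. (cmod (g x))\<^sup>2)) / 2"
      unfolding polar using L2c_square_integrable[OF f] L2c_square_integrable[OF g] L2c_square_integrable[OF fg] by simp
    also have "\<dots> = vol * (LINT k|modes. Re (coef f k * cnj (coef g k)))"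
      unfolding polar fg2 parseval(2)[OF f] parseval(2)[OF g]
      using parseval(1)[OF f] parseval(1)[OF g] i by (simp add: right_diff_distrib)
    finally show ?thesis
      unfolding polar using parseval(1)[OF f] parseval(1)[OF g] i by simp
  qed
  have if': "L2c (\<lambda>x. - \<i> * f x)" using f by (rule L2c_cmult)
  have im: "Im (a * cnj b) = Re (- \<i> * a * cnj b)" for a b by simp
  have imi: "integrable modes (\<lambda>k. Im (coef f k * cnj (coef g k)))"
    and im2: "(LINT x|\<mu>. Im (f x * cnj (g x))) = vol * (LINT k|modes. Im (coef f k * cnj (coef g k)))"
    unfolding im using re[OF if'] unfolding coef_cmult by auto
  show i: "integrable modes (\<lambda>k. coef f k * cnj (coef g k))"
    using Bochner_Integration.integrable_add[OF integrable_of_real[OF conjunct1[OF re[OF f]]]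
        integrable_mult_right[OF integrable_of_real[OF imi], of \<i>]]
    by (simp only: complex_eq[symmetric])
  have j: "integrable \<mu> (\<lambda>x. f x * cnj (g x))" using f g by (intro L2c_mult_integrable) auto
  define P Q where "P = (LINT x|\<mu>. f x * cnj (g x))" and "Q = (LINT k|modes. coef f k * cnj (coef g k))"
  have "Re P = vol * Re Q" "Im P = vol * Im Q"
    unfolding P_def Q_def using conjunct2[OF re[OF f]] im2
    unfolding integral_Re[OF i] integral_Re[OF j] integral_Im[OF i] integral_Im[OF j] .
  then have "P = of_real vol * Q" by (simp add: complex_eq_iff)
  then show "(LINT x|\<mu>. f x * cnj (g x)) = of_real vol * (LINT k|modes. coef f k * cnj (coef g k))"
    unfolding P_def Q_def .
qed

end

subsection \<open>Fourier coefficients of vector fields\<close>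

lemma norm_smult: "norm (c *s a) = cmod c * norm a" for a :: "complex^'n"
  by (simp add: norm_vec_def L2_set_right_distrib norm_mult)

lemma norm_vec_square: "(norm a)\<^sup>2 = (\<Sum>j\<in>UNIV. (norm (a $ j))\<^sup>2)" for a :: "('a::real_normed_vector)^'n"
  by (simp add: norm_vec_def L2_set_def sum_nonneg)

lemma inner_complex_vec: "a \<bullet> b = (\<Sum>j\<in>UNIV. Re (a $ j * cnj (b $ j)))" for a b :: "complex^'n"
  by (simp add: inner_vec_def inner_complex_def)

definition cnjv :: "complex^'n \<Rightarrow> complex^'n" where "cnjv a = (\<chi> j. cnj (a $ j))"

lemma cnjv_nth [simp]: "cnjv a $ j = cnj (a $ j)" by (simp add: cnjv_def)
lemma norm_cnjv [simp]: "norm (cnjv a) = norm a" by (simp add: norm_vec_def)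
lemma cnjv_simps [simp]: "cnjv 0 = 0" "cnjv (cnjv a) = a" "cnjv (a + b) = cnjv a + cnjv b"
  "cnjv (a - b) = cnjv a - cnjv b" "cnjv (- a) = - cnjv a" "cnjv (c *s a) = cnj c *s cnjv a" "cnjv (r *\<^sub>R a) = r *\<^sub>R cnjv a"
  by (simp_all add: vec_eq_iff)

text \<open>Bilinear, without conjugation: for the wave vector \<open>q\<close> of the mode
  \<open>k\<close>, \<open>rdot q (c k)\<close> is up to the factor \<i> the coefficient of the
  divergence.\<close>

definition rdot :: "real^'n \<Rightarrow> complex^'n \<Rightarrow> complex" where
  "rdot x a = (\<Sum>j\<in>UNIV. of_real (x $ j) * a $ j)"

text \<open>The condition for coefficients to belong to a real field.\<close>

definition hermitian :: "(int^3 \<Rightarrow> complex^3) \<Rightarrow> bool" where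
  "hermitian c \<longleftrightarrow> (\<forall>k. c (- k) = cnjv (c k))"

section \<open>Smooth periodic functions and multi-indices\<close>

lemma smooth_differentiable: "smooth \<phi> \<Longrightarrow> \<phi> differentiable_on UNIV"
  unfolding smooth_def by (metis foldr.simps(1) id_apply)

lemma smooth_partial: "smooth \<phi> \<Longrightarrow> smooth (partial i \<phi>)"
  unfolding smooth_def
proof
  fix "is" assume "\<forall>is. foldr partial is \<phi> differentiable_on UNIV"
  from this[rule_format, of "is @ [i]"] show "foldr partial is (partial i \<phi>) differentiable_on UNIV" by simp
qed

lemma smooth_continuous: "smooth \<phi> \<Longrightarrow> continuous_on S \<phi>"
  using differentiable_imp_continuous_on[OF smooth_differentiable] continuous_on_subset by blast

lemma smooth_has_derivative: "smooth \<phi> \<Longrightarrow> (\<phi> has_derivative frechet_derivative \<phi> (at x)) (at x)"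
  using smooth_differentiable[of \<phi>] by (simp add: differentiable_on_def frechet_derivative_works)

lemma periodic_partial:
  assumes "smooth \<phi>" "periodic L \<phi>" shows "periodic L (partial i \<phi>)"
  unfolding periodic_def
proof (intro allI)
  fix x j
  let ?a = "L $ j *\<^sub>R axis j 1 :: real^3"
  have "((\<lambda>y. \<phi> (y + ?a)) has_derivative frechet_derivative \<phi> (at (x + ?a))) (at x)"
    by (rule has_derivative_compose[OF _ smooth_has_derivative[OF assms(1)], of "\<lambda>y. y + ?a" "\<lambda>h. h", simplified])
       (auto intro!: derivative_eq_intros)
  moreover have "(\<lambda>y. \<phi> (y + ?a)) = \<phi>" using assms(2) by (simp add: periodic_def)
  ultimately have "frechet_derivative \<phi> (at x) = frechet_derivative \<phi> (at (x + ?a))"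
    using frechet_derivative_at by metis
  then show "partial i \<phi> (x + ?a) = partial i \<phi> x" by (simp add: partial_def)
qed

lemma partial_component:
  fixes \<phi> :: "real^3 \<Rightarrow> ('b::real_normed_vector)^'n"
  assumes "\<phi> differentiable (at x)"
  shows "partial i (\<lambda>x. \<phi> x $ j) x = partial i \<phi> x $ j"
proof -
  have "(\<phi> has_derivative frechet_derivative \<phi> (at x)) (at x)" using assms by (simp add: frechet_derivative_works)
  from bounded_linear.has_derivative[OF bounded_linear_vec_nth this]
  show ?thesis using frechet_derivative_at unfolding partial_def by metis
qed

lemma smooth_component:
  fixes \<phi> :: "real^3 \<Rightarrow> ('b::real_normed_vector)^'n"
  assumes "smooth \<phi>" shows "smooth (\<lambda>x. \<phi> x $ j)"
proof -
  have "foldr partial is (\<lambda>x. \<phi> x $ j) = (\<lambda>x. foldr partial is \<phi> x $ j)" for "is"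
  proof (induct "is")
    case (Cons i "is")
    have "foldr partial is \<phi> differentiable (at x)" for x
      using assms by (simp add: smooth_def differentiable_on_def)
    then show ?case by (intro ext) (simp only: foldr_Cons o_apply Cons partial_component)
  qed simp
  moreover have "(\<lambda>x. foldr partial is \<phi> x $ j) differentiable_on UNIV" for "is"
    using assms bounded_linear.has_derivative[OF bounded_linear_vec_nth]
    unfolding smooth_def differentiable_on_def differentiable_def by blast
  ultimately show ?thesis by (simp add: smooth_def)
qed

lemma smooth_periodic_funpow_partial:
  assumes "smooth \<phi>" "periodic L \<phi>"
  shows "smooth ((partial i ^^ n) \<phi>) \<and> periodic L ((partial i ^^ n) \<phi>)"
  using assms by (induct n) (auto simp: smooth_partial periodic_partial)

lemma smooth_periodic_multi_partial:
  assumes "smooth \<phi>" "periodic L \<phi>"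
  shows "smooth (multi_partial \<beta> \<phi>)" "periodic L (multi_partial \<beta> \<phi>)"
proof -
  note 3 = smooth_periodic_funpow_partial[OF assms, of "\<beta> $ 3" 3]
  note 2 = smooth_periodic_funpow_partial[OF conjunct1[OF 3] conjunct2[OF 3], of "\<beta> $ 2" 2]
  note 1 = smooth_periodic_funpow_partial[OF conjunct1[OF 2] conjunct2[OF 2], of "\<beta> $ 1" 1]
  from 1 show "smooth (multi_partial \<beta> \<phi>)" "periodic L (multi_partial \<beta> \<phi>)"
    by (simp_all add: multi_partial_def)
qed

lemma finite_mi_order [simp]: "finite {\<beta>. mi_order \<beta> \<le> m}"
proof -
  have "{\<beta>. mi_order \<beta> \<le> m} \<subseteq> (\<lambda>f. \<chi> i. f i) ` (UNIV \<rightarrow>\<^sub>E {..m})"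
  proof
    fix \<beta> assume "\<beta> \<in> {\<beta>. mi_order \<beta> \<le> m}"
    then have "\<beta> $ i \<le> m" for i using member_le_sum[of i UNIV "\<lambda>i. \<beta> $ i"] by (simp add: mi_order_def)
    then have "\<beta> = (\<chi> i. (\<lambda>i. \<beta> $ i) i)" "(\<lambda>i. \<beta> $ i) \<in> UNIV \<rightarrow>\<^sub>E {..m}" by auto
    then show "\<beta> \<in> (\<lambda>f. \<chi> i. f i) ` (UNIV \<rightarrow>\<^sub>E {..m})" by blast
  qed
  then show ?thesis by (rule finite_subset) (intro finite_imageI finite_PiE, auto)
qed

context torus begin

definition vcoef :: "vfield \<Rightarrow> int^3 \<Rightarrow> complex^3" where
  "vcoef u k = (\<chi> j. coef (\<lambda>x. of_real (u x $ j)) k)"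

definition solenoidal :: "(int^3 \<Rightarrow> complex^3) \<Rightarrow> bool" where
  "solenoidal c \<longleftrightarrow> c 0 = 0 \<and> (\<forall>k. rdot (wave k) (c k) = 0)"

lemma L2_per_iff: "u \<in> L2_per L \<longleftrightarrow> periodic L u \<and> (\<forall>j. L2c (\<lambda>x. of_real (u x $ j)))"
proof -
  have comp: "(\<lambda>x. u x $ j) \<in> borel_measurable \<mu>" if [measurable]: "u \<in> borel_measurable \<mu>" for j
    unfolding cart_eq_inner_axis by measurable
  have M: "u \<in> borel_measurable \<mu> \<longleftrightarrow> (\<forall>j. (\<lambda>x. complex_of_real (u x $ j)) \<in> borel_measurable \<mu>)"
  proof
    assume c: "\<forall>j. (\<lambda>x. complex_of_real (u x $ j)) \<in> borel_measurable \<mu>"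
    have "(\<lambda>x. Re (complex_of_real (u x $ j))) \<in> borel_measurable \<mu>" for j
      using c[rule_format, of j] by measurable
    then show "u \<in> borel_measurable \<mu>"
      by (subst borel_measurable_euclidean_space) (auto simp: Basis_vec_def inner_axis)
  qed (use comp in \<open>simp add: borel_measurable_of_real\<close>)
  show ?thesis
  proof (cases "u \<in> borel_measurable \<mu>")
    case True
    note [measurable] = True comp[OF True]
    have "integrable \<mu> (\<lambda>x. (norm (u x))\<^sup>2) \<longleftrightarrow> (\<forall>j. integrable \<mu> (\<lambda>x. (u x $ j)\<^sup>2))"
    proof
      assume i: "integrable \<mu> (\<lambda>x. (norm (u x))\<^sup>2)"
      show "\<forall>j. integrable \<mu> (\<lambda>x. (u x $ j)\<^sup>2)"
      proof
        fix j
        have "(u x $ j)\<^sup>2 \<le> (norm (u x))\<^sup>2" for x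
          unfolding norm_vec_square using member_le_sum[of j UNIV "\<lambda>j. (u x $ j)\<^sup>2"] by simp
        then show "integrable \<mu> (\<lambda>x. (u x $ j)\<^sup>2)"
          by (intro Bochner_Integration.integrable_bound[OF i]) auto
      qed
    qed (auto simp: norm_vec_square intro!: Bochner_Integration.integrable_sum)
    then show ?thesis using True M by (simp add: L2_per_def L2c_def)
  next
    case False
    then have "\<not> (\<forall>j. L2c (\<lambda>x. complex_of_real (u x $ j)))" unfolding M L2c_def by blast
    then show ?thesis using False by (simp add: L2_per_def)
  qed
qed

lemma L2_perD: "u \<in> L2_per L \<Longrightarrow> L2c (\<lambda>x. of_real (u x $ j))"
  by (simp add: L2_per_iff)

lemma L2_per_diff [intro]:
  assumes "u \<in> L2_per L" "v \<in> L2_per L" shows "(\<lambda>x. u x - v x) \<in> L2_per L"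
  using assms L2c_diff[of "\<lambda>x. of_real (u x $ j)" "\<lambda>x. of_real (v x $ j)" for j]
  by (auto simp: L2_per_iff periodic_def)

lemma L2_per_add [intro]:
  assumes "u \<in> L2_per L" "v \<in> L2_per L" shows "(\<lambda>x. u x + v x) \<in> L2_per L"
  using assms L2c_add[of "\<lambda>x. of_real (u x $ j)" "\<lambda>x. of_real (v x $ j)" for j]
  by (auto simp: L2_per_iff periodic_def)

lemma L2_per_scaleR [intro]:
  assumes "u \<in> L2_per L" shows "(\<lambda>x. r *\<^sub>R u x) \<in> L2_per L"
  using assms L2c_cmult[of "\<lambda>x. of_real (u x $ j)" "of_real r" for j]
  by (auto simp: L2_per_iff periodic_def)

lemma vcoef_diff: "u \<in> L2_per L \<Longrightarrow> v \<in> L2_per L \<Longrightarrow> vcoef (\<lambda>x. u x - v x) k = vcoef u k - vcoef v k"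
  by (simp add: vcoef_def vec_eq_iff coef_diff[OF L2c_integrable L2c_integrable] L2_perD)
lemma vcoef_add: "u \<in> L2_per L \<Longrightarrow> v \<in> L2_per L \<Longrightarrow> vcoef (\<lambda>x. u x + v x) k = vcoef u k + vcoef v k"
  by (simp add: vcoef_def vec_eq_iff coef_add[OF L2c_integrable L2c_integrable] L2_perD)
lemma vcoef_scaleR: "vcoef (\<lambda>x. r *\<^sub>R u x) k = r *\<^sub>R vcoef u k"
  by (simp add: vcoef_def vec_eq_iff coef_cmult) (simp add: scaleR_conv_of_real)

lemma hermitian_vcoef: "hermitian (vcoef u)"
proof -
  have "coef (\<lambda>x. of_real (u x $ j)) (-k) = cnj (coef (\<lambda>x. of_real (u x $ j)) k)" for j k
    using coef_cnj[of "\<lambda>x. of_real (u x $ j)" "-k"] by simp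
  then show ?thesis by (simp add: hermitian_def vcoef_def vec_eq_iff)
qed

lemma AE_eq_of_vcoef_eq:
  assumes "u \<in> L2_per L" "v \<in> L2_per L" "\<And>k. vcoef u k = vcoef v k"
  shows "AE x in \<mu>. u x = v x"
proof -
  have "AE x in \<mu>. complex_of_real (u x $ j) = of_real (v x $ j)" for j
    using assms by (intro AE_eq_of_coef_eq) (auto simp: L2_perD vcoef_def vec_eq_iff)
  then have "AE x in \<mu>. \<forall>j. u x $ j = v x $ j" by (simp add: AE_all_countable)
  then show ?thesis by eventually_elim (simp add: vec_eq_iff)
qed

lemma vcoef_cong_AE:
  assumes "u \<in> L2_per L" "v \<in> L2_per L" "AE x in \<mu>. u x = v x"
  shows "vcoef u k = vcoef v k"
proof -
  have "coef (\<lambda>x. of_real (u x $ j)) k = coef (\<lambda>x. of_real (v x $ j)) k" for j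
    by (rule coef_cong_AE) (use assms L2_perD[THEN L2c_measurable] in auto)
  then show ?thesis by (simp add: vcoef_def)
qed

lemma L2_inner_parseval:
  assumes u: "u \<in> L2_per L" and v: "v \<in> L2_per L"
  shows "integrable modes (\<lambda>k. vcoef u k \<bullet> vcoef v k)"
    "L2_inner L u v = vol * (LINT k|modes. vcoef u k \<bullet> vcoef v k)"
proof -
  let ?u = "\<lambda>j x. complex_of_real (u x $ j)" and ?v = "\<lambda>j x. complex_of_real (v x $ j)"
  note p = parseval_inner[OF L2_perD[OF u] L2_perD[OF v]]
  have i: "integrable modes (\<lambda>k. Re (coef (?u j) k * cnj (coef (?v j) k)))" for j
    by (rule integrable_Re) (rule p(1))
  then show "integrable modes (\<lambda>k. vcoef u k \<bullet> vcoef v k)"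
    unfolding inner_complex_vec vcoef_def vec_lambda_beta by (rule Bochner_Integration.integrable_sum)
  have j: "integrable \<mu> (\<lambda>x. ?u j x * cnj (?v j x))" for j
    using L2_perD[OF u] L2_perD[OF v] by (intro L2c_mult_integrable) auto
  have m: "(LINT x|\<mu>. Re (?u j x * cnj (?v j x))) = vol * (LINT k|modes. Re (coef (?u j) k * cnj (coef (?v j) k)))" for j
    unfolding integral_Re[OF j] integral_Re[OF p(1)] p(2) by simp
  have "L2_inner L u v = (LINT x|\<mu>. (\<Sum>j\<in>UNIV. Re (?u j x * cnj (?v j x))))"
    by (simp add: L2_inner_def inner_vec_def)
  also have "\<dots> = (\<Sum>j\<in>UNIV. LINT x|\<mu>. Re (?u j x * cnj (?v j x)))"
    by (rule Bochner_Integration.integral_sum) (rule integrable_Re[OF j])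
  also have "\<dots> = vol * (LINT k|modes. (\<Sum>j\<in>UNIV. Re (coef (?u j) k * cnj (coef (?v j) k))))"
    unfolding m Bochner_Integration.integral_sum[OF i] sum_distrib_left ..
  finally show "L2_inner L u v = vol * (LINT k|modes. vcoef u k \<bullet> vcoef v k)"
    by (simp add: inner_complex_vec vcoef_def)
qed

lemma L2_norm_parseval:
  assumes u: "u \<in> L2_per L"
  shows "integrable modes (\<lambda>k. (norm (vcoef u k))\<^sup>2)"
    "(L2_norm L u)\<^sup>2 = vol * (LINT k|modes. (norm (vcoef u k))\<^sup>2)"
proof -
  show "integrable modes (\<lambda>k. (norm (vcoef u k))\<^sup>2)"
    using L2_inner_parseval(1)[OF u u] by (simp add: power2_norm_eq_inner)
  have "0 \<le> L2_inner L u u" by (simp add: L2_inner_def)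
  then show "(L2_norm L u)\<^sup>2 = vol * (LINT k|modes. (norm (vcoef u k))\<^sup>2)"
    using L2_inner_parseval(2)[OF u u] by (simp add: power2_norm_eq_inner L2_norm_def)
qed

text \<open>Riesz-Fischer in each component, the symmetry making the components real. The pointwise
  bound by the sum of the coefficients is what later makes the advection term square
  integrable.\<close>

lemma field_of_coefficients:
  assumes c: "integrable modes (\<lambda>k. (norm (c k))\<^sup>2)" and h: "hermitian c"
  obtains u where "u \<in> L2_per L" "\<And>k. vcoef u k = c k"
    "\<And>B x j. (\<And>F. finite F \<Longrightarrow> (\<Sum>k\<in>F. norm (c k)) \<le> B) \<Longrightarrow> \<bar>u x $ j\<bar> \<le> B"
proof -
  have "\<exists>w. L2c w \<and> (\<forall>k. coef w k = c k $ j) \<and> periodic L w \<and> (\<forall>x. w x \<in> \<real>) \<and>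
     (\<forall>B x. (\<forall>F. finite F \<longrightarrow> (\<Sum>k\<in>F. cmod (c k $ j)) \<le> B) \<longrightarrow> cmod (w x) \<le> B)" for j
  proof -
    have "(cmod (c k $ j))\<^sup>2 \<le> (norm (c k))\<^sup>2" for k by (intro power_mono Finite_Cartesian_Product.norm_nth_le) simp
    then have i: "integrable modes (\<lambda>k. (cmod (c k $ j))\<^sup>2)"
      by (intro Bochner_Integration.integrable_bound[OF c]) auto
    show ?thesis
      by (rule riesz_fischer[OF i]) (use h in \<open>auto simp: hermitian_def\<close>)
  qed
  then obtain w where w: "\<And>j. L2c (w j)" "\<And>j k. coef (w j) k = c k $ j" "\<And>j. periodic L (w j)" "\<And>j x. w j x \<in> \<real>"
     "\<And>j B x. (\<And>F. finite F \<Longrightarrow> (\<Sum>k\<in>F. cmod (c k $ j)) \<le> B) \<Longrightarrow> cmod (w j x) \<le> B"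
    by metis
  define u where "u x = (\<chi> j. Re (w j x))" for x
  have eq: "(\<lambda>x. complex_of_real (u x $ j)) = w j" for j
    using w(4) by (simp add: u_def)
  show thesis
  proof
    show "u \<in> L2_per L" unfolding L2_per_iff eq using w by (auto simp: periodic_def u_def)
    show "vcoef u k = c k" for k unfolding vcoef_def eq by (simp add: w)
    fix B x j assume B: "\<And>F. finite F \<Longrightarrow> (\<Sum>k\<in>F. norm (c k)) \<le> B"
    have "cmod (w j x) \<le> B"
    proof (rule w(5))
      fix F :: "(int^3) set" assume "finite F"
      have "(\<Sum>k\<in>F. cmod (c k $ j)) \<le> (\<Sum>k\<in>F. norm (c k))" by (intro sum_mono Finite_Cartesian_Product.norm_nth_le)
      also have "\<dots> \<le> B" by (rule B) fact
      finally show "(\<Sum>k\<in>F. cmod (c k $ j)) \<le> B" .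
    qed
    then show "\<bar>u x $ j\<bar> \<le> B" using abs_Re_le_cmod[of "w j x"] by (simp add: u_def)
  qed
qed

text \<open>The Fourier symbol of the derivative with multi-index \<beta>.\<close>

definition dfac :: "nat^3 \<Rightarrow> int^3 \<Rightarrow> complex" where
  "dfac \<beta> k = (\<Prod>i\<in>UNIV. (\<i> * of_real (wave k $ i)) ^ (\<beta> $ i))"

lemma prod_3: "prod f (UNIV::3 set) = f 1 * f 2 * f 3"
  for f :: "3 \<Rightarrow> 'a::comm_monoid_mult"
  unfolding UNIV_3 by (simp add: ac_simps)

text \<open>Conjugation acts on the symbol by the same sign that repeated integration by parts
  produces; this matches the sign in \<open>is_weak_derivative\<close>.\<close>

lemma cnj_dfac: "cnj (dfac \<beta> k) = (-1) ^ mi_order \<beta> * dfac \<beta> k"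
  by (simp add: dfac_def prod_3 mi_order_def sum_3 power_add power_mult_distrib)
    (simp add: power_minus[of \<i>] mult_ac)

lemma dfac_uminus: "dfac \<beta> (- k) = cnj (dfac \<beta> k)"
  by (simp add: dfac_def wave_minus)

text \<open>The partial derivative of the periodic function \<open>expo (-k) x * \<phi> x\<close>
  has integral 0; the product rule does the rest.\<close>

lemma coef_partial:
  fixes \<phi> :: "real^3 \<Rightarrow> real"
  assumes s: "smooth \<phi>" and p: "periodic L \<phi>"
  shows "coef (\<lambda>x. of_real (partial i \<phi> x)) k = \<i> * of_real (wave k $ i) * coef (\<lambda>x. of_real (\<phi> x)) k"
proof -
  define \<psi> where "\<psi> x = expo (-k) x * complex_of_real (\<phi> x)" for x
  let ?D = "\<lambda>x h. expo (-k) x * complex_of_real (frechet_derivative \<phi> (at x) h)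
      + \<i> * of_real (wave (-k) \<bullet> h) * expo (-k) x * of_real (\<phi> x)"
  have der: "(\<psi> has_derivative ?D x) (at x)" for x
    unfolding \<psi>_def
    by (rule has_derivative_mult[OF expo_has_derivative
          bounded_linear.has_derivative[OF bounded_linear_of_real smooth_has_derivative[OF s]]])
  have part: "partial i \<psi> = (\<lambda>x. expo (-k) x * complex_of_real (partial i \<phi> x)
      - \<i> * of_real (wave k $ i) * (expo (-k) x * of_real (\<phi> x)))"
    by (rule ext, subst partial_eqI[OF der]) (simp add: partial_def inner_axis wave_minus mult_ac)
  note c = smooth_continuous[OF s] smooth_continuous[OF smooth_partial[OF s]]
  have "(LINT x|\<mu>. partial i \<psi> x) = 0"
  proof (rule integral_partial_periodic)
    show "periodic L \<psi>" using p expo_periodic by (simp add: periodic_def \<psi>_def)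
    show "\<psi> differentiable_on UNIV"
      using der by (auto simp: differentiable_on_def differentiable_def intro: has_derivative_at_withinI)
    show "continuous_on UNIV (partial i \<psi>)" unfolding part by (intro continuous_intros c)
  qed
  moreover have i: "integrable \<mu> (\<lambda>x. expo (-k) x * complex_of_real (partial i \<phi> x))"
      "integrable \<mu> (\<lambda>x. expo (-k) x * complex_of_real (\<phi> x))"
    by (intro continuous_imp_integrable continuous_intros c)+
  have "(LINT x|\<mu>. partial i \<psi> x) = (LINT x|\<mu>. expo (-k) x * complex_of_real (partial i \<phi> x)) -
     \<i> * of_real (wave k $ i) * (LINT x|\<mu>. expo (-k) x * of_real (\<phi> x))"
    unfolding part
    by (subst Bochner_Integration.integral_diff[OF i(1) integrable_mult_right[OF i(2)]])
      (subst integral_mult_right_zero, rule refl)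
  ultimately show ?thesis by (simp add: coef_def)
qed

lemma coef_multi_partial:
  fixes \<phi> :: "real^3 \<Rightarrow> real"
  assumes s: "smooth \<phi>" and p: "periodic L \<phi>"
  shows "coef (\<lambda>x. of_real (multi_partial \<beta> \<phi> x)) k = dfac \<beta> k * coef (\<lambda>x. of_real (\<phi> x)) k"
proof -
  have *: "coef (\<lambda>x. of_real ((partial i ^^ n) \<phi> x)) k = (\<i> * of_real (wave k $ i)) ^ n * coef (\<lambda>x. of_real (\<phi> x)) k"
    if "smooth \<phi>" "periodic L \<phi>" for i n and \<phi> :: "real^3 \<Rightarrow> real"
    using smooth_periodic_funpow_partial[OF that, where i=i] by (induct n) (auto simp: coef_partial mult_ac)
  show ?thesis
    using smooth_periodic_funpow_partial[OF s p]
      smooth_periodic_funpow_partial[OF conjunct1 conjunct2, OF smooth_periodic_funpow_partial smooth_periodic_funpow_partial, OF s p s p]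
    by (simp add: multi_partial_def * s p dfac_def prod_3 mult_ac)
qed

lemma L2c_smooth: "smooth \<phi> \<Longrightarrow> L2c (\<lambda>x. complex_of_real (\<phi> x))"
  unfolding L2c_def
  by (intro conjI continuous_imp_integrable continuous_imp_measurable_on_sets_lebesgue continuous_intros smooth_continuous) auto

lemma smooth_periodic_L2_per:
  fixes \<phi> :: vfield
  assumes "smooth \<phi>" "periodic L \<phi>" shows "\<phi> \<in> L2_per L"
  using assms L2c_smooth[OF smooth_component] by (auto simp: L2_per_iff)

end

subsection \<open>Sobolev norms and spaces in terms of coefficients\<close>

lemma integrable_vec:
  fixes f :: "'a \<Rightarrow> ('b::euclidean_space)^'n"
  assumes "\<And>j. integrable M (\<lambda>x. f x $ j)"
  shows "integrable M f" "(LINT x|M. f x) $ j = (LINT x|M. f x $ j)"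
proof -
  have bl: "bounded_linear (axis j :: 'b \<Rightarrow> 'b^'n)" for j
    by (intro linear_conv_bounded_linear[THEN iffD1] linearI) (auto simp: vec_eq_iff axis_def)
  have "f = (\<lambda>x. \<Sum>j\<in>UNIV. axis j (f x $ j))"
    by (rule ext) (simp add: vec_eq_iff axis_def if_distrib cong: if_cong)
  moreover have "integrable M (\<lambda>x. \<Sum>j\<in>UNIV. axis j (f x $ j) :: 'b^'n)"
    by (intro Bochner_Integration.integrable_sum integrable_bounded_linear[OF bl] assms)
  ultimately show i: "integrable M f" by simp
  show "(LINT x|M. f x) $ j = (LINT x|M. f x $ j)"
    using integral_bounded_linear[OF bounded_linear_vec_nth i] by simp
qed

context torus begin

text \<open>Test functions for weak derivatives are real, so exponentials enter through real parts.
  The free factor \<open>c\<close> makes up for this: \<open>1\<close> and \<open>- \<i>\<close>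
  recover both parts of a complex identity.\<close>

lemma expo_test_smooth:
  fixes c :: complex
  shows "smooth (\<lambda>x. Re (c * expo k x))" "periodic L (\<lambda>x. Re (c * expo k x))"
    "multi_partial \<beta> (\<lambda>x. Re (c * expo k x)) = (\<lambda>x. Re (c * dfac \<beta> k * expo k x))"
proof -
  have der: "((\<lambda>x. Re (c * expo k x)) has_derivative (\<lambda>h. Re (c * (\<i> * of_real (wave k \<bullet> h) * expo k x)))) (at x)" for c x
    by (intro bounded_linear.has_derivative[OF bounded_linear_Re]
        bounded_linear.has_derivative[OF bounded_linear_mult_right] expo_has_derivative)
  have part: "partial i (\<lambda>x. Re (c * expo k x)) = (\<lambda>x. Re ((c * (\<i> * of_real (wave k $ i))) * expo k x))" for i c
    by (rule ext, subst partial_eqI[OF der]) (simp add: inner_axis algebra_simps)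
  have "\<exists>d. foldr partial is (\<lambda>x. Re (c * expo k x)) = (\<lambda>x. Re (d * expo k x))" for "is"
  proof (induct "is")
    case (Cons i "is")
    then obtain d where "foldr partial is (\<lambda>x. Re (c * expo k x)) = (\<lambda>x. Re (d * expo k x))" by blast
    then have "foldr partial (i # is) (\<lambda>x. Re (c * expo k x)) = (\<lambda>x. Re ((d * (\<i> * of_real (wave k $ i))) * expo k x))"
      by (simp only: foldr_Cons o_apply part)
    then show ?case by (rule exI)
  next
    case Nil
    show ?case by (rule exI[of _ c]) simp
  qed
  moreover have "(\<lambda>x. Re (d * expo k x)) differentiable_on UNIV" for d
    using der by (auto simp: differentiable_on_def differentiable_def intro: has_derivative_at_withinI)
  ultimately show "smooth (\<lambda>x. Re (c * expo k x))" by (metis smooth_def)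
  show "periodic L (\<lambda>x. Re (c * expo k x))" using expo_periodic by (simp add: periodic_def)
  have pow: "(partial i ^^ n) (\<lambda>x. Re (c * expo k x)) = (\<lambda>x. Re ((c * (\<i> * of_real (wave k $ i)) ^ n) * expo k x))" for i n c
  proof (induct n)
    case (Suc n)
    then show ?case by (simp only: funpow.simps o_apply part) (simp add: mult_ac)
  qed simp
  have d: "c * dfac \<beta> k = c * (\<i> * of_real (wave k $ 3)) ^ (\<beta> $ 3) * (\<i> * of_real (wave k $ 2)) ^ (\<beta> $ 2) * (\<i> * of_real (wave k $ 1)) ^ (\<beta> $ 1)"
    by (simp add: dfac_def prod_3 mult_ac)
  show "multi_partial \<beta> (\<lambda>x. Re (c * expo k x)) = (\<lambda>x. Re (c * dfac \<beta> k * expo k x))"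
    unfolding multi_partial_def pow d ..
qed

lemma weak_derivative_iff_component:
  assumes u: "u \<in> L2_per L"
  shows "is_weak_derivative L \<beta> u g \<longleftrightarrow> g \<in> L2_per L \<and>
     (\<forall>\<phi> :: real^3 \<Rightarrow> real. smooth \<phi> \<longrightarrow> periodic L \<phi> \<longrightarrow> (\<forall>j.
        (LINT x|\<mu>. multi_partial \<beta> \<phi> x * u x $ j) = (-1) ^ mi_order \<beta> * (LINT x|\<mu>. \<phi> x * g x $ j)))"
proof -
  have i: "integrable \<mu> (\<lambda>x. \<psi> x * v x $ j)" if "v \<in> L2_per L" "smooth \<psi>" for \<psi> v j
  proof -
    have "integrable \<mu> (\<lambda>x. complex_of_real (\<psi> x) * of_real (v x $ j))"
      using that by (intro L2c_mult_integrable L2c_smooth L2_perD)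
    from integrable_Re[OF this] show ?thesis by simp
  qed
  have "(LINT x|\<mu>. multi_partial \<beta> \<phi> x *\<^sub>R u x) = (-1) ^ mi_order \<beta> *\<^sub>R (LINT x|\<mu>. \<phi> x *\<^sub>R g x)
     \<longleftrightarrow> (\<forall>j. (LINT x|\<mu>. multi_partial \<beta> \<phi> x * u x $ j) = (-1) ^ mi_order \<beta> * (LINT x|\<mu>. \<phi> x * g x $ j))"
    if "g \<in> L2_per L" "smooth \<phi>" "periodic L \<phi>" for \<phi> :: "real^3 \<Rightarrow> real"
  proof -
    have "(LINT x|\<mu>. multi_partial \<beta> \<phi> x *\<^sub>R u x) $ j = (LINT x|\<mu>. multi_partial \<beta> \<phi> x * u x $ j)" for j
      using i[OF u smooth_periodic_multi_partial(1)[OF that(2,3)]] by (subst integrable_vec(2)) auto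
    moreover have "(LINT x|\<mu>. \<phi> x *\<^sub>R g x) $ j = (LINT x|\<mu>. \<phi> x * g x $ j)" for j
      using i[OF that(1,2)] by (subst integrable_vec(2)) auto
    ultimately show ?thesis by (simp add: vec_eq_iff)
  qed
  then show ?thesis unfolding is_weak_derivative_def by auto
qed

text \<open>From left to right one tests with real parts of exponentials. Conversely, Parseval turns
  the pairing of a test function with a derivative into a sum over modes, in which the symbol can be
  moved from \<phi> to \<open>u\<close>.\<close>

lemma weak_derivative_iff:
  assumes u: "u \<in> L2_per L"
  shows "is_weak_derivative L \<beta> u g \<longleftrightarrow> g \<in> L2_per L \<and> (\<forall>k. vcoef g k = dfac \<beta> k *s vcoef u k)"
proof (cases "g \<in> L2_per L")
  case g: True
  let ?c = "\<lambda>v j. coef (\<lambda>x. complex_of_real (v x $ j))"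
  have "(\<forall>\<phi> :: real^3 \<Rightarrow> real. smooth \<phi> \<longrightarrow> periodic L \<phi> \<longrightarrow> (\<forall>j.
        (LINT x|\<mu>. multi_partial \<beta> \<phi> x * u x $ j) = (-1) ^ mi_order \<beta> * (LINT x|\<mu>. \<phi> x * g x $ j)))
     \<longleftrightarrow> (\<forall>k j. ?c g j k = dfac \<beta> k * ?c u j k)" (is "?A \<longleftrightarrow> ?B")
  proof
    assume A: ?A
    show ?B
    proof (intro allI)
      fix k j
      have i: "(LINT x|\<mu>. Re (c * expo (-k) x) * v x $ j) = Re (c * (of_real vol * ?c v j k))" if "v \<in> L2_per L" for c v
      proof -
        have "integrable \<mu> (\<lambda>x. c * (expo (-k) x * complex_of_real (v x $ j)))"
          using that by (intro integrable_mult_right integrable_expo_mult L2c_integrable L2_perD)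
        from integral_Re[OF this]
        have "(LINT x|\<mu>. Re (c * expo (-k) x) * v x $ j) = Re (c * (LINT x|\<mu>. expo (-k) x * complex_of_real (v x $ j)))"
          by (simp add: algebra_simps)
        then show ?thesis using vol_pos by (simp add: coef_def)
      qed
      have *: "Re (c * dfac \<beta> (-k) * (of_real vol * ?c u j k)) = (-1) ^ mi_order \<beta> * Re (c * (of_real vol * ?c g j k))" for c
        using A[rule_format, OF expo_test_smooth(1,2), of c "-k" j]
        unfolding expo_test_smooth(3) i[OF u] i[OF g] .
      define P Q where "P = dfac \<beta> (-k) * (of_real vol * ?c u j k)" and "Q = (-1) ^ mi_order \<beta> * (of_real vol * ?c g j k)"
      have r: "Re ((-1) ^ n * z) = (-1) ^ n * Re z" "Im ((-1) ^ n * z) = (-1) ^ n * Im z" for n z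
        by (cases "even n"; simp)+
      have "P = Q"
        using *[of 1] *[of "- \<i>"] unfolding P_def Q_def complex_eq_iff r by (simp add: mult.assoc)
      then have "of_real vol * ((-1) ^ mi_order \<beta> * dfac \<beta> k * ?c u j k) = of_real vol * ((-1) ^ mi_order \<beta> * ?c g j k)"
        unfolding P_def Q_def dfac_uminus cnj_dfac by (simp add: mult_ac)
      then show "?c g j k = dfac \<beta> k * ?c u j k" using vol_pos by simp
    qed
  next
    assume B: ?B
    show ?A
    proof (intro allI impI)
      fix \<phi> :: "real^3 \<Rightarrow> real" and j assume \<phi>: "smooth \<phi>" "periodic L \<phi>"
      let ?f = "\<lambda>x. complex_of_real (\<phi> x)" and ?d = "\<lambda>x. complex_of_real (multi_partial \<beta> \<phi> x)"
      have "complex_of_real (LINT x|\<mu>. multi_partial \<beta> \<phi> x * u x $ j) = (LINT x|\<mu>. complex_of_real (u x $ j) * cnj (?d x))"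
        by (subst integral_complex_of_real[symmetric]) (simp add: mult.commute)
      also have "\<dots> = of_real vol * (LINT k|modes. ?c u j k * cnj (coef ?d k))"
        by (rule parseval_inner(2)[OF L2_perD[OF u] L2c_smooth[OF smooth_periodic_multi_partial(1)[OF \<phi>]]])
      also have "(\<lambda>k. ?c u j k * cnj (coef ?d k)) = (\<lambda>k. (-1) ^ mi_order \<beta> * (?c g j k * cnj (coef ?f k)))"
        by (rule ext) (simp add: coef_multi_partial[OF \<phi>] cnj_dfac B mult_ac)
      also have "of_real vol * (LINT k|modes. (-1) ^ mi_order \<beta> * (?c g j k * cnj (coef ?f k))) =
          (-1) ^ mi_order \<beta> * (of_real vol * (LINT k|modes. ?c g j k * cnj (coef ?f k)))"
        by simp
      also have "of_real vol * (LINT k|modes. ?c g j k * cnj (coef ?f k)) = (LINT x|\<mu>. complex_of_real (g x $ j) * cnj (?f x))"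
        by (rule parseval_inner(2)[symmetric, OF L2_perD[OF g] L2c_smooth[OF \<phi>(1)]])
      also have "\<dots> = complex_of_real (LINT x|\<mu>. \<phi> x * g x $ j)"
        by (subst integral_complex_of_real[symmetric]) (simp add: mult.commute)
      finally have "complex_of_real (LINT x|\<mu>. multi_partial \<beta> \<phi> x * u x $ j) =
          complex_of_real ((-1) ^ mi_order \<beta> * (LINT x|\<mu>. \<phi> x * g x $ j))" by simp
      then show "(LINT x|\<mu>. multi_partial \<beta> \<phi> x * u x $ j) = (-1) ^ mi_order \<beta> * (LINT x|\<mu>. \<phi> x * g x $ j)"
        unfolding of_real_eq_iff .
    qed
  qed
  then show ?thesis using g unfolding weak_derivative_iff_component[OF u] by (simp add: vec_eq_iff vcoef_def)
qed (simp add: is_weak_derivative_def)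

text \<open>The Fourier multiplier of the squared Sobolev norm of order \<open>m\<close>, up to the
  factor \<open>vol\<close>.\<close>

definition swt :: "nat \<Rightarrow> int^3 \<Rightarrow> real" where
  "swt m k = (\<Sum>\<beta> | mi_order \<beta> \<le> m. (cmod (dfac \<beta> k))\<^sup>2)"

lemma mi_order_0 [simp]: "mi_order 0 = 0" by (simp add: mi_order_def)
lemma dfac_0 [simp]: "dfac 0 k = 1" by (simp add: dfac_def)

lemma swt_ge: "mi_order \<beta> \<le> m \<Longrightarrow> (cmod (dfac \<beta> k))\<^sup>2 \<le> swt m k"
  unfolding swt_def by (rule member_le_sum) auto
lemma swt_ge_1: "1 \<le> swt m k"
  using swt_ge[of 0 m k] by simp
lemma swt_0: "swt 0 k = 1"
proof -
  have "{\<beta>. mi_order \<beta> \<le> 0} = {0}" by (auto simp: mi_order_def vec_eq_iff)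
  then show ?thesis by (simp add: swt_def)
qed

lemma is_weak_derivative_weak_derivative:
  assumes "u \<in> sobolev_per L m" "mi_order \<beta> \<le> m"
  shows "is_weak_derivative L \<beta> u (weak_derivative L \<beta> u)"
proof -
  have "\<exists>g. is_weak_derivative L \<beta> u g" using assms unfolding sobolev_per_def by simp
  then show ?thesis unfolding weak_derivative_def by (rule someI_ex)
qed

lemma sobolev_per_L2: "u \<in> sobolev_per L m \<Longrightarrow> u \<in> L2_per L"
  by (simp add: sobolev_per_def)

lemma weak_derivative_coef:
  assumes "u \<in> sobolev_per L m" "mi_order \<beta> \<le> m"
  shows "weak_derivative L \<beta> u \<in> L2_per L" "vcoef (weak_derivative L \<beta> u) k = dfac \<beta> k *s vcoef u k"
  using is_weak_derivative_weak_derivative[OF assms]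
  unfolding weak_derivative_iff[OF sobolev_per_L2[OF assms(1)]] by auto

lemma sobolev_norm_parseval:
  assumes u: "u \<in> sobolev_per L m"
  shows "integrable modes (\<lambda>k. swt m k * (norm (vcoef u k))\<^sup>2)"
    "(sobolev_norm L m u)\<^sup>2 = vol * (LINT k|modes. swt m k * (norm (vcoef u k))\<^sup>2)"
proof -
  have i: "integrable modes (\<lambda>k. (cmod (dfac \<beta> k))\<^sup>2 * (norm (vcoef u k))\<^sup>2)"
    and n: "(L2_norm L (weak_derivative L \<beta> u))\<^sup>2 = vol * (LINT k|modes. (cmod (dfac \<beta> k))\<^sup>2 * (norm (vcoef u k))\<^sup>2)"
    if "mi_order \<beta> \<le> m" for \<beta>
    using L2_norm_parseval[OF weak_derivative_coef(1)[OF u that]]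
    by (simp_all add: weak_derivative_coef(2)[OF u that] norm_smult power_mult_distrib)
  have eq: "(\<lambda>k. swt m k * (norm (vcoef u k))\<^sup>2) = (\<lambda>k. \<Sum>\<beta> | mi_order \<beta> \<le> m. (cmod (dfac \<beta> k))\<^sup>2 * (norm (vcoef u k))\<^sup>2)"
    by (simp add: swt_def sum_distrib_right)
  show "integrable modes (\<lambda>k. swt m k * (norm (vcoef u k))\<^sup>2)"
    unfolding eq by (rule Bochner_Integration.integrable_sum) (simp add: i)
  have "(sobolev_norm L m u)\<^sup>2 = (\<Sum>\<beta> | mi_order \<beta> \<le> m. (L2_norm L (weak_derivative L \<beta> u))\<^sup>2)"
    unfolding sobolev_norm_def by (rule real_sqrt_pow2) (simp add: sum_nonneg)
  also have "\<dots> = vol * (LINT k|modes. swt m k * (norm (vcoef u k))\<^sup>2)"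
    unfolding eq by (subst Bochner_Integration.integral_sum) (simp_all add: i n sum_distrib_left)
  finally show "(sobolev_norm L m u)\<^sup>2 = vol * (LINT k|modes. swt m k * (norm (vcoef u k))\<^sup>2)" .
qed

text \<open>Multiplying the coefficients by the symbol gives a square-summable hermitian family, and
  the field belonging to it is the weak derivative. Existence of weak derivatives thus becomes
  summability.\<close>

lemma sobolev_per_iff:
  "u \<in> sobolev_per L m \<longleftrightarrow> u \<in> L2_per L \<and> integrable modes (\<lambda>k. swt m k * (norm (vcoef u k))\<^sup>2)"
proof
  assume A: "u \<in> L2_per L \<and> integrable modes (\<lambda>k. swt m k * (norm (vcoef u k))\<^sup>2)"
  show "u \<in> sobolev_per L m"
    unfolding sobolev_per_def
  proof (intro CollectI conjI allI impI)
    fix \<beta> assume \<beta>: "mi_order \<beta> \<le> m"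
    have "norm ((norm (dfac \<beta> k *s vcoef u k))\<^sup>2) \<le> norm (swt m k * (norm (vcoef u k))\<^sup>2)" for k
      using swt_ge[OF \<beta>, of k] swt_ge_1[of m k] by (simp add: norm_smult power_mult_distrib mult_right_mono)
    then have i: "integrable modes (\<lambda>k. (norm (dfac \<beta> k *s vcoef u k))\<^sup>2)"
      by (intro Bochner_Integration.integrable_bound[OF conjunct2[OF A]]) auto
    have h: "hermitian (\<lambda>k. dfac \<beta> k *s vcoef u k)"
      using hermitian_vcoef[of u] by (simp add: hermitian_def dfac_uminus)
    obtain g where "g \<in> L2_per L" "\<And>k. vcoef g k = dfac \<beta> k *s vcoef u k"
      by (rule field_of_coefficients[OF i h]) (rule that)
    then show "\<exists>g. is_weak_derivative L \<beta> u g" using A by (auto simp: weak_derivative_iff)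
  qed (use A in simp)
qed (auto simp: sobolev_norm_parseval sobolev_per_L2)

lemma sobolev_per_diff:
  assumes "u \<in> sobolev_per L m" "v \<in> sobolev_per L m"
  shows "(\<lambda>x. u x - v x) \<in> sobolev_per L m"
proof -
  have L: "u \<in> L2_per L" "v \<in> L2_per L" using assms by (auto simp: sobolev_per_iff)
  have i: "integrable modes (\<lambda>k. 2 * (swt m k * (norm (vcoef u k))\<^sup>2) + 2 * (swt m k * (norm (vcoef v k))\<^sup>2))"
    using assms by (auto simp: sobolev_per_iff)
  have "norm (swt m k * (norm (vcoef u k - vcoef v k))\<^sup>2) \<le> norm (2 * (swt m k * (norm (vcoef u k))\<^sup>2) + 2 * (swt m k * (norm (vcoef v k))\<^sup>2))" for k
  proof -
    have "(norm (vcoef u k - vcoef v k))\<^sup>2 \<le> (norm (vcoef u k) + norm (vcoef v k))\<^sup>2"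
      by (intro power_mono norm_triangle_ineq4) simp
    also have "\<dots> \<le> 2 * (norm (vcoef u k))\<^sup>2 + 2 * (norm (vcoef v k))\<^sup>2"
      using zero_le_power2[of "norm (vcoef u k) - norm (vcoef v k)"] by (simp add: power2_sum power2_diff)
    finally have "swt m k * (norm (vcoef u k - vcoef v k))\<^sup>2 \<le> swt m k * (2 * (norm (vcoef u k))\<^sup>2 + 2 * (norm (vcoef v k))\<^sup>2)"
      using swt_ge_1[of m k] by (intro mult_left_mono) auto
    then show ?thesis using swt_ge_1[of m k] by (simp add: algebra_simps)
  qed
  then have "integrable modes (\<lambda>k. swt m k * (norm (vcoef u k - vcoef v k))\<^sup>2)"
    by (intro Bochner_Integration.integrable_bound[OF i]) auto
  then show ?thesis using L by (auto simp: sobolev_per_iff vcoef_diff)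
qed

end

subsection \<open>Leray projection and advection in terms of coefficients\<close>

definition cvec :: "real^'n \<Rightarrow> complex^'n" where "cvec x = (\<chi> j. of_real (x $ j))"

lemma rdot_add: "rdot x (a + b) = rdot x a + rdot x b"
  by (simp add: rdot_def distrib_left sum.distrib)
lemma rdot_diff: "rdot x (a - b) = rdot x a - rdot x b"
  by (simp add: rdot_def right_diff_distrib sum_subtractf)
lemma rdot_smult: "rdot x (c *s a) = c * rdot x a"
  by (simp add: rdot_def sum_distrib_left mult_ac)
lemma rdot_scaleR: "rdot x (r *\<^sub>R a) = of_real r * rdot x a"
  by (simp only: rdot_def vector_scaleR_component) (simp add: scaleR_conv_of_real sum_distrib_left mult_ac)
lemma rdot_0 [simp]: "rdot 0 a = 0" "rdot x 0 = 0"
  by (simp_all add: rdot_def)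
lemma rdot_left_add: "rdot (x + y) a = rdot x a + rdot y a"
  by (simp add: rdot_def distrib_right sum.distrib)
lemma rdot_minus [simp]: "rdot (- x) a = - rdot x a"
  by (simp add: rdot_def sum_negf)
lemma rdot_cnjv: "rdot x (cnjv a) = cnj (rdot x a)"
  by (simp add: rdot_def)
lemma rdot_cvec: "rdot x (cvec x) = of_real ((norm x)\<^sup>2)"
  unfolding norm_vec_square by (simp add: rdot_def cvec_def power2_eq_square)

lemma norm_rdot_le: "cmod (rdot x a) \<le> norm x * norm a"
proof -
  have "cmod (rdot x a) \<le> (\<Sum>j\<in>UNIV. \<bar>x $ j\<bar> * \<bar>cmod (a $ j)\<bar>)"
    unfolding rdot_def by (rule order_trans[OF norm_sum]) (simp add: norm_mult)
  also have "\<dots> \<le> L2_set (($) x) UNIV * L2_set (\<lambda>j. cmod (a $ j)) UNIV"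
    by (rule L2_set_mult_ineq)
  finally show ?thesis by (simp add: norm_vec_def L2_set_def)
qed

lemma inner_smult_cvec: "(c *s cvec x) \<bullet> b = Re (c * cnj (rdot x b))"
  by (simp add: inner_complex_vec cvec_def rdot_def sum_distrib_left mult_ac)

lemma rdot_tendsto [tendsto_intros]: "(f \<longlongrightarrow> a) F \<Longrightarrow> ((\<lambda>n. rdot x (f n)) \<longlongrightarrow> rdot x a) F"
  unfolding rdot_def by (intro tendsto_intros)

context torus begin

text \<open>The symbol of the Leray projection, that is the orthogonal projection onto the
  complement of the wave vector. Mode 0 is sent to 0 because fields in \<open>V_space L 0\<close>
  have zero average.\<close>

definition proj :: "int^3 \<Rightarrow> complex^3 \<Rightarrow> complex^3" where
  "proj k a = (if k = 0 then 0 else a - (rdot (wave k) a / of_real ((norm (wave k))\<^sup>2)) *s cvec (wave k))"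

lemma proj_0 [simp]: "proj 0 a = 0" "proj k 0 = 0"
  by (simp_all add: proj_def vec_eq_iff)

lemma rdot_proj [simp]: "rdot (wave k) (proj k a) = 0"
  by (simp add: proj_def rdot_diff rdot_smult rdot_cvec)

lemma proj_id: "rdot (wave k) a = 0 \<Longrightarrow> (k = 0 \<Longrightarrow> a = 0) \<Longrightarrow> proj k a = a"
  by (auto simp: proj_def)

lemma proj_add: "proj k (a + b) = proj k a + proj k b"
  by (simp add: proj_def rdot_add add_divide_distrib vec_eq_iff algebra_simps)
lemma proj_scaleR: "proj k (r *\<^sub>R a) = r *\<^sub>R proj k a"
  by (simp add: proj_def rdot_scaleR vec_eq_iff) (simp add: scaleR_conv_of_real algebra_simps)
lemma proj_diff: "proj k (a - b) = proj k a - proj k b"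
  using proj_add[of k a "(-1) *\<^sub>R b"] by (simp add: proj_scaleR del: scaleR_minus_left) (simp add: proj_scaleR[of _ "-1", simplified])

lemma proj_cnjv: "proj (- k) (cnjv a) = cnjv (proj k a)"
  by (simp add: proj_def wave_minus rdot_cnjv vec_eq_iff cvec_def)

lemma proj_orthogonal:
  assumes "rdot (wave k) b = 0" "k = 0 \<Longrightarrow> b = 0"
  shows "(a - proj k a) \<bullet> b = 0"
  using assms by (cases "k = 0") (simp_all add: proj_def inner_smult_cvec)

lemma norm_proj_le: "norm (proj k a) \<le> norm a"
proof -
  have "(a - proj k a) \<bullet> proj k a = 0" by (rule proj_orthogonal) simp_all
  then have "(norm (proj k a))\<^sup>2 \<le> norm a * norm (proj k a)"
    using norm_cauchy_schwarz[of a "proj k a"] by (simp add: inner_diff_left power2_norm_eq_inner)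
  then show ?thesis
    by (cases "proj k a = 0") (auto simp: power2_eq_square)
qed

text \<open>Taking real parts yields a real field for every family; for a symmetric set of modes and
  a hermitian family it changes nothing.\<close>

definition tfield :: "(int^3) set \<Rightarrow> (int^3 \<Rightarrow> complex^3) \<Rightarrow> vfield" where
  "tfield F c x = (\<chi> j. Re (tsum F (\<lambda>k. c k $ j) x))"

lemma tfield_has_derivative:
  "(tfield F c has_derivative (\<lambda>h. \<chi> j. Re (\<Sum>k\<in>F. c k $ j * (\<i> * of_real (wave k \<bullet> h) * expo k x)))) (at x)"
proof -
  have "((\<lambda>x. Re (\<Sum>k\<in>F. c k $ j * expo k x)) has_derivative
      (\<lambda>h. Re (\<Sum>k\<in>F. c k $ j * (\<i> * of_real (wave k \<bullet> h) * expo k x)))) (at x)" for j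
    by (intro bounded_linear.has_derivative[OF bounded_linear_Re] has_derivative_sum
        bounded_linear.has_derivative[OF bounded_linear_mult_right] expo_has_derivative)
  then show ?thesis
    by (subst has_derivative_componentwise_within) (auto simp: Basis_vec_def inner_axis tfield_def tsum_def)
qed

lemma partial_tfield: "partial i (tfield F c) = tfield F (\<lambda>k. (\<i> * of_real (wave k $ i)) *s c k)"
  by (rule ext, subst partial_eqI[OF tfield_has_derivative])
    (simp add: tfield_def tsum_def inner_axis vec_eq_iff mult_ac)

lemma smooth_tfield: "smooth (tfield F c)"
proof -
  have "\<exists>d. foldr partial is (tfield F c) = tfield F d" for "is"
  proof (induct "is")
    case Nil
    show ?case by (rule exI[of _ c]) simp
  next
    case (Cons i "is")
    then obtain d where "foldr partial is (tfield F c) = tfield F d" by blast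
    then have "foldr partial (i # is) (tfield F c) = tfield F (\<lambda>k. (\<i> * of_real (wave k $ i)) *s d k)"
      by (simp only: foldr_Cons o_apply partial_tfield)
    then show ?case by blast
  qed
  moreover have "tfield F d differentiable_on UNIV" for d
    using tfield_has_derivative by (auto simp: differentiable_on_def differentiable_def intro: has_derivative_at_withinI)
  ultimately show ?thesis unfolding smooth_def by metis
qed

lemma periodic_tfield: "periodic L (tfield F c)"
  using expo_periodic by (simp add: periodic_def tfield_def tsum_def)

lemma vcoef_tfield:
  assumes F: "finite F" "\<And>k. - k \<in> F \<longleftrightarrow> k \<in> F" and h: "hermitian c"
  shows "vcoef (tfield F c) k = (if k \<in> F then c k else 0)"
proof -
  have "of_real (tfield F c x $ j) = tsum F (\<lambda>k. c k $ j) x" for x j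
  proof -
    have "cnj (tsum F (\<lambda>k. c k $ j) x) = (\<Sum>k\<in>F. c (-k) $ j * expo (-k) x)"
      using h by (simp add: tsum_def expo_minus hermitian_def)
    also have "\<dots> = tsum F (\<lambda>k. c k $ j) x" unfolding tsum_def
      by (rule sum.reindex_bij_witness[of _ uminus uminus]) (auto simp: F)
    finally have "tsum F (\<lambda>k. c k $ j) x \<in> \<real>" by (simp add: Reals_cnj_iff)
    then show ?thesis by (simp add: tfield_def)
  qed
  then show ?thesis using F(1) by (simp add: vcoef_def coef_tsum vec_eq_iff)
qed

lemma integral_eq_0_iff_vcoef:
  assumes u: "u \<in> L2_per L" shows "(LINT x|\<mu>. u x) = 0 \<longleftrightarrow> vcoef u 0 = 0"
proof -
  have "integrable \<mu> (\<lambda>x. complex_of_real (u x $ j))" for j by (rule L2c_integrable[OF L2_perD[OF u]])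
  from integrable_Re[OF this] have i: "integrable \<mu> (\<lambda>x. u x $ j)" for j by simp
  have "(LINT x|\<mu>. u x) $ j = (LINT x|\<mu>. u x $ j)" for j
    using i by (rule integrable_vec(2))
  then show ?thesis using vol_pos by (simp add: vec_eq_iff vcoef_def coef_def)
qed

lemma tfield_solenoidal:
  assumes h: "hermitian c" and s: "solenoidal c"
  shows "tfield (cube n) c \<in> smooth_solenoidal L"
  unfolding smooth_solenoidal_def
proof (intro CollectI conjI allI)
  fix x
  have "divergence (tfield (cube n) c) x = Re (\<Sum>i\<in>UNIV. \<Sum>k\<in>cube n. \<i> * of_real (wave k $ i) * c k $ i * expo k x)"
    by (simp add: divergence_def partial_tfield tfield_def tsum_def)
  also have "(\<Sum>i\<in>UNIV. \<Sum>k\<in>cube n. \<i> * of_real (wave k $ i) * c k $ i * expo k x) =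
      (\<Sum>k\<in>cube n. \<i> * rdot (wave k) (c k) * expo k x)"
    unfolding rdot_def by (subst sum.swap) (simp add: sum_distrib_left sum_distrib_right mult_ac)
  finally show "divergence (tfield (cube n) c) x = 0" using s by (simp add: solenoidal_def)
  have "tfield (cube n) c \<in> L2_per L" by (rule smooth_periodic_L2_per[OF smooth_tfield periodic_tfield])
  then show "(LINT x|\<mu>. tfield (cube n) c x) = 0"
    using s by (simp add: integral_eq_0_iff_vcoef vcoef_tfield h solenoidal_def)
qed (rule smooth_tfield periodic_tfield)+

lemma smooth_solenoidal_sobolev:
  assumes \<phi>: "\<phi> \<in> smooth_solenoidal L"
  shows "\<phi> \<in> sobolev_per L m" "solenoidal (vcoef \<phi>)"
proof -
  have s: "smooth \<phi>" and p: "periodic L \<phi>" and d: "\<And>x. divergence \<phi> x = 0" and z: "(LINT x|\<mu>. \<phi> x) = 0"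
    using \<phi> by (auto simp: smooth_solenoidal_def)
  have sj: "smooth (\<lambda>x. \<phi> x $ j)" and pj: "periodic L (\<lambda>x. \<phi> x $ j)" for j
    using smooth_component[OF s] p by (auto simp: periodic_def)
  have L2: "\<phi> \<in> L2_per L" by (rule smooth_periodic_L2_per[OF s p])
  have "integrable modes (\<lambda>k. (cmod (dfac \<beta> k))\<^sup>2 * (norm (vcoef \<phi> k))\<^sup>2)" for \<beta>
  proof -
    have "integrable modes (\<lambda>k. (cmod (coef (\<lambda>x. complex_of_real (multi_partial \<beta> (\<lambda>x. \<phi> x $ j) x)) k))\<^sup>2)" for j
      by (intro parseval L2c_smooth smooth_periodic_multi_partial[OF sj pj])
    then show ?thesis
      by (simp add: coef_multi_partial[OF sj pj] norm_vec_square vcoef_def norm_mult power_mult_distrib sum_distrib_left)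
  qed
  then show "\<phi> \<in> sobolev_per L m"
    using L2 by (auto simp: sobolev_per_iff swt_def sum_distrib_right)
  have "\<phi> differentiable (at x)" for x using smooth_differentiable[OF s] by (simp add: differentiable_on_def)
  then have dv: "(\<Sum>i\<in>UNIV. partial i (\<lambda>x. \<phi> x $ i) x) = 0" for x
    using d by (simp add: divergence_def partial_component)
  have "rdot (wave k) (vcoef \<phi> k) = 0" for k
  proof -
    have "\<i> * rdot (wave k) (vcoef \<phi> k) = (\<Sum>i\<in>UNIV. coef (\<lambda>x. of_real (partial i (\<lambda>x. \<phi> x $ i) x)) k)"
      by (simp add: coef_partial[OF sj pj] rdot_def vcoef_def sum_distrib_left mult_ac)
    also have "\<dots> = coef (\<lambda>x. \<Sum>i\<in>UNIV. of_real (partial i (\<lambda>x. \<phi> x $ i) x)) k"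
      by (simp add: sum_3 coef_add L2c_integrable L2c_smooth smooth_partial sj L2c_add)
    also have "\<dots> = 0" using dv by (simp add: coef_def flip: of_real_sum)
    finally show ?thesis by simp
  qed
  then show "solenoidal (vcoef \<phi>)" using z L2 by (simp add: solenoidal_def integral_eq_0_iff_vcoef)
qed

lemma swt_nonneg: "0 \<le> swt m k"
  by (simp add: swt_def sum_nonneg)

text \<open>As \<open>swt\<close> is at least 1, the Sobolev norm controls every single coefficient,
  and the solenoidal conditions are closed under convergence of single coefficients.\<close>

lemma solenoidal_limit:
  assumes u: "u \<in> sobolev_per L m" and \<phi>: "\<And>n. \<phi> n \<in> sobolev_per L m" "\<And>n. solenoidal (vcoef (\<phi> n))"
    and lim: "(\<lambda>n::nat. sobolev_norm L m (\<lambda>x. u x - \<phi> n x)) \<longlonglongrightarrow> 0"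
  shows "solenoidal (vcoef u)" "(\<lambda>n. vcoef (\<phi> n) k) \<longlonglongrightarrow> vcoef u k"
proof -
  have le: "(norm (vcoef u k - vcoef (\<phi> n) k))\<^sup>2 \<le> (sobolev_norm L m (\<lambda>x. u x - \<phi> n x))\<^sup>2 / vol" for n k
  proof -
    let ?w = "\<lambda>x. u x - \<phi> n x"
    have w: "?w \<in> sobolev_per L m" by (rule sobolev_per_diff[OF u \<phi>(1)])
    have "(norm (vcoef ?w k))\<^sup>2 \<le> swt m k * (norm (vcoef ?w k))\<^sup>2"
      using swt_ge_1[of m k] by (simp add: mult_le_cancel_right1)
    also have "\<dots> = (LINT j|modes. indicator {k} j *\<^sub>R (swt m j * (norm (vcoef ?w j))\<^sup>2))"
      by (subst lebesgue_integral_count_space_finite_support) (auto simp: indicator_def if_distrib[of "\<lambda>c. c *\<^sub>R _"] Collect_conj_eq)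
    also have "\<dots> \<le> (LINT j|modes. swt m j * (norm (vcoef ?w j))\<^sup>2)"
    proof (rule integral_mono)
      show "integrable modes (\<lambda>j. indicator {k} j *\<^sub>R (swt m j * (norm (vcoef ?w j))\<^sup>2))"
        by (intro integrable_mult_indicator sobolev_norm_parseval(1)[OF w]) simp
      show "indicator {k} j *\<^sub>R (swt m j * (norm (vcoef ?w j))\<^sup>2) \<le> swt m j * (norm (vcoef ?w j))\<^sup>2" for j
        using swt_ge_1[of m j] by (simp add: indicator_def)
    qed (rule sobolev_norm_parseval(1)[OF w])
    also have "\<dots> = (sobolev_norm L m ?w)\<^sup>2 / vol"
      using vol_pos by (simp add: sobolev_norm_parseval(2)[OF w])
    finally show ?thesis using u \<phi>(1)[of n] by (simp add: vcoef_diff sobolev_per_L2)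
  qed
  have c: "(\<lambda>n. vcoef (\<phi> n) k) \<longlonglongrightarrow> vcoef u k" for k
  proof -
    have "(\<lambda>n. (sobolev_norm L m (\<lambda>x. u x - \<phi> n x))\<^sup>2 / vol) \<longlonglongrightarrow> 0\<^sup>2 / vol"
      using vol_pos by (intro tendsto_intros lim) auto
    then have l: "(\<lambda>n. (sobolev_norm L m (\<lambda>x. u x - \<phi> n x))\<^sup>2 / vol) \<longlonglongrightarrow> 0" by simp
    have "(\<lambda>n. (norm (vcoef u k - vcoef (\<phi> n) k))\<^sup>2) \<longlonglongrightarrow> 0"
      by (rule tendsto_sandwich[OF _ _ tendsto_const l]) (auto intro!: always_eventually le)
    then have "(\<lambda>n. norm (vcoef u k - vcoef (\<phi> n) k)) \<longlonglongrightarrow> 0"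
      using tendsto_real_sqrt by fastforce
    then have "(\<lambda>n. norm (vcoef (\<phi> n) k - vcoef u k)) \<longlonglongrightarrow> 0" by (simp add: norm_minus_commute)
    then show ?thesis by (simp add: tendsto_norm_zero_iff LIM_zero_iff)
  qed
  show "(\<lambda>n. vcoef (\<phi> n) k) \<longlonglongrightarrow> vcoef u k" by (rule c)
  have "vcoef u 0 = 0"
    by (rule LIMSEQ_unique[OF c]) (use \<phi>(2) in \<open>simp add: solenoidal_def\<close>)
  moreover have "rdot (wave k) (vcoef u k) = 0" for k
    by (rule LIMSEQ_unique[OF rdot_tendsto[OF c]]) (use \<phi>(2) in \<open>simp add: solenoidal_def\<close>)
  ultimately show "solenoidal (vcoef u)" by (simp add: solenoidal_def)
qed

text \<open>Limits of smooth solenoidal fields are solenoidal by \<open>solenoidal_limit\<close>.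
  Conversely, the truncations to cubes are smooth and solenoidal, and their distance is a tail that
  tends to 0 by dominated convergence.\<close>

lemma V_space_iff:
  "u \<in> V_space L m \<longleftrightarrow> u \<in> L2_per L \<and> integrable modes (\<lambda>k. swt m k * (norm (vcoef u k))\<^sup>2) \<and> solenoidal (vcoef u)"
proof
  assume "u \<in> V_space L m"
  then obtain \<phi> where u: "u \<in> sobolev_per L m" and \<phi>: "\<And>n. \<phi> n \<in> smooth_solenoidal L"
      "(\<lambda>n::nat. sobolev_norm L m (\<lambda>x. u x - \<phi> n x)) \<longlonglongrightarrow> 0"
    by (auto simp: V_space_def)
  show "u \<in> L2_per L \<and> integrable modes (\<lambda>k. swt m k * (norm (vcoef u k))\<^sup>2) \<and> solenoidal (vcoef u)"
    using u solenoidal_limit(1)[OF u smooth_solenoidal_sobolev[OF \<phi>(1)] \<phi>(2)] by (simp add: sobolev_per_iff)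
next
  assume A: "u \<in> L2_per L \<and> integrable modes (\<lambda>k. swt m k * (norm (vcoef u k))\<^sup>2) \<and> solenoidal (vcoef u)"
  then have u: "u \<in> sobolev_per L m" by (simp add: sobolev_per_iff)
  define \<phi> where "\<phi> n = tfield (cube n) (vcoef u)" for n
  have \<phi>: "\<phi> n \<in> smooth_solenoidal L" for n
    unfolding \<phi>_def using A by (intro tfield_solenoidal hermitian_vcoef) auto
  note \<phi>s = smooth_solenoidal_sobolev(1)[OF \<phi>, of _ m]
  have c: "vcoef (\<lambda>x. u x - \<phi> n x) k = (if k \<in> cube n then 0 else vcoef u k)" for n k
    using u \<phi>s[of n] by (simp add: vcoef_diff sobolev_per_L2) (simp add: \<phi>_def vcoef_tfield hermitian_vcoef)
  have "(\<lambda>n. LINT k|modes. swt m k * (norm (vcoef (\<lambda>x. u x - \<phi> n x) k))\<^sup>2) \<longlonglongrightarrow> (LINT k|modes. 0 :: real)"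
  proof (rule integral_dominated_convergence[where w="\<lambda>k. swt m k * (norm (vcoef u k))\<^sup>2"])
    show "AE k in modes. (\<lambda>n. swt m k * (norm (vcoef (\<lambda>x. u x - \<phi> n x) k))\<^sup>2) \<longlonglongrightarrow> 0"
    proof (rule AE_I2)
      fix k
      show "(\<lambda>n. swt m k * (norm (vcoef (\<lambda>x. u x - \<phi> n x) k))\<^sup>2) \<longlonglongrightarrow> 0"
        by (rule tendsto_eventually) (use eventually_in_cube[of k] in eventually_elim, simp add: c)
    qed
    show "AE k in modes. norm (swt m k * (norm (vcoef (\<lambda>x. u x - \<phi> n x) k))\<^sup>2) \<le> swt m k * (norm (vcoef u k))\<^sup>2" for n
      by (intro AE_I2) (auto simp: c abs_mult abs_of_nonneg swt_nonneg)
  qed (use A in auto)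
  then have "(\<lambda>n. vol * (LINT k|modes. swt m k * (norm (vcoef (\<lambda>x. u x - \<phi> n x) k))\<^sup>2)) \<longlonglongrightarrow> vol * 0"
    by (intro tendsto_intros) simp
  then have "(\<lambda>n. sqrt ((sobolev_norm L m (\<lambda>x. u x - \<phi> n x))\<^sup>2)) \<longlonglongrightarrow> sqrt 0"
    by (intro tendsto_real_sqrt) (simp add: sobolev_norm_parseval(2)[OF sobolev_per_diff[OF u \<phi>s]])
  moreover have "0 \<le> sobolev_norm L m v" for v by (simp add: sobolev_norm_def sum_nonneg)
  ultimately have "(\<lambda>n. sobolev_norm L m (\<lambda>x. u x - \<phi> n x)) \<longlonglongrightarrow> 0" by simp
  then show "u \<in> V_space L m" using u \<phi> by (auto simp: V_space_def)
qed

lemma V_0_iff: "u \<in> V_space L 0 \<longleftrightarrow> u \<in> L2_per L \<and> solenoidal (vcoef u)"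
  by (auto simp: V_space_iff swt_0 L2_norm_parseval)

lemma V_space_sobolev: "u \<in> V_space L m \<Longrightarrow> u \<in> sobolev_per L m"
  by (simp add: V_space_def)

text \<open>\<open>leray_proj\<close> is a chosen element, so two things are shown: the projection
  taken mode by mode meets the specification, and any two fields that meet it have the same
  coefficients. For the latter, their difference \<open>d\<close> lies in \<open>V_space L 0\<close>
  and is orthogonal to itself.\<close>

lemma leray_proj_coef:
  assumes w: "w \<in> L2_per L"
  shows "leray_proj L w \<in> V_space L 0" "vcoef (leray_proj L w) k = proj k (vcoef w k)"
proof -
  have "(norm (proj k (vcoef w k)))\<^sup>2 \<le> (norm (vcoef w k))\<^sup>2" for k
    by (intro power_mono norm_proj_le) simp
  then have i: "integrable modes (\<lambda>k. (norm (proj k (vcoef w k)))\<^sup>2)"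
    by (intro Bochner_Integration.integrable_bound[OF L2_norm_parseval(1)[OF w]]) auto
  have h: "hermitian (\<lambda>k. proj k (vcoef w k))"
    using hermitian_vcoef[of w] by (simp add: hermitian_def proj_cnjv)
  obtain p where p: "p \<in> L2_per L" "\<And>k. vcoef p k = proj k (vcoef w k)"
    by (rule field_of_coefficients[OF i h]) (rule that)
  let ?P = "\<lambda>q. q \<in> V_space L 0 \<and> (\<forall>v\<in>V_space L 0. L2_inner L (\<lambda>x. w x - q x) v = 0)"
  have pV: "p \<in> V_space L 0" using p by (simp add: V_0_iff solenoidal_def)
  have "L2_inner L (\<lambda>x. w x - p x) v = 0" if v: "v \<in> V_space L 0" for v
  proof -
    have vL: "v \<in> L2_per L" and vs: "rdot (wave k) (vcoef v k) = 0" "k = 0 \<Longrightarrow> vcoef v k = 0" for k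
      using v by (auto simp: V_0_iff solenoidal_def)
    have "vcoef (\<lambda>x. w x - p x) k \<bullet> vcoef v k = 0" for k
      using proj_orthogonal[OF vs] by (simp add: vcoef_diff w p)
    then show ?thesis using L2_inner_parseval(2)[OF L2_per_diff[OF w p(1)] vL] by simp
  qed
  then have "?P p" using pV by simp
  then have "?P (SOME q. ?P q)" by (rule someI[of ?P])
  then have l: "?P (leray_proj L w)" unfolding leray_proj_def .
  then show V: "leray_proj L w \<in> V_space L 0" ..
  let ?q = "leray_proj L w"
  have q: "?q \<in> L2_per L" "solenoidal (vcoef ?q)" using V by (auto simp: V_0_iff)
  define d where "d x = p x - ?q x" for x
  have dL: "d \<in> L2_per L" and dc: "vcoef d k = proj k (vcoef w k) - vcoef ?q k" for k
    unfolding d_def[abs_def] using p q by (auto simp: vcoef_diff)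
  have dV: "d \<in> V_space L 0" using dL q by (simp add: V_0_iff dc solenoidal_def rdot_diff)
  then have "rdot (wave k) (vcoef d k) = 0" "k = 0 \<Longrightarrow> vcoef d k = 0" for k
    by (auto simp: V_0_iff solenoidal_def)
  then have "vcoef (\<lambda>x. w x - ?q x) k \<bullet> vcoef d k = (norm (vcoef d k))\<^sup>2" for k
    using proj_orthogonal[of k "vcoef d k" "vcoef w k"]
    by (simp add: vcoef_diff w q dc inner_diff_left power2_norm_eq_inner)
  then have "vol * (LINT k|modes. (norm (vcoef d k))\<^sup>2) = 0"
    using l dV L2_inner_parseval(2)[OF L2_per_diff[OF w q(1)] dL] by simp
  then have "AE k in modes. (norm (vcoef d k))\<^sup>2 = 0"
    using integral_nonneg_eq_0_iff_AE[OF L2_norm_parseval(1)[OF dL]] vol_pos by simp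
  then show "vcoef ?q k = proj k (vcoef w k)" by (simp add: AE_count_space dc)
qed


section \<open>Laplacian, Stokes operator and advection on coefficients\<close>

lemma dfac_axis: "dfac (axis i n) k = (\<i> * of_real (wave k $ i)) ^ n"
proof -
  have "dfac (axis i n) k = (\<Prod>j\<in>UNIV. if j = i then (\<i> * of_real (wave k $ j)) ^ n else 1)"
    unfolding dfac_def by (intro prod.cong) (auto simp: axis_def)
  then show ?thesis by simp
qed

lemma mi_order_axis: "mi_order (axis i n) = n"
  by (simp add: mi_order_def axis_def)

lemma laplacian_coef:
  assumes u: "u \<in> sobolev_per L 2"
  shows "laplacian L u \<in> L2_per L" "vcoef (laplacian L u) k = - ((norm (wave k))\<^sup>2 *\<^sub>R vcoef u k)"
proof -
  have o: "mi_order (axis i 2 :: nat^3) \<le> 2" for i by (simp add: mi_order_axis)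
  note w = weak_derivative_coef[OF u o]
  have eq: "laplacian L u = (\<lambda>x. weak_derivative L (axis 1 2) u x + weak_derivative L (axis 2 2) u x + weak_derivative L (axis 3 2) u x)"
    by (simp add: fun_eq_iff laplacian_def sum_3)
  show "laplacian L u \<in> L2_per L" unfolding eq by (intro L2_per_add w)
  show "vcoef (laplacian L u) k = - ((norm (wave k))\<^sup>2 *\<^sub>R vcoef u k)"
    unfolding eq by (simp add: vcoef_add w L2_per_add dfac_axis norm_vec_square sum_3 vec_eq_iff power_mult_distrib)
      (simp add: scaleR_conv_of_real algebra_simps)
qed

lemma stokes_coef:
  assumes u: "u \<in> V_space L 2"
  shows "stokes L u \<in> L2_per L" "vcoef (stokes L u) k = (norm (wave k))\<^sup>2 *\<^sub>R vcoef u k"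
proof -
  note l = laplacian_coef[OF V_space_sobolev[OF u]]
  have eq: "stokes L u = (\<lambda>x. (-1) *\<^sub>R leray_proj L (laplacian L u) x)"
    by (simp add: fun_eq_iff stokes_def)
  have "leray_proj L (laplacian L u) \<in> L2_per L"
    using leray_proj_coef(1)[OF l(1)] by (simp add: V_0_iff)
  then show "stokes L u \<in> L2_per L" unfolding eq by (rule L2_per_scaleR)
  have "proj k (vcoef u k) = vcoef u k"
    using u by (intro proj_id) (auto simp: V_space_iff solenoidal_def)
  moreover have "- ((norm (wave k))\<^sup>2 *\<^sub>R vcoef u k) = (- (norm (wave k))\<^sup>2) *\<^sub>R vcoef u k" by simp
  ultimately show "vcoef (stokes L u) k = (norm (wave k))\<^sup>2 *\<^sub>R vcoef u k"
    unfolding eq vcoef_scaleR leray_proj_coef(2)[OF l(1)] l(2) by (simp only: proj_scaleR) simp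
qed

text \<open>The coefficient of a product at \<open>k\<close> is, up to \<open>vol\<close>, the inner
  product of \<open>g\<close> with \<open>expo k x * cnj (f x)\<close>, whose coefficients are the
  reflected and shifted ones of \<open>f\<close>; Parseval gives the convolution.\<close>

lemma coef_product:
  assumes f: "L2c f" and g: "L2c g"
  shows "integrable modes (\<lambda>l. coef f (k - l) * coef g l)"
    "coef (\<lambda>x. f x * g x) k = (LINT l|modes. coef f (k - l) * coef g l)"
proof -
  define h where "h = (\<lambda>x. expo k x * cnj (f x))"
  have h: "L2c h" unfolding h_def by (intro L2c_expo_mult L2c_cnj f)
  have hc: "cnj (coef h l) = coef f (k - l)" for l
    by (simp add: h_def coef_expo_mult coef_cnj)
  note p = parseval_inner[OF g h]
  show "integrable modes (\<lambda>l. coef f (k - l) * coef g l)"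
    using p(1) by (simp add: hc mult.commute)
  have "(\<lambda>x. expo (-k) x * (f x * g x)) = (\<lambda>x. g x * cnj (h x))"
    by (simp add: h_def expo_minus mult_ac)
  then show "coef (\<lambda>x. f x * g x) k = (LINT l|modes. coef f (k - l) * coef g l)"
    using p(2) vol_pos by (simp add: coef_def[of _ k] hc mult.commute)
qed

text \<open>
  The Bochner integral is 0 when the sum over modes does not converge absolutely.
\<close>

definition conv :: "(int^3 \<Rightarrow> complex^3) \<Rightarrow> (int^3 \<Rightarrow> complex^3) \<Rightarrow> int^3 \<Rightarrow> complex^3" where
  "conv a b k = (LINT l|modes. (\<i> * rdot (wave l) (a (k - l))) *s b l)"

text \<open>Summable coefficients give a representative \<open>u'\<close> of \<open>u\<close> that
  is bounded by \<open>B\<close>, so the products with the weak derivatives of \<open>v\<close> are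
  square integrable and have convolutions as coefficients.\<close>

lemma advection_coef:
  assumes u: "u \<in> L2_per L" and v: "v \<in> sobolev_per L 1"
    and B: "\<And>F. finite F \<Longrightarrow> (\<Sum>k\<in>F. norm (vcoef u k)) \<le> B"
  shows "advection L u v \<in> L2_per L" "vcoef (advection L u v) k = conv (vcoef u) (vcoef v) k"
proof -
  have o: "mi_order (axis i 1 :: nat^3) \<le> 1" for i by (simp add: mi_order_axis)
  let ?w = "\<lambda>i. weak_derivative L (axis i 1) v"
  note w = weak_derivative_coef[OF v o]
  obtain u' where u': "u' \<in> L2_per L" "\<And>k. vcoef u' k = vcoef u k" and ub: "\<And>x i. \<bar>u' x $ i\<bar> \<le> B"
  proof (rule field_of_coefficients[OF L2_norm_parseval(1)[OF u] hermitian_vcoef])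
    fix w assume w: "w \<in> L2_per L" "\<And>k. vcoef w k = vcoef u k"
      and b: "\<And>B x j. (\<And>F. finite F \<Longrightarrow> (\<Sum>k\<in>F. norm (vcoef u k)) \<le> B) \<Longrightarrow> \<bar>w x $ j\<bar> \<le> B"
    show thesis by (rule that[OF w]) (rule b[OF B])
  qed
  have ae: "AE x in \<mu>. u x = u' x" by (rule AE_eq_of_vcoef_eq[OF u u'(1)]) (simp add: u'(2))
  let ?c = "\<lambda>v j x. complex_of_real (v x $ j)"
  have prod: "L2c (\<lambda>x. ?c u i x * ?c (?w i) j x)" for i j
  proof -
    note [measurable] = L2c_measurable[OF L2_perD[OF u]] L2c_measurable[OF L2_perD[OF w(1)]]
    show ?thesis unfolding L2c_def
    proof
      show "integrable \<mu> (\<lambda>x. (cmod (?c u i x * ?c (?w i) j x))\<^sup>2)"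
      proof (rule Bochner_Integration.integrable_bound)
        show "integrable \<mu> (\<lambda>x. B\<^sup>2 * (cmod (?c (?w i) j x))\<^sup>2)"
          by (intro integrable_mult_right L2c_square_integrable L2_perD w)
        show "AE x in \<mu>. norm ((cmod (?c u i x * ?c (?w i) j x))\<^sup>2) \<le> norm (B\<^sup>2 * (cmod (?c (?w i) j x))\<^sup>2)"
          using ae
        proof eventually_elim
          case (elim x)
          have "\<bar>u' x $ i\<bar>\<^sup>2 \<le> B\<^sup>2" by (intro power_mono ub) simp
          then show ?case using elim by (simp add: norm_mult power_mult_distrib mult_right_mono)
        qed
      qed measurable
    qed measurable
  qed
  have comp: "(\<lambda>x. complex_of_real (advection L u v x $ j)) = (\<lambda>x. \<Sum>i\<in>UNIV. ?c u i x * ?c (?w i) j x)" for j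
    by (simp add: advection_def)
  have per: "periodic L (advection L u v)"
    using u w(1) by (simp add: L2_per_def periodic_def advection_def)
  show "advection L u v \<in> L2_per L"
    unfolding L2_per_iff comp using per prod by (auto intro: L2c_sum)
  have i: "integrable modes (\<lambda>l. coef (?c u i) (k - l) * coef (?c (?w i) j) l)" for i j
    by (rule coef_product(1)) (intro L2_perD u w)+
  have s: "(\<Sum>i\<in>UNIV. coef (?c u i) (k - l) * coef (?c (?w i) j) l) = ((\<i> * rdot (wave l) (vcoef u (k - l))) *s vcoef v l) $ j" for l j
  proof -
    have "coef (?c (?w i) j) l = \<i> * of_real (wave l $ i) * vcoef v l $ j" for i
      using arg_cong[OF w(2)[of i l], of "\<lambda>z. z $ j"] by (simp add: vcoef_def dfac_axis)
    then show ?thesis by (simp add: rdot_def vcoef_def sum_distrib_left sum_distrib_right mult_ac)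
  qed
  have "vcoef (advection L u v) k $ j = (LINT l|modes. ((\<i> * rdot (wave l) (vcoef u (k - l))) *s vcoef v l) $ j)" for j
  proof -
    have "vcoef (advection L u v) k $ j = coef (\<lambda>x. \<Sum>i\<in>UNIV. ?c u i x * ?c (?w i) j x) k"
      by (simp only: vcoef_def vec_lambda_beta comp)
    also have "\<dots> = (\<Sum>i\<in>UNIV. coef (\<lambda>x. ?c u i x * ?c (?w i) j x) k)"
      by (simp only: sum_3 coef_add L2c_integrable prod L2c_add)
    also have "\<dots> = (\<Sum>i\<in>UNIV. (LINT l|modes. coef (?c u i) (k - l) * coef (?c (?w i) j) l))"
      by (intro sum.cong refl coef_product(2)) (intro L2_perD u w)+
    also have "\<dots> = (LINT l|modes. (\<Sum>i\<in>UNIV. coef (?c u i) (k - l) * coef (?c (?w i) j) l))"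
      by (rule Bochner_Integration.integral_sum[symmetric]) (rule i)
    finally show ?thesis unfolding s .
  qed
  moreover have "integrable modes (\<lambda>l. ((\<i> * rdot (wave l) (vcoef u (k - l))) *s vcoef v l) $ j)" for j
    unfolding s[symmetric] by (intro Bochner_Integration.integrable_sum i)
  ultimately show "vcoef (advection L u v) k = conv (vcoef u) (vcoef v) k"
    unfolding conv_def vec_eq_iff by (simp only: integrable_vec(2) simp_thms)
qed

end

subsection \<open>Bilinear estimates\<close>

text \<open>If \<open>f\<close> is not integrable, the left side is 0 by the default value of the
  integral. Estimates can therefore precede questions of convergence.\<close>

lemma ennreal_norm_integral_le:
  fixes f :: "'a \<Rightarrow> 'b::{banach,second_countable_topology}"
  shows "ennreal (norm (LINT x|M. f x)) \<le> (\<integral>\<^sup>+x. ennreal (norm (f x)) \<partial>M)"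
proof (cases "integrable M f")
  case True
  then show ?thesis by (rule integral_norm_bound_ennreal)
qed (simp add: not_integrable_integral_eq)

lemma nn_integral_modes_shift: "(\<integral>\<^sup>+k. f (k - l) \<partial>modes) = (\<integral>\<^sup>+k. f k \<partial>modes)" for l :: "int^3"
  by (rule nn_integral_bij_count_space[of "\<lambda>k. k - l" UNIV UNIV f])
    (rule bij_betw_byWitness[where f'="\<lambda>k. k + l"], auto)

lemma nn_integral_modes_reflect: "(\<integral>\<^sup>+k. f (l - k) \<partial>modes) = (\<integral>\<^sup>+k. f k \<partial>modes)" for l :: "int^3"
  by (rule nn_integral_bij_count_space[of "\<lambda>k. l - k" UNIV UNIV f])
    (rule bij_betw_byWitness[where f'="\<lambda>k. l - k"], auto)

lemma integral_modes_uminus: "(LINT k|modes. f (- k)) = (LINT k|modes. f k)"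
  for f :: "int^3 \<Rightarrow> 'b::{banach,second_countable_topology}"
  by (rule integral_bij_count_space) (rule bij_betw_byWitness[where f'=uminus], auto)

text \<open>Convolution with extended values, so that it can be estimated before it is known to be
  finite.\<close>

definition cvol :: "(int^3 \<Rightarrow> real) \<Rightarrow> (int^3 \<Rightarrow> real) \<Rightarrow> int^3 \<Rightarrow> ennreal" where
  "cvol f g k = (\<integral>\<^sup>+l. ennreal (f (k - l) * g l) \<partial>modes)"

lemma cvol_commute: "cvol f g = cvol g f"
proof
  fix k
  show "cvol f g k = cvol g f k"
    using nn_integral_modes_reflect[of "\<lambda>l. ennreal (f (k - l) * g l)" k]
    by (simp add: cvol_def mult.commute)
qed

text \<open>Young's inequality for a summable and a square-summable factor: \<open>f\<close> is
  split into two square roots, Cauchy-Schwarz is applied for each \<open>k\<close>, and the sums are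
  interchanged.\<close>

lemma young_convolution:
  assumes f: "\<And>k. 0 \<le> f k" and g: "\<And>k. 0 \<le> g k"
  shows "(\<integral>\<^sup>+k. (cvol f g k)\<^sup>2 \<partial>modes) \<le> (\<integral>\<^sup>+k. ennreal (f k) \<partial>modes)\<^sup>2 * (\<integral>\<^sup>+k. ennreal ((g k)\<^sup>2) \<partial>modes)"
proof -
  let ?F = "\<integral>\<^sup>+k. ennreal (f k) \<partial>modes"
  have "(cvol f g k)\<^sup>2 \<le> ?F * (\<integral>\<^sup>+l. ennreal (f (k - l)) * ennreal ((g l)\<^sup>2) \<partial>modes)" for k
  proof -
    have "cvol f g k = (\<integral>\<^sup>+l. ennreal (sqrt (f (k - l))) * ennreal (sqrt (f (k - l)) * g l) \<partial>modes)"
      unfolding cvol_def using f g by (intro nn_integral_cong) (simp flip: ennreal_mult add: mult.assoc[symmetric])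
    then have "(cvol f g k)\<^sup>2 \<le> (\<integral>\<^sup>+l. (ennreal (sqrt (f (k - l))))\<^sup>2 \<partial>modes) * (\<integral>\<^sup>+l. (ennreal (sqrt (f (k - l)) * g l))\<^sup>2 \<partial>modes)"
      using Cauchy_Schwarz_nn_integral[of "\<lambda>l. ennreal (sqrt (f (k - l)))" modes "\<lambda>l. ennreal (sqrt (f (k - l)) * g l)"] by simp
    also have "(\<integral>\<^sup>+l. (ennreal (sqrt (f (k - l))))\<^sup>2 \<partial>modes) = ?F"
      using nn_integral_modes_reflect[of "\<lambda>k. ennreal (f k)" k] f by (simp add: ennreal_power)
    also have "(\<integral>\<^sup>+l. (ennreal (sqrt (f (k - l)) * g l))\<^sup>2 \<partial>modes) = (\<integral>\<^sup>+l. ennreal (f (k - l)) * ennreal ((g l)\<^sup>2) \<partial>modes)"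
      using f g by (intro nn_integral_cong) (simp add: ennreal_power power_mult_distrib ennreal_mult)
    finally show ?thesis .
  qed
  then have "(\<integral>\<^sup>+k. (cvol f g k)\<^sup>2 \<partial>modes) \<le> (\<integral>\<^sup>+k. ?F * (\<integral>\<^sup>+l. ennreal (f (k - l)) * ennreal ((g l)\<^sup>2) \<partial>modes) \<partial>modes)"
    by (intro nn_integral_mono)
  also have "\<dots> = ?F * (\<integral>\<^sup>+k. \<integral>\<^sup>+l. ennreal (f (k - l)) * ennreal ((g l)\<^sup>2) \<partial>modes \<partial>modes)"
    by (rule nn_integral_cmult) simp
  also have "(\<integral>\<^sup>+k. \<integral>\<^sup>+l. ennreal (f (k - l)) * ennreal ((g l)\<^sup>2) \<partial>modes \<partial>modes) =
      (\<integral>\<^sup>+l. \<integral>\<^sup>+k. ennreal (f (k - l)) * ennreal ((g l)\<^sup>2) \<partial>modes \<partial>modes)"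
    by (rule nn_integral_count_space_nn_integral) auto
  also have "\<dots> = ?F * (\<integral>\<^sup>+k. ennreal ((g k)\<^sup>2) \<partial>modes)"
    using nn_integral_modes_shift[of "\<lambda>k. ennreal (f k)"] by (simp add: nn_integral_multc nn_integral_cmult)
  finally show ?thesis by (simp add: power2_eq_square mult.assoc)
qed

lemma card_cube: "card (cube n) = (2 * n + 1) ^ 3"
proof -
  let ?I = "{- int n..int n}"
  have "bij_betw (\<lambda>k. (k $ 1, k $ 2, k $ 3)) (cube n) (?I \<times> ?I \<times> ?I)"
    by (rule bij_betw_byWitness[where f'="\<lambda>(a, b, c). vector [a, b, c]"])
      (auto simp: cube_def vec_eq_iff forall_3 vector_3 abs_le_iff)
  then have "card (cube n) = card (?I \<times> ?I \<times> ?I)" by (rule bij_betw_same_card)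
  then show ?thesis by (simp add: card_cartesian_product power3_eq_cube nat_add_distrib nat_mult_distrib)
qed

text \<open>The derivative of \<open>arctan\<close> is smallest at the right end of the interval, so
  right-endpoint Riemann sums of \<open>1 / (1 + x\<^sup>2)\<close> are bounded by increments of
  \<open>arctan\<close>.\<close>

lemma arctan_increment:
  assumes "0 \<le> x" "x < y" shows "(y - x) / (1 + y\<^sup>2) \<le> arctan y - arctan x"
proof -
  obtain z where z: "x < z" "z < y" "arctan y - arctan x = (y - x) * inverse (1 + z\<^sup>2)"
    using MVT2[OF assms(2), of arctan "\<lambda>x. inverse (1 + x\<^sup>2)"] DERIV_arctan by blast
  have "z\<^sup>2 \<le> y\<^sup>2" using z assms by (intro power_mono) auto
  moreover have "0 < 1 + z\<^sup>2" by (simp add: add_pos_nonneg)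
  ultimately have "inverse (1 + y\<^sup>2) \<le> inverse (1 + z\<^sup>2)" by (intro le_imp_inverse_le) auto
  then show ?thesis using z(3) assms by (simp add: divide_inverse mult_left_mono)
qed

context torus begin

text \<open>
  Optimising \<open>\<theta>\<close> turns the weighted norm into \<open>\<parallel>u\<parallel> \<parallel>\<nabla>u\<parallel>\<close>, the scaling-critical
  quantity. All constants below have to be uniform in \<open>\<theta>\<close>.
\<close>

definition wt :: "real \<Rightarrow> int^3 \<Rightarrow> real" where "wt \<theta> k = \<theta> + (norm (wave k))\<^sup>2 / \<theta>"

lemma wt_pos: "0 < \<theta> \<Longrightarrow> 0 < wt \<theta> k"
  by (simp add: wt_def add_pos_nonneg)

definition wmin :: real where "wmin = Min (range (\<lambda>i. 2 * pi / L $ i))"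

lemma wmin_pos: "0 < wmin"
  unfolding wmin_def by (subst Min_gr_iff) (auto simp: L_pos)

lemma wave_lower: "wmin * of_int \<bar>k $ i\<bar> \<le> norm (wave k)"
proof -
  have "wmin * of_int \<bar>k $ i\<bar> \<le> 2 * pi / L $ i * of_int \<bar>k $ i\<bar>"
    unfolding wmin_def by (intro mult_right_mono Min_le) auto
  also have "\<dots> = \<bar>wave k $ i\<bar>" using L_pos[of i] by (simp add: wave_def abs_mult)
  also have "\<dots> \<le> norm (wave k)" by (rule component_le_norm_cart)
  finally show ?thesis .
qed

lemma wave_lower_nonzero: "k \<noteq> 0 \<Longrightarrow> wmin \<le> norm (wave k)"
proof -
  assume "k \<noteq> 0"
  then obtain i where "k $ i \<noteq> 0" by (auto simp: vec_eq_iff)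
  then have "wmin * 1 \<le> wmin * of_int \<bar>k $ i\<bar>" using wmin_pos by (intro mult_left_mono) linarith+
  then show ?thesis using wave_lower[of k i] by simp
qed

text \<open>The factor \<open>26 / wmin ^ 3\<close> of the shell estimate below times
  \<open>pi / 2\<close>, the bound for \<open>arctan\<close>.\<close>

definition CA :: real where "CA = 13 * pi / wmin ^ 3"

lemma CA_pos: "0 < CA" using wmin_pos by (simp add: CA_def)

text \<open>The modes are grouped in the shells between consecutive cubes. A shell of radius
  \<open>m\<close> has of the order of \<open>m\<^sup>2\<close> modes, which cancels the factor
  \<open>1 / m\<^sup>2\<close> of the summand and leaves a Riemann sum of
  \<open>1 / (1 + x\<^sup>2)\<close> with step \<open>wmin / \<theta>\<close>. Such sums telescope
  below \<open>arctan\<close>, which is bounded; hence the bound does not depend on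
  \<theta>.\<close>

lemma sum_inverse_weights:
  assumes l: "0 < \<theta>"
  shows "(\<integral>\<^sup>+k. ennreal (1 / ((norm (wave k))\<^sup>2 * wt \<theta> k)) \<partial>modes) \<le> ennreal CA"
proof -
  let ?h = "\<lambda>k. 1 / ((norm (wave k))\<^sup>2 * wt \<theta> k)"
  let ?c = wmin
  have c: "0 < ?c" by (rule wmin_pos)
  have h0: "0 \<le> ?h k" for k using wt_pos[OF l, of k] by simp
  have "(\<Sum>k\<in>cube n. ?h k) \<le> 26 / ?c ^ 3 * arctan (?c * n / \<theta>)" for n
  proof (induct n)
    case 0
    \<comment> \<open>Division by zero makes the summand 0 at \<open>k = 0\<close>.\<close>
    have "cube 0 = {0}" by (auto simp: cube_def vec_eq_iff)
    then show ?case by simp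
  next
    case (Suc n)
    let ?m = "real (Suc n)"
    let ?S = "cube (Suc n) - cube n"
    let ?y = "?c * ?m / \<theta>" and ?x = "?c * real n / \<theta>"
    have sub: "cube n \<subseteq> cube (Suc n)" by (rule cube_mono) simp
    have "?h k \<le> 1 / ((?c * ?m)\<^sup>2 * (\<theta> + (?c * ?m)\<^sup>2 / \<theta>))" if "k \<in> ?S" for k
    proof -
      have "k \<notin> cube n" using that by simp
      then obtain i where "\<not> \<bar>k $ i\<bar> \<le> int n" by (auto simp: cube_def)
      then have "?m \<le> of_int \<bar>k $ i\<bar>" by linarith
      then have "?c * ?m \<le> ?c * of_int \<bar>k $ i\<bar>" using c by simp
      also have "\<dots> \<le> norm (wave k)" by (rule wave_lower)
      finally have "(?c * ?m)\<^sup>2 \<le> (norm (wave k))\<^sup>2" using c by (intro power_mono) auto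
      moreover have "0 < (?c * ?m)\<^sup>2" using c by simp
      moreover have "1 / (b * (\<theta> + b / \<theta>)) \<le> 1 / (a * (\<theta> + a / \<theta>))" if "0 < a" "a \<le> b" for a b
      proof (rule divide_left_mono)
        have "0 < b" using that by simp
        then show "0 < b * (\<theta> + b / \<theta>) * (a * (\<theta> + a / \<theta>))"
          using that l by (intro mult_pos_pos add_pos_pos divide_pos_pos) auto
        show "a * (\<theta> + a / \<theta>) \<le> b * (\<theta> + b / \<theta>)"
          using that l by (intro mult_mono add_left_mono divide_right_mono) auto
      qed simp
      ultimately show ?thesis unfolding wt_def by blast
    qed
    then have "(\<Sum>k\<in>?S. ?h k) \<le> of_nat (card ?S) * (1 / ((?c * ?m)\<^sup>2 * (\<theta> + (?c * ?m)\<^sup>2 / \<theta>)))"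
      by (rule sum_bounded_above)
    also have "card ?S = (2 * Suc n + 1) ^ 3 - (2 * n + 1) ^ 3"
      using sub by (simp add: card_Diff_subset card_cube)
    also have "real ((2 * Suc n + 1) ^ 3 - (2 * n + 1) ^ 3) = (2 * ?m + 1) ^ 3 - (2 * ?m - 1) ^ 3"
      by (subst of_nat_diff) (auto intro!: power_mono)
    \<comment> \<open>The exact number of modes in the shell; the bound
      \<open>26 * m\<^sup>2\<close> used next needs \<open>m \<ge> 1\<close>.\<close>
    also have "\<dots> = 24 * ?m\<^sup>2 + 2" by (simp add: power3_eq_cube power2_eq_square algebra_simps)
    also have "(24 * ?m\<^sup>2 + 2) * (1 / ((?c * ?m)\<^sup>2 * (\<theta> + (?c * ?m)\<^sup>2 / \<theta>))) \<le>
        (26 * ?m\<^sup>2) * (1 / ((?c * ?m)\<^sup>2 * (\<theta> + (?c * ?m)\<^sup>2 / \<theta>)))"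
    proof (rule mult_right_mono)
      have "1 \<le> ?m\<^sup>2" by (rule one_le_power) simp
      then show "24 * ?m\<^sup>2 + 2 \<le> 26 * ?m\<^sup>2" by linarith
    qed (use l in \<open>auto intro!: add_nonneg_nonneg\<close>)
    also have "\<dots> = 26 / ?c\<^sup>2 * (1 / (\<theta> + (?c * ?m)\<^sup>2 / \<theta>))"
    proof -
      have "(26 * m\<^sup>2) * (1 / ((d * m)\<^sup>2 * X)) = 26 / d\<^sup>2 * (1 / X)" if "m \<noteq> 0" for m d X :: real
        using that by (simp add: power_mult_distrib)
      from this[of ?m] show ?thesis by simp
    qed
    \<comment> \<open>In the variable \<open>?y\<close> the shells have distance
      \<open>?c / \<theta>\<close>, and the powers of \<theta> cancel.\<close>
    also have "1 / (\<theta> + (?c * ?m)\<^sup>2 / \<theta>) = 1 / ?c * ((?y - ?x) / (1 + ?y\<^sup>2))"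
    proof -
      have "?y - ?x = ?c / \<theta>" by (simp add: add_divide_distrib distrib_left)
      moreover have "\<theta> + (?c * ?m)\<^sup>2 / \<theta> = \<theta> * (1 + ?y\<^sup>2)" using l by (simp add: power2_eq_square field_simps del: of_nat_Suc)
      ultimately show ?thesis using c l by (simp del: of_nat_Suc)
    qed
    also have "26 / ?c\<^sup>2 * (1 / ?c * ((?y - ?x) / (1 + ?y\<^sup>2))) \<le> 26 / ?c\<^sup>2 * (1 / ?c * (arctan ?y - arctan ?x))"
      using c l by (intro mult_left_mono arctan_increment) (auto intro!: divide_strict_right_mono mult_strict_left_mono)
    also have "\<dots> = 26 / ?c ^ 3 * (arctan ?y - arctan ?x)" by (simp add: power2_eq_square power3_eq_cube)
    finally have "(\<Sum>k\<in>?S. ?h k) \<le> 26 / ?c ^ 3 * (arctan ?y - arctan ?x)" .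
    moreover have "(\<Sum>k\<in>cube (Suc n). ?h k) = (\<Sum>k\<in>cube n. ?h k) + (\<Sum>k\<in>?S. ?h k)"
      using sum.subset_diff[OF sub finite_cube, of ?h] by simp
    ultimately show ?case using Suc by (simp add: right_diff_distrib)
  qed
  also have "26 / ?c ^ 3 * arctan (?c * real n / \<theta>) \<le> 26 / ?c ^ 3 * (pi / 2)" for n
    using c arctan_ubound[of "?c * real n / \<theta>"] by (intro mult_left_mono) auto
  finally have "(\<Sum>k\<in>cube n. ?h k) \<le> CA" for n by (simp add: CA_def)
  then show ?thesis
    unfolding nn_integral_modes_SUP using h0 by (intro SUP_least) (simp add: sum_ennreal ennreal_leI)
qed

section \<open>Agmon's inequality and estimates of the projected bilinear term\<close>

definition W :: "(int^3 \<Rightarrow> complex^3) \<Rightarrow> ennreal" where "W a = (\<integral>\<^sup>+k. ennreal (norm (a k)) \<partial>modes)"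

definition N :: "(int^3 \<Rightarrow> real) \<Rightarrow> (int^3 \<Rightarrow> complex^3) \<Rightarrow> ennreal" where
  "N w a = (\<integral>\<^sup>+k. ennreal (w k * (norm (a k))\<^sup>2) \<partial>modes)"

text \<open>Cauchy-Schwarz against the weight whose inverse is summable uniformly in
  \<theta>.\<close>

lemma agmon:
  assumes l: "0 < \<theta>" and a: "a 0 = 0"
  shows "(W a)\<^sup>2 \<le> ennreal CA * N (\<lambda>k. wt \<theta> k * (norm (wave k))\<^sup>2) a"
proof -
  let ?r = "\<lambda>k. norm (wave k) * sqrt (wt \<theta> k)"
  have r2: "(?r k)\<^sup>2 = (norm (wave k))\<^sup>2 * wt \<theta> k" for k
    using wt_pos[OF l, of k] by (simp add: power_mult_distrib)
  have w0: "0 \<le> wt \<theta> k" for k using wt_pos[OF l, of k] by simp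
  have "W a = (\<integral>\<^sup>+k. ennreal (1 / ?r k) * ennreal (?r k * norm (a k)) \<partial>modes)"
    unfolding W_def
  proof (rule nn_integral_cong)
    fix k
    \<comment> \<open>At \<open>k = 0\<close> the left side is 0 by division by zero and the right
      side by \<open>a 0 = 0\<close>.\<close>
    have "1 / ?r k * (?r k * norm (a k)) = norm (a k)"
      using wt_pos[OF l, of k] a by (cases "k = 0") auto
    moreover have "0 \<le> 1 / ?r k" "0 \<le> ?r k * norm (a k)" using wt_pos[OF l, of k] by auto
    ultimately show "ennreal (norm (a k)) = ennreal (1 / ?r k) * ennreal (?r k * norm (a k))"
      by (metis ennreal_mult)
  qed
  then have "(W a)\<^sup>2 \<le> (\<integral>\<^sup>+k. (ennreal (1 / ?r k))\<^sup>2 \<partial>modes) * (\<integral>\<^sup>+k. (ennreal (?r k * norm (a k)))\<^sup>2 \<partial>modes)"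
    using Cauchy_Schwarz_nn_integral[of "\<lambda>k. ennreal (1 / ?r k)" modes "\<lambda>k. ennreal (?r k * norm (a k))"] by simp
  also have "(\<integral>\<^sup>+k. (ennreal (1 / ?r k))\<^sup>2 \<partial>modes) = (\<integral>\<^sup>+k. ennreal (1 / ((norm (wave k))\<^sup>2 * wt \<theta> k)) \<partial>modes)"
    using w0 by (intro nn_integral_cong) (subst ennreal_power, simp, simp add: power_divide r2 del: power_mult_distrib)
  also have "(\<integral>\<^sup>+k. (ennreal (?r k * norm (a k)))\<^sup>2 \<partial>modes) = N (\<lambda>k. wt \<theta> k * (norm (wave k))\<^sup>2) a"
    unfolding N_def using w0
    by (intro nn_integral_cong) (subst ennreal_power, simp, simp add: power_mult_distrib mult_ac)
  also have "(\<integral>\<^sup>+k. ennreal (1 / ((norm (wave k))\<^sup>2 * wt \<theta> k)) \<partial>modes) \<le> ennreal CA" by (rule sum_inverse_weights[OF l])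
  finally show ?thesis by (simp add: mult_right_mono)
qed

lemma norm_conv_le_gradient:
  "ennreal (norm (conv a b k)) \<le> cvol (\<lambda>k. norm (a k)) (\<lambda>k. norm (wave k) * norm (b k)) k"
proof -
  have "norm ((\<i> * rdot (wave l) (a (k - l))) *s b l) \<le> norm (a (k - l)) * (norm (wave l) * norm (b l))" for l
    using mult_right_mono[OF norm_rdot_le[of "wave l" "a (k - l)"], of "norm (b l)"]
    by (simp add: norm_smult norm_mult mult_ac)
  then show ?thesis
    unfolding conv_def cvol_def
    by (intro order_trans[OF ennreal_norm_integral_le] nn_integral_mono ennreal_leI)
qed

text \<open>Because \<open>a\<close> is divergence free, the wave vector of \<open>l\<close> may be
  replaced by that of \<open>k\<close>: the derivative is moved from \<open>b\<close> to the whole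
  product. This costs a derivative outside but puts none on \<open>b\<close>.\<close>

lemma norm_conv_term_le:
  assumes "\<And>k. rdot (wave k) (a k) = 0"
  shows "norm ((\<i> * rdot (wave l) (a (k - l))) *s b l) \<le> norm (wave k) * (norm (a (k - l)) * norm (b l))"
proof -
  have "rdot (wave k) (a (k - l)) = rdot (wave l) (a (k - l)) + rdot (wave (k - l)) (a (k - l))"
    by (simp flip: rdot_left_add wave_add)
  then have "rdot (wave l) (a (k - l)) = rdot (wave k) (a (k - l))" using assms[of "k - l"] by simp
  then show ?thesis
    using mult_right_mono[OF norm_rdot_le[of "wave k" "a (k - l)"], of "norm (b l)"]
    by (simp add: norm_smult norm_mult mult_ac)
qed

lemma norm_conv_le_divergence:
  assumes "\<And>k. rdot (wave k) (a k) = 0"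
  shows "ennreal (norm (conv a b k)) \<le> ennreal (norm (wave k)) * cvol (\<lambda>k. norm (a k)) (\<lambda>k. norm (b k)) k"
proof -
  have "ennreal (norm (conv a b k)) \<le> (\<integral>\<^sup>+l. ennreal (norm (wave k) * (norm (a (k - l)) * norm (b l))) \<partial>modes)"
    unfolding conv_def
    by (intro order_trans[OF ennreal_norm_integral_le] nn_integral_mono ennreal_leI norm_conv_term_le assms)
  also have "\<dots> = ennreal (norm (wave k)) * cvol (\<lambda>k. norm (a k)) (\<lambda>k. norm (b k)) k"
    unfolding cvol_def by (simp add: ennreal_mult nn_integral_cmult)
  finally show ?thesis .
qed

definition PB :: "(int^3 \<Rightarrow> complex^3) \<Rightarrow> (int^3 \<Rightarrow> complex^3) \<Rightarrow> int^3 \<Rightarrow> complex^3" where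
  "PB a b k = proj k (conv a b k)"

lemma energy_bilinear:
  assumes a: "solenoidal a"
  shows "N (\<lambda>k. 1 / (norm (wave k))\<^sup>2) (PB a b) \<le> (\<integral>\<^sup>+k. (cvol (\<lambda>k. norm (a k)) (\<lambda>k. norm (b k)) k)\<^sup>2 \<partial>modes)"
  unfolding N_def
proof (rule nn_integral_mono)
  fix k
  let ?c = "cvol (\<lambda>k. norm (a k)) (\<lambda>k. norm (b k)) k"
  have d: "\<And>k. rdot (wave k) (a k) = 0" using a by (simp add: solenoidal_def)
  show "ennreal (1 / (norm (wave k))\<^sup>2 * (norm (PB a b k))\<^sup>2) \<le> ?c\<^sup>2"
  proof (cases "k = 0")
    case False
    let ?r = "norm (wave k)"
    have r: "0 < ?r" using False by simp
    have "ennreal (norm (PB a b k)) \<le> ennreal (norm (conv a b k))" unfolding PB_def by (intro ennreal_leI norm_proj_le)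
    also have "\<dots> \<le> ennreal ?r * ?c" by (rule norm_conv_le_divergence[OF d])
    finally have "ennreal (1 / ?r) * ennreal (norm (PB a b k)) \<le> ennreal (1 / ?r) * (ennreal ?r * ?c)"
      by (rule mult_left_mono) simp
    also have "\<dots> = ?c" using r by (simp add: mult.assoc[symmetric] ennreal_mult[symmetric])
    finally have "(ennreal (1 / ?r) * ennreal (norm (PB a b k)))\<^sup>2 \<le> ?c\<^sup>2" by (rule power_mono) simp
    then show ?thesis using r by (simp add: ennreal_mult[symmetric] ennreal_power power_divide)
  qed (simp add: PB_def)
qed

lemma energy_bilinear_left:
  assumes a: "solenoidal a"
  shows "N (\<lambda>k. 1 / (norm (wave k))\<^sup>2) (PB a b) \<le> (W a)\<^sup>2 * N (\<lambda>_. 1) b"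
  using order_trans[OF energy_bilinear[OF a] young_convolution] by (simp add: W_def N_def)

text \<open>Convolution is commutative, so the Wiener norm may fall on either factor. In the
  uniqueness proof the difference of two solutions occupies both slots in turn and is controlled in
  \<open>L^2\<close> only.\<close>

lemma energy_bilinear_right:
  assumes a: "solenoidal a"
  shows "N (\<lambda>k. 1 / (norm (wave k))\<^sup>2) (PB a b) \<le> (W b)\<^sup>2 * N (\<lambda>_. 1) a"
  using order_trans[OF energy_bilinear[OF a, unfolded cvol_commute[of "\<lambda>k. norm (a k)"]] young_convolution] by (simp add: W_def N_def)

lemma gradient_bilinear:
  shows "N (\<lambda>_. 1) (PB a b) \<le> (W a)\<^sup>2 * N (\<lambda>k. (norm (wave k))\<^sup>2) b"
proof -
  have "N (\<lambda>_. 1) (PB a b) \<le> (\<integral>\<^sup>+k. (cvol (\<lambda>k. norm (a k)) (\<lambda>k. norm (wave k) * norm (b k)) k)\<^sup>2 \<partial>modes)"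
    unfolding N_def
  proof (rule nn_integral_mono)
    fix k
    have "ennreal (norm (PB a b k)) \<le> ennreal (norm (conv a b k))" unfolding PB_def by (intro ennreal_leI norm_proj_le)
    also note norm_conv_le_gradient
    finally show "ennreal (1 * (norm (PB a b k))\<^sup>2) \<le> (cvol (\<lambda>k. norm (a k)) (\<lambda>k. norm (wave k) * norm (b k)) k)\<^sup>2"
      using power_mono by (fastforce simp flip: ennreal_power)
  qed
  also have "\<dots> \<le> (W a)\<^sup>2 * N (\<lambda>k. (norm (wave k))\<^sup>2) b"
    using young_convolution[of "\<lambda>k. norm (a k)" "\<lambda>k. norm (wave k) * norm (b k)"] by (simp add: W_def N_def power_mult_distrib)
  finally show ?thesis .
qed

lemma N_add:
  assumes "\<And>k. 0 \<le> v k" "\<And>k. 0 \<le> w k"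
  shows "N (\<lambda>k. v k + w k) a = N v a + N w a"
  unfolding N_def using assms by (subst nn_integral_add[symmetric]) (auto simp: distrib_right simp flip: ennreal_plus)

lemma N_cmult:
  assumes "0 \<le> c" "\<And>k. 0 \<le> w k"
  shows "N (\<lambda>k. c * w k) a = ennreal c * N w a"
  unfolding N_def using assms by (subst nn_integral_cmult[symmetric]) (auto simp: mult.assoc ennreal_mult)

lemma N_lincomb:
  assumes "0 \<le> c" "0 \<le> d" "\<And>k. 0 \<le> v k" "\<And>k. 0 \<le> w k"
  shows "N (\<lambda>k. c * v k + d * w k) a = ennreal c * N v a + ennreal d * N w a"
  by (subst N_add) (use assms in \<open>auto simp: N_cmult\<close>)

text \<open>The two terms of the weight call for the two forms of the nonlinearity. The part with
  \<theta> is one derivative lower and uses the divergence form, the part with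
  \<open>1 / \<theta>\<close> uses the gradient form; on the right they recombine to the same weight
  of \<open>b\<close>, with no loss in \<theta>.\<close>

lemma weighted_bilinear:
  assumes a: "solenoidal a" and l: "0 < \<theta>"
  shows "N (\<lambda>k. wt \<theta> k / (norm (wave k))\<^sup>2) (PB a b) \<le> (W a)\<^sup>2 * N (wt \<theta>) b"
proof -
  have "N (\<lambda>k. wt \<theta> k / (norm (wave k))\<^sup>2) (PB a b) = N (\<lambda>k. \<theta> * (1 / (norm (wave k))\<^sup>2) + (1 / \<theta>) * 1) (PB a b)"
    unfolding N_def
  proof (rule nn_integral_cong)
    fix k
    \<comment> \<open>At \<open>k = 0\<close> the two weights differ, but the projected term
      vanishes there.\<close>
    show "ennreal (wt \<theta> k / (norm (wave k))\<^sup>2 * (norm (PB a b k))\<^sup>2) = ennreal ((\<theta> * (1 / (norm (wave k))\<^sup>2) + 1 / \<theta> * 1) * (norm (PB a b k))\<^sup>2)"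
      using l by (cases "k = 0") (auto simp: PB_def wt_def add_divide_distrib)
  qed
  also have "\<dots> = ennreal \<theta> * N (\<lambda>k. 1 / (norm (wave k))\<^sup>2) (PB a b) + ennreal (1 / \<theta>) * N (\<lambda>_. 1) (PB a b)"
    using l by (intro N_lincomb) auto
  also have "\<dots> \<le> ennreal \<theta> * ((W a)\<^sup>2 * N (\<lambda>_. 1) b) + ennreal (1 / \<theta>) * ((W a)\<^sup>2 * N (\<lambda>k. (norm (wave k))\<^sup>2) b)"
    by (intro add_mono mult_left_mono energy_bilinear_left[OF a] gradient_bilinear) auto
  also have "\<dots> = (W a)\<^sup>2 * (ennreal \<theta> * N (\<lambda>_. 1) b + ennreal (1 / \<theta>) * N (\<lambda>k. (norm (wave k))\<^sup>2) b)"
    by (simp add: distrib_left mult_ac)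
  also have "ennreal \<theta> * N (\<lambda>_. 1) b + ennreal (1 / \<theta>) * N (\<lambda>k. (norm (wave k))\<^sup>2) b = N (\<lambda>k. \<theta> * 1 + (1 / \<theta>) * (norm (wave k))\<^sup>2) b"
    using l by (intro N_lincomb[symmetric]) auto
  also have "\<dots> = N (wt \<theta>) b" by (simp add: wt_def[abs_def])
  finally show ?thesis .
qed

end

subsection \<open>Gronwall's lemma and the Duhamel integral\<close>

lemma indicator_Icc: "indicator {a..b} x = (if a \<le> x \<and> x \<le> b then 1 else 0)" for a b x :: real
  by (simp add: indicator_def)

lemma nn_integral_exp_left:
  fixes c t :: real assumes c: "0 < c"
  shows "(\<integral>\<^sup>+s. ennreal (indicator {0..t} s * exp (- c * (t - s))) \<partial>lborel) \<le> ennreal (1 / c)"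
proof (cases "0 \<le> t")
  case True
  have "(\<integral>\<^sup>+s. ennreal (indicator {0..t} s * exp (- c * (t - s))) \<partial>lborel) =
      (\<integral>\<^sup>+s. ennreal (exp (- c * (t - s))) * indicator {0..t} s \<partial>lborel)"
    by (intro nn_integral_cong) (simp add: indicator_def)
  also have "\<dots> = ennreal (exp (- c * (t - t)) / c - exp (- c * (t - 0)) / c)"
    by (rule nn_integral_FTC_Icc) (use c True in \<open>auto intro!: derivative_eq_intros\<close>)
  also have "\<dots> \<le> ennreal (1 / c)" using c by (intro ennreal_leI) simp
  finally show ?thesis .
qed simp

lemma nn_integral_exp_right:
  fixes c s :: real assumes c: "0 < c"
  shows "(\<integral>\<^sup>+t. ennreal (indicator {s..} t * exp (- c * (t - s))) \<partial>lborel) = ennreal (1 / c)"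
proof -
  have "(\<integral>\<^sup>+t. ennreal (indicator {s..} t * exp (- c * (t - s))) \<partial>lborel) =
      (\<integral>\<^sup>+t. ennreal (exp (- c * (t - s))) * indicator {s..} t \<partial>lborel)"
    by (intro nn_integral_cong) (simp add: indicator_def)
  also have "\<dots> = ennreal (0 - (- exp (- c * (s - s)) / c))"
  proof (rule nn_integral_FTC_atLeast[where F="\<lambda>x. - exp (- c * (x - s)) / c" and T=0])
    have "filterlim (\<lambda>x. c * (- s + x)) at_top at_top"
      by (intro filterlim_tendsto_pos_mult_at_top[OF tendsto_const c]
          filterlim_tendsto_add_at_top[OF tendsto_const filterlim_ident])
    then have "filterlim (\<lambda>x. - (c * (- s + x))) at_bot at_top" by (simp add: filterlim_uminus_at_bot)
    then have "((\<lambda>x. exp (- (c * (- s + x)))) \<longlongrightarrow> 0) at_top" by (rule filterlim_compose[OF exp_at_bot])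
    then have "((\<lambda>x. - exp (- (c * (- s + x))) / c) \<longlongrightarrow> - 0 / c) at_top" using c by (intro tendsto_intros) auto
    then show "((\<lambda>x. - exp (- c * (x - s)) / c) \<longlongrightarrow> 0) at_top" by simp
  qed (use c in \<open>auto intro!: derivative_eq_intros\<close>)
  finally show ?thesis by simp
qed

text \<open>Gronwall's lemma for an integrable coefficient and a function that is only measurable
  and essentially bounded. On an interval over which \<open>h\<close> has integral at most 1/2, the
  inequality halves every bound, so \<phi> vanishes there. The supremum of the times up to which
  \<phi> vanishes is attained, and it cannot lie before \<open>S\<close> because the integral of
  \<open>h\<close> over short intervals to its right is small.\<close>

lemma gronwall_nn:
  fixes h \<phi> :: "real \<Rightarrow> ennreal" and S :: real
  assumes [measurable]: "h \<in> borel_measurable borel" "\<phi> \<in> borel_measurable borel"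
    and h: "(\<integral>\<^sup>+s. h s * indicator {0..S} s \<partial>lborel) < \<infinity>"
    and C: "C < \<infinity>" "AE s in lborel. s \<in> {0..S} \<longrightarrow> \<phi> s \<le> C"
    and le: "\<And>t. t \<in> {0..S} \<Longrightarrow> \<phi> t \<le> (\<integral>\<^sup>+s. h s * \<phi> s * indicator {0..t} s \<partial>lborel)"
    and t: "t \<in> {0..S}"
  shows "\<phi> t = 0"
proof -
  define A where "A = {\<tau> \<in> {0..S}. \<forall>s\<in>{0..\<tau>}. \<phi> s = 0}"
  have step: "b \<in> A" if r: "0 \<le> r" "r \<le> b" "b \<le> S" and z: "\<And>s. 0 \<le> s \<Longrightarrow> s < r \<Longrightarrow> \<phi> s = 0"
    and half: "(\<integral>\<^sup>+s. h s * indicator {r..b} s \<partial>lborel) \<le> ennreal (1 / 2)" for r b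
  proof -
    have *: "\<phi> s \<le> ennreal (1 / 2) * K" if s: "s \<in> {0..b}" and K: "AE s in lborel. s \<in> {0..b} \<longrightarrow> \<phi> s \<le> K" for s K
    proof -
      have "\<phi> s \<le> (\<integral>\<^sup>+x. h x * \<phi> x * indicator {0..s} x \<partial>lborel)" using s r by (intro le) auto
      also have "\<dots> \<le> (\<integral>\<^sup>+x. h x * indicator {r..b} x * K \<partial>lborel)"
      proof (rule nn_integral_mono_AE)
        show "AE x in lborel. h x * \<phi> x * indicator {0..s} x \<le> h x * indicator {r..b} x * K"
          using K
        proof eventually_elim
          case (elim x)
          show ?case
          proof (cases "x \<in> {0..s}")
            case True
            then have x: "0 \<le> x" "x \<le> b" using s by auto
            show ?thesis
            proof (cases "x < r")
              case False
              then show ?thesis using True x elim by (simp add: mult_left_mono)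
            qed (use z x in simp)
          qed simp
        qed
      qed
      also have "\<dots> = (\<integral>\<^sup>+x. h x * indicator {r..b} x \<partial>lborel) * K" by (rule nn_integral_multc) measurable
      also have "\<dots> \<le> ennreal (1 / 2) * K" by (rule mult_right_mono[OF half]) simp
      finally show ?thesis .
    qed
    \<comment> \<open>The bound \<open>C\<close> holds almost everywhere only; one use of the
      inequality makes it hold everywhere, hence the induction starts at 1.\<close>
    have "\<phi> s \<le> ennreal ((1 / 2) ^ n) * C" if "s \<in> {0..b}" "0 < n" for s n
      using that(2,1)
    proof (induct n arbitrary: s rule: nat_induct_non_zero)
      case 1
      have "AE s in lborel. s \<in> {0..b} \<longrightarrow> \<phi> s \<le> C" using C(2) by eventually_elim (use r in auto)
      then show ?case using *[OF 1] by simp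
    next
      case (Suc n)
      have "AE s in lborel. s \<in> {0..b} \<longrightarrow> \<phi> s \<le> ennreal ((1 / 2) ^ n) * C" using Suc by (intro AE_I2) auto
      from *[OF Suc.prems this] have "\<phi> s \<le> ennreal (1 / 2) * (ennreal ((1 / 2) ^ n) * C)" .
      moreover have "ennreal (1 / 2) * ennreal ((1 / 2) ^ n) = ennreal ((1 / 2) ^ Suc n)"
        by (subst ennreal_mult[symmetric]) auto
      ultimately show ?case by (simp only: mult.assoc[symmetric])
    qed
    then have bnd: "\<phi> s \<le> ennreal ((1 / 2) ^ Suc n) * C" if "s \<in> {0..b}" for s n using that by blast
    have "\<phi> s = 0" if s: "s \<in> {0..b}" for s
    proof -
      have C': "C = ennreal (enn2real C)" using C(1) by simp
      have "\<phi> s \<le> ennreal ((1 / 2) ^ Suc n * enn2real C)" for n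
      proof -
        have "ennreal ((1 / 2) ^ Suc n * enn2real C) = ennreal ((1 / 2) ^ Suc n) * C"
          using C' by (subst ennreal_mult) auto
        then show ?thesis using bnd[OF s, of n] by (simp only:)
      qed
      moreover have "(\<lambda>n. ennreal ((1 / 2) ^ Suc n * enn2real C)) \<longlonglongrightarrow> ennreal (0 * enn2real C)"
        by (intro tendsto_ennrealI tendsto_mult tendsto_const filterlim_compose[OF LIMSEQ_realpow_zero filterlim_Suc]) auto
      ultimately have "\<phi> s \<le> 0" using tendsto_lowerbound[of _ "ennreal (0 * enn2real C)" sequentially "\<phi> s"] by auto
      then show ?thesis by simp
    qed
    then show "b \<in> A" using r by (auto simp: A_def)
  qed
  have S0: "0 \<le> S" using t by auto
  have pt: "(\<integral>\<^sup>+s. h s * indicator {r..r} s \<partial>lborel) = 0" for r :: real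
  proof -
    have "AE s in lborel. s \<noteq> r" by (rule AE_lborel_singleton)
    then have "AE s in lborel. h s * indicator {r..r} s = 0" by eventually_elim auto
    then show ?thesis by (subst nn_integral_0_iff_AE) auto
  qed
  have A0: "0 \<in> A" by (rule step[of 0]) (use S0 pt in auto)
  define r where "r = Sup A"
  have bdd: "bdd_above A" by (auto simp: A_def intro!: bdd_aboveI[of _ S])
  have r: "0 \<le> r" "r \<le> S"
  proof -
    show "0 \<le> r" unfolding r_def by (rule cSup_upper[OF A0 bdd])
    show "r \<le> S" unfolding r_def by (rule cSup_least) (use A0 in blast, simp add: A_def)
  qed
  have z: "\<phi> s = 0" if "0 \<le> s" "s < r" for s
  proof -
    obtain \<tau> where "\<tau> \<in> A" "s < \<tau>" using less_cSup_iff[of A s] A0 bdd \<open>s < r\<close> unfolding r_def by auto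
    then show ?thesis using that by (auto simp: A_def)
  qed
  \<comment> \<open>The degenerate interval from \<open>r\<close> to \<open>r\<close> carries no
    mass, so vanishing before \<open>r\<close> extends to \<open>r\<close> itself.\<close>
  have rA: "r \<in> A" by (rule step[of r]) (use r z pt in auto)
  have "r = S"
  proof (rule ccontr)
    assume "r \<noteq> S"
    then have rS: "r < S" using r by simp
    \<comment> \<open>The masses of \<open>h\<close> to the right of \<open>r\<close> tend to 0 by
      dominated convergence; intersecting with \<open>{0..S}\<close> keeps them below the integrable
      majorant.\<close>
    define G where "G n = (\<integral>\<^sup>+s. h s * indicator ({r..r + 1 / real (Suc n)} \<inter> {0..S}) s \<partial>lborel)" for n
    have "G \<longlonglongrightarrow> (\<integral>\<^sup>+s. h s * indicator {r..r} s \<partial>lborel)"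
      unfolding G_def
    proof (rule nn_integral_dominated_convergence[where w="\<lambda>s. h s * indicator {0..S} s"])
      show "AE s in lborel. (\<lambda>n. h s * indicator ({r..r + 1 / real (Suc n)} \<inter> {0..S}) s) \<longlonglongrightarrow> h s * indicator {r..r} s"
      proof (rule AE_I2)
        fix s
        show "(\<lambda>n. h s * indicator ({r..r + 1 / real (Suc n)} \<inter> {0..S}) s) \<longlonglongrightarrow> h s * indicator {r..r} s"
        proof (cases "s > r")
          case True
          then obtain m where m: "1 / real (Suc m) < s - r" using nat_approx_posE[of "s - r"] by auto
          show ?thesis
          proof (rule tendsto_eventually, rule eventually_sequentiallyI[of m])
            fix n assume "m \<le> n"
            then have "1 / real (Suc n) \<le> 1 / real (Suc m)" by (intro divide_left_mono) auto
            then show "h s * indicator ({r..r + 1 / real (Suc n)} \<inter> {0..S}) s = h s * indicator {r..r} s"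
              using m True by (auto simp: indicator_def)
          qed
        qed (use r in \<open>auto simp: indicator_def intro!: tendsto_eventually always_eventually\<close>)
      qed
      show "AE s in lborel. h s * indicator ({r..r + 1 / real (Suc n)} \<inter> {0..S}) s \<le> h s * indicator {0..S} s" for n
        by (intro AE_I2) (auto simp: indicator_def)
    qed (use h in auto)
    then have "G \<longlonglongrightarrow> 0" by (simp add: pt)
    then have "eventually (\<lambda>n. G n < ennreal (1 / 2)) sequentially"
    proof (rule order_tendstoD)
      have "ennreal 0 < ennreal (1 / 2)" by (subst ennreal_less_iff) auto
      then show "0 < ennreal (1 / 2)" by (simp only: ennreal_0)
    qed
    then obtain n where n: "G n < ennreal (1 / 2)" by (auto simp: eventually_sequentially)
    define b where "b = min S (r + 1 / real (Suc n))"
    have b: "r < b" "b \<le> S" using rS by (auto simp: b_def)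
    have "{r..b} \<subseteq> {r..r + 1 / real (Suc n)} \<inter> {0..S}" using r by (auto simp: b_def)
    then have "(\<integral>\<^sup>+s. h s * indicator {r..b} s \<partial>lborel) \<le> G n"
      unfolding G_def by (intro nn_integral_mono mult_left_mono) (auto simp: indicator_def)
    then have "b \<in> A" using n b r z by (intro step[of r]) auto
    then show False using b cSup_upper[OF _ bdd, of b] by (simp add: r_def)
  qed
  then show ?thesis using rA t by (auto simp: A_def)
qed

text \<open>For integrable \<open>h\<close>, the solution of \<open>y' + c y = h\<close> with
  initial value 0. For negative \<open>t\<close> the interval is empty and the value is 0.\<close>

definition duh :: "real \<Rightarrow> (real \<Rightarrow> 'b::{banach,second_countable_topology}) \<Rightarrow> real \<Rightarrow> 'b" where
  "duh c h t = (LINT s|lborel. (indicator {0..t} s * exp (- c * (t - s))) *\<^sub>R h s)"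

section \<open>Estimates and integral equations for the Duhamel integral\<close>

lemma borel_measurable_duh [measurable]:
  assumes [measurable]: "h \<in> borel_measurable borel" shows "duh c h \<in> borel_measurable borel"
proof -
  have "(\<lambda>t. LINT s|lborel. (indicator {0..t} s * exp (- c * (t - s))) *\<^sub>R h s) \<in> borel_measurable lborel"
    unfolding indicator_Icc by measurable
  then show ?thesis by (simp add: duh_def[abs_def])
qed

text \<open>Cauchy-Schwarz with the kernel split into two square roots, one of which integrates to
  at most \<open>1 / c\<close>. Bounding the remaining kernel by 1 gives the supremum estimate,
  integrating it over \<open>t\<close> the square-integral estimate; with \<open>c\<close> equal to
  \<nu> times the squared wave number these are the gains of the heat semigroup.\<close>

lemma duh_square_le:
  assumes [measurable]: "h \<in> borel_measurable borel" and c: "0 < c"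
  shows "ennreal ((norm (duh c h t))\<^sup>2) \<le> ennreal (1 / c) *
    (\<integral>\<^sup>+s. ennreal (indicator {0..t} s * exp (- c * (t - s))) * ennreal ((norm (h s))\<^sup>2) \<partial>lborel)"
proof -
  let ?e = "\<lambda>s. indicator {0..t} s * exp (- c * (t - s))"
  have "ennreal (norm (duh c h t)) \<le> (\<integral>\<^sup>+s. ennreal (norm (?e s *\<^sub>R h s)) \<partial>lborel)"
    unfolding duh_def by (rule ennreal_norm_integral_le)
  also have "\<dots> = (\<integral>\<^sup>+s. ennreal (sqrt (?e s)) * ennreal (sqrt (?e s) * norm (h s)) \<partial>lborel)"
    by (intro nn_integral_cong) (simp flip: ennreal_mult add: mult.assoc[symmetric] abs_mult)
  finally have "(ennreal (norm (duh c h t)))\<^sup>2 \<le> (\<integral>\<^sup>+s. ennreal (sqrt (?e s)) * ennreal (sqrt (?e s) * norm (h s)) \<partial>lborel)\<^sup>2"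
    by (rule power_mono) simp
  also have "\<dots> \<le> (\<integral>\<^sup>+s. (ennreal (sqrt (?e s)))\<^sup>2 \<partial>lborel) * (\<integral>\<^sup>+s. (ennreal (sqrt (?e s) * norm (h s)))\<^sup>2 \<partial>lborel)"
    by (rule Cauchy_Schwarz_nn_integral) measurable
  also have "(\<integral>\<^sup>+s. (ennreal (sqrt (?e s)))\<^sup>2 \<partial>lborel) = (\<integral>\<^sup>+s. ennreal (?e s) \<partial>lborel)"
    by (intro nn_integral_cong) (simp add: ennreal_power)
  also have "(\<integral>\<^sup>+s. (ennreal (sqrt (?e s) * norm (h s)))\<^sup>2 \<partial>lborel) = (\<integral>\<^sup>+s. ennreal (?e s) * ennreal ((norm (h s))\<^sup>2) \<partial>lborel)"
    by (intro nn_integral_cong) (simp add: ennreal_power power_mult_distrib ennreal_mult)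
  also have "(\<integral>\<^sup>+s. ennreal (?e s) \<partial>lborel) \<le> ennreal (1 / c)" by (rule nn_integral_exp_left[OF c])
  finally show ?thesis by (simp add: ennreal_power mult_right_mono)
qed

lemma duh_sup_le:
  assumes [measurable]: "h \<in> borel_measurable borel" and c: "0 < c"
  shows "ennreal ((norm (duh c h t))\<^sup>2) \<le> ennreal (1 / c) * (\<integral>\<^sup>+s. ennreal ((norm (h s))\<^sup>2) * indicator {0..t} s \<partial>lborel)"
proof -
  have "ennreal (indicator {0..t} s * exp (- c * (t - s))) * ennreal ((norm (h s))\<^sup>2) \<le> ennreal ((norm (h s))\<^sup>2) * indicator {0..t} s" for s
  proof (cases "s \<in> {0..t}")
    case True
    then have "exp (- c * (t - s)) \<le> 1" using c by simp
    then have "ennreal (exp (- c * (t - s))) * ennreal ((norm (h s))\<^sup>2) \<le> 1 * ennreal ((norm (h s))\<^sup>2)"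
      by (intro mult_right_mono) auto
    then show ?thesis using True by simp
  qed simp
  then show ?thesis
    by (intro order_trans[OF duh_square_le[OF assms]] mult_left_mono nn_integral_mono) auto
qed

lemma duh_L2_le:
  assumes [measurable]: "h \<in> borel_measurable borel" and c: "0 < c"
  shows "(\<integral>\<^sup>+t. ennreal ((norm (duh c h t))\<^sup>2) * indicator {0..} t \<partial>lborel)
    \<le> ennreal (1 / c\<^sup>2) * (\<integral>\<^sup>+s. ennreal ((norm (h s))\<^sup>2) * indicator {0..} s \<partial>lborel)"
proof -
  let ?e = "\<lambda>t s. indicator {0..t} s * exp (- c * (t - s))"
  have [measurable]: "(\<lambda>(t, s). ?e t s) \<in> borel_measurable (borel \<Otimes>\<^sub>M borel)"
    unfolding indicator_Icc by measurable
  have "(\<integral>\<^sup>+t. ennreal ((norm (duh c h t))\<^sup>2) * indicator {0..} t \<partial>lborel) \<le>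
      (\<integral>\<^sup>+t. ennreal (1 / c) * (\<integral>\<^sup>+s. ennreal (?e t s) * ennreal ((norm (h s))\<^sup>2) \<partial>lborel) \<partial>lborel)"
    using duh_square_le[OF assms] by (intro nn_integral_mono) (auto simp: indicator_def)
  also have "\<dots> = ennreal (1 / c) * (\<integral>\<^sup>+t. \<integral>\<^sup>+s. ennreal (?e t s) * ennreal ((norm (h s))\<^sup>2) \<partial>lborel \<partial>lborel)"
    by (rule nn_integral_cmult) measurable
  also have "(\<integral>\<^sup>+t. \<integral>\<^sup>+s. ennreal (?e t s) * ennreal ((norm (h s))\<^sup>2) \<partial>lborel \<partial>lborel) =
      (\<integral>\<^sup>+s. \<integral>\<^sup>+t. ennreal (?e t s) * ennreal ((norm (h s))\<^sup>2) \<partial>lborel \<partial>lborel)"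
    by (rule lborel_pair.Fubini'[symmetric]) measurable
  also have "\<dots> = (\<integral>\<^sup>+s. ennreal (1 / c) * (ennreal ((norm (h s))\<^sup>2) * indicator {0..} s) \<partial>lborel)"
  proof (rule nn_integral_cong)
    fix s :: real
    have "(\<integral>\<^sup>+t. ennreal (?e t s) * ennreal ((norm (h s))\<^sup>2) \<partial>lborel) = (\<integral>\<^sup>+t. ennreal (?e t s) \<partial>lborel) * ennreal ((norm (h s))\<^sup>2)"
      by (rule nn_integral_multc) measurable
    also have "(\<integral>\<^sup>+t. ennreal (?e t s) \<partial>lborel) = (\<integral>\<^sup>+t. ennreal (indicator {s..} t * exp (- c * (t - s))) * indicator {0..} s \<partial>lborel)"
      by (intro nn_integral_cong) (auto simp: indicator_def)
    also have "\<dots> = ennreal (1 / c) * indicator {0..} s"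
      using nn_integral_exp_right[OF c, of s] by (simp add: nn_integral_multc)
    finally show "(\<integral>\<^sup>+t. ennreal (?e t s) * ennreal ((norm (h s))\<^sup>2) \<partial>lborel) = ennreal (1 / c) * (ennreal ((norm (h s))\<^sup>2) * indicator {0..} s)"
      by (simp add: mult_ac)
  qed
  also have "\<dots> = ennreal (1 / c) * (\<integral>\<^sup>+s. ennreal ((norm (h s))\<^sup>2) * indicator {0..} s \<partial>lborel)"
    by (rule nn_integral_cmult) measurable
  finally show ?thesis
    using c by (simp add: mult.assoc[symmetric] flip: ennreal_mult) (simp add: power2_eq_square)
qed


lemma set_integrable_subinterval:
  fixes h :: "real \<Rightarrow> 'b::{banach,second_countable_topology}"
  assumes "set_integrable lborel {0..T} h" "t \<le> T"
  shows "set_integrable lborel {0..t} h"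
  by (rule set_integrable_subset[OF assms(1)]) (use assms(2) in auto)

lemma integrable_duh_kernel:
  fixes h :: "real \<Rightarrow> 'b::{banach,second_countable_topology}"
  assumes i: "set_integrable lborel {0..t} h" and c: "0 \<le> c"
  shows "integrable lborel (\<lambda>s. (indicator {0..t} s * exp (- c * (t - s))) *\<^sub>R h s)"
proof (rule Bochner_Integration.integrable_bound)
  show i': "integrable lborel (\<lambda>s. indicator {0..t} s *\<^sub>R h s)" using i by (simp add: set_integrable_def)
  have [measurable]: "(\<lambda>s. indicator {0..t} s *\<^sub>R h s) \<in> borel_measurable lborel" using i' by simp
  have "(\<lambda>s. exp (- c * (t - s)) *\<^sub>R (indicator {0..t} s *\<^sub>R h s)) \<in> borel_measurable lborel" by measurable
  then show "(\<lambda>s. (indicator {0..t} s * exp (- c * (t - s))) *\<^sub>R h s) \<in> borel_measurable lborel"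
    by (simp add: mult.commute)
  show "AE s in lborel. norm ((indicator {0..t} s * exp (- c * (t - s))) *\<^sub>R h s) \<le> norm (indicator {0..t} s *\<^sub>R h s)"
    using c by (intro AE_I2) (auto simp: indicator_def intro!: mult_left_le_one_le)
qed

lemma duh_diff:
  fixes h g :: "real \<Rightarrow> 'b::{banach,second_countable_topology}"
  assumes "set_integrable lborel {0..t} h" "set_integrable lborel {0..t} g" "0 \<le> c"
  shows "duh c (\<lambda>s. h s - g s) t = duh c h t - duh c g t"
  unfolding duh_def scaleR_right_diff_distrib
  by (intro Bochner_Integration.integral_diff integrable_duh_kernel assms)

lemma integral_exp_kernel:
  fixes c r t :: real
  assumes "r \<le> t"
  shows "(LINT s|lborel. c * exp (- c * (s - r)) * indicator {r..t} s) = 1 - exp (- c * (t - r))"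
proof -
  have "(LINT s|lborel. c * exp (- c * (s - r)) * indicator {r..t} s) = - exp (- c * (t - r)) - (- exp (- c * (r - r)))"
    by (rule integral_FTC_Icc_real[OF assms]) (auto intro!: derivative_eq_intros continuous_intros)
  then show ?thesis by simp
qed

text \<open>Expresses the decay of a constant as a Duhamel integral, so that an initial value can be
  absorbed into the source.\<close>

lemma duh_const:
  fixes v :: "'b::{banach,second_countable_topology}"
  assumes "0 \<le> t" shows "duh c (\<lambda>_. c *\<^sub>R v) t = (1 - exp (- c * t)) *\<^sub>R v"
proof -
  have "(LINT s|lborel. c * exp (- c * (t - s)) * indicator {0..t} s) = exp (- c * (t - t)) - exp (- c * (t - 0))"
    by (rule integral_FTC_Icc_real[OF assms]) (auto intro!: derivative_eq_intros continuous_intros)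
  then have l: "(LINT s|lborel. c * exp (- c * (t - s)) * indicator {0..t} s) = 1 - exp (- c * t)" by simp
  have "integrable lborel (\<lambda>s. indicator {0..t} s *\<^sub>R (c * exp (- c * (t - s))))"
    by (rule borel_integrable_compact) (auto intro!: continuous_intros)
  then have "(LINT s|lborel. (c * exp (- c * (t - s)) * indicator {0..t} s) *\<^sub>R v) = (1 - exp (- c * t)) *\<^sub>R v"
    unfolding l[symmetric] by (subst integral_scaleR_left) (auto simp: mult_ac)
  then show ?thesis by (simp add: duh_def mult_ac)
qed

text \<open>As \<open>h\<close> is only integrable, the differential equation is stated in
  integrated form. It follows from Fubini on the triangle \<open>r \<le> s \<le> t\<close> and the
  explicit integral of the kernel over \<open>s\<close>.\<close>

lemma duh_integral_equation:
  fixes h :: "real \<Rightarrow> 'b::{banach,second_countable_topology}"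
  assumes [measurable]: "h \<in> borel_measurable borel" and i: "set_integrable lborel {0..t} h" and c: "0 \<le> c" and t: "0 \<le> t"
  shows "set_integrable lborel {0..t} (duh c h)"
    "duh c h t = (LINT s|lborel. indicator {0..t} s *\<^sub>R (h s - c *\<^sub>R duh c h s))"
proof -
  let ?K = "\<lambda>s r. (indicator {0..t} s * (indicator {0..s} r * (exp (- c * (s - r))))) *\<^sub>R h r"
  have hi: "integrable lborel (\<lambda>s. indicator {0..t} s *\<^sub>R h s)" using i by (simp add: set_integrable_def)
  have Km: "(\<lambda>p. ?K (fst p) (snd p)) \<in> borel_measurable (lborel \<Otimes>\<^sub>M lborel)"
    unfolding indicator_Icc by measurable
  have fin: "(\<integral>\<^sup>+r. ennreal (norm (indicator {0..t} r *\<^sub>R h r)) \<partial>lborel) < \<infinity>"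
    using hi by (simp add: integrable_iff_bounded)
  have "(\<integral>\<^sup>+p. ennreal (norm (?K (fst p) (snd p))) \<partial>(lborel \<Otimes>\<^sub>M lborel)) \<le>
      (\<integral>\<^sup>+p. indicator {0..t} (fst p) * ennreal (norm (indicator {0..t} (snd p) *\<^sub>R h (snd p))) \<partial>(lborel \<Otimes>\<^sub>M lborel))"
  proof (rule nn_integral_mono)
    fix p :: "real \<times> real"
    have "exp (- c * (fst p - snd p)) * norm (h (snd p)) \<le> norm (h (snd p))" if "snd p \<le> fst p"
      using that c by (intro mult_left_le_one_le) auto
    then show "ennreal (norm (?K (fst p) (snd p))) \<le> indicator {0..t} (fst p) * ennreal (norm (indicator {0..t} (snd p) *\<^sub>R h (snd p)))"
      by (auto simp: indicator_def intro!: ennreal_leI)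
  qed
  also have "\<dots> = (\<integral>\<^sup>+s. \<integral>\<^sup>+r. indicator {0..t} s * ennreal (norm (indicator {0..t} r *\<^sub>R h r)) \<partial>lborel \<partial>lborel)"
    by (subst lborel.nn_integral_fst[symmetric]) (auto simp: indicator_Icc)
  also have "\<dots> = ennreal t * (\<integral>\<^sup>+r. ennreal (norm (indicator {0..t} r *\<^sub>R h r)) \<partial>lborel)"
    using t by (simp add: nn_integral_cmult nn_integral_multc)
  also have "\<dots> < \<infinity>" using fin by (simp add: ennreal_mult_less_top)
  finally have Ki: "integrable (lborel \<Otimes>\<^sub>M lborel) (\<lambda>(s, r). ?K s r)"
    using Km by (intro integrableI_bounded) (auto simp: case_prod_beta)
  have inner: "(LINT r|lborel. ?K s r) = indicator {0..t} s *\<^sub>R duh c h s" for s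
    unfolding duh_def by (simp add: mult.assoc flip: scaleR_scaleR)
  have ds: "integrable lborel (\<lambda>s. indicator {0..t} s *\<^sub>R duh c h s)"
    using lborel_pair.integrable_fst[OF Ki] unfolding inner .
  then show "set_integrable lborel {0..t} (duh c h)" by (simp add: set_integrable_def)
  have "c *\<^sub>R (LINT s|lborel. indicator {0..t} s *\<^sub>R duh c h s) = c *\<^sub>R (LINT r|lborel. LINT s|lborel. ?K s r)"
    using lborel_pair.Fubini_integral[OF Ki] unfolding inner by simp
  also have "\<dots> = (LINT r|lborel. c *\<^sub>R (LINT s|lborel. ?K s r))" by simp
  also have "\<dots> = (LINT r|lborel. indicator {0..t} r *\<^sub>R h r - (indicator {0..t} r * exp (- c * (t - r))) *\<^sub>R h r)"
  proof (rule Bochner_Integration.integral_cong[OF refl])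
    fix r
    show "c *\<^sub>R (LINT s|lborel. ?K s r) = indicator {0..t} r *\<^sub>R h r - (indicator {0..t} r * exp (- c * (t - r))) *\<^sub>R h r"
    proof (cases "r \<in> {0..t}")
      case True
      have "c *\<^sub>R (LINT s|lborel. ?K s r) = (LINT s|lborel. (c * exp (- c * (s - r)) * indicator {r..t} s) *\<^sub>R h r)"
        unfolding integral_scaleR_right[symmetric] scaleR_scaleR
        using True by (intro Bochner_Integration.integral_cong) (auto simp: indicator_def)
      also have "\<dots> = (LINT s|lborel. c * exp (- c * (s - r)) * indicator {r..t} s) *\<^sub>R h r"
      proof (rule integral_scaleR_left)
        have "integrable lborel (\<lambda>s. indicator {r..t} s *\<^sub>R (c * exp (- c * (s - r))))"
          by (rule borel_integrable_compact) (auto intro!: continuous_intros)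
        then show "integrable lborel (\<lambda>s. c * exp (- c * (s - r)) * indicator {r..t} s)" by (simp add: mult_ac)
      qed
      also have "\<dots> = (1 - exp (- c * (t - r))) *\<^sub>R h r"
        using True by (subst integral_exp_kernel) auto
      finally show ?thesis using True by (simp add: scaleR_left_diff_distrib)
    next
      case False
      then have 0: "(\<lambda>s. ?K s r) = (\<lambda>_. 0)" by (auto simp: indicator_def fun_eq_iff)
      show ?thesis unfolding 0 using False by simp
    qed
  qed
  also have "\<dots> = (LINT r|lborel. indicator {0..t} r *\<^sub>R h r) - duh c h t"
    unfolding duh_def by (intro Bochner_Integration.integral_diff hi integrable_duh_kernel i c)
  finally have "duh c h t = (LINT r|lborel. indicator {0..t} r *\<^sub>R h r) - c *\<^sub>R (LINT s|lborel. indicator {0..t} s *\<^sub>R duh c h s)"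
    by simp
  also have "\<dots> = (LINT s|lborel. indicator {0..t} s *\<^sub>R h s - c *\<^sub>R (indicator {0..t} s *\<^sub>R duh c h s))"
    by (simp only: Bochner_Integration.integral_diff[OF hi integrable_scaleR_right[OF ds]] integral_scaleR_right)
  finally show "duh c h t = (LINT s|lborel. indicator {0..t} s *\<^sub>R (h s - c *\<^sub>R duh c h s))"
    by (simp add: scaleR_right_diff_distrib mult.commute)
qed

text \<open>The difference of the two solutions satisfies the homogeneous equation, to which
  Gronwall with the constant coefficient \<open>c\<close> applies; \<open>B\<close> and the integral
  of \<open>norm (h s)\<close> provide its a priori bound.\<close>

lemma duh_unique:
  fixes h y :: "real \<Rightarrow> 'b::{banach,second_countable_topology}"
  assumes [measurable]: "h \<in> borel_measurable borel" "y \<in> borel_measurable borel"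
    and i: "set_integrable lborel {0..T} h" and c: "0 \<le> c"
    and B: "\<And>t. t \<in> {0..T} \<Longrightarrow> norm (y t) \<le> B"
    and eq: "\<And>t. t \<in> {0..T} \<Longrightarrow> y t = (LINT s|lborel. indicator {0..t} s *\<^sub>R (h s - c *\<^sub>R y s))"
    and t: "t \<in> {0..T}"
  shows "y t = duh c h t"
proof -
  define d where "d t = y t - duh c h t" for t
  have [measurable]: "d \<in> borel_measurable borel" unfolding d_def by measurable
  have yi: "set_integrable lborel {0..t} y" if "t \<in> {0..T}" for t
    unfolding set_integrable_def
  proof (rule Bochner_Integration.integrable_bound)
    show "integrable lborel (\<lambda>s. indicator {0..t} s *\<^sub>R B)"
      by (rule borel_integrable_compact) (auto intro!: continuous_intros)
    show "AE s in lborel. norm (indicator {0..t} s *\<^sub>R y s) \<le> norm (indicator {0..t} s *\<^sub>R B)"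
      using B that by (intro AE_I2) (auto simp: indicator_def intro!: order_trans[OF _ abs_ge_self])
  qed measurable
  have hi: "set_integrable lborel {0..t} h" if "t \<in> {0..T}" for t
    using i that by (auto intro: set_integrable_subinterval)
  have deq: "d t = (LINT s|lborel. indicator {0..t} s *\<^sub>R (- c *\<^sub>R d s))" if t: "t \<in> {0..T}" for t
  proof -
    have t0: "0 \<le> t" using t by simp
    note e = duh_integral_equation[OF assms(1) hi[OF t] c t0]
    have I: "integrable lborel (\<lambda>s. indicator {0..t} s *\<^sub>R (h s - c *\<^sub>R y s))"
      "integrable lborel (\<lambda>s. indicator {0..t} s *\<^sub>R (h s - c *\<^sub>R duh c h s))"
      using Bochner_Integration.integrable_diff[OF hi[OF t, unfolded set_integrable_def] integrable_scaleR_right[OF yi[OF t, unfolded set_integrable_def], of c]]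
        Bochner_Integration.integrable_diff[OF hi[OF t, unfolded set_integrable_def] integrable_scaleR_right[OF e(1)[unfolded set_integrable_def], of c]]
      by (simp_all add: scaleR_right_diff_distrib mult.commute)
    have "d t = (LINT s|lborel. indicator {0..t} s *\<^sub>R (h s - c *\<^sub>R y s) - indicator {0..t} s *\<^sub>R (h s - c *\<^sub>R duh c h s))"
      unfolding d_def by (subst eq[OF t], subst e(2), rule Bochner_Integration.integral_diff[OF I, symmetric])
    also have "\<dots> = (LINT s|lborel. indicator {0..t} s *\<^sub>R (- c *\<^sub>R d s))"
      by (intro Bochner_Integration.integral_cong refl) (simp add: d_def algebra_simps)
    finally show ?thesis .
  qed
  have "ennreal (norm (d t)) = 0"
  proof (rule gronwall_nn[where h="\<lambda>_. ennreal c" and \<phi>="\<lambda>t. ennreal (norm (d t))" and t=t and S=T and C="ennreal (B + (LINT s|lborel. norm (indicator {0..T} s *\<^sub>R h s)))"])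
    show "(\<integral>\<^sup>+s. ennreal c * indicator {0..T} s \<partial>lborel) < \<infinity>"
      by (cases "0 \<le> T") (auto simp: nn_integral_cmult ennreal_mult_less_top)
    have "norm (d s) \<le> B + (LINT s|lborel. norm (indicator {0..T} s *\<^sub>R h s))" if s: "s \<in> {0..T}" for s
    proof -
      have "norm (duh c h s) \<le> (LINT r|lborel. norm ((indicator {0..s} r * exp (- c * (s - r))) *\<^sub>R h r))"
        unfolding duh_def by (rule integral_norm_bound)
      also have "\<dots> \<le> (LINT r|lborel. norm (indicator {0..T} r *\<^sub>R h r))"
      proof (rule integral_mono)
        show "integrable lborel (\<lambda>r. norm ((indicator {0..s} r * exp (- c * (s - r))) *\<^sub>R h r))"
          by (intro integrable_norm integrable_duh_kernel hi s c)
        show "integrable lborel (\<lambda>r. norm (indicator {0..T} r *\<^sub>R h r))"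
          by (rule integrable_norm[OF i[unfolded set_integrable_def]])
        show "norm ((indicator {0..s} r * exp (- c * (s - r))) *\<^sub>R h r) \<le> norm (indicator {0..T} r *\<^sub>R h r)" for r
          using c s by (auto simp: indicator_def intro!: mult_left_le_one_le)
      qed
      finally show ?thesis unfolding d_def using B[OF s] norm_triangle_ineq4[of "y s" "duh c h s"] by linarith
    qed
    then show "AE s in lborel. s \<in> {0..T} \<longrightarrow> ennreal (norm (d s)) \<le> ennreal (B + (LINT s|lborel. norm (indicator {0..T} s *\<^sub>R h s)))"
      by (intro AE_I2) (auto intro!: ennreal_leI)
    show "ennreal (norm (d t)) \<le> (\<integral>\<^sup>+s. ennreal c * ennreal (norm (d s)) * indicator {0..t} s \<partial>lborel)" if "t \<in> {0..T}" for t
    proof -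
      have "ennreal (norm (d t)) \<le> (\<integral>\<^sup>+s. ennreal (norm (indicator {0..t} s *\<^sub>R (- c *\<^sub>R d s))) \<partial>lborel)"
        by (subst deq[OF that]) (rule ennreal_norm_integral_le)
      also have "\<dots> = (\<integral>\<^sup>+s. ennreal c * ennreal (norm (d s)) * indicator {0..t} s \<partial>lborel)"
        using c by (intro nn_integral_cong) (auto simp: indicator_def ennreal_mult)
      finally show ?thesis .
    qed
  qed (use t in auto)
  then show ?thesis by (simp add: d_def)
qed

text \<open>\<open>y - v\<close> is the Duhamel integral of \<open>h - c *\<^sub>R v\<close>, which
  reduces the claim to initial value 0. Together with \<open>mild_unique\<close> this makes the mild
  and the integrated form of the equation equivalent for bounded solutions.\<close>

lemma mild_integral_equation:
  fixes h :: "real \<Rightarrow> 'b::{banach,second_countable_topology}"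
  assumes [measurable]: "h \<in> borel_measurable borel" and i: "set_integrable lborel {0..t} h" and c: "0 \<le> c" and t: "0 \<le> t"
    and y: "\<And>s. s \<in> {0..t} \<Longrightarrow> y s = exp (- c * s) *\<^sub>R v + duh c h s"
  shows "y t = v + (LINT s|lborel. indicator {0..t} s *\<^sub>R (h s - c *\<^sub>R y s))"
proof -
  have cst: "set_integrable lborel {0..s} (\<lambda>_::real. c *\<^sub>R v)" for s
    unfolding set_integrable_def by (rule borel_integrable_compact) (auto intro!: continuous_intros)
  define g where "g = (\<lambda>s. h s - c *\<^sub>R v)"
  have gm: "g \<in> borel_measurable borel" unfolding g_def by measurable
  have gi: "set_integrable lborel {0..t} g" unfolding g_def by (intro set_integral_diff i cst)
  have dg: "duh c g s = y s - v" if s: "s \<in> {0..t}" for s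
    using s unfolding g_def
    by (subst duh_diff[OF set_integrable_subinterval[OF i] cst c]) (auto simp: duh_const y algebra_simps)
  have "y t - v = (LINT s|lborel. indicator {0..t} s *\<^sub>R (g s - c *\<^sub>R duh c g s))"
    using duh_integral_equation(2)[OF gm gi c t] dg[of t] t by simp
  also have "\<dots> = (LINT s|lborel. indicator {0..t} s *\<^sub>R (h s - c *\<^sub>R y s))"
  proof (intro Bochner_Integration.integral_cong refl)
    fix s show "indicator {0..t} s *\<^sub>R (g s - c *\<^sub>R duh c g s) = indicator {0..t} s *\<^sub>R (h s - c *\<^sub>R y s)"
    proof (cases "s \<in> {0..t}")
      case True
      then show ?thesis by (simp add: dg) (simp add: g_def algebra_simps)
    qed simp
  qed
  finally show ?thesis by (simp add: algebra_simps)
qed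

lemma mild_unique:
  fixes h y :: "real \<Rightarrow> 'b::{banach,second_countable_topology}"
  assumes [measurable]: "h \<in> borel_measurable borel" "y \<in> borel_measurable borel"
    and i: "set_integrable lborel {0..T} h" and c: "0 \<le> c"
    and B: "\<And>t. t \<in> {0..T} \<Longrightarrow> norm (y t) \<le> B"
    and eq: "\<And>t. t \<in> {0..T} \<Longrightarrow> y t = v + (LINT s|lborel. indicator {0..t} s *\<^sub>R (h s - c *\<^sub>R y s))"
    and t: "t \<in> {0..T}"
  shows "y t = exp (- c * t) *\<^sub>R v + duh c h t"
proof -
  have cst: "set_integrable lborel {0..s} (\<lambda>_::real. c *\<^sub>R v)" for s
    unfolding set_integrable_def by (rule borel_integrable_compact) (auto intro!: continuous_intros)
  have "y t - v = duh c (\<lambda>s. h s - c *\<^sub>R v) t"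
  proof (rule duh_unique[where y="\<lambda>t. y t - v" and T=T and B="B + norm v"])
    show "set_integrable lborel {0..T} (\<lambda>s. h s - c *\<^sub>R v)" by (intro set_integral_diff i cst)
    show "norm (y t - v) \<le> B + norm v" if "t \<in> {0..T}" for t
      using B[OF that] norm_triangle_ineq4[of "y t" v] by linarith
    show "y t - v = (LINT s|lborel. indicator {0..t} s *\<^sub>R (h s - c *\<^sub>R v - c *\<^sub>R (y s - v)))" if "t \<in> {0..T}" for t
      by (subst eq[OF that]) (simp add: algebra_simps)
  qed (use c t in auto)
  also have "\<dots> = duh c h t - (1 - exp (- c * t)) *\<^sub>R v"
    using t by (subst duh_diff[OF set_integrable_subinterval[OF i] cst c]) (auto simp: duh_const)
  finally show ?thesis by (simp add: algebra_simps)
qed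

subsection \<open>Space-time norms\<close>

lemma borel_measurable_smult [measurable (raw)]:
  fixes c :: "'a \<Rightarrow> complex" and v :: "'a \<Rightarrow> complex^'n"
  assumes [measurable]: "c \<in> borel_measurable M" "v \<in> borel_measurable M"
  shows "(\<lambda>x. c x *s v x) \<in> borel_measurable M"
  by (rule borel_measurable_continuous_Pair[where H="\<lambda>c v. c *s v"])
    (auto simp: vector_scalar_mult_def intro!: continuous_intros)

lemma borel_measurable_rdot [measurable (raw)]:
  assumes "v \<in> borel_measurable M" shows "(\<lambda>x. rdot y (v x)) \<in> borel_measurable M"
proof (rule measurable_compose[OF assms])
  show "rdot y \<in> borel_measurable borel"
    unfolding rdot_def[abs_def] by (intro borel_measurable_continuous_onI continuous_intros)
qed

lemma borel_measurable_modes_integral [measurable (raw)]: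
  fixes f :: "'a \<Rightarrow> int^3 \<Rightarrow> 'b::{banach,second_countable_topology}"
  assumes "\<And>k. (\<lambda>x. f x k) \<in> borel_measurable M"
  shows "(\<lambda>x. LINT k|modes. f x k) \<in> borel_measurable M"
proof -
  interpret sigma_finite_measure modes by (rule sigma_finite_measure_count_space)
  have "(\<lambda>(k, x). f x k) \<in> borel_measurable (modes \<Otimes>\<^sub>M M)"
    by (rule measurable_pair_measure_countable1) (auto simp: assms)
  then have "(\<lambda>(x, k). f x k) \<in> borel_measurable (M \<Otimes>\<^sub>M modes)"
    by (subst measurable_pair_swap_iff) (simp add: split_beta')
  then show ?thesis by (rule borel_measurable_lebesgue_integral)
qed

lemma borel_measurable_modes_nn_integral [measurable (raw)]:
  fixes f :: "'a \<Rightarrow> int^3 \<Rightarrow> ennreal"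
  assumes "\<And>k. (\<lambda>x. f x k) \<in> borel_measurable M"
  shows "(\<lambda>x. \<integral>\<^sup>+k. f x k \<partial>modes) \<in> borel_measurable M"
proof -
  interpret sigma_finite_measure modes by (rule sigma_finite_measure_count_space)
  have "(\<lambda>(k, x). f x k) \<in> borel_measurable (modes \<Otimes>\<^sub>M M)"
    by (rule measurable_pair_measure_countable1) (auto simp: assms)
  then have "(\<lambda>(x, k). f x k) \<in> borel_measurable (M \<Otimes>\<^sub>M modes)"
    by (subst measurable_pair_swap_iff) (simp add: split_beta')
  then show ?thesis by (rule borel_measurable_nn_integral)
qed

lemma square_norm_add_le: "(norm (x + y))\<^sup>2 \<le> 2 * (norm x)\<^sup>2 + 2 * (norm y)\<^sup>2" for x y :: "'a::real_normed_vector"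
proof -
  have "(norm (x + y))\<^sup>2 \<le> (norm x + norm y)\<^sup>2" by (intro power_mono norm_triangle_ineq) simp
  also have "\<dots> \<le> 2 * (norm x)\<^sup>2 + 2 * (norm y)\<^sup>2"
    using zero_le_power2[of "norm x - norm y"] by (simp add: power2_sum power2_diff)
  finally show ?thesis .
qed

lemma ennreal_square_norm_add_le:
  "ennreal ((norm (x + y))\<^sup>2) \<le> 2 * ennreal ((norm x)\<^sup>2) + 2 * ennreal ((norm y)\<^sup>2)" for x y :: "'a::real_normed_vector"
proof -
  have "ennreal ((norm (x + y))\<^sup>2) \<le> ennreal (2 * (norm x)\<^sup>2 + 2 * (norm y)\<^sup>2)" by (intro ennreal_leI square_norm_add_le)
  also have "\<dots> = 2 * ennreal ((norm x)\<^sup>2) + 2 * ennreal ((norm y)\<^sup>2)"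
    by (simp add: ennreal_mult)
  finally show ?thesis .
qed

text \<open>A divergent integral has the value 0, which \<open>T\<close> also annihilates; so
  Duhamel integrals are solenoidal before their convergence is known.\<close>

lemma integral_kernel_eq_0:
  fixes T :: "'b::{banach,second_countable_topology} \<Rightarrow> 'c::{banach,second_countable_topology}"
  assumes T: "bounded_linear T" and z: "\<And>x. T (f x) = 0"
  shows "T (LINT x|M. f x) = 0"
proof (cases "integrable M f")
  case True
  then show ?thesis using integral_bounded_linear[OF T True] z by simp
next
  case False
  then show ?thesis using bounded_linear.linear[OF T] by (simp add: not_integrable_integral_eq linear_0)
qed

lemma bounded_linear_rdot: "bounded_linear (rdot x)"
  by (intro linear_conv_bounded_linear[THEN iffD1] linearI)
    (rule rdot_add, subst rdot_scaleR, simp add: scaleR_conv_of_real)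

lemma bounded_linear_cnjv: "bounded_linear cnjv"
  by (intro linear_conv_bounded_linear[THEN iffD1] linearI) simp_all

lemma integral_cnjv: "(LINT x|M. cnjv (f x)) = cnjv (LINT x|M. f x)"
  by (rule integral_bounded_linear'[OF bounded_linear_cnjv bounded_linear_cnjv]) simp

locale navier = torus +
  fixes \<nu> :: real
  assumes \<nu>_pos: "0 < \<nu>"
begin

definition rate :: "int^3 \<Rightarrow> real" where "rate k = \<nu> * (norm (wave k))\<^sup>2"

lemma rate_pos: "k \<noteq> 0 \<Longrightarrow> 0 < rate k" using \<nu>_pos by (simp add: rate_def)
lemma rate_nonneg: "0 \<le> rate k" using \<nu>_pos by (simp add: rate_def)

definition NL :: "(int^3 \<Rightarrow> real \<Rightarrow> complex^3) \<Rightarrow> (int^3 \<Rightarrow> real \<Rightarrow> complex^3) \<Rightarrow> int^3 \<Rightarrow> real \<Rightarrow> complex^3" where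
  "NL u v k t = PB (\<lambda>k. u k t) (\<lambda>k. v k t) k"

text \<open>Structure without size, at every time. These conditions pass through the bilinear term
  and the Duhamel integral even where the sums or integrals diverge, so sizes can be tracked
  separately by \<open>Z\<close>.\<close>

definition good :: "(int^3 \<Rightarrow> real \<Rightarrow> complex^3) \<Rightarrow> bool" where
  "good u \<longleftrightarrow> (\<forall>k. u k \<in> borel_measurable borel) \<and> (\<forall>t. solenoidal (\<lambda>k. u k t) \<and> hermitian (\<lambda>k. u k t))"

lemma goodD [measurable_dest]: "good u \<Longrightarrow> u k \<in> borel_measurable borel" by (simp add: good_def)
lemma good_solenoidal: "good u \<Longrightarrow> solenoidal (\<lambda>k. u k t)" by (simp add: good_def)
lemma good_hermitian: "good u \<Longrightarrow> hermitian (\<lambda>k. u k t)" by (simp add: good_def)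
lemma good_0: "good u \<Longrightarrow> u 0 t = 0" by (simp add: good_def solenoidal_def)

section \<open>Closure of the structural conditions under the Duhamel map\<close>

lemma good_diff: "good u \<Longrightarrow> good v \<Longrightarrow> good (\<lambda>k t. u k t - v k t)"
  by (auto simp: good_def solenoidal_def hermitian_def rdot_diff intro!: borel_measurable_diff)

lemma good_add: "good u \<Longrightarrow> good v \<Longrightarrow> good (\<lambda>k t. u k t + v k t)"
  by (auto simp: good_def solenoidal_def hermitian_def rdot_add intro!: borel_measurable_add)

lemma borel_measurable_proj [measurable (raw)]:
  assumes [measurable]: "v \<in> borel_measurable M" shows "(\<lambda>x. proj k (v x)) \<in> borel_measurable M"
  unfolding proj_def by (cases "k = 0") simp_all

lemma NL_measurable:
  assumes "\<And>k. u k \<in> borel_measurable borel" "\<And>k. v k \<in> borel_measurable borel"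
  shows "NL u v k \<in> borel_measurable borel"
proof -
  note [measurable] = assms
  show ?thesis unfolding NL_def[abs_def] PB_def conv_def by measurable
qed

text \<open>Replacing \<open>l\<close> by \<open>-l\<close> in the sum; this keeps the Picard
  iterates real.\<close>

lemma hermitian_PB:
  assumes a: "hermitian a" and b: "hermitian b" shows "hermitian (PB a b)"
proof -
  have "conv a b (- k) = cnjv (conv a b k)" for k
  proof -
    have "conv a b (- k) = (LINT l|modes. (\<i> * rdot (wave (- l)) (a (- k - (- l)))) *s b (- l))"
      unfolding conv_def by (rule integral_modes_uminus[symmetric])
    also have "\<dots> = (LINT l|modes. cnjv ((\<i> * rdot (wave l) (a (k - l))) *s b l))"
    proof (intro Bochner_Integration.integral_cong refl)
      fix l
      have "a (- k - (- l)) = cnjv (a (k - l))" using a[unfolded hermitian_def, rule_format, of "k - l"] by simp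
      then show "(\<i> * rdot (wave (- l)) (a (- k - (- l)))) *s b (- l) = cnjv ((\<i> * rdot (wave l) (a (k - l))) *s b l)"
        using b by (simp add: hermitian_def wave_minus rdot_cnjv)
    qed
    also have "\<dots> = cnjv (conv a b k)" unfolding conv_def by (rule integral_cnjv)
    finally show ?thesis .
  qed
  then show ?thesis by (simp add: hermitian_def PB_def proj_cnjv)
qed

lemma solenoidal_PB: "solenoidal (PB a b)"
  by (simp add: solenoidal_def PB_def)

lemma good_NL: "good u \<Longrightarrow> good v \<Longrightarrow> good (NL u v)"
  by (simp add: good_def NL_measurable) (simp add: NL_def solenoidal_PB hermitian_PB)

lemma good_duh:
  assumes g: "good g" shows "good (\<lambda>k. duh (rate k) (g k))"
  unfolding good_def
proof (intro conjI allI)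
  fix t
  have "rdot (wave k) (duh (rate k) (g k) t) = 0" for k
    unfolding duh_def by (rule integral_kernel_eq_0[OF bounded_linear_rdot])
      (use g in \<open>simp add: rdot_scaleR good_def solenoidal_def\<close>)
  then show "solenoidal (\<lambda>k. duh (rate k) (g k) t)"
    using good_0[OF g] by (simp add: solenoidal_def duh_def)
  have "duh (rate (- k)) (g (- k)) t = cnjv (duh (rate k) (g k) t)" for k
    unfolding duh_def integral_cnjv[symmetric] using good_hermitian[OF g]
    by (simp add: hermitian_def rate_def wave_minus)
  then show "hermitian (\<lambda>k. duh (rate k) (g k) t)" by (simp add: hermitian_def)
next
  fix k show "duh (rate k) (g k) \<in> borel_measurable borel" using g by measurable
qed

lemma good_exp:
  assumes "solenoidal a" "hermitian a"
  shows "good (\<lambda>k t. exp (- rate k * t) *\<^sub>R a k)"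
  using assms by (auto simp: good_def solenoidal_def hermitian_def rdot_scaleR rate_def wave_minus)

text \<open>A norm of Chemin-Lerner type: the supremum stands inside the sum, which is stronger than
  the supremum over time of the sum.\<close>

definition Z1 :: "real \<Rightarrow> (int^3 \<Rightarrow> real \<Rightarrow> complex^3) \<Rightarrow> ennreal" where
  "Z1 \<theta> u = (\<integral>\<^sup>+k. ennreal (wt \<theta> k) * (SUP t\<in>{0..}. ennreal ((norm (u k t))\<^sup>2)) \<partial>modes)"
definition L2t :: "(real \<Rightarrow> complex^3) \<Rightarrow> ennreal" where
  "L2t h = (\<integral>\<^sup>+t. ennreal ((norm (h t))\<^sup>2) * indicator {0..} t \<partial>lborel)"
definition Z2 :: "real \<Rightarrow> (int^3 \<Rightarrow> real \<Rightarrow> complex^3) \<Rightarrow> ennreal" where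
  "Z2 \<theta> u = (\<integral>\<^sup>+k. ennreal (wt \<theta> k * (norm (wave k))\<^sup>2) * L2t (u k) \<partial>modes)"
definition Z :: "real \<Rightarrow> (int^3 \<Rightarrow> real \<Rightarrow> complex^3) \<Rightarrow> ennreal" where "Z \<theta> u = Z1 \<theta> u + Z2 \<theta> u"
text \<open>The space of sources, two derivatives below \<open>Z2\<close>, which is what the Duhamel
  integral gains. The weight at \<open>k = 0\<close> is 0 by division by zero.\<close>

definition Lz :: "real \<Rightarrow> (int^3 \<Rightarrow> real \<Rightarrow> complex^3) \<Rightarrow> ennreal" where
  "Lz \<theta> g = (\<integral>\<^sup>+k. ennreal (wt \<theta> k / (norm (wave k))\<^sup>2) * L2t (g k) \<partial>modes)"

lemma Z_minus: "Z \<theta> (\<lambda>k t. - u k t) = Z \<theta> u"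
  by (simp add: Z_def Z1_def Z2_def L2t_def)

lemma L2t_add_le:
  assumes [measurable]: "g \<in> borel_measurable borel" "h \<in> borel_measurable borel"
  shows "L2t (\<lambda>t. g t + h t) \<le> 2 * L2t g + 2 * L2t h"
proof -
  have "L2t (\<lambda>t. g t + h t) \<le> (\<integral>\<^sup>+t. 2 * (ennreal ((norm (g t))\<^sup>2) * indicator {0..} t) + 2 * (ennreal ((norm (h t))\<^sup>2) * indicator {0..} t) \<partial>lborel)"
    unfolding L2t_def by (intro nn_integral_mono) (auto simp: indicator_def ennreal_square_norm_add_le)
  also have "\<dots> = 2 * L2t g + 2 * L2t h"
    unfolding L2t_def by (subst nn_integral_add) (auto simp: nn_integral_cmult)
  finally show ?thesis .
qed

lemma Lz_add_le:
  assumes "\<And>k. g k \<in> borel_measurable borel" "\<And>k. h k \<in> borel_measurable borel"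
  shows "Lz \<theta> (\<lambda>k t. g k t + h k t) \<le> 2 * Lz \<theta> g + 2 * Lz \<theta> h"
proof -
  have "Lz \<theta> (\<lambda>k t. g k t + h k t) \<le> (\<integral>\<^sup>+k. 2 * (ennreal (wt \<theta> k / (norm (wave k))\<^sup>2) * L2t (g k)) + 2 * (ennreal (wt \<theta> k / (norm (wave k))\<^sup>2) * L2t (h k)) \<partial>modes)"
    unfolding Lz_def
    by (intro nn_integral_mono order_trans[OF mult_left_mono[OF L2t_add_le[OF assms]]]) (auto simp: distrib_left mult_ac)
  also have "\<dots> = 2 * Lz \<theta> g + 2 * Lz \<theta> h"
    unfolding Lz_def by (subst nn_integral_add) (auto simp: nn_integral_cmult)
  finally show ?thesis .
qed

text \<open>\<open>Z\<close> is a squared norm. The factor 2 takes the place of the triangle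
  inequality and recurs in the numerical constants of the Picard iteration.\<close>

lemma Z_add_le:
  assumes "\<And>k. u k \<in> borel_measurable borel" "\<And>k. v k \<in> borel_measurable borel"
  shows "Z \<theta> (\<lambda>k t. u k t + v k t) \<le> 2 * Z \<theta> u + 2 * Z \<theta> v"
proof -
  have S: "(SUP t\<in>{0..}. ennreal ((norm (u k t + v k t))\<^sup>2)) \<le>
      2 * (SUP t\<in>{0..}. ennreal ((norm (u k t))\<^sup>2)) + 2 * (SUP t\<in>{0..}. ennreal ((norm (v k t))\<^sup>2))" for k
  proof (rule SUP_least)
    fix t :: real assume t: "t \<in> {0..}"
    have "ennreal ((norm (u k t))\<^sup>2) \<le> (SUP t\<in>{0..}. ennreal ((norm (u k t))\<^sup>2))"
      "ennreal ((norm (v k t))\<^sup>2) \<le> (SUP t\<in>{0..}. ennreal ((norm (v k t))\<^sup>2))"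
      using t by (rule SUP_upper)+
    then show "ennreal ((norm (u k t + v k t))\<^sup>2) \<le>
      2 * (SUP t\<in>{0..}. ennreal ((norm (u k t))\<^sup>2)) + 2 * (SUP t\<in>{0..}. ennreal ((norm (v k t))\<^sup>2))"
      by (intro order_trans[OF ennreal_square_norm_add_le] add_mono mult_left_mono) simp_all
  qed
  have "Z1 \<theta> (\<lambda>k t. u k t + v k t) \<le> (\<integral>\<^sup>+k. 2 * (ennreal (wt \<theta> k) * (SUP t\<in>{0..}. ennreal ((norm (u k t))\<^sup>2)))
      + 2 * (ennreal (wt \<theta> k) * (SUP t\<in>{0..}. ennreal ((norm (v k t))\<^sup>2))) \<partial>modes)"
    unfolding Z1_def
  proof (rule nn_integral_mono)
    fix k
    show "ennreal (wt \<theta> k) * (SUP t\<in>{0..}. ennreal ((norm (u k t + v k t))\<^sup>2)) \<le>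
      2 * (ennreal (wt \<theta> k) * (SUP t\<in>{0..}. ennreal ((norm (u k t))\<^sup>2)))
      + 2 * (ennreal (wt \<theta> k) * (SUP t\<in>{0..}. ennreal ((norm (v k t))\<^sup>2)))"
      using mult_left_mono[OF S[of k], of "ennreal (wt \<theta> k)"]
      by (simp only: distrib_left mult.left_commute zero_le)
  qed
  also have "\<dots> = 2 * Z1 \<theta> u + 2 * Z1 \<theta> v"
    unfolding Z1_def by (subst nn_integral_add) (auto simp: nn_integral_cmult)
  finally have 1: "Z1 \<theta> (\<lambda>k t. u k t + v k t) \<le> 2 * Z1 \<theta> u + 2 * Z1 \<theta> v" .
  have "Z2 \<theta> (\<lambda>k t. u k t + v k t) \<le> (\<integral>\<^sup>+k. 2 * (ennreal (wt \<theta> k * (norm (wave k))\<^sup>2) * L2t (u k)) + 2 * (ennreal (wt \<theta> k * (norm (wave k))\<^sup>2) * L2t (v k)) \<partial>modes)"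
    unfolding Z2_def
    by (intro nn_integral_mono order_trans[OF mult_left_mono[OF L2t_add_le[OF assms]]]) (auto simp: distrib_left mult_ac)
  also have "\<dots> = 2 * Z2 \<theta> u + 2 * Z2 \<theta> v"
    unfolding Z2_def by (subst nn_integral_add) (auto simp: nn_integral_cmult)
  finally have 2: "Z2 \<theta> (\<lambda>k t. u k t + v k t) \<le> 2 * Z2 \<theta> u + 2 * Z2 \<theta> v" .
  show ?thesis using add_mono[OF 1 2] by (simp add: Z_def distrib_left algebra_simps)
qed

lemma Z_diff_le:
  assumes "\<And>k. u k \<in> borel_measurable borel" "\<And>k. v k \<in> borel_measurable borel"
  shows "Z \<theta> (\<lambda>k t. u k t - v k t) \<le> 2 * Z \<theta> u + 2 * Z \<theta> v"
  using Z_add_le[of u "\<lambda>k t. - v k t" \<theta>] assms by (simp add: Z_minus)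

lemma Z_cong: "(\<And>k t. 0 \<le> t \<Longrightarrow> u k t = v k t) \<Longrightarrow> Z \<theta> u = Z \<theta> v"
proof -
  assume *: "\<And>k t. 0 \<le> t \<Longrightarrow> u k t = v k t"
  have "L2t (u k) = L2t (v k)" for k
    unfolding L2t_def by (intro nn_integral_cong) (auto simp: indicator_def *)
  moreover have "(SUP t\<in>{0..}. ennreal ((norm (u k t))\<^sup>2)) = (SUP t\<in>{0..}. ennreal ((norm (v k t))\<^sup>2))" for k
    by (intro SUP_cong refl) (simp add: *)
  ultimately show ?thesis by (simp add: Z_def Z1_def Z2_def)
qed

lemma N_le_Z1:
  assumes "0 \<le> t" "0 < \<theta>" shows "N (wt \<theta>) (\<lambda>k. u k t) \<le> Z1 \<theta> u"
  unfolding N_def Z1_def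
proof (rule nn_integral_mono)
  fix k
  have "ennreal (wt \<theta> k * (norm (u k t))\<^sup>2) = ennreal (wt \<theta> k) * ennreal ((norm (u k t))\<^sup>2)"
    using wt_pos[OF assms(2), of k] by (simp add: ennreal_mult)
  also have "\<dots> \<le> ennreal (wt \<theta> k) * (SUP t\<in>{0..}. ennreal ((norm (u k t))\<^sup>2))"
    using assms by (intro mult_left_mono SUP_upper) auto
  finally show "ennreal (wt \<theta> k * (norm (u k t))\<^sup>2) \<le> ennreal (wt \<theta> k) * (SUP t\<in>{0..}. ennreal ((norm (u k t))\<^sup>2))" .
qed

lemma N_time_integral:
  assumes [measurable]: "\<And>k. u k \<in> borel_measurable borel" and w: "\<And>k. 0 \<le> w k"
  shows "(\<integral>\<^sup>+t. N w (\<lambda>k. u k t) * indicator {0..} t \<partial>lborel) = (\<integral>\<^sup>+k. ennreal (w k) * L2t (u k) \<partial>modes)"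
proof -
  have "(\<integral>\<^sup>+t. N w (\<lambda>k. u k t) * indicator {0..} t \<partial>lborel) =
      (\<integral>\<^sup>+t. \<integral>\<^sup>+k. ennreal (w k) * (ennreal ((norm (u k t))\<^sup>2) * indicator {0..} t) \<partial>modes \<partial>lborel)"
    unfolding N_def using w
    by (intro nn_integral_cong) (simp add: nn_integral_multc[symmetric] ennreal_mult mult.assoc)
  also have "\<dots> = (\<integral>\<^sup>+k. \<integral>\<^sup>+t. ennreal (w k) * (ennreal ((norm (u k t))\<^sup>2) * indicator {0..} t) \<partial>lborel \<partial>modes)"
    by (rule nn_integral_count_space_nn_integral) auto
  also have "\<dots> = (\<integral>\<^sup>+k. ennreal (w k) * L2t (u k) \<partial>modes)"
    unfolding L2t_def by (intro nn_integral_cong nn_integral_cmult) auto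
  finally show ?thesis .
qed

lemma W_time_integral:
  assumes u: "good u" and th: "0 < \<theta>"
  shows "(\<integral>\<^sup>+t. (W (\<lambda>k. u k t))\<^sup>2 * indicator {0..} t \<partial>lborel) \<le> ennreal CA * Z2 \<theta> u"
proof -
  note [measurable] = goodD[OF u]
  have "(\<integral>\<^sup>+t. (W (\<lambda>k. u k t))\<^sup>2 * indicator {0..} t \<partial>lborel) \<le>
      (\<integral>\<^sup>+t. ennreal CA * (N (\<lambda>k. wt \<theta> k * (norm (wave k))\<^sup>2) (\<lambda>k. u k t) * indicator {0..} t) \<partial>lborel)"
    using agmon[OF th, of "\<lambda>k. u k t" for t] good_0[OF u]
    by (intro nn_integral_mono) (auto simp: indicator_def)
  also have "\<dots> = ennreal CA * (\<integral>\<^sup>+t. N (\<lambda>k. wt \<theta> k * (norm (wave k))\<^sup>2) (\<lambda>k. u k t) * indicator {0..} t \<partial>lborel)"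
    unfolding N_def by (rule nn_integral_cmult) measurable
  also have "(\<integral>\<^sup>+t. N (\<lambda>k. wt \<theta> k * (norm (wave k))\<^sup>2) (\<lambda>k. u k t) * indicator {0..} t \<partial>lborel) = Z2 \<theta> u"
    unfolding Z2_def by (rule N_time_integral) (use wt_pos[OF th] in \<open>auto simp: less_imp_le\<close>)
  finally show ?thesis .
qed

text \<open>Hoelder in time: the Wiener norm of \<open>u\<close> is square integrable by Agmon's
  inequality and the dissipation part of \<open>Z\<close>, while the weighted sum for
  \<open>v\<close> is bounded uniformly in time by the supremum part.\<close>

lemma Lz_NL_le:
  assumes u: "good u" and v: "good v" and th: "0 < \<theta>"
  shows "Lz \<theta> (NL u v) \<le> ennreal CA * Z \<theta> u * Z \<theta> v"
proof -
  note [measurable] = goodD[OF u] goodD[OF v] goodD[OF good_NL[OF u v]]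
  have w: "0 \<le> wt \<theta> k / (norm (wave k))\<^sup>2" for k using wt_pos[OF th, of k] by simp
  have "Lz \<theta> (NL u v) = (\<integral>\<^sup>+t. N (\<lambda>k. wt \<theta> k / (norm (wave k))\<^sup>2) (\<lambda>k. NL u v k t) * indicator {0..} t \<partial>lborel)"
    unfolding Lz_def by (rule N_time_integral[symmetric]) (use w in auto)
  also have "\<dots> \<le> (\<integral>\<^sup>+t. ((W (\<lambda>k. u k t))\<^sup>2 * indicator {0..} t) * Z1 \<theta> v \<partial>lborel)"
  proof (rule nn_integral_mono)
    fix t
    show "N (\<lambda>k. wt \<theta> k / (norm (wave k))\<^sup>2) (\<lambda>k. NL u v k t) * indicator {0..} t \<le> ((W (\<lambda>k. u k t))\<^sup>2 * indicator {0..} t) * Z1 \<theta> v"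
    proof (cases "0 \<le> t")
      case True
      have "N (\<lambda>k. wt \<theta> k / (norm (wave k))\<^sup>2) (\<lambda>k. NL u v k t) \<le> (W (\<lambda>k. u k t))\<^sup>2 * N (wt \<theta>) (\<lambda>k. v k t)"
        unfolding NL_def by (rule weighted_bilinear[OF good_solenoidal[OF u] th])
      also have "\<dots> \<le> (W (\<lambda>k. u k t))\<^sup>2 * Z1 \<theta> v" by (intro mult_left_mono N_le_Z1 True th) simp
      finally show ?thesis using True by simp
    qed simp
  qed
  also have "\<dots> = (\<integral>\<^sup>+t. (W (\<lambda>k. u k t))\<^sup>2 * indicator {0..} t \<partial>lborel) * Z1 \<theta> v"
    unfolding W_def by (rule nn_integral_multc) measurable
  also have "\<dots> \<le> (ennreal CA * Z2 \<theta> u) * Z1 \<theta> v"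
    by (intro mult_right_mono W_time_integral u th) simp
  also have "\<dots> \<le> ennreal CA * Z \<theta> u * Z \<theta> v"
    unfolding Z_def by (intro mult_mono) auto
  finally show ?thesis .
qed

text \<open>\<open>1 / \<nu>\<close> comes from the supremum part of \<open>Z\<close>,
  \<open>1 / \<nu>\<^sup>2\<close> from the dissipation part.\<close>

definition CD :: real where "CD = 1 / \<nu> + 1 / \<nu>\<^sup>2"

lemma CD_pos: "0 < CD" using \<nu>_pos by (simp add: CD_def add_pos_pos)

lemma Z_duh_le:
  assumes g: "\<And>k. g k \<in> borel_measurable borel" "\<And>t. g 0 t = 0" and th: "0 < \<theta>"
  shows "Z \<theta> (\<lambda>k. duh (rate k) (g k)) \<le> ennreal CD * Lz \<theta> g"
proof -
  let ?q = "\<lambda>k. (norm (wave k))\<^sup>2"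
  have w0: "0 \<le> wt \<theta> k" for k using wt_pos[OF th, of k] by simp
  \<comment> \<open>Mode 0 has rate 0, for which the kernel estimates fail; it is covered by the
    assumption that the source has no mode 0.\<close>
  have z: "duh (rate 0) (g 0) t = 0" for t using g(2) by (simp add: duh_def)
  have "Z1 \<theta> (\<lambda>k. duh (rate k) (g k)) \<le> (\<integral>\<^sup>+k. ennreal (1 / \<nu>) * (ennreal (wt \<theta> k / ?q k) * L2t (g k)) \<partial>modes)"
    unfolding Z1_def
  proof (rule nn_integral_mono)
    fix k
    show "ennreal (wt \<theta> k) * (SUP t\<in>{0..}. ennreal ((norm (duh (rate k) (g k) t))\<^sup>2)) \<le> ennreal (1 / \<nu>) * (ennreal (wt \<theta> k / ?q k) * L2t (g k))"
    proof (cases "k = 0")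
      case False
      have "(SUP t\<in>{0..}. ennreal ((norm (duh (rate k) (g k) t))\<^sup>2)) \<le> ennreal (1 / rate k) * L2t (g k)"
      proof (rule SUP_least)
        fix t :: real
        show "ennreal ((norm (duh (rate k) (g k) t))\<^sup>2) \<le> ennreal (1 / rate k) * L2t (g k)"
          unfolding L2t_def
          by (intro order_trans[OF duh_sup_le[OF g(1) rate_pos[OF False]]] mult_left_mono nn_integral_mono) (auto simp: indicator_def)
      qed
      then have "ennreal (wt \<theta> k) * (SUP t\<in>{0..}. ennreal ((norm (duh (rate k) (g k) t))\<^sup>2)) \<le> ennreal (wt \<theta> k) * (ennreal (1 / rate k) * L2t (g k))"
        by (rule mult_left_mono) simp
      also have "\<dots> = ennreal (wt \<theta> k * (1 / rate k)) * L2t (g k)"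
        by (subst ennreal_mult) (use w0[of k] rate_nonneg[of k] in \<open>auto simp only: mult.assoc divide_nonneg_nonneg zero_le_one\<close>)
      also have "wt \<theta> k * (1 / rate k) = 1 / \<nu> * (wt \<theta> k / ?q k)" by (simp add: rate_def)
      also have "ennreal (1 / \<nu> * (wt \<theta> k / ?q k)) = ennreal (1 / \<nu>) * ennreal (wt \<theta> k / ?q k)"
        using w0[of k] \<nu>_pos by (intro ennreal_mult) auto
      finally show ?thesis by (simp add: mult.assoc)
    qed (simp add: z)
  qed
  also have "\<dots> = ennreal (1 / \<nu>) * Lz \<theta> g" unfolding Lz_def by (rule nn_integral_cmult) simp
  finally have 1: "Z1 \<theta> (\<lambda>k. duh (rate k) (g k)) \<le> ennreal (1 / \<nu>) * Lz \<theta> g" .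
  have "Z2 \<theta> (\<lambda>k. duh (rate k) (g k)) \<le> (\<integral>\<^sup>+k. ennreal (1 / \<nu>\<^sup>2) * (ennreal (wt \<theta> k / ?q k) * L2t (g k)) \<partial>modes)"
    unfolding Z2_def
  proof (rule nn_integral_mono)
    fix k
    show "ennreal (wt \<theta> k * ?q k) * L2t (duh (rate k) (g k)) \<le> ennreal (1 / \<nu>\<^sup>2) * (ennreal (wt \<theta> k / ?q k) * L2t (g k))"
    proof (cases "k = 0")
      case False
      have "L2t (duh (rate k) (g k)) \<le> ennreal (1 / (rate k)\<^sup>2) * L2t (g k)"
        unfolding L2t_def by (rule duh_L2_le[OF g(1) rate_pos[OF False]])
      then have "ennreal (wt \<theta> k * ?q k) * L2t (duh (rate k) (g k)) \<le> ennreal (wt \<theta> k * ?q k) * (ennreal (1 / (rate k)\<^sup>2) * L2t (g k))"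
        by (rule mult_left_mono) simp
      also have "\<dots> = ennreal (wt \<theta> k * ?q k * (1 / (rate k)\<^sup>2)) * L2t (g k)"
        by (subst ennreal_mult[of "wt \<theta> k * ?q k" "1 / (rate k)\<^sup>2"]) (use w0[of k] in \<open>simp, simp, simp only: mult.assoc\<close>)
      also have "wt \<theta> k * ?q k * (1 / (rate k)\<^sup>2) = 1 / \<nu>\<^sup>2 * (wt \<theta> k / ?q k)"
        using False by (simp add: rate_def power2_eq_square)
      also have "ennreal (1 / \<nu>\<^sup>2 * (wt \<theta> k / ?q k)) = ennreal (1 / \<nu>\<^sup>2) * ennreal (wt \<theta> k / ?q k)"
        using w0[of k] by (intro ennreal_mult) auto
      finally show ?thesis by (simp add: mult.assoc)
    qed simp
  qed
  also have "\<dots> = ennreal (1 / \<nu>\<^sup>2) * Lz \<theta> g" unfolding Lz_def by (rule nn_integral_cmult) simp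
  finally have 2: "Z2 \<theta> (\<lambda>k. duh (rate k) (g k)) \<le> ennreal (1 / \<nu>\<^sup>2) * Lz \<theta> g" .
  have "ennreal CD = ennreal (1 / \<nu>) + ennreal (1 / \<nu>\<^sup>2)" using \<nu>_pos by (simp add: CD_def)
  then show ?thesis using add_mono[OF 1 2] by (simp add: Z_def distrib_right)
qed

lemma Z_exp_le:
  assumes th: "0 < \<theta>"
  shows "Z \<theta> (\<lambda>k t. exp (- rate k * t) *\<^sub>R a k) \<le> ennreal (1 + 1 / \<nu>) * N (wt \<theta>) a"
proof -
  let ?q = "\<lambda>k. (norm (wave k))\<^sup>2"
  have w0: "0 \<le> wt \<theta> k" for k using wt_pos[OF th, of k] by simp
  \<comment> \<open>Dropping the square costs a factor 2 and allows the kernel integral for the rate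
    itself to be used.\<close>
  have e: "(exp (- rate k * t))\<^sup>2 \<le> exp (- rate k * t)" "exp (- rate k * t) \<le> 1" if "0 \<le> t" for k t
  proof -
    show le1: "exp (- rate k * t) \<le> 1" using that rate_nonneg[of k] by simp
    show "(exp (- rate k * t))\<^sup>2 \<le> exp (- rate k * t)"
      using mult_left_mono[OF le1, of "exp (- rate k * t)"] by (simp add: power2_eq_square)
  qed
  have "Z1 \<theta> (\<lambda>k t. exp (- rate k * t) *\<^sub>R a k) \<le> N (wt \<theta>) a"
    unfolding Z1_def N_def
  proof (rule nn_integral_mono)
    fix k
    have "(SUP t\<in>{0..}. ennreal ((norm (exp (- rate k * t) *\<^sub>R a k))\<^sup>2)) \<le> ennreal ((norm (a k))\<^sup>2)"
      using e(2)[of _ k] by (intro SUP_least ennreal_leI power_mono) (auto simp: mult_left_le_one_le)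
    then show "ennreal (wt \<theta> k) * (SUP t\<in>{0..}. ennreal ((norm (exp (- rate k * t) *\<^sub>R a k))\<^sup>2)) \<le> ennreal (wt \<theta> k * (norm (a k))\<^sup>2)"
      using w0[of k] by (subst ennreal_mult) (auto intro: mult_left_mono)
  qed
  moreover have "Z2 \<theta> (\<lambda>k t. exp (- rate k * t) *\<^sub>R a k) \<le> (\<integral>\<^sup>+k. ennreal (1 / \<nu>) * ennreal (wt \<theta> k * (norm (a k))\<^sup>2) \<partial>modes)"
    unfolding Z2_def
  proof (rule nn_integral_mono)
    fix k
    show "ennreal (wt \<theta> k * ?q k) * L2t (\<lambda>t. exp (- rate k * t) *\<^sub>R a k) \<le> ennreal (1 / \<nu>) * ennreal (wt \<theta> k * (norm (a k))\<^sup>2)"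
    proof (cases "k = 0")
      case False
      have "L2t (\<lambda>t. exp (- rate k * t) *\<^sub>R a k) \<le> (\<integral>\<^sup>+t. ennreal (indicator {0..} t * exp (- rate k * (t - 0))) * ennreal ((norm (a k))\<^sup>2) \<partial>lborel)"
        unfolding L2t_def
      proof (rule nn_integral_mono)
        fix t :: real
        show "ennreal ((norm (exp (- rate k * t) *\<^sub>R a k))\<^sup>2) * indicator {0..} t \<le> ennreal (indicator {0..} t * exp (- rate k * (t - 0))) * ennreal ((norm (a k))\<^sup>2)"
          using e(1)[of t k] by (auto simp: indicator_def power_mult_distrib simp flip: ennreal_mult intro!: ennreal_leI mult_right_mono)
      qed
      also have "\<dots> = ennreal (1 / rate k) * ennreal ((norm (a k))\<^sup>2)"
        by (subst nn_integral_multc) (use nn_integral_exp_right[OF rate_pos[OF False], of 0] in auto)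
      finally have "ennreal (wt \<theta> k * ?q k) * L2t (\<lambda>t. exp (- rate k * t) *\<^sub>R a k) \<le> ennreal (wt \<theta> k * ?q k) * (ennreal (1 / rate k) * ennreal ((norm (a k))\<^sup>2))"
        by (rule mult_left_mono) simp
      also have "\<dots> = ennreal (wt \<theta> k * ?q k * (1 / rate k * (norm (a k))\<^sup>2))"
        using w0[of k] rate_nonneg[of k] by (simp only: ennreal_mult[symmetric] mult_nonneg_nonneg zero_le_power2 divide_nonneg_nonneg zero_le_one)
      also have "wt \<theta> k * ?q k * (1 / rate k * (norm (a k))\<^sup>2) = 1 / \<nu> * (wt \<theta> k * (norm (a k))\<^sup>2)"
        using False by (simp add: rate_def)
      also have "ennreal (1 / \<nu> * (wt \<theta> k * (norm (a k))\<^sup>2)) = ennreal (1 / \<nu>) * ennreal (wt \<theta> k * (norm (a k))\<^sup>2)"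
        using w0[of k] \<nu>_pos by (intro ennreal_mult) auto
      finally show ?thesis .
    qed simp
  qed
  moreover have "(\<integral>\<^sup>+k. ennreal (1 / \<nu>) * ennreal (wt \<theta> k * (norm (a k))\<^sup>2) \<partial>modes) = ennreal (1 / \<nu>) * N (wt \<theta>) a"
    unfolding N_def by (rule nn_integral_cmult) simp
  moreover have "ennreal (1 + 1 / \<nu>) = 1 + ennreal (1 / \<nu>)" using \<nu>_pos by simp
  ultimately show ?thesis by (simp add: Z_def distrib_right add_mono)
qed

end

subsection \<open>Picard iteration\<close>

lemma ennreal_le_real_power_limit:
  fixes x :: ennreal
  assumes "\<And>n. x \<le> ennreal (c * (1 / 16) ^ n)" shows "x = 0"
proof -
  have "(\<lambda>n. ennreal (c * (1 / 16) ^ n)) \<longlonglongrightarrow> ennreal (c * 0)"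
    by (intro tendsto_ennrealI tendsto_mult tendsto_const LIMSEQ_realpow_zero) auto
  then have "x \<le> ennreal (c * 0)" using assms by (intro tendsto_lowerbound) auto
  then show ?thesis by simp
qed

lemma AE_finite_time:
  fixes f :: "real \<Rightarrow> ennreal"
  assumes [measurable]: "f \<in> borel_measurable borel" and "(\<integral>\<^sup>+t. f t * indicator A t \<partial>lborel) < \<infinity>" and [measurable]: "A \<in> sets borel"
  shows "AE t in lborel. t \<in> A \<longrightarrow> f t < \<infinity>"
proof -
  have "AE t in lborel. f t * indicator A t \<noteq> \<infinity>" using assms by (intro nn_integral_PInf_AE) auto
  then show ?thesis by eventually_elim (auto simp: top.not_eq_extremum)
qed

context torus begin

text \<open>Upper bounds hold for divergent sums too, by their default value 0; convergence is what
  linearity requires, that is, for splitting the difference of two convolutions.\<close>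

lemma conv_integrable:
  assumes a: "\<And>k. rdot (wave k) (a k) = 0" and W: "W a < \<infinity>" and N: "N (\<lambda>_. 1) b < \<infinity>"
  shows "integrable modes (\<lambda>l. (\<i> * rdot (wave l) (a (k - l))) *s b l)"
proof (rule integrableI_bounded)
  let ?c = "cvol (\<lambda>k. norm (a k)) (\<lambda>k. norm (b k))"
  have "(?c k)\<^sup>2 \<le> (\<integral>\<^sup>+k. (?c k)\<^sup>2 \<partial>modes)" by (rule nn_integral_ge_point) simp
  also have "\<dots> \<le> (W a)\<^sup>2 * N (\<lambda>_. 1) b"
    using young_convolution[of "\<lambda>k. norm (a k)" "\<lambda>k. norm (b k)"] by (simp add: W_def N_def)
  also have "\<dots> < \<infinity>" using W N by (simp add: ennreal_mult_less_top power_less_top_ennreal)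
  finally have "?c k < \<infinity>" by (simp add: power_less_top_ennreal)
  moreover have "(\<integral>\<^sup>+l. ennreal (norm ((\<i> * rdot (wave l) (a (k - l))) *s b l)) \<partial>modes) \<le> ennreal (norm (wave k)) * ?c k"
  proof -
    have "(\<integral>\<^sup>+l. ennreal (norm ((\<i> * rdot (wave l) (a (k - l))) *s b l)) \<partial>modes)
      \<le> (\<integral>\<^sup>+l. ennreal (norm (wave k) * (norm (a (k - l)) * norm (b l))) \<partial>modes)"
      by (intro nn_integral_mono ennreal_leI norm_conv_term_le a)
    also have "\<dots> = ennreal (norm (wave k)) * ?c k"
      unfolding cvol_def by (simp add: ennreal_mult nn_integral_cmult)
    finally show ?thesis .
  qed
  ultimately show "(\<integral>\<^sup>+l. ennreal (norm ((\<i> * rdot (wave l) (a (k - l))) *s b l)) \<partial>modes) < \<infinity>"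
    by (auto simp: ennreal_mult_less_top intro: le_less_trans)
qed simp

text \<open>The usual splitting of a quadratic difference. The assumptions make the sums for
  \<open>a, a\<close>, for \<open>c, a\<close> and for \<open>c, c\<close> converge; along a
  solution they hold for almost every time.\<close>

lemma PB_difference:
  assumes a: "solenoidal a" "W a < \<infinity>" "N (\<lambda>_. 1) a < \<infinity>" and c: "solenoidal c" "W c < \<infinity>" "N (\<lambda>_. 1) c < \<infinity>"
  shows "PB a a k - PB c c k = PB (\<lambda>k. a k - c k) a k + PB c (\<lambda>k. a k - c k) k"
proof -
  have s: "\<And>k. rdot (wave k) (a k) = 0" "\<And>k. rdot (wave k) (c k) = 0" using a c by (auto simp: solenoidal_def)
  let ?T = "\<lambda>a b l. (\<i> * rdot (wave l) (a (k - l))) *s b l"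
  note I = conv_integrable[OF s(1) a(2) a(3), of k] conv_integrable[OF s(2) c(2) a(3), of k] conv_integrable[OF s(2) c(2) c(3), of k]
  have "conv (\<lambda>k. a k - c k) a k = (LINT l|modes. ?T a a l - ?T c a l)"
    unfolding conv_def by (intro Bochner_Integration.integral_cong) (auto simp: rdot_diff vec_eq_iff algebra_simps)
  also have "\<dots> = conv a a k - conv c a k"
    unfolding conv_def by (intro Bochner_Integration.integral_diff I)
  finally have 1: "conv (\<lambda>k. a k - c k) a k = conv a a k - conv c a k" .
  have "conv c (\<lambda>k. a k - c k) k = (LINT l|modes. ?T c a l - ?T c c l)"
    unfolding conv_def by (intro Bochner_Integration.integral_cong) (auto simp: vec_eq_iff algebra_simps)
  also have "\<dots> = conv c a k - conv c c k"
    unfolding conv_def by (intro Bochner_Integration.integral_diff I)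
  finally show ?thesis using 1 by (simp add: PB_def proj_diff)
qed

lemma N_1_le:
  assumes "0 < \<theta>" shows "N (\<lambda>_. 1) a \<le> ennreal (1 / \<theta>) * N (wt \<theta>) a"
proof -
  have "N (\<lambda>_. 1) a \<le> N (\<lambda>k. (1 / \<theta>) * wt \<theta> k) a"
    unfolding N_def
  proof (intro nn_integral_mono ennreal_leI mult_right_mono)
    fix k show "1 \<le> 1 / \<theta> * wt \<theta> k" using assms by (simp add: wt_def field_simps)
  qed simp
  also have "\<dots> = ennreal (1 / \<theta>) * N (wt \<theta>) a"
    using assms wt_pos[OF assms] by (intro N_cmult) (auto simp: less_imp_le)
  finally show ?thesis .
qed

end

context navier begin

lemma L2t_set_integrable:
  assumes [measurable]: "h \<in> borel_measurable borel" and L: "L2t h < \<infinity>"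
  shows "set_integrable lborel {0..t} h"
  unfolding set_integrable_def
proof (rule integrableI_bounded)
  have "norm (h s) \<le> 1 + (norm (h s))\<^sup>2" for s
  proof -
    have "0 \<le> (norm (h s) - 1)\<^sup>2 + (norm (h s))\<^sup>2 + 1" by simp
    then show ?thesis by (simp add: power2_diff)
  qed
  then have "(\<integral>\<^sup>+s. ennreal (norm (indicator {0..t} s *\<^sub>R h s)) \<partial>lborel) \<le>
      (\<integral>\<^sup>+s. indicator {0..t} s + ennreal ((norm (h s))\<^sup>2) * indicator {0..} s \<partial>lborel)"
  proof (intro nn_integral_mono)
    fix s
    have "ennreal (norm (h s)) \<le> ennreal (1 + (norm (h s))\<^sup>2)" by (rule ennreal_leI) fact
    also have "\<dots> = 1 + ennreal ((norm (h s))\<^sup>2)" by simp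
    finally show "ennreal (norm (indicator {0..t} s *\<^sub>R h s)) \<le> indicator {0..t} s + ennreal ((norm (h s))\<^sup>2) * indicator {0..} s"
      by (simp add: indicator_def)
  qed
  also have "\<dots> = emeasure lborel {0..t} + L2t h"
    unfolding L2t_def by (subst nn_integral_add) auto
  also have "\<dots> < \<infinity>" using L by (simp add: emeasure_lborel_Icc_eq)
  finally show "(\<integral>\<^sup>+s. ennreal (norm (indicator {0..t} s *\<^sub>R h s)) \<partial>lborel) < \<infinity>" .
qed simp

lemma Lz_finite_L2t:
  assumes g: "Lz \<theta> g < \<infinity>" "\<And>t. g 0 t = 0" and th: "0 < \<theta>" shows "L2t (g k) < \<infinity>"
proof (cases "k = 0")
  case False
  have "ennreal (wt \<theta> k / (norm (wave k))\<^sup>2) * L2t (g k) \<le> Lz \<theta> g"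
    unfolding Lz_def by (rule nn_integral_ge_point) simp
  then have "ennreal (wt \<theta> k / (norm (wave k))\<^sup>2) * L2t (g k) < \<infinity>" using g(1) by (rule le_less_trans)
  moreover have "0 < wt \<theta> k / (norm (wave k))\<^sup>2" using wt_pos[OF th, of k] False by simp
  ultimately show ?thesis by (auto simp: ennreal_mult_less_top ennreal_eq_0_iff)
qed (simp add: L2t_def g(2))

lemma Z_point:
  assumes "0 \<le> t" "0 < \<theta>" shows "ennreal (wt \<theta> k * (norm (u k t))\<^sup>2) \<le> Z \<theta> u"
proof -
  have "ennreal (wt \<theta> k * (norm (u k t))\<^sup>2) \<le> N (wt \<theta>) (\<lambda>k. u k t)"
    unfolding N_def by (rule nn_integral_ge_point) simp
  also have "\<dots> \<le> Z1 \<theta> u" by (rule N_le_Z1[OF assms])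
  finally show ?thesis by (simp add: Z_def add_increasing2)
qed

lemma AE_W_finite:
  assumes u: "good u" and th: "0 < \<theta>" and Z: "Z \<theta> u < \<infinity>"
  shows "AE t in lborel. t \<in> {0..} \<longrightarrow> W (\<lambda>k. u k t) < \<infinity>"
proof -
  note [measurable] = goodD[OF u]
  have "Z2 \<theta> u < \<infinity>" using Z by (simp add: Z_def)
  then have "(\<integral>\<^sup>+t. (W (\<lambda>k. u k t))\<^sup>2 * indicator {0..} t \<partial>lborel) < \<infinity>"
    by (intro le_less_trans[OF W_time_integral[OF u th]]) (simp add: ennreal_mult_less_top)
  moreover have "(\<lambda>t. (W (\<lambda>k. u k t))\<^sup>2) \<in> borel_measurable borel" unfolding W_def by measurable
  ultimately have "AE t in lborel. t \<in> {0..} \<longrightarrow> (W (\<lambda>k. u k t))\<^sup>2 < \<infinity>"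
    by (intro AE_finite_time) auto
  then show ?thesis by eventually_elim (auto simp: power_less_top_ennreal)
qed

lemma N_1_finite:
  assumes "0 \<le> t" "0 < \<theta>" "Z \<theta> u < \<infinity>" shows "N (\<lambda>_. 1) (\<lambda>k. u k t) < \<infinity>"
proof -
  have "N (wt \<theta>) (\<lambda>k. u k t) < \<infinity>"
    using N_le_Z1[OF assms(1,2), of u] assms(3) by (auto simp: Z_def intro: le_less_trans)
  then show ?thesis
    by (intro le_less_trans[OF N_1_le[OF assms(2)]]) (simp add: ennreal_mult_less_top)
qed

lemma Lz_NL_finite:
  assumes "good u" "good v" "0 < \<theta>" "Z \<theta> u < \<infinity>" "Z \<theta> v < \<infinity>" shows "Lz \<theta> (NL u v) < \<infinity>"
  using assms(4,5) by (intro le_less_trans[OF Lz_NL_le[OF assms(1-3)]]) (simp add: ennreal_mult_less_top)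

lemma NL_set_integrable:
  assumes "good u" "good v" "0 < \<theta>" "Z \<theta> u < \<infinity>" "Z \<theta> v < \<infinity>"
  shows "set_integrable lborel {0..t} (NL u v k)"
  by (rule L2t_set_integrable[OF goodD[OF good_NL[OF assms(1,2)]]
        Lz_finite_L2t[OF Lz_NL_finite[OF assms] good_0[OF good_NL[OF assms(1,2)]] assms(3)]])

lemma Z_duh_NL_diff:
  assumes u: "good u" "Z \<theta> u < \<infinity>" and v: "good v" "Z \<theta> v < \<infinity>" and th: "0 < \<theta>"
  defines "w \<equiv> \<lambda>k t. u k t - v k t"
  shows "Z \<theta> (\<lambda>k t. duh (rate k) (NL u u k) t - duh (rate k) (NL v v k) t)
    \<le> ennreal CD * (2 * (ennreal CA * Z \<theta> w * Z \<theta> u) + 2 * (ennreal CA * Z \<theta> v * Z \<theta> w))"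
proof -
  have w: "good w" unfolding w_def by (rule good_diff[OF u(1) v(1)])
  let ?s = "\<lambda>k t. NL u u k t - NL v v k t"
  have s: "good ?s" by (intro good_diff good_NL u v)
  note [measurable] = goodD[OF s] goodD[OF u(1)] goodD[OF v(1)] goodD[OF w] goodD[OF good_NL[OF w u(1)]] goodD[OF good_NL[OF v(1) w]]
  have "Z \<theta> (\<lambda>k t. duh (rate k) (NL u u k) t - duh (rate k) (NL v v k) t) = Z \<theta> (\<lambda>k. duh (rate k) (?s k))"
    by (intro Z_cong duh_diff[symmetric] NL_set_integrable[OF _ _ th] u v rate_nonneg)
  also have "\<dots> \<le> ennreal CD * Lz \<theta> ?s"
    by (rule Z_duh_le) (use th good_0[OF s] in auto)
  also have "Lz \<theta> ?s = Lz \<theta> (\<lambda>k t. NL w u k t + NL v w k t)"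
  proof -
    \<comment> \<open>The splitting holds for almost every time only, which is enough inside the
      time integrals of \<open>Lz\<close>.\<close>
    have "AE t in lborel. t \<in> {0..} \<longrightarrow> (\<forall>k. ?s k t = NL w u k t + NL v w k t)"
      using AE_W_finite[OF u(1) th u(2)] AE_W_finite[OF v(1) th v(2)]
    proof eventually_elim
      case (elim t)
      show ?case
      proof (intro impI allI)
        fix k assume t: "t \<in> {0..}"
        show "?s k t = NL w u k t + NL v w k t"
          unfolding NL_def w_def
          by (rule PB_difference) (use t elim u v good_solenoidal N_1_finite[OF _ th] in auto)
      qed
    qed
    then have "AE t in lborel. ennreal ((norm (?s k t))\<^sup>2) * indicator {0..} t =
        ennreal ((norm (NL w u k t + NL v w k t))\<^sup>2) * indicator {0..} t" for k
      by eventually_elim (simp add: indicator_def)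
    then have "L2t (?s k) = L2t (\<lambda>t. NL w u k t + NL v w k t)" for k
      unfolding L2t_def by (rule nn_integral_cong_AE)
    then show ?thesis by (simp add: Lz_def)
  qed
  also have "\<dots> \<le> 2 * Lz \<theta> (NL w u) + 2 * Lz \<theta> (NL v w)" by (rule Lz_add_le) measurable
  also have "\<dots> \<le> 2 * (ennreal CA * Z \<theta> w * Z \<theta> u) + 2 * (ennreal CA * Z \<theta> v * Z \<theta> w)"
    by (intro add_mono mult_left_mono Lz_NL_le u v w th) auto
  finally show ?thesis by (simp add: mult_left_mono)
qed

text \<open>Lower semicontinuity by Fatou's lemma, applied to the sum over modes and to the time
  integral. The supremum and the dissipation part are each bounded by \<open>B\<close>, hence the
  factor 2.\<close>

lemma Z_limit:
  assumes f: "\<And>m k. f m k \<in> borel_measurable borel" and B: "\<And>m. Z \<theta> (f m) \<le> B"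
    and lim: "\<And>k t. 0 \<le> t \<Longrightarrow> (\<lambda>m. f m k t) \<longlonglongrightarrow> g k t"
  shows "Z \<theta> g \<le> 2 * B"
proof -
  note [measurable] = f
  have b1: "Z1 \<theta> (f m) \<le> B" and b2: "Z2 \<theta> (f m) \<le> B" for m
    by (rule order_trans[OF _ B[of m]], simp add: Z_def add_increasing add_increasing2)+
  have l: "ennreal ((norm (g k t))\<^sup>2) = liminf (\<lambda>m. ennreal ((norm (f m k t))\<^sup>2))" if "0 \<le> t" for k t
    by (rule lim_imp_Liminf[symmetric]) (auto intro!: tendsto_ennrealI tendsto_intros lim that)
  have cm: "ennreal c * liminf X \<le> liminf (\<lambda>m. ennreal c * X m)" for c and X :: "nat \<Rightarrow> ennreal"
    unfolding liminf_SUP_INF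
    by (subst SUP_mult_left_ennreal, intro SUP_mono' INF_greatest mult_left_mono INF_lower) auto
  have "Z1 \<theta> g \<le> (\<integral>\<^sup>+k. liminf (\<lambda>m. ennreal (wt \<theta> k) * (SUP t\<in>{0..}. ennreal ((norm (f m k t))\<^sup>2))) \<partial>modes)"
    unfolding Z1_def
  proof (rule nn_integral_mono)
    fix k
    have "(SUP t\<in>{0..}. ennreal ((norm (g k t))\<^sup>2)) \<le> liminf (\<lambda>m. SUP t\<in>{0..}. ennreal ((norm (f m k t))\<^sup>2))"
    proof (rule SUP_least)
      fix t :: real assume t: "t \<in> {0..}"
      then show "ennreal ((norm (g k t))\<^sup>2) \<le> liminf (\<lambda>m. SUP t\<in>{0..}. ennreal ((norm (f m k t))\<^sup>2))"
        by (subst l) (auto intro!: Liminf_mono always_eventually SUP_upper2[of t])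
    qed
    then show "ennreal (wt \<theta> k) * (SUP t\<in>{0..}. ennreal ((norm (g k t))\<^sup>2)) \<le> liminf (\<lambda>m. ennreal (wt \<theta> k) * (SUP t\<in>{0..}. ennreal ((norm (f m k t))\<^sup>2)))"
      by (intro order_trans[OF mult_left_mono cm]) auto
  qed
  also have "\<dots> \<le> liminf (\<lambda>m. Z1 \<theta> (f m))"
    unfolding Z1_def by (rule nn_integral_liminf) simp
  also have "\<dots> \<le> B"
    using b1 by (intro Liminf_le always_eventually allI) auto
  finally have 1: "Z1 \<theta> g \<le> B" .
  have "Z2 \<theta> g \<le> (\<integral>\<^sup>+k. liminf (\<lambda>m. ennreal (wt \<theta> k * (norm (wave k))\<^sup>2) * L2t (f m k)) \<partial>modes)"
    unfolding Z2_def
  proof (rule nn_integral_mono)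
    fix k
    have "L2t (g k) = (\<integral>\<^sup>+t. liminf (\<lambda>m. ennreal ((norm (f m k t))\<^sup>2) * indicator {0..} t) \<partial>lborel)"
      unfolding L2t_def by (intro nn_integral_cong) (auto simp: indicator_def l Liminf_const)
    also have "\<dots> \<le> liminf (\<lambda>m. L2t (f m k))"
      unfolding L2t_def by (rule nn_integral_liminf) measurable
    finally show "ennreal (wt \<theta> k * (norm (wave k))\<^sup>2) * L2t (g k) \<le> liminf (\<lambda>m. ennreal (wt \<theta> k * (norm (wave k))\<^sup>2) * L2t (f m k))"
      by (intro order_trans[OF mult_left_mono cm]) auto
  qed
  also have "\<dots> \<le> liminf (\<lambda>m. Z2 \<theta> (f m))"
    unfolding Z2_def by (rule nn_integral_liminf) simp
  also have "\<dots> \<le> B"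
    using b2 by (intro Liminf_le always_eventually allI) auto
  finally have 2: "Z2 \<theta> g \<le> B" .
  show ?thesis using add_mono[OF 1 2] by (simp add: Z_def mult_2)
qed


definition CK :: real where "CK = CD * CA"

lemma CK_pos: "0 < CK" using CD_pos CA_pos by (simp add: CK_def)

lemma Z_duh_NL_diff_real:
  assumes u: "good u" "Z \<theta> u \<le> ennreal R" and v: "good v" "Z \<theta> v \<le> ennreal R" and th: "0 < \<theta>"
    and w: "Z \<theta> (\<lambda>k t. u k t - v k t) \<le> ennreal d" and d: "0 \<le> d" "0 \<le> R"
  shows "Z \<theta> (\<lambda>k t. duh (rate k) (NL u u k) t - duh (rate k) (NL v v k) t) \<le> ennreal (4 * CK * R * d)"
proof -
  let ?w = "\<lambda>k t. u k t - v k t"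
  have "Z \<theta> (\<lambda>k t. duh (rate k) (NL u u k) t - duh (rate k) (NL v v k) t) \<le>
      ennreal CD * (2 * (ennreal CA * Z \<theta> ?w * Z \<theta> u) + 2 * (ennreal CA * Z \<theta> v * Z \<theta> ?w))"
    by (rule Z_duh_NL_diff) (use u v th in \<open>auto intro: le_less_trans\<close>)
  also have "\<dots> \<le> ennreal CD * (ennreal 2 * (ennreal CA * ennreal d * ennreal R) + ennreal 2 * (ennreal CA * ennreal R * ennreal d))"
    by (intro mult_left_mono add_mono mult_mono u v w) auto
  also have "\<dots> = ennreal (CD * (2 * (CA * d * R) + 2 * (CA * R * d)))"
    using CD_pos CA_pos d
    by (simp only: ennreal_mult[symmetric] ennreal_plus[symmetric] mult_nonneg_nonneg add_nonneg_nonneg less_imp_le zero_le_numeral)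
  also have "CD * (2 * (CA * d * R) + 2 * (CA * R * d)) = 4 * CK * R * d" by (simp add: CK_def)
  finally show ?thesis .
qed

text \<open>On the ball \<open>Z \<theta> u \<le> R\<close> the map has Lipschitz constant
  \<open>4 * CK * R\<close>, at most 1/16, with respect to \<open>Z\<close>, and it preserves the
  ball since \<open>2 * (R / 4) + R / 8 \<le> R\<close>. The limit is placed in the ball of radius
  \<open>8 * R\<close>: the sum of the increments costs a factor 4 and the passage to the limit a
  factor 2.\<close>

theorem picard:
  assumes x: "good x" "Z \<theta> x \<le> ennreal (R / 4)" and R: "0 \<le> R" "64 * CK * R \<le> 1" and th: "0 < \<theta>"
  obtains u where "good u" "Z \<theta> u \<le> ennreal (8 * R)"
    "\<And>k t. 0 \<le> t \<Longrightarrow> u k t = x k t - duh (rate k) (NL u u k) t"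
proof -
  define step where "step u = (\<lambda>k t. x k t - duh (rate k) (NL u u k) t)" for u
  define U where "U n = (step ^^ n) (\<lambda>k t. 0)" for n
  have U0: "U 0 = (\<lambda>k t. 0)" and US: "U (Suc n) = step (U n)" for n by (simp_all add: U_def)
  have Ueq: "U (Suc n) k t = x k t - duh (rate k) (NL (U n) (U n) k) t" for n k t
    by (simp add: US step_def)
  have gstep: "good (step u)" if "good u" for u
    unfolding step_def by (intro good_diff x good_duh good_NL that)
  have g: "good (U n)" for n
  proof (induct n)
    case 0
    show ?case by (simp add: U0 good_def solenoidal_def hermitian_def)
  next
    case (Suc n)
    then show ?case by (simp add: US gstep)
  qed
  note [measurable] = goodD[OF g] goodD[OF x(1)]
  have Z0: "Z \<theta> (\<lambda>k t. 0) = 0" by (simp add: Z_def Z1_def Z2_def L2t_def)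
  have NL0: "NL (\<lambda>k t. 0) (\<lambda>k t. 0) = (\<lambda>k t. 0)"
    by (intro ext) (simp add: NL_def PB_def conv_def)
  have duh0: "duh c (\<lambda>t. 0 :: complex^3) t = 0" for c t by (simp add: duh_def)
  have CK0: "0 \<le> CK" using CK_pos by simp
  have quarter: "ennreal (R / 4) \<le> ennreal R" using R by (intro ennreal_leI) simp
  have ZU: "Z \<theta> (U n) \<le> ennreal R" for n
  proof (induct n)
    case 0
    show ?case by (simp add: U0 Z0)
  next
    case (Suc n)
    have "Z \<theta> (\<lambda>k t. duh (rate k) (NL (U n) (U n) k) t - duh (rate k) (NL (\<lambda>k t. 0) (\<lambda>k t. 0) k) t) \<le> ennreal (4 * CK * R * R)"
      by (rule Z_duh_NL_diff_real) (use g Suc th R Z0 g[of 0] in \<open>auto simp: U0\<close>)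
    then have 1: "Z \<theta> (\<lambda>k. duh (rate k) (NL (U n) (U n) k)) \<le> ennreal (4 * CK * R * R)"
      by (simp add: NL0 duh0)
    have "Z \<theta> (U (Suc n)) \<le> 2 * Z \<theta> x + 2 * Z \<theta> (\<lambda>k. duh (rate k) (NL (U n) (U n) k))"
      unfolding US step_def by (rule Z_diff_le) (use x goodD[OF good_duh[OF good_NL[OF g g]]] goodD in auto)
    also have "\<dots> \<le> ennreal 2 * ennreal (R / 4) + ennreal 2 * ennreal (4 * CK * R * R)"
      by (intro add_mono mult_mono 1 x) auto
    also have "\<dots> = ennreal (2 * (R / 4) + 2 * (4 * CK * R * R))"
      using CK0 R by (simp only: ennreal_mult[symmetric] ennreal_plus[symmetric] mult_nonneg_nonneg zero_le_numeral divide_nonneg_nonneg)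
    also have "\<dots> \<le> ennreal R"
    proof (rule ennreal_leI)
      have "(64 * CK * R) * R \<le> 1 * R" by (rule mult_right_mono) (use R in auto)
      then show "2 * (R / 4) + 2 * (4 * CK * R * R) \<le> R" using R(1) by simp
    qed
    finally show ?case .
  qed
  have Zw: "Z \<theta> (\<lambda>k t. U (Suc n) k t - U n k t) \<le> ennreal (R * (1 / 16) ^ n)" for n
  proof (induct n)
    case 0
    then show ?case using ZU[of 1] by (simp add: U0)
  next
    case (Suc n)
    have eq: "(\<lambda>k t. U (Suc (Suc n)) k t - U (Suc n) k t) =
        (\<lambda>k t. - (duh (rate k) (NL (U (Suc n)) (U (Suc n)) k) t - duh (rate k) (NL (U n) (U n) k) t))"
      by (intro ext) (simp only: Ueq[of "Suc n"] Ueq[of n], simp)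
    have "Z \<theta> (\<lambda>k t. U (Suc (Suc n)) k t - U (Suc n) k t) \<le> ennreal (4 * CK * R * (R * (1 / 16) ^ n))"
      unfolding eq Z_minus by (rule Z_duh_NL_diff_real) (use g ZU th R Suc in auto)
    also have "\<dots> \<le> ennreal (R * (1 / 16) ^ Suc n)"
    proof (rule ennreal_leI)
      have "(64 * CK * R) * (R * (1 / 16) ^ n) \<le> 1 * (R * (1 / 16) ^ n)" by (rule mult_right_mono) (use R in auto)
      then show "4 * CK * R * (R * (1 / 16) ^ n) \<le> R * (1 / 16) ^ Suc n" by simp
    qed
    finally show ?case .
  qed
  \<comment> \<open>Each telescoping step doubles the bound; the ratio 1/16 compensates for it, as
    \<open>2 * 4 / 16 + 2 \<le> 4\<close>.\<close>
  have tail: "Z \<theta> (\<lambda>k t. U (n + j) k t - U n k t) \<le> ennreal (4 * R * (1 / 16) ^ n)" for n j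
  proof (induct j arbitrary: n)
    case 0
    then show ?case by (simp add: Z0)
  next
    case (Suc j)
    have eq: "(\<lambda>k t. U (n + Suc j) k t - U n k t) = (\<lambda>k t. (U (Suc n + j) k t - U (Suc n) k t) + (U (Suc n) k t - U n k t))"
      by simp
    have "Z \<theta> (\<lambda>k t. U (n + Suc j) k t - U n k t) \<le> 2 * Z \<theta> (\<lambda>k t. U (Suc n + j) k t - U (Suc n) k t) + 2 * Z \<theta> (\<lambda>k t. U (Suc n) k t - U n k t)"
      unfolding eq by (rule Z_add_le) measurable
    also have "\<dots> \<le> ennreal 2 * ennreal (4 * R * (1 / 16) ^ Suc n) + ennreal 2 * ennreal (R * (1 / 16) ^ n)"
      by (intro add_mono mult_mono Suc Zw) auto
    also have "\<dots> = ennreal (2 * (4 * R * (1 / 16) ^ Suc n) + 2 * (R * (1 / 16) ^ n))"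
      using R by (simp only: ennreal_mult[symmetric] ennreal_plus[symmetric] mult_nonneg_nonneg zero_le_numeral zero_le_power zero_le_divide_1_iff)
    also have "\<dots> \<le> ennreal (4 * R * (1 / 16) ^ n)"
    proof (rule ennreal_leI)
      have "0 \<le> R * (1 / 16) ^ n" using R by simp
      then show "2 * (4 * R * (1 / 16) ^ Suc n) + 2 * (R * (1 / 16) ^ n) \<le> 4 * R * (1 / 16) ^ n" by simp
    qed
    finally show ?case .
  qed
  have cauchy: "Cauchy (\<lambda>n. U n k t)" if t: "0 \<le> t" for k t
  proof -
    have w: "0 < wt \<theta> k" by (rule wt_pos[OF th])
    \<comment> \<open>\<open>Z\<close> controls squares, so the ratio 1/16 becomes 1/4 for the
      values at a fixed mode and time.\<close>
    define c where "c = sqrt (4 * R / wt \<theta> k)"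
    have le: "norm (U (n + j) k t - U n k t) \<le> c * (1 / 4) ^ n" for n j
    proof -
      have "ennreal (wt \<theta> k * (norm (U (n + j) k t - U n k t))\<^sup>2) \<le> ennreal (4 * R * (1 / 16) ^ n)"
        using order_trans[OF Z_point[OF t th, of k "\<lambda>k t. U (n + j) k t - U n k t"] tail[of n j]] by simp
      then have "wt \<theta> k * (norm (U (n + j) k t - U n k t))\<^sup>2 \<le> 4 * R * (1 / 16) ^ n"
        using R by (subst (asm) ennreal_le_iff) auto
      then have "(norm (U (n + j) k t - U n k t))\<^sup>2 \<le> 4 * R / wt \<theta> k * (1 / 16) ^ n" using w by (simp add: field_simps)
      also have "\<dots> = (c * (1 / 4) ^ n)\<^sup>2"
      proof -
        have "((1 / 4 :: real) ^ n)\<^sup>2 = (1 / 16) ^ n" by (simp add: power2_eq_square flip: power_mult_distrib)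
        moreover have "c\<^sup>2 = 4 * R / wt \<theta> k" using w R by (simp add: c_def)
        ultimately show ?thesis by (simp add: power_mult_distrib)
      qed
      finally show ?thesis by (rule power2_le_imp_le) (use w R in \<open>simp add: c_def\<close>)
    qed
    have lim: "(\<lambda>n. c * (1 / 4) ^ n) \<longlonglongrightarrow> 0"
      using LIMSEQ_realpow_zero[of "1/4 :: real"] tendsto_mult_right_zero by fastforce
    show ?thesis
    proof (rule metric_CauchyI)
      fix e :: real assume "0 < e"
      then have "eventually (\<lambda>n. c * (1 / 4) ^ n < e / 2) sequentially" using lim by (intro order_tendstoD) auto
      then obtain M where M: "c * (1 / 4) ^ M < e / 2" by (auto simp: eventually_sequentially)
      show "\<exists>M. \<forall>m\<ge>M. \<forall>n\<ge>M. dist (U m k t) (U n k t) < e"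
      proof (intro exI allI impI)
        fix m n assume "M \<le> m" "M \<le> n"
        then have "dist (U m k t) (U M k t) < e / 2" "dist (U n k t) (U M k t) < e / 2"
          using le[of M "m - M"] le[of M "n - M"] M by (auto simp: dist_norm)
        then show "dist (U m k t) (U n k t) < e" by (rule dist_triangle_half_l)
      qed
    qed
  qed
  \<comment> \<open>For negative times the Duhamel integral is 0 and the iterates are constant from
    the first on. The limit is taken there as well because \<open>good\<close> speaks about all
    times.\<close>
  have conv: "convergent (\<lambda>n. U n k t)" for k t
  proof (cases "0 \<le> t")
    case True
    then show ?thesis using cauchy by (simp add: Cauchy_convergent)
  next
    case False
    then have "duh c h t = 0" for c and h :: "real \<Rightarrow> complex^3" by (simp add: duh_def)
    then have "U (Suc n) k t = x k t" for n by (simp add: US step_def)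
    then have "convergent (\<lambda>n. U (Suc n) k t)" by (simp add: convergent_const)
    then show ?thesis by (rule convergent_Suc_iff[THEN iffD1])
  qed
  define u where "u k t = lim (\<lambda>n. U n k t)" for k t
  have ulim: "(\<lambda>n. U n k t) \<longlonglongrightarrow> u k t" for k t
    using conv by (simp add: u_def convergent_LIMSEQ_iff)
  have gu: "good u"
    unfolding good_def
  proof (intro conjI allI)
    show "u k \<in> borel_measurable borel" for k
      by (rule borel_measurable_LIMSEQ_metric[OF _ ulim]) measurable
    fix t
    have "u 0 t = 0" by (rule LIMSEQ_unique[OF ulim]) (use good_0[OF g] in simp)
    moreover have "rdot (wave k) (u k t) = 0" for k
      by (rule LIMSEQ_unique[OF rdot_tendsto[OF ulim]]) (use good_solenoidal[OF g, where t=t] in \<open>simp add: solenoidal_def\<close>)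
    ultimately show "solenoidal (\<lambda>k. u k t)" by (simp add: solenoidal_def)
    have "u (- k) t = cnjv (u k t)" for k
      by (rule LIMSEQ_unique[OF ulim])
        (use bounded_linear.tendsto[OF bounded_linear_cnjv ulim[of k t]] good_hermitian[OF g, where t=t] in \<open>simp add: hermitian_def\<close>)
    then show "hermitian (\<lambda>k. u k t)" by (simp add: hermitian_def)
  qed
  note [measurable] = goodD[OF gu]
  have Zlim: "Z \<theta> (\<lambda>k t. u k t - U n k t) \<le> ennreal (8 * R * (1 / 16) ^ n)" for n
  proof -
    have "Z \<theta> (\<lambda>k t. u k t - U n k t) \<le> 2 * ennreal (4 * R * (1 / 16) ^ n)"
    proof (rule Z_limit[where f="\<lambda>j k t. U (n + j) k t - U n k t"])
      show "(\<lambda>j. U (n + j) k t - U n k t) \<longlonglongrightarrow> u k t - U n k t" for k t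
        using LIMSEQ_ignore_initial_segment[OF ulim[of k t], of n] by (intro tendsto_intros) (simp add: add.commute)
    qed (use tail in auto)
    also have "\<dots> = ennreal 2 * ennreal (4 * R * (1 / 16) ^ n)" by simp
    also have "\<dots> = ennreal (2 * (4 * R * (1 / 16) ^ n))" using R by (subst ennreal_mult) auto
    also have "2 * (4 * R * (1 / 16) ^ n) = 8 * R * (1 / 16) ^ n" by simp
    finally show ?thesis .
  qed
  have Zu: "Z \<theta> u \<le> ennreal (8 * R)" using Zlim[of 0] by (simp add: U0)
  have ZU8: "Z \<theta> (U n) \<le> ennreal (8 * R)" for n
    by (rule order_trans[OF ZU]) (use R in \<open>simp add: ennreal_leI\<close>)
  have gsu: "good (step u)" by (rule gstep[OF gu])
  note [measurable] = goodD[OF gsu]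
  \<comment> \<open>The iterates and \<open>u\<close> lie in the ball of radius
    \<open>8 * R\<close>, on which the map is still Lipschitz; hence \<open>step u\<close> is a
    limit of the iterates too, and \<open>Z\<close> of the difference is 0.\<close>
  have "Z \<theta> (\<lambda>k t. u k t - step u k t) \<le> ennreal ((16 * R + 64 * CK * (8 * R) * R) * (1 / 16) ^ n)" for n
  proof -
    have eq: "(\<lambda>k t. u k t - step u k t) = (\<lambda>k t. (u k t - U (Suc n) k t) + (U (Suc n) k t - step u k t))" by simp
    have eq2: "(\<lambda>k t. U (Suc n) k t - step u k t) = (\<lambda>k t. duh (rate k) (NL u u k) t - duh (rate k) (NL (U n) (U n) k) t)"
      by (simp add: US step_def)
    have "Z \<theta> (\<lambda>k t. u k t - step u k t) \<le> 2 * Z \<theta> (\<lambda>k t. u k t - U (Suc n) k t) + 2 * Z \<theta> (\<lambda>k t. U (Suc n) k t - step u k t)"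
      unfolding eq by (rule Z_add_le) measurable
    also have "Z \<theta> (\<lambda>k t. u k t - U (Suc n) k t) \<le> ennreal (8 * R * (1 / 16) ^ n)"
      by (rule order_trans[OF Zlim]) (use R in \<open>auto intro!: ennreal_leI mult_left_mono\<close>)
    also have "Z \<theta> (\<lambda>k t. U (Suc n) k t - step u k t) \<le> ennreal (4 * CK * (8 * R) * (8 * R * (1 / 16) ^ n))"
      unfolding eq2 by (rule Z_duh_NL_diff_real) (use gu g Zu ZU8 th Zlim R in auto)
    also have "2 * ennreal (8 * R * (1 / 16) ^ n) + 2 * ennreal (4 * CK * (8 * R) * (8 * R * (1 / 16) ^ n)) =
        ennreal 2 * ennreal (8 * R * (1 / 16) ^ n) + ennreal 2 * ennreal (4 * CK * (8 * R) * (8 * R * (1 / 16) ^ n))" by simp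
    also have "\<dots> = ennreal (2 * (8 * R * (1 / 16) ^ n) + 2 * (4 * CK * (8 * R) * (8 * R * (1 / 16) ^ n)))"
      using R CK0 by (simp only: ennreal_mult[symmetric] ennreal_plus[symmetric] mult_nonneg_nonneg zero_le_numeral zero_le_power zero_le_divide_1_iff)
    also have "2 * (8 * R * (1 / 16) ^ n) + 2 * (4 * CK * (8 * R) * (8 * R * (1 / 16) ^ n)) = (16 * R + 64 * CK * (8 * R) * R) * (1 / 16) ^ n"
      by (simp add: algebra_simps)
    finally show ?thesis by (simp add: add_mono mult_left_mono)
  qed
  then have "Z \<theta> (\<lambda>k t. u k t - step u k t) = 0" by (rule ennreal_le_real_power_limit)
  then have "u k t = step u k t" if "0 \<le> t" for k t
    using Z_point[OF that th, of k "\<lambda>k t. u k t - step u k t"] wt_pos[OF th, of k]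
    by (simp add: ennreal_eq_0_iff mult_le_0_iff)
  then show thesis using gu Zu by (intro that[of u]) (auto simp: step_def)
qed

end

subsection \<open>Bochner measurability\<close>

lemma complete_lebesgue_on:
  assumes "I \<in> sets lebesgue" shows "complete_measure (lebesgue_on I)"
proof
  fix A B assume "B \<subseteq> A" "A \<in> null_sets (lebesgue_on I)"
  then have "A \<subseteq> I" "A \<in> null_sets lebesgue" using assms by (auto simp: null_sets_restrict_space)
  then show "B \<in> sets (lebesgue_on I)"
    using \<open>B \<subseteq> A\<close> completion.complete2[of B A] assms by (auto simp: sets_restrict_space_iff null_sets_def)
qed

text \<open>The measure is complete, so almost everywhere modifications stay measurable. This is how
  functions built from chosen fields or chosen derivatives become measurable in time.\<close>

lemma measurable_cong_AE_lebesgue_on: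
  fixes f g :: "real \<Rightarrow> 'b::topological_space"
  assumes I: "I \<in> sets lebesgue" and f: "f \<in> borel_measurable (lebesgue_on I)"
    and ae: "AE t in lebesgue_on I. f t = g t"
  shows "g \<in> borel_measurable (lebesgue_on I)"
proof (rule borel_measurableI)
  fix S :: "'b set" assume "open S"
  interpret complete_measure "lebesgue_on I" by (rule complete_lebesgue_on[OF I])
  show "g -` S \<inter> space (lebesgue_on I) \<in> sets (lebesgue_on I)"
  proof (rule in_sets_AE)
    show "f -` S \<inter> space (lebesgue_on I) \<in> sets (lebesgue_on I)"
      using f \<open>open S\<close> by (intro measurable_sets[OF f]) auto
    show "AE t in lebesgue_on I. (t \<in> f -` S \<inter> space (lebesgue_on I)) \<longleftrightarrow> (t \<in> g -` S \<inter> space (lebesgue_on I))"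
      using ae by eventually_elim auto
  qed simp
qed

lemma borel_lebesgue_on: "f \<in> borel_measurable borel \<Longrightarrow> f \<in> borel_measurable (lebesgue_on I)"
  for f :: "real \<Rightarrow> 'b::topological_space"
  by (intro measurable_restrict_space1 measurable_completion) simp

lemma integral_lebesgue_on_borel:
  fixes h :: "real \<Rightarrow> 'b::{banach,second_countable_topology}"
  assumes [measurable]: "h \<in> borel_measurable borel" "I \<in> sets borel"
  shows "(LINT s|lebesgue_on I. h s) = (LINT s|lborel. indicator I s *\<^sub>R h s)"
proof -
  have "(LINT s|lebesgue_on I. h s) = (LINT s|lebesgue. indicator I s *\<^sub>R h s)"
    by (rule integral_restrict_space) (simp add: sets_completionI_sets)
  also have "\<dots> = (LINT s|lborel. indicator I s *\<^sub>R h s)"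
    by (rule integral_completion) measurable
  finally show ?thesis .
qed

lemma nn_integral_lebesgue_on_borel:
  fixes h :: "real \<Rightarrow> ennreal"
  assumes "I \<in> sets borel"
  shows "(\<integral>\<^sup>+s. h s \<partial>lebesgue_on I) = (\<integral>\<^sup>+s. h s * indicator I s \<partial>lborel)"
proof -
  have "(\<integral>\<^sup>+s. h s \<partial>lebesgue_on I) = (\<integral>\<^sup>+s. h s * indicator I s \<partial>lebesgue)"
    by (rule nn_integral_restrict_space) (use assms in \<open>simp add: sets_completionI_sets\<close>)
  then show ?thesis by (simp add: nn_integral_completion)
qed

lemma AE_lebesgue_on_iff:
  fixes I :: "real set"
  assumes "I \<in> sets borel" shows "(AE t in lebesgue_on I. P t) \<longleftrightarrow> (AE t in lborel. t \<in> I \<longrightarrow> P t)"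
proof -
  have "(AE t in lebesgue_on I. P t) \<longleftrightarrow> (AE t in lebesgue. t \<in> I \<longrightarrow> P t)"
    by (rule AE_restrict_space_iff) (use assms in \<open>simp add: sets_completionI_sets\<close>)
  then show ?thesis by (simp add: AE_completion_iff)
qed

text \<open>Bochner measurability yields Lebesgue measurable coefficients, whereas the Duhamel
  integrals and the use of Fubini are set up for Borel functions.\<close>

lemma borel_representative:
  fixes f :: "real \<Rightarrow> 'b::euclidean_space"
  assumes f: "f \<in> borel_measurable (lebesgue_on I)" and I: "I \<in> sets borel"
  obtains g where "g \<in> borel_measurable borel" "AE t in lborel. t \<in> I \<longrightarrow> f t = g t"
proof -
  have "(\<lambda>t. indicator I t *\<^sub>R f t) \<in> borel_measurable lebesgue"
    using f I by (subst borel_measurable_restrict_space_iff[symmetric]) (auto simp: sets_completionI_sets)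
  then have "(\<lambda>t. (indicator I t *\<^sub>R f t) \<bullet> b) \<in> borel_measurable lebesgue" for b by measurable
  then have "\<exists>g\<in>borel_measurable lborel. AE t in lborel. (indicator I t *\<^sub>R f t) \<bullet> b = g t" for b
    by (rule completion_ex_borel_measurable_real)
  then have "\<forall>b. \<exists>g. g \<in> borel_measurable borel \<and> (AE t in lborel. (indicator I t *\<^sub>R f t) \<bullet> b = g t)"
    by (auto simp: Bex_def)
  from choice[OF this] obtain g where "\<forall>b. g b \<in> borel_measurable borel \<and> (AE t in lborel. (indicator I t *\<^sub>R f t) \<bullet> b = g b t)" ..
  then have g: "\<And>b. g b \<in> borel_measurable borel" "\<And>b. AE t in lborel. (indicator I t *\<^sub>R f t) \<bullet> b = g b t"
    by auto
  show thesis
  proof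
    note [measurable] = g(1)
    show "(\<lambda>t. \<Sum>b\<in>Basis. g b t *\<^sub>R b) \<in> borel_measurable borel" by measurable
    have "AE t in lborel. \<forall>b\<in>Basis. (indicator I t *\<^sub>R f t) \<bullet> b = g b t"
      by (rule AE_finite_allI) (rule finite_Basis, rule g(2))
    then show "AE t in lborel. t \<in> I \<longrightarrow> f t = (\<Sum>b\<in>Basis. g b t *\<^sub>R b)"
    proof eventually_elim
      case (elim t)
      then have "(\<Sum>b\<in>Basis. g b t *\<^sub>R b) = (\<Sum>b\<in>Basis. ((indicator I t *\<^sub>R f t) \<bullet> b) *\<^sub>R b)" by simp
      also have "\<dots> = indicator I t *\<^sub>R f t" by (rule euclidean_representation)
      finally show ?case by simp
    qed
  qed
qed

text \<open>The family arises from a constant one by finitely many point updates, each of which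
  composes two simple functions.\<close>

lemma simple_function_finite_family:
  assumes "finite F" "\<And>k. k \<in> F \<Longrightarrow> simple_function M (a k)"
  shows "simple_function M (\<lambda>t k. if k \<in> F then a k t else d)"
  using assms
proof (induct F rule: finite_induct)
  case (insert j F)
  have "simple_function M (\<lambda>t. (\<lambda>f x. f(j := x)) (\<lambda>k. if k \<in> F then a k t else d) (a j t))"
    by (rule simple_function_compose2[where h="\<lambda>f x. f(j := x)"]) (use insert in auto)
  moreover have "(\<lambda>t. (\<lambda>f x. f(j := x)) (\<lambda>k. if k \<in> F then a k t else d) (a j t)) = (\<lambda>t k. if k \<in> insert j F then a k t else d)"
    by (auto simp: fun_eq_iff)
  ultimately show ?case by simp
qed simp

context torus begin

text \<open>By \<open>solenoidal_limit\<close> coefficients are continuous in the Sobolev norm, so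
  those of the approximating simple functions converge for almost every time.\<close>

lemma vcoef_measurable_of_bochner:
  assumes u: "bochner_measurable L m I u" and I: "I \<in> sets lebesgue"
  shows "(\<lambda>t. vcoef (u t) k) \<in> borel_measurable (lebesgue_on I)"
proof -
  obtain s where V: "AE t in lebesgue_on I. u t \<in> V_space L m"
    and s: "\<And>n. simple_function (lebesgue_on I) (s n)" "\<And>n t. t \<in> I \<Longrightarrow> s n t \<in> V_space L m"
    and lim: "AE t in lebesgue_on I. (\<lambda>n::nat. sobolev_norm L m (\<lambda>x. u t x - s n t x)) \<longlonglongrightarrow> 0"
    using u unfolding bochner_measurable_def by blast
  have sm: "(\<lambda>t. vcoef (s n t) k) \<in> borel_measurable (lebesgue_on I)" for n
    by (rule borel_measurable_simple_function[OF simple_function_compose1[OF s(1)]])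
  define l where "l t = lim (\<lambda>n. vcoef (s n t) k)" for t
  have "l \<in> borel_measurable (lebesgue_on I)" unfolding l_def using sm by (rule borel_measurable_lim_metric)
  moreover have "AE t in lebesgue_on I. t \<in> space (lebesgue_on I)" by (rule AE_space)
  then have "AE t in lebesgue_on I. l t = vcoef (u t) k"
    using V lim
  proof eventually_elim
    case (elim t)
    have "(\<lambda>n. vcoef (s n t) k) \<longlonglongrightarrow> vcoef (u t) k"
    proof (rule solenoidal_limit(2))
      show "u t \<in> sobolev_per L m" using elim by (simp add: V_space_sobolev)
      show "s n t \<in> sobolev_per L m" "solenoidal (vcoef (s n t))" for n
        using s(2)[of t n] elim by (auto simp: V_space_sobolev V_space_iff)
    qed (use elim in auto)
    then show ?case by (simp add: l_def limI)
  qed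
  ultimately show ?thesis using I by (rule measurable_cong_AE_lebesgue_on[rotated])
qed

lemma tfield_cong: "(\<And>k. k \<in> F \<Longrightarrow> c k = d k) \<Longrightarrow> tfield F c = tfield F d"
  by (intro ext) (simp add: tfield_def tsum_def cong: sum.cong)

lemma bounded_linear_proj: "bounded_linear (proj k)"
  by (intro linear_conv_bounded_linear[THEN iffD1] linearI) (rule proj_add, rule proj_scaleR)

text \<open>Each coefficient is approximated by simple functions dominated by twice its norm.
  Finitely many of these are assembled into a trigonometric polynomial, and dominated convergence
  over the modes gives convergence in the Sobolev norm.\<close>

lemma bochner_measurable_of_vcoef:
  assumes V: "AE t in lebesgue_on I. u t \<in> V_space L m"
    and meas: "\<And>k. (\<lambda>t. vcoef (u t) k) \<in> borel_measurable (lebesgue_on I)"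
  shows "bochner_measurable L m I u"
proof -
  let ?M = "lebesgue_on I"
  let ?P = "\<lambda>k A. (\<forall>i. simple_function ?M (A i)) \<and> (\<forall>t\<in>space ?M. (\<lambda>i. A i t) \<longlonglongrightarrow> vcoef (u t) k) \<and>
      (\<forall>i. \<forall>t\<in>space ?M. dist (A i t) 0 \<le> 2 * dist (vcoef (u t) k) 0)"
  have "\<forall>k. \<exists>A. ?P k A"
    by (intro allI borel_measurable_implies_sequence_metric meas)
  from choice[OF this] obtain A where AA: "\<And>k. ?P k (A k)" by auto
  have A: "simple_function ?M (A k i)" "t \<in> I \<Longrightarrow> (\<lambda>i. A k i t) \<longlonglongrightarrow> vcoef (u t) k"
      "t \<in> I \<Longrightarrow> norm (A k i t) \<le> 2 * norm (vcoef (u t) k)" for k i t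
    using AA[of k] by (auto simp: dist_norm)
  \<comment> \<open>Approximating the coefficients one by one destroys symmetry and zero divergence.
    Projecting and averaging with the reflected conjugate restores both and fixes coefficients that
    already have them.\<close>
  define sym where "sym b k = (1/2) *\<^sub>R (proj k (b k) + cnjv (proj (-k) (b (-k))))" for b :: "int^3 \<Rightarrow> complex^3" and k
  have sym_h: "hermitian (sym b)" for b by (simp add: hermitian_def sym_def add.commute)
  have sym_s: "solenoidal (sym b)" for b
  proof -
    have "rdot (wave k) (cnjv (proj (-k) (b (-k)))) = 0" for k
      using rdot_proj[of "-k" "b (-k)"] by (simp add: rdot_cnjv wave_minus)
    then show ?thesis by (simp add: solenoidal_def sym_def rdot_scaleR rdot_add)
  qed
  \<comment> \<open>Setting the family to 0 outside the cube makes \<open>s n\<close> a function of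
    finitely many simple functions.\<close>
  define s where "s n t = tfield (cube n) (sym (\<lambda>k. if k \<in> cube n then A k n t else 0))" for n t
  have s_eq: "s n t = tfield (cube n) (sym (\<lambda>k. A k n t))" for n t
    unfolding s_def by (rule tfield_cong) (simp add: sym_def)
  have simpf: "simple_function ?M (s n)" for n
    unfolding s_def by (rule simple_function_compose1[OF simple_function_finite_family]) (auto simp: A)
  have sV: "s n t \<in> V_space L m" for n t
    using smooth_solenoidal_sobolev[OF tfield_solenoidal[OF sym_h sym_s]]
    by (auto simp: s_def V_space_iff sobolev_per_iff)
  have vs: "vcoef (s n t) k = (if k \<in> cube n then sym (\<lambda>k. A k n t) k else 0)" for n t k
    unfolding s_eq by (rule vcoef_tfield) (auto simp: sym_h)
  have "AE t in ?M. t \<in> space ?M" by (rule AE_space)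
  then have "AE t in ?M. (\<lambda>n::nat. sobolev_norm L m (\<lambda>x. u t x - s n t x)) \<longlonglongrightarrow> 0"
    using V
  proof eventually_elim
    case (elim t)
    then have t: "t \<in> I" and u: "u t \<in> sobolev_per L m" and us: "solenoidal (vcoef (u t))"
      by (auto simp: V_space_sobolev V_space_iff)
    have uh: "vcoef (u t) (- k) = cnjv (vcoef (u t) k)" for k using hermitian_vcoef[of "u t"] by (simp add: hermitian_def)
    have p: "proj k (vcoef (u t) k) = vcoef (u t) k" for k
      using us by (intro proj_id) (auto simp: solenoidal_def)
    have ss: "s n t \<in> sobolev_per L m" for n using sV by (rule V_space_sobolev)
    note d = sobolev_per_diff[OF u ss]
    have vd: "vcoef (\<lambda>x. u t x - s n t x) k = vcoef (u t) k - vcoef (s n t) k" for n k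
      by (rule vcoef_diff[OF sobolev_per_L2[OF u] sobolev_per_L2[OF ss]])
    have "(\<lambda>n. LINT k|modes. swt m k * (norm (vcoef (\<lambda>x. u t x - s n t x) k))\<^sup>2) \<longlonglongrightarrow> (LINT k|(modes::(int^3) measure). 0 :: real)"
    proof (rule integral_dominated_convergence[where w="\<lambda>k. 9 * (swt m k * (norm (vcoef (u t) k))\<^sup>2)"])
      show "AE k in modes. (\<lambda>n. swt m k * (norm (vcoef (\<lambda>x. u t x - s n t x) k))\<^sup>2) \<longlonglongrightarrow> 0"
      proof (rule AE_I2)
        fix k
        have "(\<lambda>n. sym (\<lambda>k. A k n t) k) \<longlonglongrightarrow> (1/2) *\<^sub>R (proj k (vcoef (u t) k) + cnjv (proj (-k) (vcoef (u t) (-k))))"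
          unfolding sym_def
          by (intro tendsto_intros bounded_linear.tendsto[OF bounded_linear_cnjv] bounded_linear.tendsto[OF bounded_linear_proj] A t)
        also have "(1/2) *\<^sub>R (proj k (vcoef (u t) k) + cnjv (proj (-k) (vcoef (u t) (-k)))) = vcoef (u t) k"
          unfolding p by (simp add: uh flip: scaleR_2)
        finally have "(\<lambda>n. vcoef (s n t) k) \<longlonglongrightarrow> vcoef (u t) k"
          by (rule Lim_transform_eventually) (use eventually_in_cube[of k] in eventually_elim, simp add: vs)
        then have "(\<lambda>n. swt m k * (norm (vcoef (u t) k - vcoef (s n t) k))\<^sup>2) \<longlonglongrightarrow> swt m k * (norm (vcoef (u t) k - vcoef (u t) k))\<^sup>2"
          by (intro tendsto_intros)
        then show "(\<lambda>n. swt m k * (norm (vcoef (\<lambda>x. u t x - s n t x) k))\<^sup>2) \<longlonglongrightarrow> 0" by (simp add: vd)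
      qed
      \<comment> \<open>Domination by twice the norm survives \<open>sym\<close>, because the
        coefficients at \<open>k\<close> and \<open>-k\<close> have equal norm; adding the
        coefficient itself gives 3, and 9 after squaring.\<close>
      have "norm (vcoef (u t) k - vcoef (s n t) k) \<le> 3 * norm (vcoef (u t) k)" for n k
      proof -
        have "norm (sym (\<lambda>k. A k n t) k) \<le> (1/2) * (norm (A k n t) + norm (A (-k) n t))"
          unfolding sym_def using norm_proj_le[of k "A k n t"] norm_proj_le[of "-k" "A (-k) n t"]
          by (auto intro!: order_trans[OF norm_triangle_ineq] add_mono)
        also have "\<dots> \<le> (1/2) * (2 * norm (vcoef (u t) k) + 2 * norm (vcoef (u t) (-k)))"
          by (intro mult_left_mono add_mono A t) auto
        also have "\<dots> = 2 * norm (vcoef (u t) k)" by (simp add: uh)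
        finally have "norm (vcoef (s n t) k) \<le> 2 * norm (vcoef (u t) k)" by (simp add: vs)
        then show ?thesis using norm_triangle_ineq4[of "vcoef (u t) k" "vcoef (s n t) k"] by simp
      qed
      then have "(norm (vcoef (u t) k - vcoef (s n t) k))\<^sup>2 \<le> (3 * norm (vcoef (u t) k))\<^sup>2" for n k
        by (intro power_mono) auto
      then have "swt m k * (norm (vcoef (u t) k - vcoef (s n t) k))\<^sup>2 \<le> swt m k * (9 * (norm (vcoef (u t) k))\<^sup>2)" for n k
        by (intro mult_left_mono swt_nonneg) (simp add: power_mult_distrib)
      then show "AE k in modes. norm (swt m k * (norm (vcoef (\<lambda>x. u t x - s n t x) k))\<^sup>2) \<le> 9 * (swt m k * (norm (vcoef (u t) k))\<^sup>2)" for n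
        by (intro AE_I2) (simp add: vd abs_mult abs_of_nonneg swt_nonneg mult.left_commute)
    qed (use sobolev_norm_parseval(1)[OF u] in auto)
    then have "(\<lambda>n. vol * (LINT k|modes. swt m k * (norm (vcoef (\<lambda>x. u t x - s n t x) k))\<^sup>2)) \<longlonglongrightarrow> vol * 0"
      by (intro tendsto_intros) simp
    then have "(\<lambda>n. sqrt ((sobolev_norm L m (\<lambda>x. u t x - s n t x))\<^sup>2)) \<longlonglongrightarrow> sqrt 0"
      by (intro tendsto_real_sqrt) (simp add: sobolev_norm_parseval(2)[OF d])
    moreover have "0 \<le> sobolev_norm L m v" for v by (simp add: sobolev_norm_def sum_nonneg)
    ultimately show ?case by simp
  qed
  then show ?thesis
    unfolding bochner_measurable_def by (intro conjI V exI[of _ s] allI ballI simpf sV)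
qed

section \<open>Norms of fields as extended sums over modes\<close>

lemma sobolev_norm_nn:
  assumes u: "u \<in> sobolev_per L m"
  shows "ennreal ((sobolev_norm L m u)\<^sup>2) = ennreal vol * N (swt m) (vcoef u)"
proof -
  have "N (swt m) (vcoef u) = ennreal (LINT k|modes. swt m k * (norm (vcoef u k))\<^sup>2)"
    unfolding N_def by (rule nn_integral_eq_integral) (use sobolev_norm_parseval[OF u] swt_nonneg in auto)
  then show ?thesis using vol_pos by (simp add: sobolev_norm_parseval(2)[OF u] ennreal_mult swt_nonneg)
qed

lemma L2_norm_nn:
  assumes u: "u \<in> L2_per L"
  shows "ennreal ((L2_norm L u)\<^sup>2) = ennreal vol * N (\<lambda>_. 1) (vcoef u)"
proof -
  have "N (\<lambda>_. 1) (vcoef u) = ennreal (LINT k|modes. (norm (vcoef u k))\<^sup>2)"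
    unfolding N_def by (simp, rule nn_integral_eq_integral) (use L2_norm_parseval[OF u] in auto)
  then show ?thesis using vol_pos by (simp add: L2_norm_parseval(2)[OF u] ennreal_mult)
qed

lemma N_finite_integrable:
  assumes "N w a < \<infinity>" "\<And>k. 0 \<le> w k" shows "integrable modes (\<lambda>k. w k * (norm (a k))\<^sup>2)"
  by (rule integrableI_bounded) (use assms in \<open>auto simp: N_def\<close>)

end

subsection \<open>Uniqueness\<close>

context torus begin

section \<open>Comparison of weights, and test fields with a single wave number\<close>

lemma W_measurable [measurable]:
  assumes [measurable]: "\<And>k. u k \<in> borel_measurable M" shows "(\<lambda>t. W (\<lambda>k. u k t)) \<in> borel_measurable M"
  unfolding W_def by measurable

lemma N_measurable [measurable]:
  assumes [measurable]: "\<And>k. u k \<in> borel_measurable M" shows "(\<lambda>t. N w (\<lambda>k. u k t)) \<in> borel_measurable M"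
  unfolding N_def by measurable

lemma N_add_le:
  assumes "\<And>k. 0 \<le> w k"
  shows "N w (\<lambda>k. a k + b k) \<le> 2 * N w a + 2 * N w b"
proof -
  have "N w (\<lambda>k. a k + b k) \<le> (\<integral>\<^sup>+k. 2 * ennreal (w k * (norm (a k))\<^sup>2) + 2 * ennreal (w k * (norm (b k))\<^sup>2) \<partial>modes)"
    unfolding N_def
  proof (rule nn_integral_mono)
    fix k
    have "w k * (norm (a k + b k))\<^sup>2 \<le> w k * (2 * (norm (a k))\<^sup>2 + 2 * (norm (b k))\<^sup>2)"
      by (intro mult_left_mono square_norm_add_le assms)
    then have "ennreal (w k * (norm (a k + b k))\<^sup>2) \<le> ennreal (2 * (w k * (norm (a k))\<^sup>2) + 2 * (w k * (norm (b k))\<^sup>2))"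
      by (intro ennreal_leI) (simp add: algebra_simps)
    also have "\<dots> = 2 * ennreal (w k * (norm (a k))\<^sup>2) + 2 * ennreal (w k * (norm (b k))\<^sup>2)"
      using assms[of k] by (simp add: ennreal_mult)
    finally show "ennreal (w k * (norm (a k + b k))\<^sup>2) \<le> 2 * ennreal (w k * (norm (a k))\<^sup>2) + 2 * ennreal (w k * (norm (b k))\<^sup>2)" .
  qed
  also have "\<dots> = 2 * N w a + 2 * N w b"
    unfolding N_def by (subst nn_integral_add) (auto simp: nn_integral_cmult)
  finally show ?thesis .
qed

lemma N_diff_le:
  assumes "\<And>k. 0 \<le> w k"
  shows "N w (\<lambda>k. a k - b k) \<le> 2 * N w a + 2 * N w b"
  using N_add_le[where w=w and a=a and b="\<lambda>k. - b k", OF assms] by (simp add: N_def)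

lemma N_mono: "(\<And>k. v k \<le> w k) \<Longrightarrow> N v a \<le> N w a"
  unfolding N_def by (intro nn_integral_mono ennreal_leI mult_right_mono) auto

lemma N_point: "ennreal (w k * (norm (a k))\<^sup>2) \<le> N w a"
  unfolding N_def by (rule nn_integral_ge_point) simp

lemma sum_le_W:
  assumes "W a < \<infinity>" "finite F" shows "(\<Sum>k\<in>F. norm (a k)) \<le> enn2real (W a)"
proof -
  have "ennreal (\<Sum>k\<in>F. norm (a k)) = (\<integral>\<^sup>+k. ennreal (norm (a k)) * indicator F k \<partial>modes)"
    using assms(2) by (simp add: nn_integral_count_space_indicator[symmetric] nn_integral_count_space_finite sum_ennreal)
  also have "\<dots> \<le> W a" unfolding W_def by (intro nn_integral_mono) (auto simp: indicator_def)
  also have "W a = ennreal (enn2real (W a))" using assms(1) by simp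
  finally show ?thesis by (subst (asm) ennreal_le_iff) simp_all
qed

lemma swt_1_ge: "(norm (wave k))\<^sup>2 \<le> 3 * swt m k" if "1 \<le> m"
proof -
  have "(wave k $ i)\<^sup>2 \<le> swt m k" for i
    using swt_ge[of "axis i 1" m k] that by (simp add: mi_order_axis dfac_axis norm_mult power_mult_distrib)
  then have "(\<Sum>i\<in>UNIV. (wave k $ i)\<^sup>2) \<le> (\<Sum>i\<in>(UNIV::3 set). swt m k)" by (intro sum_mono)
  then show ?thesis by (simp add: norm_vec_square)
qed

lemma swt_1_ge': "(norm (wave k))\<^sup>2 \<le> swt 1 k"
proof -
  have "(\<Sum>\<beta>\<in>range (\<lambda>i. axis i 1). (cmod (dfac \<beta> k))\<^sup>2) \<le> swt 1 k"
    unfolding swt_def by (rule sum_mono2) (auto simp: mi_order_axis)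
  moreover have "inj (\<lambda>i::3. axis i (1::nat))" by (rule injI) (simp add: axis_eq_axis)
  ultimately show ?thesis by (simp add: sum.reindex dfac_axis norm_mult norm_vec_square)
qed

text \<open>The constant is \<open>3 + 9\<close>: with \<theta> = 1 the left side is the sum of the
  second and the fourth power of the wave number, bounded by \<open>3 * swt 2 k\<close> and
  \<open>9 * swt 2 k\<close>.\<close>

lemma swt_2_ge: "wt 1 k * (norm (wave k))\<^sup>2 \<le> 12 * swt 2 k"
proof -
  let ?q = "\<lambda>i. (wave k $ i)\<^sup>2"
  have q: "(?q i)\<^sup>2 \<le> swt 2 k" for i
    using swt_ge[of "axis i 2" 2 k] by (simp add: mi_order_axis dfac_axis norm_mult norm_power power_mult_distrib flip: power_mult)
  have "(?q 1 + ?q 2 + ?q 3)\<^sup>2 \<le> 3 * ((?q 1)\<^sup>2 + (?q 2)\<^sup>2 + (?q 3)\<^sup>2)"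
    using zero_le_power2[of "?q 1 - ?q 2"] zero_le_power2[of "?q 2 - ?q 3"] zero_le_power2[of "?q 1 - ?q 3"]
    by (simp add: power2_eq_square algebra_simps)
  also have "\<dots> \<le> 3 * (swt 2 k + swt 2 k + swt 2 k)" by (intro mult_left_mono add_mono q) simp
  finally have "((norm (wave k))\<^sup>2)\<^sup>2 \<le> 9 * swt 2 k" by (simp add: norm_vec_square sum_3)
  then show ?thesis using swt_1_ge[of 2 k] by (simp add: wt_def power2_eq_square algebra_simps)
qed

lemma inner_cnjv: "cnjv a \<bullet> cnjv b = a \<bullet> b"
  by (simp add: inner_complex_vec)

text \<open>A field in \<open>V_space L 0\<close> supported on the modes \<open>k\<close> and
  \<open>-k\<close>. Pairing with it reads off one coefficient; both modes contribute equally, hence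
  the factor 2 below.\<close>

definition mode_test :: "int^3 \<Rightarrow> complex^3 \<Rightarrow> vfield" where
  "mode_test k b = tfield {k, - k} (\<lambda>j. if j = k then proj k b else if j = - k then cnjv (proj k b) else 0)"

lemma mode_test:
  assumes k: "k \<noteq> 0"
  shows "mode_test k b \<in> V_space L 0"
    "w \<in> V_space L 0 \<Longrightarrow> L2_inner L w (mode_test k b) = 2 * vol * (vcoef w k \<bullet> b)"
proof -
  let ?c = "\<lambda>j. if j = k then proj k b else if j = - k then cnjv (proj k b) else 0"
  have kk: "k \<noteq> - k"
  proof
    assume "k = - k"
    then have h: "k $ i = (- k) $ i" for i by (rule arg_cong)
    have "k $ i = 0" for i using h[of i] unfolding vector_uminus_component by linarith
    then show False using k by (auto simp: vec_eq_iff)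
  qed
  have h: "hermitian ?c" using kk by (auto simp: hermitian_def minus_equation_iff)
  have L2: "mode_test k b \<in> L2_per L" unfolding mode_test_def by (rule smooth_periodic_L2_per[OF smooth_tfield periodic_tfield])
  have c: "vcoef (mode_test k b) j = ?c j" for j
    unfolding mode_test_def by (subst vcoef_tfield[OF _ _ h]) (auto simp: minus_equation_iff)
  have "rdot (wave (- k)) (cnjv (proj k b)) = 0" by (simp add: wave_minus rdot_cnjv)
  then have "solenoidal (vcoef (mode_test k b))" using k by (auto simp: solenoidal_def c)
  then show "mode_test k b \<in> V_space L 0" using L2 by (simp add: V_0_iff)
  assume w: "w \<in> V_space L 0"
  then have wL: "w \<in> L2_per L" and ws: "rdot (wave k) (vcoef w k) = 0" by (auto simp: V_0_iff solenoidal_def)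
  let ?f = "\<lambda>j. vcoef w j \<bullet> ?c j"
  have sub: "{j. ?f j \<noteq> 0} \<subseteq> {k, - k}" by auto
  have fin: "finite {j. ?f j \<noteq> 0}" by (rule finite_subset[OF sub]) simp
  have "(LINT j|modes. ?f j) = (\<Sum>j | ?f j \<noteq> 0. ?f j)"
    by (subst lebesgue_integral_count_space_finite_support) (use fin in auto)
  also have "\<dots> = (\<Sum>j\<in>{k, - k}. ?f j)" by (rule sum.mono_neutral_left) (use sub in auto)
  also have "\<dots> = vcoef w k \<bullet> proj k b + vcoef w (- k) \<bullet> cnjv (proj k b)" using kk by simp
  also have "vcoef w (- k) \<bullet> cnjv (proj k b) = vcoef w k \<bullet> proj k b"
    using hermitian_vcoef[of w] by (simp add: hermitian_def inner_cnjv)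
  also have "vcoef w k \<bullet> proj k b = vcoef w k \<bullet> b"
  proof -
    have "(b - proj k b) \<bullet> vcoef w k = 0" by (rule proj_orthogonal[OF ws]) (use k in simp)
    then have "b \<bullet> vcoef w k - proj k b \<bullet> vcoef w k = 0" unfolding inner_diff_left .
    then show ?thesis using inner_commute[of "vcoef w k" b] inner_commute[of "vcoef w k" "proj k b"] by linarith
  qed
  finally show "L2_inner L w (mode_test k b) = 2 * vol * (vcoef w k \<bullet> b)"
    by (simp add: L2_inner_parseval(2)[OF wL L2] c)
qed

end

context navier begin

text \<open>
  A class containing both the Picard solution and the coefficients of every strong solution.
\<close>

definition energy_class :: "(int^3 \<Rightarrow> real \<Rightarrow> complex^3) \<Rightarrow> bool" where
  "energy_class u \<longleftrightarrow> good u \<and> (\<integral>\<^sup>+t. (W (\<lambda>k. u k t))\<^sup>2 * indicator {0..} t \<partial>lborel) < \<infinity> \<and>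
     (\<exists>C<\<infinity>. AE t in lborel. t \<in> {0..} \<longrightarrow> N (\<lambda>_. 1) (\<lambda>k. u k t) \<le> C)"

lemma energy_class_NL_integrable:
  assumes u: "energy_class u" shows "set_integrable lborel {0..t} (NL u u k)"
proof -
  have g: "good u" using u by (simp add: energy_class_def)
  note gN = good_NL[OF g g]
  note [measurable] = goodD[OF g] goodD[OF gN]
  obtain C where C: "C < \<infinity>" "AE t in lborel. t \<in> {0..} \<longrightarrow> N (\<lambda>_. 1) (\<lambda>k. u k t) \<le> C"
    and Wf: "(\<integral>\<^sup>+t. (W (\<lambda>k. u k t))\<^sup>2 * indicator {0..} t \<partial>lborel) < \<infinity>"
    using u by (auto simp: energy_class_def)
  have "(\<integral>\<^sup>+k. ennreal (1 / (norm (wave k))\<^sup>2) * L2t (NL u u k) \<partial>modes) =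
      (\<integral>\<^sup>+t. N (\<lambda>k. 1 / (norm (wave k))\<^sup>2) (\<lambda>k. NL u u k t) * indicator {0..} t \<partial>lborel)"
    by (rule N_time_integral[symmetric]) auto
  also have "\<dots> \<le> (\<integral>\<^sup>+t. (W (\<lambda>k. u k t))\<^sup>2 * indicator {0..} t * C \<partial>lborel)"
  proof (rule nn_integral_mono_AE)
    show "AE t in lborel. N (\<lambda>k. 1 / (norm (wave k))\<^sup>2) (\<lambda>k. NL u u k t) * indicator {0..} t \<le> (W (\<lambda>k. u k t))\<^sup>2 * indicator {0..} t * C"
      using C(2)
    proof eventually_elim
      case (elim t)
      have "N (\<lambda>k. 1 / (norm (wave k))\<^sup>2) (\<lambda>k. NL u u k t) \<le> (W (\<lambda>k. u k t))\<^sup>2 * N (\<lambda>_. 1) (\<lambda>k. u k t)"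
        unfolding NL_def by (rule energy_bilinear_left[OF good_solenoidal[OF g]])
      moreover have "(W (\<lambda>k. u k t))\<^sup>2 * N (\<lambda>_. 1) (\<lambda>k. u k t) \<le> (W (\<lambda>k. u k t))\<^sup>2 * C" if "0 \<le> t"
        using elim that by (intro mult_left_mono) auto
      ultimately show ?case by (auto simp: indicator_def)
    qed
  qed
  also have "\<dots> = (\<integral>\<^sup>+t. (W (\<lambda>k. u k t))\<^sup>2 * indicator {0..} t \<partial>lborel) * C"
    by (rule nn_integral_multc) measurable
  also have "\<dots> < \<infinity>" using Wf C(1) by (simp add: ennreal_mult_less_top)
  finally have fin: "(\<integral>\<^sup>+k. ennreal (1 / (norm (wave k))\<^sup>2) * L2t (NL u u k) \<partial>modes) < \<infinity>" .
  have "L2t (NL u u k) < \<infinity>"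
  proof (cases "k = 0")
    case False
    have "ennreal (1 / (norm (wave k))\<^sup>2) * L2t (NL u u k) < \<infinity>"
      by (rule le_less_trans[OF nn_integral_ge_point[of k UNIV "\<lambda>k. ennreal (1 / (norm (wave k))\<^sup>2) * L2t (NL u u k)"] fin]) simp
    then show ?thesis using False by (auto simp: ennreal_mult_less_top ennreal_eq_0_iff)
  qed (simp add: L2t_def good_0[OF gN])
  then show ?thesis by (intro L2t_set_integrable) measurable
qed

text \<open>Gronwall for the \<open>L^2\<close> norm of the difference \<open>w\<close>. The
  divergence form loses one derivative, and the factor \<open>1 / rate k\<close> of the Duhamel
  estimate gives it back, so only the Wiener norms of \<open>u\<close> and \<open>v\<close>, which
  are square integrable in time, enter the coefficient \<open>h\<close>.\<close>

lemma mild_unique_energy: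
  assumes u: "energy_class u" and v: "energy_class v"
    and eq: "\<And>k t. t \<in> {0..S} \<Longrightarrow> u k t - v k t = - (duh (rate k) (NL u u k) t - duh (rate k) (NL v v k) t)"
    and t: "t \<in> {0..S}"
  shows "u k t = v k t"
proof -
  have gu: "good u" and gv: "good v" using u v by (auto simp: energy_class_def)
  define w where "w = (\<lambda>k t. u k t - v k t)"
  have gw: "good w" unfolding w_def by (rule good_diff[OF gu gv])
  define s where "s = (\<lambda>k t. NL u u k t - NL v v k t)"
  have gs: "good s" unfolding s_def by (intro good_diff good_NL gu gv)
  note [measurable] = goodD[OF gu] goodD[OF gv] goodD[OF gw] goodD[OF gs]
  obtain Cu where Cu: "Cu < \<infinity>" "AE t in lborel. t \<in> {0..} \<longrightarrow> N (\<lambda>_. 1) (\<lambda>k. u k t) \<le> Cu"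
    and Wu: "(\<integral>\<^sup>+t. (W (\<lambda>k. u k t))\<^sup>2 * indicator {0..} t \<partial>lborel) < \<infinity>"
    using u by (auto simp: energy_class_def)
  obtain Cv where Cv: "Cv < \<infinity>" "AE t in lborel. t \<in> {0..} \<longrightarrow> N (\<lambda>_. 1) (\<lambda>k. v k t) \<le> Cv"
    and Wv: "(\<integral>\<^sup>+t. (W (\<lambda>k. v k t))\<^sup>2 * indicator {0..} t \<partial>lborel) < \<infinity>"
    using v by (auto simp: energy_class_def)
  have AEu: "AE t in lborel. t \<in> {0..} \<longrightarrow> (W (\<lambda>k. u k t))\<^sup>2 < \<infinity>" by (rule AE_finite_time[OF _ Wu]) auto
  have AEv: "AE t in lborel. t \<in> {0..} \<longrightarrow> (W (\<lambda>k. v k t))\<^sup>2 < \<infinity>" by (rule AE_finite_time[OF _ Wv]) auto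
  have src: "AE t in lborel. t \<in> {0..} \<longrightarrow> N (\<lambda>k. 1 / (norm (wave k))\<^sup>2) (\<lambda>k. s k t) \<le>
      2 * ((W (\<lambda>k. u k t))\<^sup>2 + (W (\<lambda>k. v k t))\<^sup>2) * N (\<lambda>_. 1) (\<lambda>k. w k t)"
    using AEu AEv Cu(2) Cv(2)
  proof eventually_elim
    case (elim t)
    show ?case
    proof
      assume t: "t \<in> {0..}"
      have "s k t = PB (\<lambda>k. w k t) (\<lambda>k. u k t) k + PB (\<lambda>k. v k t) (\<lambda>k. w k t) k" for k
        unfolding s_def NL_def w_def
        by (rule PB_difference)
          (use t elim Cu(1) Cv(1) good_solenoidal[OF gu] good_solenoidal[OF gv] in \<open>auto simp: power_less_top_ennreal intro: le_less_trans\<close>)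
      then have "N (\<lambda>k. 1 / (norm (wave k))\<^sup>2) (\<lambda>k. s k t) \<le>
          2 * N (\<lambda>k. 1 / (norm (wave k))\<^sup>2) (PB (\<lambda>k. w k t) (\<lambda>k. u k t)) + 2 * N (\<lambda>k. 1 / (norm (wave k))\<^sup>2) (PB (\<lambda>k. v k t) (\<lambda>k. w k t))"
        by (simp add: N_add_le)
      also have "\<dots> \<le> 2 * ((W (\<lambda>k. u k t))\<^sup>2 * N (\<lambda>_. 1) (\<lambda>k. w k t)) + 2 * ((W (\<lambda>k. v k t))\<^sup>2 * N (\<lambda>_. 1) (\<lambda>k. w k t))"
        by (intro add_mono mult_left_mono energy_bilinear_right energy_bilinear_left good_solenoidal[OF gw] good_solenoidal[OF gv]) auto
      also have "\<dots> = 2 * ((W (\<lambda>k. u k t))\<^sup>2 + (W (\<lambda>k. v k t))\<^sup>2) * N (\<lambda>_. 1) (\<lambda>k. w k t)"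
        by (simp add: distrib_left distrib_right mult_ac)
      finally show "N (\<lambda>k. 1 / (norm (wave k))\<^sup>2) (\<lambda>k. s k t) \<le>
        2 * ((W (\<lambda>k. u k t))\<^sup>2 + (W (\<lambda>k. v k t))\<^sup>2) * N (\<lambda>_. 1) (\<lambda>k. w k t)" .
    qed
  qed
  \<comment> \<open>\<open>1 / \<nu>\<close> from the Duhamel estimate, the rest from splitting the
    quadratic difference; the factor 2 is that of \<open>N_add_le\<close>.\<close>
  define h where "h t = ennreal (1 / \<nu>) * (2 * ((W (\<lambda>k. u k t))\<^sup>2 + (W (\<lambda>k. v k t))\<^sup>2))" for t
  have hm [measurable]: "h \<in> borel_measurable borel" unfolding h_def by measurable
  have le: "N (\<lambda>_. 1) (\<lambda>k. w k t) \<le> (\<integral>\<^sup>+r. h r * N (\<lambda>_. 1) (\<lambda>k. w k r) * indicator {0..t} r \<partial>lborel)" if t: "t \<in> {0..S}" for t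
  proof -
    have wd: "w k t = - duh (rate k) (s k) t" for k
      unfolding s_def using eq[OF t] t
      by (subst duh_diff[OF energy_class_NL_integrable[OF u] energy_class_NL_integrable[OF v] rate_nonneg]) (simp add: w_def)
    have "N (\<lambda>_. 1) (\<lambda>k. w k t) \<le> (\<integral>\<^sup>+k. \<integral>\<^sup>+r. ennreal (1 / \<nu>) * (ennreal (1 / (norm (wave k))\<^sup>2 * (norm (s k r))\<^sup>2) * indicator {0..t} r) \<partial>lborel \<partial>modes)"
      unfolding N_def
    proof (rule nn_integral_mono)
      fix k
      show "ennreal (1 * (norm (w k t))\<^sup>2) \<le> (\<integral>\<^sup>+r. ennreal (1 / \<nu>) * (ennreal (1 / (norm (wave k))\<^sup>2 * (norm (s k r))\<^sup>2) * indicator {0..t} r) \<partial>lborel)"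
      proof (cases "k = 0")
        case False
        have "ennreal (1 * (norm (w k t))\<^sup>2) \<le> ennreal (1 / rate k) * (\<integral>\<^sup>+r. ennreal ((norm (s k r))\<^sup>2) * indicator {0..t} r \<partial>lborel)"
          unfolding wd using duh_sup_le[OF goodD[OF gs] rate_pos[OF False], where t=t] by simp
        also have "\<dots> = (\<integral>\<^sup>+r. ennreal (1 / rate k) * (ennreal ((norm (s k r))\<^sup>2) * indicator {0..t} r) \<partial>lborel)"
          by (rule nn_integral_cmult[symmetric]) measurable
        also have "\<dots> = (\<integral>\<^sup>+r. ennreal (1 / \<nu>) * (ennreal (1 / (norm (wave k))\<^sup>2 * (norm (s k r))\<^sup>2) * indicator {0..t} r) \<partial>lborel)"
        proof (rule nn_integral_cong)
          fix r
          have "ennreal (1 / rate k) = ennreal (1 / \<nu>) * ennreal (1 / (norm (wave k))\<^sup>2)"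
            using \<nu>_pos by (subst ennreal_mult[symmetric]) (auto simp: rate_def)
          moreover have "ennreal (1 / (norm (wave k))\<^sup>2 * (norm (s k r))\<^sup>2) = ennreal (1 / (norm (wave k))\<^sup>2) * ennreal ((norm (s k r))\<^sup>2)"
            by (rule ennreal_mult) auto
          ultimately show "ennreal (1 / rate k) * (ennreal ((norm (s k r))\<^sup>2) * indicator {0..t} r) =
            ennreal (1 / \<nu>) * (ennreal (1 / (norm (wave k))\<^sup>2 * (norm (s k r))\<^sup>2) * indicator {0..t} r)"
            by (simp only: mult.assoc)
        qed
        finally show ?thesis .
      qed (simp add: good_0[OF gw])
    qed
    also have "\<dots> = (\<integral>\<^sup>+r. \<integral>\<^sup>+k. ennreal (1 / \<nu>) * (ennreal (1 / (norm (wave k))\<^sup>2 * (norm (s k r))\<^sup>2) * indicator {0..t} r) \<partial>modes \<partial>lborel)"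
      by (rule nn_integral_count_space_nn_integral[symmetric]) auto
    also have "\<dots> = (\<integral>\<^sup>+r. ennreal (1 / \<nu>) * (N (\<lambda>k. 1 / (norm (wave k))\<^sup>2) (\<lambda>k. s k r) * indicator {0..t} r) \<partial>lborel)"
      unfolding N_def by (intro nn_integral_cong) (simp add: nn_integral_cmult nn_integral_multc)
    also have "\<dots> \<le> (\<integral>\<^sup>+r. h r * N (\<lambda>_. 1) (\<lambda>k. w k r) * indicator {0..t} r \<partial>lborel)"
    proof (rule nn_integral_mono_AE)
      show "AE r in lborel. ennreal (1 / \<nu>) * (N (\<lambda>k. 1 / (norm (wave k))\<^sup>2) (\<lambda>k. s k r) * indicator {0..t} r) \<le> h r * N (\<lambda>_. 1) (\<lambda>k. w k r) * indicator {0..t} r"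
        using src
      proof eventually_elim
        case (elim r)
        show ?case
        proof (cases "r \<in> {0..t}")
          case True
          then have "N (\<lambda>k. 1 / (norm (wave k))\<^sup>2) (\<lambda>k. s k r) \<le> 2 * ((W (\<lambda>k. u k r))\<^sup>2 + (W (\<lambda>k. v k r))\<^sup>2) * N (\<lambda>_. 1) (\<lambda>k. w k r)"
            using elim by auto
          from mult_left_mono[OF this, of "ennreal (1 / \<nu>)"] show ?thesis using True by (simp add: h_def mult.assoc)
        qed simp
      qed
    qed
    finally show ?thesis .
  qed
  have "N (\<lambda>_. 1) (\<lambda>k. w k t) = 0"
  proof (rule gronwall_nn[where h=h and \<phi>="\<lambda>t. N (\<lambda>_. 1) (\<lambda>k. w k t)" and S=S and C="2 * Cu + 2 * Cv" and t=t])
    show "(\<lambda>t. N (\<lambda>_. 1) (\<lambda>k. w k t)) \<in> borel_measurable borel" by measurable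
    have "(\<integral>\<^sup>+r. h r * indicator {0..S} r \<partial>lborel) \<le> (\<integral>\<^sup>+r. ennreal (1 / \<nu>) * (2 * ((W (\<lambda>k. u k r))\<^sup>2 * indicator {0..} r + (W (\<lambda>k. v k r))\<^sup>2 * indicator {0..} r)) \<partial>lborel)"
      unfolding h_def by (intro nn_integral_mono) (auto simp: indicator_def)
    also have "\<dots> = ennreal (1 / \<nu>) * (2 * ((\<integral>\<^sup>+r. (W (\<lambda>k. u k r))\<^sup>2 * indicator {0..} r \<partial>lborel) + (\<integral>\<^sup>+r. (W (\<lambda>k. v k r))\<^sup>2 * indicator {0..} r \<partial>lborel)))"
      by (simp add: nn_integral_cmult nn_integral_add)
    also have "\<dots> < \<infinity>" using Wu Wv by (simp add: ennreal_mult_less_top)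
    finally show "(\<integral>\<^sup>+r. h r * indicator {0..S} r \<partial>lborel) < \<infinity>" .
    show "2 * Cu + 2 * Cv < \<infinity>" using Cu Cv by (simp add: ennreal_mult_less_top)
    show "AE t in lborel. t \<in> {0..S} \<longrightarrow> N (\<lambda>_. 1) (\<lambda>k. w k t) \<le> 2 * Cu + 2 * Cv"
      using Cu(2) Cv(2)
    proof eventually_elim
      case (elim t)
      show ?case
      proof
        assume "t \<in> {0..S}"
        then have "2 * N (\<lambda>_. 1) (\<lambda>k. u k t) + 2 * N (\<lambda>_. 1) (\<lambda>k. v k t) \<le> 2 * Cu + 2 * Cv"
          using elim by (intro add_mono mult_left_mono) auto
        then show "N (\<lambda>_. 1) (\<lambda>k. w k t) \<le> 2 * Cu + 2 * Cv"
          unfolding w_def by (rule order_trans[OF N_diff_le, rotated]) simp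
      qed
    qed
  qed (use le t in auto)
  then have "ennreal (1 * (norm (w k t))\<^sup>2) \<le> 0" using N_point[of "\<lambda>_. 1" k "\<lambda>k. w k t"] by simp
  then show ?thesis by (simp add: w_def ennreal_eq_0_iff)
qed

end

subsection \<open>Strong solutions in terms of coefficients\<close>

context navier begin

text \<open>Fields agree almost everywhere exactly if their coefficients do. The finite Wiener norm
  is what makes the coefficients of the advection term available.\<close>

lemma vcoef_equation:
  assumes v: "v \<in> V_space L 2" and W: "W (vcoef v) < \<infinity>" and g: "g \<in> L2_per L" and f: "f \<in> L2_per L"
  shows "(AE x in \<mu>. g x + \<nu> *\<^sub>R stokes L v x + leray_proj L (advection L v v) x = f x)
    \<longleftrightarrow> (\<forall>k. vcoef g k + rate k *\<^sub>R vcoef v k + PB (vcoef v) (vcoef v) k = vcoef f k)"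
proof -
  have vL: "v \<in> L2_per L" using v by (simp add: V_space_iff)
  have v1: "v \<in> sobolev_per L 1"
  proof -
    have i: "integrable modes (\<lambda>k. swt 2 k * (norm (vcoef v k))\<^sup>2)" using v by (simp add: V_space_iff)
    have "swt 1 k \<le> swt 2 k" for k
      unfolding swt_def by (rule sum_mono2) auto
    then have "integrable modes (\<lambda>k. swt 1 k * (norm (vcoef v k))\<^sup>2)"
      by (intro Bochner_Integration.integrable_bound[OF i])
        (auto simp: abs_mult abs_of_nonneg swt_nonneg intro!: mult_right_mono)
    then show ?thesis using vL by (simp add: sobolev_per_iff)
  qed
  note a = advection_coef[OF vL v1 sum_le_W[OF W]]
  note l = leray_proj_coef[OF a(1)]
  have lL: "leray_proj L (advection L v v) \<in> L2_per L" using l(1) by (simp add: V_0_iff)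
  note s = stokes_coef[OF v]
  let ?e = "\<lambda>x. g x + \<nu> *\<^sub>R stokes L v x + leray_proj L (advection L v v) x"
  have e: "?e \<in> L2_per L" by (intro L2_per_add L2_per_scaleR g s lL)
  have c: "vcoef ?e k = vcoef g k + rate k *\<^sub>R vcoef v k + PB (vcoef v) (vcoef v) k" for k
    by (simp add: vcoef_add L2_per_add L2_per_scaleR g s lL vcoef_scaleR l a rate_def PB_def)
  show ?thesis
    using vcoef_cong_AE[OF e f] AE_eq_of_vcoef_eq[OF e f] unfolding c by blast
qed

text \<open>Passes from a class of fields to Borel coefficients that satisfy \<open>good\<close> at
  every time. They vanish outside \<open>I\<close>; for the force this is the extension by 0 to the
  half line.\<close>

lemma L2_time_coefs:
  assumes f: "f \<in> L2_time L 0 I" and I: "I \<in> sets borel"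
  obtains G where "\<And>k. G k \<in> borel_measurable borel" "\<And>k t. t \<notin> I \<Longrightarrow> G k t = 0"
    "AE t in lborel. t \<in> I \<longrightarrow> f t \<in> V_space L 0 \<and> (\<forall>k. vcoef (f t) k = G k t)"
    "(\<integral>\<^sup>+t. N (\<lambda>_. 1) (\<lambda>k. G k t) \<partial>lborel) = ennreal ((1 / vol) * (LINT t|lebesgue_on I. (sobolev_norm L 0 (f t))\<^sup>2))"
    "good G"
proof -
  have bm: "bochner_measurable L 0 I f" and int: "integrable (lebesgue_on I) (\<lambda>t. (sobolev_norm L 0 (f t))\<^sup>2)"
    using f by (auto simp: L2_time_def)
  have V: "AE t in lborel. t \<in> I \<longrightarrow> f t \<in> V_space L 0"
    using bm I by (simp add: bochner_measurable_def AE_lebesgue_on_iff)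
  have "\<exists>g. g \<in> borel_measurable borel \<and> (AE t in lborel. t \<in> I \<longrightarrow> vcoef (f t) k = g t)" for k
    by (rule borel_representative[OF vcoef_measurable_of_bochner[OF bm] I]) (use I in \<open>auto simp: sets_completionI_sets\<close>)
  then have "\<forall>k. \<exists>g. g \<in> borel_measurable borel \<and> (AE t in lborel. t \<in> I \<longrightarrow> vcoef (f t) k = g t)" by blast
  from choice[OF this] obtain g where "\<forall>k. g k \<in> borel_measurable borel \<and> (AE t in lborel. t \<in> I \<longrightarrow> vcoef (f t) k = g k t)" ..
  then have gm [measurable]: "\<And>k. g k \<in> borel_measurable borel"
    and gA: "\<forall>k. AE t in lborel. t \<in> I \<longrightarrow> vcoef (f t) k = g k t"
    by blast+
  have gae: "AE t in lborel. \<forall>k. t \<in> I \<longrightarrow> vcoef (f t) k = g k t"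
    by (rule AE_all_countable[THEN iffD2, OF gA])
  \<comment> \<open>Representatives chosen one mode at a time satisfy the symmetry and divergence
    conditions almost everywhere only. Cutting off to the Borel set where all of them hold makes
    them hold everywhere.\<close>
  define E where "E = {t \<in> space borel. t \<in> I \<and> g 0 t = 0 \<and> (\<forall>k. rdot (wave k) (g k t) = 0) \<and> (\<forall>k. g (- k) t - cnjv (g k t) = 0)}"
  have cm [measurable]: "(\<lambda>t. cnjv (g k t)) \<in> borel_measurable borel" for k
    by (rule measurable_compose[OF gm]) (intro borel_measurable_continuous_onI linear_continuous_on bounded_linear_cnjv)
  have Em [measurable]: "E \<in> sets borel" unfolding E_def using I by measurable
  define G where "G k t = indicator E t *\<^sub>R g k t" for k t
  have Gm: "G k \<in> borel_measurable borel" for k unfolding G_def by measurable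
  have G0: "G k t = 0" if "t \<notin> I" for k t using that by (auto simp: G_def E_def indicator_def)
  have ae: "AE t in lborel. t \<in> I \<longrightarrow> f t \<in> V_space L 0 \<and> (\<forall>k. vcoef (f t) k = G k t)"
    using V gae
  proof eventually_elim
    case (elim t)
    show ?case
    proof
      assume t: "t \<in> I"
      then have "vcoef (f t) = (\<lambda>k. g k t)" "solenoidal (vcoef (f t))" "hermitian (vcoef (f t))"
        using elim hermitian_vcoef by (auto simp: V_0_iff)
      then have "t \<in> E" using t by (auto simp: E_def solenoidal_def hermitian_def)
      then show "f t \<in> V_space L 0 \<and> (\<forall>k. vcoef (f t) k = G k t)" using elim t by (simp add: G_def)
    qed
  qed
  have good: "good G"
    unfolding good_def
  proof (intro conjI allI Gm)
    fix t show "solenoidal (\<lambda>k. G k t)" "hermitian (\<lambda>k. G k t)"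
      by (cases "t \<in> E"; simp add: G_def E_def solenoidal_def hermitian_def)+
  qed
  have "ennreal (LINT t|lebesgue_on I. (sobolev_norm L 0 (f t))\<^sup>2) = (\<integral>\<^sup>+t. ennreal ((sobolev_norm L 0 (f t))\<^sup>2) \<partial>lebesgue_on I)"
    by (rule nn_integral_eq_integral[symmetric]) (use int in auto)
  also have "\<dots> = (\<integral>\<^sup>+t. ennreal ((sobolev_norm L 0 (f t))\<^sup>2) * indicator I t \<partial>lborel)"
    by (rule nn_integral_lebesgue_on_borel[OF I])
  also have "\<dots> = (\<integral>\<^sup>+t. ennreal vol * N (\<lambda>_. 1) (\<lambda>k. G k t) \<partial>lborel)"
  proof (rule nn_integral_cong_AE)
    show "AE t in lborel. ennreal ((sobolev_norm L 0 (f t))\<^sup>2) * indicator I t = ennreal vol * N (\<lambda>_. 1) (\<lambda>k. G k t)"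
      using ae
    proof eventually_elim
      case (elim t)
      show ?case
      proof (cases "t \<in> I")
        case True
        then have V: "f t \<in> V_space L 0" and c: "vcoef (f t) = (\<lambda>k. G k t)" using elim by auto
        have "swt 0 = (\<lambda>_. 1)" by (rule ext) (rule swt_0)
        then show ?thesis using sobolev_norm_nn[OF V_space_sobolev[OF V]] True by (simp add: c)
      qed (simp add: G0 N_def)
    qed
  qed
  also have "\<dots> = ennreal vol * (\<integral>\<^sup>+t. N (\<lambda>_. 1) (\<lambda>k. G k t) \<partial>lborel)"
    using Gm by (intro nn_integral_cmult) measurable
  finally have "ennreal (1 / vol) * ennreal (LINT t|lebesgue_on I. (sobolev_norm L 0 (f t))\<^sup>2) =
      ennreal (1 / vol) * (ennreal vol * (\<integral>\<^sup>+t. N (\<lambda>_. 1) (\<lambda>k. G k t) \<partial>lborel))" by simp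
  also have "\<dots> = (\<integral>\<^sup>+t. N (\<lambda>_. 1) (\<lambda>k. G k t) \<partial>lborel)"
    using vol_pos by (simp add: mult.assoc[symmetric] ennreal_mult[symmetric])
  finally have n: "(\<integral>\<^sup>+t. N (\<lambda>_. 1) (\<lambda>k. G k t) \<partial>lborel) = ennreal ((1 / vol) * (LINT t|lebesgue_on I. (sobolev_norm L 0 (f t))\<^sup>2))"
    using vol_pos by (subst ennreal_mult) auto
  show thesis by (rule that[OF Gm G0 ae n good])
qed

lemma L2t_le_N:
  assumes G: "\<And>k. G k \<in> borel_measurable borel"
  shows "L2t (G k) \<le> (\<integral>\<^sup>+t. N (\<lambda>_. 1) (\<lambda>k. G k t) \<partial>lborel)"
  unfolding L2t_def
proof (rule nn_integral_mono)
  fix t show "ennreal ((norm (G k t))\<^sup>2) * indicator {0..} t \<le> N (\<lambda>_. 1) (\<lambda>k. G k t)"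
    using N_point[of "\<lambda>_. 1" k "\<lambda>k. G k t"] by (auto simp: indicator_def)
qed

text \<open>Testing the weak time derivative with \<open>mode_test k b\<close> for all
  \<open>b\<close> determines the coefficient at \<open>k\<close>. For \<open>k = 0\<close> there is
  no such test field, and the coefficients of fields in \<open>V_space L 0\<close> vanish
  there.\<close>

lemma derivative_coefs:
  assumes d: "has_time_derivative L S v v'" and S: "0 < S"
    and G: "\<And>k. G k \<in> borel_measurable borel" "AE t in lborel. t \<in> {0..S} \<longrightarrow> v' t \<in> V_space L 0 \<and> (\<forall>k. vcoef (v' t) k = G k t)"
    and Gi: "\<And>k. set_integrable lborel {0..S} (G k)"
    and t: "t \<in> {0..S}" and k: "k \<noteq> 0"
  shows "vcoef (v t) k = vcoef (v 0) k + (LINT s|lborel. indicator {0..t} s *\<^sub>R G k s)"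
proof -
  note [measurable] = G(1)
  have t0: "{0..t} \<in> sets borel" by simp
  have i: "integrable lborel (\<lambda>s. indicator {0..t} s *\<^sub>R G k s)"
    using set_integrable_subinterval[OF Gi, of t k] t by (simp add: set_integrable_def)
  have V: "v t \<in> V_space L 0" "v 0 \<in> V_space L 0" using d t S by (auto simp: has_time_derivative_def)
  have "vcoef (v t) k \<bullet> b = (vcoef (v 0) k + (LINT s|lborel. indicator {0..t} s *\<^sub>R G k s)) \<bullet> b" for b
  proof -
    note T1 = mode_test(1)[OF k, of b] and T2 = mode_test(2)[OF k, where b=b]
    have "L2_inner L (v t) (mode_test k b) = L2_inner L (v 0) (mode_test k b) + (LINT s|lebesgue_on {0..t}. L2_inner L (v' s) (mode_test k b))"
      using d t T1 unfolding has_time_derivative_def by blast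
    also have "(LINT s|lebesgue_on {0..t}. L2_inner L (v' s) (mode_test k b)) = (LINT s|lebesgue_on {0..t}. 2 * vol * (G k s \<bullet> b))"
    proof (rule integral_cong_AE)
      have ae: "AE s in lebesgue_on {0..t}. 2 * vol * (G k s \<bullet> b) = L2_inner L (v' s) (mode_test k b)"
        unfolding AE_lebesgue_on_iff[OF t0] using G(2) by eventually_elim (use t T2 in auto)
      show m: "(\<lambda>s. 2 * vol * (G k s \<bullet> b)) \<in> borel_measurable (lebesgue_on {0..t})"
        by (intro borel_lebesgue_on) measurable
      show "(\<lambda>s. L2_inner L (v' s) (mode_test k b)) \<in> borel_measurable (lebesgue_on {0..t})"
        by (rule measurable_cong_AE_lebesgue_on[OF _ m ae]) simp
      show "AE s in lebesgue_on {0..t}. L2_inner L (v' s) (mode_test k b) = 2 * vol * (G k s \<bullet> b)"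
        using ae by eventually_elim simp
    qed
    also have "\<dots> = (LINT s|lborel. indicator {0..t} s *\<^sub>R (2 * vol * (G k s \<bullet> b)))"
      by (rule integral_lebesgue_on_borel) auto
    also have "\<dots> = (LINT s|lborel. (2 * vol) * ((indicator {0..t} s *\<^sub>R G k s) \<bullet> b))"
      by (intro Bochner_Integration.integral_cong) auto
    also have "\<dots> = 2 * vol * ((LINT s|lborel. indicator {0..t} s *\<^sub>R G k s) \<bullet> b)"
      by (simp only: integral_mult_right_zero integral_inner_left[OF i])
    finally have "2 * vol * (vcoef (v t) k \<bullet> b) = 2 * vol * ((vcoef (v 0) k + (LINT s|lborel. indicator {0..t} s *\<^sub>R G k s)) \<bullet> b)"
      by (simp add: T2[OF V(1)] T2[OF V(2)] inner_add_left algebra_simps)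
    then show ?thesis using vol_pos by simp
  qed
  then show ?thesis by (subst vector_eq_rdot[symmetric]) blast
qed

text \<open>Cutting off to 0 outside \<open>{0..S}\<close> places the coefficients in a class on the
  whole half line. Square integrability of the Wiener norm comes from the \<open>V_2\<close>
  regularity, the energy bound from the \<open>V_1\<close> bound, and the mild form from uniqueness
  for the scalar linear equations.\<close>

lemma strong_solution_coefs:
  assumes st: "strong_solution L \<nu> f u0 S v" and S: "0 < S"
    and F: "good F" "\<And>k. set_integrable lborel {0..S} (F k)"
      "AE t in lborel. t \<in> {0..S} \<longrightarrow> f t \<in> V_space L 0 \<and> (\<forall>k. vcoef (f t) k = F k t)"
    and u0: "u0 \<in> V_space L 1"
  defines "c \<equiv> \<lambda>k t. if t \<in> {0..S} then vcoef (v t) k else 0"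
  shows "energy_class c"
    "t \<in> {0..S} \<Longrightarrow> c k t = exp (- rate k * t) *\<^sub>R vcoef u0 k + duh (rate k) (\<lambda>s. F k s - NL c c k s) t"
proof -
  let ?I = "{0..S}"
  have I: "?I \<in> sets borel" by simp
  obtain v' C where v1: "bochner_measurable L 1 ?I v" and C: "AE t in lborel. t \<in> ?I \<longrightarrow> sobolev_norm L 1 (v t) \<le> C"
    and v2: "bochner_measurable L 2 ?I v" and v2i: "integrable (lebesgue_on ?I) (\<lambda>t. (sobolev_norm L 2 (v t))\<^sup>2)"
    and init: "AE x in \<mu>. v 0 x = u0 x"
    and d: "has_time_derivative L S v v'"
    and eq: "AE t in lborel. t \<in> ?I \<longrightarrow> (AE x in \<mu>. v' t x + \<nu> *\<^sub>R stokes L (v t) x + leray_proj L (advection L (v t) (v t)) x = f t x)"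
    using st I by (auto simp: strong_solution_def Linf_time_def L2_time_def AE_lebesgue_on_iff)
  have V1: "AE t in lborel. t \<in> ?I \<longrightarrow> v t \<in> V_space L 1" and V2: "AE t in lborel. t \<in> ?I \<longrightarrow> v t \<in> V_space L 2"
    using v1 v2 I by (auto simp: bochner_measurable_def AE_lebesgue_on_iff)
  have V0: "v t \<in> V_space L 0" if "t \<in> ?I" for t using d that by (auto simp: has_time_derivative_def)
  have "v' \<in> L2_time L 0 ?I" using d by (simp add: has_time_derivative_def)
  then obtain G where G: "\<And>k. G k \<in> borel_measurable borel" "\<And>k t. t \<notin> ?I \<Longrightarrow> G k t = 0"
      "AE t in lborel. t \<in> ?I \<longrightarrow> v' t \<in> V_space L 0 \<and> (\<forall>k. vcoef (v' t) k = G k t)"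
      "(\<integral>\<^sup>+t. N (\<lambda>_. 1) (\<lambda>k. G k t) \<partial>lborel) = ennreal ((1 / vol) * (LINT t|lebesgue_on ?I. (sobolev_norm L 0 (v' t))\<^sup>2))"
      and gG: "good G"
    by (rule L2_time_coefs[OF _ I]) (rule that)
  note [measurable] = G(1) goodD[OF F(1)]
  have Gi: "set_integrable lborel {0..s} (G k)" for k s
    by (rule L2t_set_integrable[OF G(1)], rule le_less_trans[OF L2t_le_N[OF G(1)]]) (simp add: G(4))
  have form: "vcoef (v t) k = vcoef (v 0) k + (LINT s|lborel. indicator {0..t} s *\<^sub>R G k s)" if "t \<in> ?I" "k \<noteq> 0" for t k
    by (rule derivative_coefs[OF d S G(1,3) Gi that])
  \<comment> \<open>Measurability is read off from the integral formula, which holds at every time;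
    Bochner measurability would only give it up to null sets.\<close>
  have cm: "c k \<in> borel_measurable borel" for k
  proof (cases "k = 0")
    case True
    have "vcoef (v t) 0 = 0" if "t \<in> ?I" for t using V0[OF that] by (simp add: V_0_iff solenoidal_def)
    then have "c k = (\<lambda>_. 0)" using True by (auto simp: c_def)
    then show ?thesis by simp
  next
    case False
    have "c k = (\<lambda>t. indicator ?I t *\<^sub>R (vcoef (v 0) k + (LINT s|lborel. indicator {0..t} s *\<^sub>R G k s)))"
    proof (rule ext)
      fix t
      show "c k t = indicator ?I t *\<^sub>R (vcoef (v 0) k + (LINT s|lborel. indicator {0..t} s *\<^sub>R G k s))"
      proof (cases "t \<in> ?I")
        case True
        then show ?thesis unfolding c_def by (subst form[OF True False]) simp
      next
        case out: False
        then show ?thesis unfolding c_def by (simp only: if_False indicator_def of_bool_eq scaleR_zero_left)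
      qed
    qed
    moreover have "(\<lambda>t. indicator ?I t *\<^sub>R (vcoef (v 0) k + (LINT s|lborel. indicator {0..t} s *\<^sub>R G k s))) \<in> borel_measurable lborel"
      unfolding indicator_Icc by measurable
    ultimately show ?thesis by simp
  qed
  have cg: "good c"
    unfolding good_def
  proof (intro conjI allI cm)
    fix t
    have "(\<lambda>k. c k t) = (if t \<in> ?I then vcoef (v t) else (\<lambda>_. 0))" unfolding c_def by (intro ext) (simp only: if_distribR)
    moreover have "solenoidal (\<lambda>_. 0)" "hermitian (\<lambda>_. 0)" by (simp_all add: solenoidal_def hermitian_def cnjv_def vec_eq_iff)
    moreover have "solenoidal (vcoef (v t))" "hermitian (vcoef (v t))" if "t \<in> ?I"
      using V0[OF that] hermitian_vcoef[of "v t"] by (auto simp only: V_0_iff)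
    ultimately show "solenoidal (\<lambda>k. c k t)" "hermitian (\<lambda>k. c k t)"
      by (simp_all only: split: if_split) blast+
  qed
  note [measurable] = cm
  \<comment> \<open>Any fixed parameter would do for a qualitative bound; here Agmon's inequality is
    used with \<theta> = 1.\<close>
  have W2: "(W (vcoef (v t)))\<^sup>2 \<le> ennreal (12 * CA / vol) * ennreal ((sobolev_norm L 2 (v t))\<^sup>2)" if "v t \<in> V_space L 2" for t
  proof -
    have "vcoef (v t) 0 = 0" using that by (simp add: V_space_iff solenoidal_def)
    then have "(W (vcoef (v t)))\<^sup>2 \<le> ennreal CA * N (\<lambda>k. wt 1 k * (norm (wave k))\<^sup>2) (vcoef (v t))"
      by (intro agmon) auto
    also have "\<dots> \<le> ennreal CA * N (\<lambda>k. 12 * swt 2 k) (vcoef (v t))"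
      by (intro mult_left_mono N_mono swt_2_ge) simp
    also have "N (\<lambda>k. 12 * swt 2 k) (vcoef (v t)) = ennreal 12 * N (swt 2) (vcoef (v t))"
      by (rule N_cmult) (auto simp: swt_nonneg)
    also have "N (swt 2) (vcoef (v t)) = ennreal (1 / vol) * (ennreal vol * N (swt 2) (vcoef (v t)))"
      using vol_pos by (simp add: mult.assoc[symmetric] ennreal_mult[symmetric])
    also have "ennreal vol * N (swt 2) (vcoef (v t)) = ennreal ((sobolev_norm L 2 (v t))\<^sup>2)"
      by (rule sobolev_norm_nn[symmetric, OF V_space_sobolev[OF that]])
    also have "ennreal CA * (ennreal 12 * (ennreal (1 / vol) * ennreal ((sobolev_norm L 2 (v t))\<^sup>2))) =
        ennreal (CA * (12 * ((1 / vol) * (sobolev_norm L 2 (v t))\<^sup>2)))"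
      using CA_pos vol_pos by (simp only: ennreal_mult[symmetric] mult_nonneg_nonneg zero_le_power2 zero_le_divide_1_iff less_imp_le zero_le_numeral)
    also have "CA * (12 * ((1 / vol) * (sobolev_norm L 2 (v t))\<^sup>2)) = 12 * CA / vol * (sobolev_norm L 2 (v t))\<^sup>2" by simp
    also have "ennreal \<dots> = ennreal (12 * CA / vol) * ennreal ((sobolev_norm L 2 (v t))\<^sup>2)"
      using CA_pos vol_pos by (intro ennreal_mult) auto
    finally show ?thesis .
  qed
  have Wfin: "(\<integral>\<^sup>+t. (W (\<lambda>k. c k t))\<^sup>2 * indicator {0..} t \<partial>lborel) < \<infinity>"
  proof -
    have "(\<integral>\<^sup>+t. (W (\<lambda>k. c k t))\<^sup>2 * indicator {0..} t \<partial>lborel) \<le>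
        (\<integral>\<^sup>+t. ennreal (12 * CA / vol * (sobolev_norm L 2 (v t))\<^sup>2) * indicator ?I t \<partial>lborel)"
    proof (rule nn_integral_mono_AE)
      show "AE t in lborel. (W (\<lambda>k. c k t))\<^sup>2 * indicator {0..} t \<le> ennreal (12 * CA / vol * (sobolev_norm L 2 (v t))\<^sup>2) * indicator ?I t"
        using V2
      proof eventually_elim
        case (elim t)
        show ?case
        proof (cases "t \<in> ?I")
          case True
          then have "(\<lambda>k. c k t) = vcoef (v t)" by (auto simp: c_def)
          moreover have "ennreal (12 * CA / vol) * ennreal ((sobolev_norm L 2 (v t))\<^sup>2) = ennreal (12 * CA / vol * (sobolev_norm L 2 (v t))\<^sup>2)"
            using CA_pos vol_pos by (intro ennreal_mult[symmetric]) auto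
          moreover have "v t \<in> V_space L 2" using elim True by blast
          ultimately show ?thesis using W2[of t] True by simp
        next
          case False
          then have "(\<lambda>k. c k t) = (\<lambda>k. 0)" by (auto simp: c_def)
          then show ?thesis by (simp add: W_def)
        qed
      qed
    qed
    also have "\<dots> = (\<integral>\<^sup>+t. ennreal (12 * CA / vol * (sobolev_norm L 2 (v t))\<^sup>2) \<partial>lebesgue_on ?I)"
      by (rule nn_integral_lebesgue_on_borel[OF I, symmetric])
    also have "\<dots> < \<infinity>"
      using integrable_mult_right[OF v2i, of "12 * CA / vol"] CA_pos vol_pos by (subst nn_integral_eq_integral) auto
    finally show ?thesis .
  qed
  have Nbd: "AE t in lborel. t \<in> {0..} \<longrightarrow> N (\<lambda>_. 1) (\<lambda>k. c k t) \<le> ennreal (C\<^sup>2 / vol)"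
    using V1 C
  proof eventually_elim
    case (elim t)
    show ?case
    proof (cases "t \<in> ?I")
      case True
      then have ct: "(\<lambda>k. c k t) = vcoef (v t)" by (auto simp: c_def)
      have V: "v t \<in> V_space L 1" and le: "sobolev_norm L 1 (v t) \<le> C" using elim True by auto
      have "ennreal vol * N (\<lambda>_. 1) (vcoef (v t)) \<le> ennreal vol * N (swt 1) (vcoef (v t))"
        by (intro mult_left_mono N_mono swt_ge_1) simp
      also have "\<dots> = ennreal ((sobolev_norm L 1 (v t))\<^sup>2)" by (rule sobolev_norm_nn[symmetric, OF V_space_sobolev[OF V]])
      also have "\<dots> \<le> ennreal (C\<^sup>2)"
        using le by (intro ennreal_leI power_mono) (simp_all add: sobolev_norm_def sum_nonneg)
      finally have "ennreal (1 / vol) * (ennreal vol * N (\<lambda>_. 1) (vcoef (v t))) \<le> ennreal (1 / vol) * ennreal (C\<^sup>2)"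
        by (rule mult_left_mono) simp
      then show ?thesis using vol_pos by (simp add: ct mult.assoc[symmetric] ennreal_mult[symmetric])
    next
      case False
      then have "(\<lambda>k. c k t) = (\<lambda>k. 0)" by (auto simp: c_def)
      then show ?thesis by (simp add: N_def)
    qed
  qed
  show ec: "energy_class c"
    unfolding energy_class_def using cg Wfin Nbd by (auto intro!: exI[of _ "ennreal (C\<^sup>2 / vol)"])
  \<comment> \<open>The equation between fields holds for almost every time; there the Wiener norm
    is finite, so it can be read off mode by mode.\<close>
  have Geq: "AE t in lborel. t \<in> ?I \<longrightarrow> (\<forall>k. G k t = F k t - NL c c k t - rate k *\<^sub>R c k t)"
    using V2 G(3) F(3) eq
  proof eventually_elim
    case (elim t)
    show ?case
    proof (intro impI allI)
      fix k assume t: "t \<in> ?I"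
      then have ct: "(\<lambda>k. c k t) = vcoef (v t)" by (auto simp: c_def)
      have V: "v t \<in> V_space L 2" using elim t by simp
      have "(W (vcoef (v t)))\<^sup>2 < \<infinity>" using W2[OF V] by (rule le_less_trans) (simp add: ennreal_mult_less_top)
      then have "W (vcoef (v t)) < \<infinity>" by (simp add: power_less_top_ennreal)
      then have "vcoef (v' t) k + rate k *\<^sub>R vcoef (v t) k + PB (vcoef (v t)) (vcoef (v t)) k = vcoef (f t) k"
        using vcoef_equation[OF V, of "v' t" "f t"] elim t by (simp add: V_0_iff)
      then have "G k t + rate k *\<^sub>R c k t + NL c c k t = F k t"
        using elim t by (simp add: NL_def ct c_def)
      then show "G k t = F k t - NL c c k t - rate k *\<^sub>R c k t" by (simp add: algebra_simps)
    qed
  qed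
  assume t: "t \<in> ?I"
  show "c k t = exp (- rate k * t) *\<^sub>R vcoef u0 k + duh (rate k) (\<lambda>s. F k s - NL c c k s) t"
  proof (cases "k = 0")
    case True
    have "vcoef u0 0 = 0" using u0 by (simp add: V_space_iff solenoidal_def)
    then show ?thesis using True good_0[OF cg] good_0[OF F(1)] good_0[OF good_NL[OF cg cg]] by (simp add: duh_def)
  next
    case False
    note [measurable] = goodD[OF good_NL[OF cg cg]]
    have v0: "vcoef (v 0) k = vcoef u0 k"
      using V0[of 0] S u0 init by (intro vcoef_cong_AE) (auto simp: V_0_iff V_space_iff)
    have ceq: "c k t = vcoef u0 k + (LINT s|lborel. indicator {0..t} s *\<^sub>R G k s)" if "t \<in> ?I" for t
      using form[OF that False] that by (simp add: c_def v0)
    show ?thesis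
    proof (rule mild_unique[where y="c k" and T=S and B="norm (vcoef u0 k) + (LINT s|lborel. norm (indicator ?I s *\<^sub>R G k s))"])
      show "(\<lambda>s. F k s - NL c c k s) \<in> borel_measurable borel" by measurable
      show "set_integrable lborel {0..S} (\<lambda>s. F k s - NL c c k s)"
        by (intro set_integral_diff F energy_class_NL_integrable[OF ec])
      show "norm (c k t) \<le> norm (vcoef u0 k) + (LINT s|lborel. norm (indicator ?I s *\<^sub>R G k s))" if t: "t \<in> ?I" for t
      proof -
        have "norm (LINT s|lborel. indicator {0..t} s *\<^sub>R G k s) \<le> (LINT s|lborel. norm (indicator {0..t} s *\<^sub>R G k s))"
          by (rule integral_norm_bound)
        also have "\<dots> \<le> (LINT s|lborel. norm (indicator ?I s *\<^sub>R G k s))"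
        proof (rule integral_mono)
          show "integrable lborel (\<lambda>s. norm (indicator {0..t} s *\<^sub>R G k s))"
            by (rule integrable_norm[OF Gi[unfolded set_integrable_def]])
          show "integrable lborel (\<lambda>s. norm (indicator ?I s *\<^sub>R G k s))"
            by (rule integrable_norm[OF Gi[unfolded set_integrable_def]])
        qed (use t in \<open>auto simp: indicator_def\<close>)
        finally show ?thesis unfolding ceq[OF t] using norm_triangle_ineq[of "vcoef u0 k"] by (meson add_left_mono order_trans)
      qed
      show "c k t = vcoef u0 k + (LINT s|lborel. indicator {0..t} s *\<^sub>R (F k s - NL c c k s - rate k *\<^sub>R c k s))" if t: "t \<in> ?I" for t
      proof -
        have "(LINT s|lborel. indicator {0..t} s *\<^sub>R G k s) = (LINT s|lborel. indicator {0..t} s *\<^sub>R (F k s - NL c c k s - rate k *\<^sub>R c k s))"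
        proof (rule integral_cong_AE)
          show "AE s in lborel. indicator {0..t} s *\<^sub>R G k s = indicator {0..t} s *\<^sub>R (F k s - NL c c k s - rate k *\<^sub>R c k s)"
            using Geq by eventually_elim (use t in \<open>auto simp: indicator_def\<close>)
        qed measurable
        then show ?thesis using ceq[OF t] by simp
      qed
    qed (use t cm rate_nonneg in auto)
  qed
qed

end

subsection \<open>Existence\<close>

text \<open>The three parts of \<open>C * ((y + D + 1) * D)\<close> are at most 1, 4 and 2. Their
  sum is 7, and \<open>28 = 4 * 7\<close> absorbs the denominator of the conclusion.\<close>

lemma arctan_margin_small:
  fixes D y e :: real
  assumes e: "0 < e" and D: "0 \<le> D" and y: "0 \<le> y"
    and C: "1 \<le> C" "28 \<le> C * e\<^sup>2" and le: "C * D + arctan y < pi / 2"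
  shows "(y + D + 1) * D \<le> e\<^sup>2 / 4"
proof -
  have "C * (D * y) \<le> 1"
  proof (cases "y = 0")
    case False
    then have y0: "0 < y" using y by simp
    have "arctan (1 / y) = pi / 2 - arctan y" using arctan_inverse[of y] y0 by (simp add: inverse_eq_divide)
    moreover have "arctan (1 / y) \<le> 1 / y" using arctan_le_self[of "1 / y"] y0 by simp
    ultimately have "C * D \<le> 1 / y" using le by simp
    then show ?thesis using y0 by (simp add: field_simps)
  qed simp
  moreover have CD: "C * D \<le> 2"
  proof -
    have "0 \<le> arctan y" using y by simp
    then show ?thesis using le pi_half_less_two by linarith
  qed
  moreover have "C * (D * D) \<le> 4"
  proof -
    have "1 * D \<le> C * D" by (rule mult_right_mono[OF C(1) D])
    then have "D \<le> 2" using CD by linarith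
    then have "(C * D) * D \<le> 2 * 2" using CD D C by (intro mult_mono) auto
    then show ?thesis by (simp add: mult.assoc)
  qed
  ultimately have "C * ((y + D + 1) * D) \<le> 7" by (simp add: algebra_simps)
  also have "\<dots> \<le> C * (e\<^sup>2 / 4)" using C(2) by simp
  finally show ?thesis using C(1) by (subst (asm) mult_le_cancel_left_pos) auto
qed

context navier begin

text \<open>
  \<open>CM * margin\<close> is the size of the free evolution, \<open>1 / (4 * 64 * CK)\<close>, that the Picard iteration
  tolerates; 28 is what \<open>arctan_margin_small\<close> requires.
\<close>

definition CM :: real where "CM = (2 * (1 + 1 / \<nu>) + 2 * CD * (1 / wmin\<^sup>2 + 1)) / vol"

definition margin :: real where "margin = 1 / (256 * CK * CM)"

definition CS :: real where "CS = max 1 (28 / margin\<^sup>2)"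

lemma CM_pos: "0 < CM"
  using \<nu>_pos CD_pos vol_pos wmin_pos by (auto simp: CM_def intro!: divide_pos_pos add_pos_pos mult_pos_pos)

lemma margin_pos: "0 < margin" using CK_pos CM_pos by (simp add: margin_def)

lemma CS: "1 \<le> CS" "28 \<le> CS * margin\<^sup>2"
proof -
  have "28 / margin\<^sup>2 \<le> CS" by (simp add: CS_def)
  then show "28 \<le> CS * margin\<^sup>2" using margin_pos by (simp add: divide_le_eq)
qed (simp add: CS_def)

text \<open>Nonzero wave vectors have length at least \<open>wmin\<close>, a Poincare inequality by
  which the \<open>L^2\<close> norm of the force controls the negative-order part of the
  weight.\<close>

lemma Lz_le:
  assumes F: "good F" and J: "(\<integral>\<^sup>+t. N (\<lambda>_. 1) (\<lambda>k. F k t) \<partial>lborel) \<le> J" and th: "0 < \<theta>"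
  shows "Lz \<theta> F \<le> ennreal (\<theta> / wmin\<^sup>2 + 1 / \<theta>) * J"
proof -
  note [measurable] = goodD[OF F]
  have "wt \<theta> k / (norm (wave k))\<^sup>2 \<le> \<theta> / wmin\<^sup>2 + 1 / \<theta>" for k
  proof (cases "k = 0")
    case False
    have w: "wmin \<le> norm (wave k)" by (rule wave_lower_nonzero[OF False])
    then have "wmin\<^sup>2 \<le> (norm (wave k))\<^sup>2" using wmin_pos by (intro power_mono) auto
    then have "\<theta> / (norm (wave k))\<^sup>2 \<le> \<theta> / wmin\<^sup>2" using wmin_pos th less_le_trans[OF wmin_pos w] by (intro divide_left_mono mult_pos_pos zero_less_power) auto
    then show ?thesis using w wmin_pos by (auto simp: wt_def add_divide_distrib)
  qed (use th in \<open>simp add: wave_def zero_vec_def[symmetric]\<close>)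
  then have "Lz \<theta> F \<le> (\<integral>\<^sup>+k. ennreal (\<theta> / wmin\<^sup>2 + 1 / \<theta>) * (ennreal 1 * L2t (F k)) \<partial>modes)"
    unfolding Lz_def by (intro nn_integral_mono) (auto intro!: mult_right_mono ennreal_leI)
  also have "\<dots> = ennreal (\<theta> / wmin\<^sup>2 + 1 / \<theta>) * (\<integral>\<^sup>+k. ennreal 1 * L2t (F k) \<partial>modes)"
    by (rule nn_integral_cmult) simp
  also have "(\<integral>\<^sup>+k. ennreal 1 * L2t (F k) \<partial>modes) = (\<integral>\<^sup>+t. N (\<lambda>_. 1) (\<lambda>k. F k t) * indicator {0..} t \<partial>lborel)"
    by (rule N_time_integral[symmetric]) (use goodD[OF F] in auto)
  also have "\<dots> \<le> (\<integral>\<^sup>+t. N (\<lambda>_. 1) (\<lambda>k. F k t) \<partial>lborel)"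
    by (intro nn_integral_mono) (auto simp: indicator_def)
  also have "\<dots> \<le> J" by (rule J)
  finally show ?thesis by (simp add: mult_left_mono)
qed

lemma N_wt_le:
  assumes u0: "u0 \<in> V_space L 1" and th: "0 < \<theta>"
  shows "N (wt \<theta>) (vcoef u0) \<le> ennreal ((\<theta> * (L2_norm L u0)\<^sup>2 + (sobolev_norm L 1 u0)\<^sup>2 / \<theta>) / vol)"
proof -
  have u: "u0 \<in> L2_per L" using u0 by (simp add: V_space_iff)
  have inv: "a = ennreal (x / vol)" if "ennreal x = ennreal vol * a" "0 \<le> x" for a x
  proof -
    have "ennreal (1 / vol) * ennreal x = (ennreal (1 / vol) * ennreal vol) * a" by (simp add: that mult.assoc)
    then show ?thesis using vol_pos that(2) by (simp add: ennreal_mult[symmetric])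
  qed
  have "N (wt \<theta>) (vcoef u0) = N (\<lambda>k. \<theta> * 1 + 1 / \<theta> * (norm (wave k))\<^sup>2) (vcoef u0)"
    by (simp add: wt_def[abs_def])
  also have "\<dots> = ennreal \<theta> * N (\<lambda>_. 1) (vcoef u0) + ennreal (1 / \<theta>) * N (\<lambda>k. (norm (wave k))\<^sup>2) (vcoef u0)"
    using th by (intro N_lincomb) auto
  also have "\<dots> \<le> ennreal \<theta> * N (\<lambda>_. 1) (vcoef u0) + ennreal (1 / \<theta>) * N (swt 1) (vcoef u0)"
    by (intro add_left_mono mult_left_mono N_mono swt_1_ge') simp
  also have "N (\<lambda>_. 1) (vcoef u0) = ennreal ((L2_norm L u0)\<^sup>2 / vol)"
    by (rule inv[OF L2_norm_nn[OF u]]) simp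
  also have "N (swt 1) (vcoef u0) = ennreal ((sobolev_norm L 1 u0)\<^sup>2 / vol)"
    by (rule inv[OF sobolev_norm_nn[OF V_space_sobolev[OF u0]]]) simp
  also have "ennreal \<theta> * ennreal ((L2_norm L u0)\<^sup>2 / vol) + ennreal (1 / \<theta>) * ennreal ((sobolev_norm L 1 u0)\<^sup>2 / vol) =
      ennreal (\<theta> * ((L2_norm L u0)\<^sup>2 / vol) + 1 / \<theta> * ((sobolev_norm L 1 u0)\<^sup>2 / vol))"
    using th vol_pos by (simp add: ennreal_mult[symmetric] ennreal_plus[symmetric] del: ennreal_plus)
  also have "\<theta> * ((L2_norm L u0)\<^sup>2 / vol) + 1 / \<theta> * ((sobolev_norm L 1 u0)\<^sup>2 / vol) = (\<theta> * (L2_norm L u0)\<^sup>2 + (sobolev_norm L 1 u0)\<^sup>2 / \<theta>) / vol"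
    by (simp add: add_divide_distrib)
  finally show ?thesis .
qed

theorem small_data_mild_solution:
  assumes u0: "u0 \<in> V_space L 1" and F: "good F"
    and J: "(\<integral>\<^sup>+t. N (\<lambda>_. 1) (\<lambda>k. F k t) \<partial>lborel) \<le> ennreal (J / vol)" "0 \<le> J"
    and small: "CS * ((L2_norm L u0)\<^sup>2 + J) + arctan ((sobolev_norm L 1 u0)\<^sup>2) < pi / 2"
  obtains u \<theta> where "0 < \<theta>" "good u" "Z \<theta> u < \<infinity>"
    "\<And>k t. 0 \<le> t \<Longrightarrow> u k t = exp (- rate k * t) *\<^sub>R vcoef u0 k + duh (rate k) (\<lambda>s. F k s - NL u u k s) t"
proof -
  define D where "D = (L2_norm L u0)\<^sup>2 + J"
  define y where "y = (sobolev_norm L 1 u0)\<^sup>2"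
  \<comment> \<open>Balances the two parts of the data: \<open>(y + D + 1) / \<theta>\<close> equals
    \<open>margin / 2\<close>, and \<open>arctan_margin_small\<close> says that
    \<open>\<theta> * D\<close> is at most \<open>margin / 2\<close> as well. The summand 1 keeps
    \<theta> positive for zero data.\<close>
  define \<theta> where "\<theta> = 2 * (y + D + 1) / margin"
  have D0: "0 \<le> D" and y0: "0 \<le> y" using J by (auto simp: D_def y_def)
  have th: "0 < \<theta>" using D0 y0 margin_pos by (simp add: \<theta>_def)
  have sm: "(y + D + 1) * D \<le> margin\<^sup>2 / 4"
    by (rule arctan_margin_small[OF margin_pos D0 y0 CS]) (use small in \<open>simp add: D_def y_def\<close>)
  have "\<theta> * D = 2 * ((y + D + 1) * D) / margin" by (simp add: \<theta>_def)
  also have "\<dots> \<le> margin / 2" using sm margin_pos by (simp add: divide_le_eq power2_eq_square)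
  finally have t1: "\<theta> * D \<le> margin / 2" .
  have t2: "(y + D + 1) / \<theta> = margin / 2" using D0 y0 margin_pos by (simp add: \<theta>_def field_simps)
  define x1 where "x1 k t = exp (- rate k * t) *\<^sub>R vcoef u0 k" for k t
  define x2 where "x2 k = duh (rate k) (F k)" for k
  have s0: "solenoidal (vcoef u0)" using u0 by (simp add: V_space_iff)
  have h0: "hermitian (vcoef u0)" by (rule hermitian_vcoef)
  have g1: "good x1" unfolding x1_def by (rule good_exp[OF s0 h0])
  have g2: "good x2" unfolding x2_def by (rule good_duh[OF F])
  have gx: "good (\<lambda>k t. x1 k t + x2 k t)" by (rule good_add[OF g1 g2])
  have "Z \<theta> (\<lambda>k t. x1 k t + x2 k t) \<le> 2 * Z \<theta> x1 + 2 * Z \<theta> x2"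
    by (rule Z_add_le) (use goodD[OF g1] goodD[OF g2] in auto)
  also have "\<dots> \<le> 2 * (ennreal (1 + 1 / \<nu>) * ennreal ((\<theta> * (L2_norm L u0)\<^sup>2 + y / \<theta>) / vol))
      + 2 * (ennreal CD * (ennreal (\<theta> / wmin\<^sup>2 + 1 / \<theta>) * ennreal (J / vol)))"
  proof (intro add_mono mult_left_mono)
    have "Z \<theta> x1 \<le> ennreal (1 + 1 / \<nu>) * N (wt \<theta>) (vcoef u0)"
      unfolding x1_def by (rule Z_exp_le[OF th])
    also have "\<dots> \<le> ennreal (1 + 1 / \<nu>) * ennreal ((\<theta> * (L2_norm L u0)\<^sup>2 + y / \<theta>) / vol)"
      unfolding y_def by (intro mult_left_mono N_wt_le[OF u0 th]) simp
    finally show "Z \<theta> x1 \<le> ennreal (1 + 1 / \<nu>) * ennreal ((\<theta> * (L2_norm L u0)\<^sup>2 + y / \<theta>) / vol)" .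
    have "Z \<theta> x2 \<le> ennreal CD * Lz \<theta> F"
      unfolding x2_def by (rule Z_duh_le[where g=F, OF goodD[OF F] good_0[OF F] th])
    also have "\<dots> \<le> ennreal CD * (ennreal (\<theta> / wmin\<^sup>2 + 1 / \<theta>) * ennreal (J / vol))"
      by (intro mult_left_mono Lz_le[OF F J(1) th]) simp
    finally show "Z \<theta> x2 \<le> ennreal CD * (ennreal (\<theta> / wmin\<^sup>2 + 1 / \<theta>) * ennreal (J / vol))" .
  qed simp_all
  also have "\<dots> = ennreal (2 * ((1 + 1 / \<nu>) * ((\<theta> * (L2_norm L u0)\<^sup>2 + y / \<theta>) / vol))
      + 2 * (CD * ((\<theta> / wmin\<^sup>2 + 1 / \<theta>) * (J / vol))))"
  proof -
    have a: "0 \<le> (1 + 1 / \<nu>)" "0 \<le> (\<theta> * (L2_norm L u0)\<^sup>2 + y / \<theta>) / vol" "0 \<le> CD" "0 \<le> \<theta> / wmin\<^sup>2 + 1 / \<theta>" "0 \<le> J / vol"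
      using \<nu>_pos th y0 vol_pos CD_pos J by auto
    have n: "2 = ennreal 2" by simp
    show ?thesis unfolding n
      by (simp only: ennreal_mult[symmetric] ennreal_plus[symmetric] a mult_nonneg_nonneg zero_le_numeral)
  qed
  also have "\<dots> \<le> ennreal (CM * margin)"
  proof (rule ennreal_leI)
    \<comment> \<open>One quantity that dominates the contributions of the initial value and of the
      force; \<open>CM\<close> collects the constants in front of it.\<close>
    let ?S = "\<theta> * D + (y + D + 1) / \<theta>"
    have s: "0 \<le> \<theta> * D" "0 \<le> (y + D + 1) / \<theta>" using th D0 y0 by auto
    have "\<theta> * (L2_norm L u0)\<^sup>2 + y / \<theta> \<le> ?S"
      using th J D0 by (intro add_mono mult_left_mono divide_right_mono) (auto simp: D_def)
    then have 1: "(1 + 1 / \<nu>) * ((\<theta> * (L2_norm L u0)\<^sup>2 + y / \<theta>) / vol) \<le> (1 + 1 / \<nu>) * (?S / vol)"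
      using \<nu>_pos vol_pos by (intro mult_left_mono divide_right_mono) auto
    have "(\<theta> / wmin\<^sup>2 + 1 / \<theta>) * J = 1 / wmin\<^sup>2 * (\<theta> * J) + 1 * (J / \<theta>)" by (simp add: algebra_simps)
    also have "\<dots> \<le> 1 / wmin\<^sup>2 * ?S + 1 * ?S"
    proof (intro add_mono mult_left_mono)
      have "\<theta> * J \<le> \<theta> * D" using th by (simp add: D_def)
      then show "\<theta> * J \<le> ?S" using s by linarith
      have "J / \<theta> \<le> (y + D + 1) / \<theta>" using th y0 by (intro divide_right_mono) (auto simp: D_def)
      then show "J / \<theta> \<le> ?S" using s by linarith
    qed simp_all
    also have "\<dots> = (1 / wmin\<^sup>2 + 1) * ?S" by (simp only: distrib_right)
    finally have "(\<theta> / wmin\<^sup>2 + 1 / \<theta>) * J / vol \<le> (1 / wmin\<^sup>2 + 1) * ?S / vol"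
      using vol_pos by (intro divide_right_mono) auto
    then have 2: "CD * ((\<theta> / wmin\<^sup>2 + 1 / \<theta>) * (J / vol)) \<le> CD * ((1 / wmin\<^sup>2 + 1) * (?S / vol))"
      using CD_pos by (intro mult_left_mono) auto
    have "2 * ((1 + 1 / \<nu>) * ((\<theta> * (L2_norm L u0)\<^sup>2 + y / \<theta>) / vol))
      + 2 * (CD * ((\<theta> / wmin\<^sup>2 + 1 / \<theta>) * (J / vol))) \<le> 2 * ((1 + 1 / \<nu>) * (?S / vol)) + 2 * (CD * ((1 / wmin\<^sup>2 + 1) * (?S / vol)))"
      using 1 2 by linarith
    also have "\<dots> = CM * ?S" unfolding CM_def by (simp add: add_divide_distrib algebra_simps)
    also have "\<dots> \<le> CM * margin"
    proof (rule mult_left_mono)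
      show "?S \<le> margin" using t1 unfolding t2 by linarith
    qed (use CM_pos in simp)
    finally show "2 * ((1 + 1 / \<nu>) * ((\<theta> * (L2_norm L u0)\<^sup>2 + y / \<theta>) / vol))
      + 2 * (CD * ((\<theta> / wmin\<^sup>2 + 1 / \<theta>) * (J / vol))) \<le> CM * margin" .
  qed
  \<comment> \<open>This is \<open>R / 4\<close> for the radius \<open>R = 1 / (64 * CK)\<close>,
    the largest one that \<open>picard\<close> admits.\<close>
  also have "CM * margin = (1 / (64 * CK)) / 4" using CM_pos by (simp add: margin_def)
  finally have Zx: "Z \<theta> (\<lambda>k t. x1 k t + x2 k t) \<le> ennreal ((1 / (64 * CK)) / 4)" .
  obtain u where u: "good u" "Z \<theta> u \<le> ennreal (8 * (1 / (64 * CK)))"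
    "\<And>k t. 0 \<le> t \<Longrightarrow> u k t = x1 k t + x2 k t - duh (rate k) (NL u u k) t"
    by (rule picard[OF gx Zx _ _ th]) (use CK_pos in \<open>auto intro: that\<close>)
  have Zu: "Z \<theta> u < \<infinity>" using u(2) by (rule le_less_trans) simp
  show thesis
  proof (rule that[OF th u(1) Zu])
    fix k and t :: real assume t: "0 \<le> t"
    have "L2t (F k) < \<infinity>"
      by (rule le_less_trans[OF L2t_le_N[OF goodD[OF F]]], rule le_less_trans[OF J(1)]) simp
    then have Fi: "set_integrable lborel {0..t} (F k)" by (rule L2t_set_integrable[OF goodD[OF F]])
    show "u k t = exp (- rate k * t) *\<^sub>R vcoef u0 k + duh (rate k) (\<lambda>s. F k s - NL u u k s) t"
      unfolding duh_diff[OF Fi NL_set_integrable[OF u(1) u(1) th Zu Zu] rate_nonneg] u(3)[OF t]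
      by (simp add: x1_def x2_def)
  qed
qed

end

context torus begin

section \<open>From families of coefficients back to time-dependent fields\<close>

lemma swt_le: "swt m k \<le> real (card {\<beta>. mi_order \<beta> \<le> m}) * (1 + (norm (wave k))\<^sup>2) ^ m"
proof -
  have "(cmod (dfac \<beta> k))\<^sup>2 \<le> (1 + (norm (wave k))\<^sup>2) ^ m" if "mi_order \<beta> \<le> m" for \<beta>
  proof -
    have "(cmod (dfac \<beta> k))\<^sup>2 = (\<Prod>i\<in>UNIV. ((wave k $ i)\<^sup>2) ^ (\<beta> $ i))"
    proof -
      have "cmod (dfac \<beta> k) = (\<Prod>i\<in>UNIV. \<bar>wave k $ i\<bar> ^ (\<beta> $ i))"
        by (simp add: dfac_def prod_norm[symmetric] norm_power norm_mult)
      moreover have "(\<bar>x\<bar> ^ n)\<^sup>2 = (x\<^sup>2) ^ n" for x :: real and n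
        by (metis mult.commute power2_abs power_mult)
      ultimately show ?thesis by (simp add: prod_power_distrib)
    qed
    also have "\<dots> \<le> (\<Prod>i\<in>UNIV. (1 + (norm (wave k))\<^sup>2) ^ (\<beta> $ i))"
    proof (intro prod_mono conjI power_mono)
      fix i
      have "\<bar>wave k $ i\<bar> \<le> norm (wave k)" by (rule component_le_norm_cart)
      then have "(wave k $ i)\<^sup>2 \<le> (norm (wave k))\<^sup>2" by (metis abs_ge_zero power2_abs power_mono)
      then show "(wave k $ i)\<^sup>2 \<le> 1 + (norm (wave k))\<^sup>2" by simp
    qed auto
    also have "\<dots> = (1 + (norm (wave k))\<^sup>2) ^ mi_order \<beta>" by (simp add: mi_order_def power_sum)
    also have "\<dots> \<le> (1 + (norm (wave k))\<^sup>2) ^ m" by (rule power_increasing[OF that]) simp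
    finally show ?thesis .
  qed
  then show ?thesis unfolding swt_def by (intro sum_bounded_above) auto
qed

lemma wt_ge: "0 < \<theta> \<Longrightarrow> 1 + (norm (wave k))\<^sup>2 \<le> (1 / \<theta> + \<theta>) * wt \<theta> k"
proof -
  assume th: "0 < \<theta>"
  then have "(1 / \<theta> + \<theta>) * wt \<theta> k = 1 + (norm (wave k))\<^sup>2 + (\<theta>\<^sup>2 + (norm (wave k))\<^sup>2 / \<theta>\<^sup>2)"
    by (simp add: wt_def field_simps power2_eq_square)
  then show ?thesis by simp
qed

lemma swt_1_le_wt:
  assumes th: "0 < \<theta>"
  obtains A where "0 \<le> A" "\<And>k. swt 1 k \<le> A * wt \<theta> k"
proof
  let ?n = "real (card {\<beta>. mi_order \<beta> \<le> 1})"
  show "0 \<le> ?n * (1 / \<theta> + \<theta>)" using th by simp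
  fix k
  have "1 + (norm (wave k))\<^sup>2 \<le> (1 / \<theta> + \<theta>) * wt \<theta> k" by (rule wt_ge[OF th])
  then show "swt 1 k \<le> ?n * (1 / \<theta> + \<theta>) * wt \<theta> k"
    using swt_le[of 1 k] mult_left_mono[of "1 + (norm (wave k))\<^sup>2" "(1 / \<theta> + \<theta>) * wt \<theta> k" ?n]
    by (simp add: mult.assoc)
qed

lemma swt_2_le_wt:
  assumes th: "0 < \<theta>"
  obtains A where "0 \<le> A" "\<And>k. k \<noteq> 0 \<Longrightarrow> swt 2 k \<le> A * (wt \<theta> k * (norm (wave k))\<^sup>2)"
proof
  let ?n = "real (card {\<beta>. mi_order \<beta> \<le> 2})" and ?a = "1 / \<theta> + \<theta>" and ?b = "1 / wmin\<^sup>2 + 1"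
  show "0 \<le> ?n * (?a * ?b)" using th by simp
  fix k :: "int^3" assume k: "k \<noteq> 0"
  let ?q = "(norm (wave k))\<^sup>2"
  have 1: "1 + ?q \<le> ?a * wt \<theta> k" by (rule wt_ge[OF th])
  have "wmin\<^sup>2 \<le> ?q" using wave_lower_nonzero[OF k] wmin_pos by (intro power_mono) auto
  then have "1 \<le> ?q / wmin\<^sup>2" using wmin_pos by (simp add: le_divide_eq)
  then have 2: "1 + ?q \<le> ?b * ?q" by (simp add: distrib_right)
  have "(1 + ?q)\<^sup>2 \<le> (?a * wt \<theta> k) * (?b * ?q)"
    unfolding power2_eq_square[of "1 + ?q"] using th by (intro mult_mono 1 2) (auto simp: wt_def)
  then have "?n * (1 + ?q)\<^sup>2 \<le> ?n * ((?a * wt \<theta> k) * (?b * ?q))" by (rule mult_left_mono) simp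
  also have "\<dots> = ?n * (?a * ?b) * (wt \<theta> k * ?q)" by (simp only: mult_ac)
  finally show "swt 2 k \<le> ?n * (?a * ?b) * (wt \<theta> k * ?q)" using swt_le[of 2 k] by linarith
qed

text \<open>The fields are chosen independently at each time; measurability in time is supplied
  afterwards through the coefficients.\<close>

lemma fields_of_coefficients:
  assumes "\<And>t. t \<in> A \<Longrightarrow> N (\<lambda>_. 1) (\<lambda>k. c k t) < \<infinity>" "\<And>t. hermitian (\<lambda>k. c k t)"
  obtains U where "\<And>t. t \<in> A \<Longrightarrow> U t \<in> L2_per L" "\<And>t k. t \<in> A \<Longrightarrow> vcoef (U t) k = c k t"
proof -
  have "\<exists>u. t \<in> A \<longrightarrow> u \<in> L2_per L \<and> (\<forall>k. vcoef u k = c k t)" for t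
  proof (cases "t \<in> A")
    case True
    have "integrable modes (\<lambda>k. (norm (c k t))\<^sup>2)" using N_finite_integrable[OF assms(1)[OF True]] by simp
    then obtain u where "u \<in> L2_per L" "\<And>k. vcoef u k = c k t"
      by (rule field_of_coefficients[OF _ assms(2)]) (rule that)
    then show ?thesis by blast
  qed simp
  then have "\<forall>t. \<exists>u. t \<in> A \<longrightarrow> u \<in> L2_per L \<and> (\<forall>k. vcoef u k = c k t)" by blast
  from choice[OF this] obtain U where "\<forall>t. t \<in> A \<longrightarrow> U t \<in> L2_per L \<and> (\<forall>k. vcoef (U t) k = c k t)" ..
  then show thesis by (intro that[of U]) auto
qed

lemma coefs_measurable:
  fixes I :: "real set"
  assumes I: "I \<in> sets borel" and c: "c k \<in> borel_measurable borel"
    and ae: "AE t in lborel. t \<in> I \<longrightarrow> vcoef (U t) k = c k t"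
  shows "(\<lambda>t. vcoef (U t) k) \<in> borel_measurable (lebesgue_on I)"
proof (rule measurable_cong_AE_lebesgue_on[OF _ borel_lebesgue_on[OF c]])
  show "I \<in> sets lebesgue" using I by (simp add: sets_completionI_sets)
  show "AE t in lebesgue_on I. c k t = vcoef (U t) k"
    unfolding AE_lebesgue_on_iff[OF I] using ae by eventually_elim simp
qed

lemma L2_time_of_coefs:
  assumes I: "I \<in> sets borel" and c: "\<And>k. c k \<in> borel_measurable borel"
    and ae: "AE t in lborel. t \<in> I \<longrightarrow> U t \<in> V_space L m \<and> (\<forall>k. vcoef (U t) k = c k t)"
    and fin: "(\<integral>\<^sup>+t. N (swt m) (\<lambda>k. c k t) * indicator I t \<partial>lborel) < \<infinity>"
  shows "U \<in> L2_time L m I"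
proof -
  note [measurable] = c I
  let ?h = "\<lambda>t. N (swt m) (\<lambda>k. c k t)"
  have hm: "?h \<in> borel_measurable borel" by measurable
  have Vae: "AE t in lebesgue_on I. U t \<in> V_space L m"
    unfolding AE_lebesgue_on_iff[OF I] using ae by eventually_elim simp
  have b: "bochner_measurable L m I U"
    by (rule bochner_measurable_of_vcoef[OF Vae coefs_measurable[where c=c, OF I c]]) (use ae in eventually_elim, simp)
  have eq: "AE t in lebesgue_on I. ennreal ((sobolev_norm L m (U t))\<^sup>2) = ennreal vol * ?h t"
    unfolding AE_lebesgue_on_iff[OF I] using ae
  proof eventually_elim
    case (elim t)
    show ?case
    proof
      assume "t \<in> I"
      then have "vcoef (U t) = (\<lambda>k. c k t)" "U t \<in> V_space L m" using elim by auto
      then show "ennreal ((sobolev_norm L m (U t))\<^sup>2) = ennreal vol * ?h t"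
        using sobolev_norm_nn[OF V_space_sobolev, of "U t" m] by simp
    qed
  qed
  have "integrable (lebesgue_on I) (\<lambda>t. (sobolev_norm L m (U t))\<^sup>2)"
  proof (rule integrableI_nonneg)
    show "(\<lambda>t. (sobolev_norm L m (U t))\<^sup>2) \<in> borel_measurable (lebesgue_on I)"
    proof (rule measurable_cong_AE_lebesgue_on)
      show "I \<in> sets lebesgue" using I by (simp add: sets_completionI_sets)
      show "(\<lambda>t. enn2real (ennreal vol * ?h t)) \<in> borel_measurable (lebesgue_on I)"
        by (rule borel_lebesgue_on) measurable
      show "AE t in lebesgue_on I. enn2real (ennreal vol * ?h t) = (sobolev_norm L m (U t))\<^sup>2"
        using eq by eventually_elim (metis enn2real_ennreal zero_le_power2)
    qed
    have "(\<integral>\<^sup>+t. ennreal ((sobolev_norm L m (U t))\<^sup>2) \<partial>lebesgue_on I) = (\<integral>\<^sup>+t. ennreal vol * ?h t \<partial>lebesgue_on I)"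
      by (rule nn_integral_cong_AE[OF eq])
    also have "\<dots> = (\<integral>\<^sup>+t. ennreal vol * (?h t * indicator I t) \<partial>lborel)"
      by (simp only: nn_integral_lebesgue_on_borel[OF I] mult.assoc)
    also have "\<dots> = ennreal vol * (\<integral>\<^sup>+t. ?h t * indicator I t \<partial>lborel)"
      using I by (intro nn_integral_cmult) measurable
    also have "\<dots> < \<infinity>" using fin by (simp add: ennreal_mult_less_top)
    finally show "(\<integral>\<^sup>+t. ennreal ((sobolev_norm L m (U t))\<^sup>2) \<partial>lebesgue_on I) < \<infinity>" .
  qed simp
  then show ?thesis using b by (simp add: L2_time_def)
qed

text \<open>Interchanges time and modes, which turns the integral equations for the coefficients
  into the tested form of \<open>has_time_derivative\<close>. Absolute convergence follows by
  bounding each product by the sum of the two squares.\<close>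

lemma time_integral_inner:
  fixes t :: real
  assumes g: "\<And>k. g k \<in> borel_measurable borel" and a: "N (\<lambda>_. 1) a < \<infinity>"
    and fin: "(\<integral>\<^sup>+s. N (\<lambda>_. 1) (\<lambda>k. g k s) * indicator {0..t} s \<partial>lborel) < \<infinity>"
    and gi: "\<And>k. set_integrable lborel {0..t} (g k)"
  shows "(LINT s|lborel. indicator {0..t} s *\<^sub>R (LINT k|modes. g k s \<bullet> a k)) =
    (LINT k|modes. (LINT s|lborel. indicator {0..t} s *\<^sub>R g k s) \<bullet> a k)"
proof -
  note [measurable] = g
  interpret P: pair_sigma_finite modes lborel
    by (intro pair_sigma_finite.intro sigma_finite_measure_count_space_countable lborel.sigma_finite_measure_axioms) simp
  let ?f = "\<lambda>k s. indicator {0..t} s * (g k s \<bullet> a k)"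
  have fm: "case_prod ?f \<in> borel_measurable (modes \<Otimes>\<^sub>M lborel)"
    by (rule measurable_pair_measure_countable1) (auto intro!: borel_measurable_times)
  have "integrable (modes \<Otimes>\<^sub>M lborel) (case_prod ?f)"
  proof (rule integrableI_bounded[OF fm])
    have "(\<integral>\<^sup>+x. ennreal (norm (case_prod ?f x)) \<partial>(modes \<Otimes>\<^sub>M lborel)) = (\<integral>\<^sup>+k. \<integral>\<^sup>+s. ennreal (norm (?f k s)) \<partial>lborel \<partial>modes)"
      by (subst lborel.nn_integral_fst[symmetric]) (use fm in \<open>auto intro!: measurable_compose[OF measurable_compose[OF fm borel_measurable_norm] measurable_ennreal]\<close>)
    also have "\<dots> = (\<integral>\<^sup>+s. \<integral>\<^sup>+k. ennreal (norm (?f k s)) \<partial>modes \<partial>lborel)"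
      by (rule nn_integral_count_space_nn_integral[symmetric]) auto
    also have "\<dots> \<le> (\<integral>\<^sup>+s. (N (\<lambda>_. 1) (\<lambda>k. g k s) * indicator {0..t} s + N (\<lambda>_. 1) a * indicator {0..t} s) \<partial>lborel)"
    proof (rule nn_integral_mono)
      fix s
      have "(\<integral>\<^sup>+k. ennreal (norm (?f k s)) \<partial>modes) \<le> (\<integral>\<^sup>+k. (ennreal (1 * (norm (g k s))\<^sup>2) + ennreal (1 * (norm (a k))\<^sup>2)) * indicator {0..t} s \<partial>modes)"
      proof (rule nn_integral_mono)
        fix k
        have "\<bar>g k s \<bullet> a k\<bar> \<le> norm (g k s) * norm (a k)" by (rule Cauchy_Schwarz_ineq2)
        also have "\<dots> \<le> (norm (g k s))\<^sup>2 + (norm (a k))\<^sup>2"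
          using sum_squares_bound[of "norm (g k s)" "norm (a k)"] mult_nonneg_nonneg[OF norm_ge_zero[of "g k s"] norm_ge_zero[of "a k"]] by linarith
        finally show "ennreal (norm (?f k s)) \<le> (ennreal (1 * (norm (g k s))\<^sup>2) + ennreal (1 * (norm (a k))\<^sup>2)) * indicator {0..t} s"
          by (auto simp: indicator_def ennreal_plus[symmetric] ennreal_leI simp del: ennreal_plus)
      qed
      also have "\<dots> = (N (\<lambda>_. 1) (\<lambda>k. g k s) + N (\<lambda>_. 1) a) * indicator {0..t} s"
        unfolding N_def by (simp add: nn_integral_multc nn_integral_add)
      finally show "(\<integral>\<^sup>+k. ennreal (norm (?f k s)) \<partial>modes) \<le> N (\<lambda>_. 1) (\<lambda>k. g k s) * indicator {0..t} s + N (\<lambda>_. 1) a * indicator {0..t} s"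
        by (simp add: distrib_right)
    qed
    also have "\<dots> = (\<integral>\<^sup>+s. N (\<lambda>_. 1) (\<lambda>k. g k s) * indicator {0..t} s \<partial>lborel) + N (\<lambda>_. 1) a * emeasure lborel {0..t}"
      by (subst nn_integral_add) (auto simp: nn_integral_cmult)
    also have "\<dots> < \<infinity>" using fin a by (auto simp: ennreal_mult_less_top emeasure_lborel_Icc_eq)
    finally show "(\<integral>\<^sup>+x. ennreal (norm (case_prod ?f x)) \<partial>(modes \<Otimes>\<^sub>M lborel)) < \<infinity>" .
  qed
  from P.Fubini_integral[OF this]
  have "(LINT s|lborel. (LINT k|modes. ?f k s)) = (LINT k|modes. (LINT s|lborel. ?f k s))" .
  moreover have "(LINT s|lborel. ?f k s) = (LINT s|lborel. indicator {0..t} s *\<^sub>R g k s) \<bullet> a k" for k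
    using integral_inner_left[OF gi[unfolded set_integrable_def], of k "a k"] by simp
  moreover have "(LINT k|modes. ?f k s) = indicator {0..t} s *\<^sub>R (LINT k|modes. g k s \<bullet> a k)" for s by simp
  ultimately show ?thesis by simp
qed

end

context navier begin

lemma duh_0: "duh c h 0 = 0"
proof -
  have "AE s in lborel. s \<noteq> (0::real)" by (rule AE_lborel_singleton)
  then have "AE s in lborel. (indicator {0..0} s * exp (- c * (0 - s))) *\<^sub>R h s = 0"
    by eventually_elim (simp add: indicator_def)
  then show ?thesis unfolding duh_def by (rule integral_eq_zero_AE)
qed

text \<open>The time derivative of a strong solution has to be square integrable with values in
  \<open>L^2\<close>. The nonlinear term is bounded in gradient form, where
  \<open>\<theta> * wt \<theta>\<close> dominates the squared wave number; the Stokes term is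
  bounded by the dissipation part of \<open>Z\<close>.\<close>

lemma derivative_coefs_square_integrable:
  assumes u: "good u" "Z \<theta> u < \<infinity>" and th: "0 < \<theta>" and F: "good F"
    and Ffin: "(\<integral>\<^sup>+t. N (\<lambda>_. 1) (\<lambda>k. F k t) \<partial>lborel) < \<infinity>"
  shows "(\<integral>\<^sup>+t. N (\<lambda>_. 1) (\<lambda>k. F k t - NL u u k t - rate k *\<^sub>R u k t) * indicator {0..} t \<partial>lborel) < \<infinity>"
proof -
  note [measurable] = goodD[OF u(1)] goodD[OF F] goodD[OF good_NL[OF u(1) u(1)]]
  let ?a = "\<lambda>t. N (\<lambda>_. 1) (\<lambda>k. F k t)" and ?b = "\<lambda>t. N (\<lambda>_. 1) (\<lambda>k. NL u u k t)" and ?c = "\<lambda>t. N (\<lambda>_. 1) (\<lambda>k. rate k *\<^sub>R u k t)"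
  have Z2: "Z2 \<theta> u < \<infinity>" and Z1: "Z1 \<theta> u < \<infinity>" using u(2) by (auto simp: Z_def)
  have "?b t * indicator {0..} t \<le> (ennreal \<theta> * Z1 \<theta> u) * ((W (\<lambda>k. u k t))\<^sup>2 * indicator {0..} t)" for t
  proof (cases "t \<in> {0..}")
    case True
    have "N (\<lambda>k. (norm (wave k))\<^sup>2) (\<lambda>k. u k t) \<le> N (\<lambda>k. \<theta> * wt \<theta> k) (\<lambda>k. u k t)"
      using th by (intro N_mono) (simp add: wt_def distrib_left)
    also have "\<dots> = ennreal \<theta> * N (wt \<theta>) (\<lambda>k. u k t)"
      using th by (intro N_cmult) (auto intro: less_imp_le wt_pos)
    also have "\<dots> \<le> ennreal \<theta> * Z1 \<theta> u" using True th by (intro mult_left_mono N_le_Z1) auto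
    finally have "(W (\<lambda>k. u k t))\<^sup>2 * N (\<lambda>k. (norm (wave k))\<^sup>2) (\<lambda>k. u k t) \<le> (W (\<lambda>k. u k t))\<^sup>2 * (ennreal \<theta> * Z1 \<theta> u)"
      by (rule mult_left_mono) simp
    with gradient_bilinear[of "\<lambda>k. u k t" "\<lambda>k. u k t"] have "?b t \<le> (W (\<lambda>k. u k t))\<^sup>2 * (ennreal \<theta> * Z1 \<theta> u)"
      unfolding NL_def by (rule order_trans)
    then show ?thesis using True by (simp add: mult.commute)
  qed simp
  then have "(\<integral>\<^sup>+t. ?b t * indicator {0..} t \<partial>lborel) \<le> (\<integral>\<^sup>+t. (ennreal \<theta> * Z1 \<theta> u) * ((W (\<lambda>k. u k t))\<^sup>2 * indicator {0..} t) \<partial>lborel)"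
    by (intro nn_integral_mono)
  also have "\<dots> = (ennreal \<theta> * Z1 \<theta> u) * (\<integral>\<^sup>+t. (W (\<lambda>k. u k t))\<^sup>2 * indicator {0..} t \<partial>lborel)"
    by (rule nn_integral_cmult) measurable
  also have "\<dots> \<le> (ennreal \<theta> * Z1 \<theta> u) * (ennreal CA * Z2 \<theta> u)"
    by (intro mult_left_mono W_time_integral[OF u(1) th]) simp
  also have "\<dots> < \<infinity>" using Z1 Z2 by (simp add: ennreal_mult_less_top)
  finally have b: "(\<integral>\<^sup>+t. ?b t * indicator {0..} t \<partial>lborel) < \<infinity>" .
  have ceq: "?c t \<le> ennreal (\<nu>\<^sup>2 * \<theta>) * N (\<lambda>k. wt \<theta> k * (norm (wave k))\<^sup>2) (\<lambda>k. u k t)" for t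
  proof -
    have "?c t = N (\<lambda>k. (rate k)\<^sup>2) (\<lambda>k. u k t)" by (simp add: N_def power_mult_distrib)
    also have "\<dots> \<le> N (\<lambda>k. (\<nu>\<^sup>2 * \<theta>) * (wt \<theta> k * (norm (wave k))\<^sup>2)) (\<lambda>k. u k t)"
    proof (rule N_mono)
      fix k
      have "(norm (wave k))\<^sup>2 \<le> \<theta> * wt \<theta> k" using th by (simp add: wt_def distrib_left)
      then have "\<nu>\<^sup>2 * ((norm (wave k))\<^sup>2 * (norm (wave k))\<^sup>2) \<le> \<nu>\<^sup>2 * (\<theta> * wt \<theta> k * (norm (wave k))\<^sup>2)"
        by (intro mult_left_mono mult_right_mono) auto
      then show "(rate k)\<^sup>2 \<le> (\<nu>\<^sup>2 * \<theta>) * (wt \<theta> k * (norm (wave k))\<^sup>2)"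
        by (simp only: rate_def power_mult_distrib power2_eq_square mult_ac)
    qed
    also have "\<dots> = ennreal (\<nu>\<^sup>2 * \<theta>) * N (\<lambda>k. wt \<theta> k * (norm (wave k))\<^sup>2) (\<lambda>k. u k t)"
      using th by (intro N_cmult) (auto intro!: mult_nonneg_nonneg less_imp_le[OF wt_pos])
    finally show ?thesis .
  qed
  have "(\<integral>\<^sup>+t. ?c t * indicator {0..} t \<partial>lborel) \<le> (\<integral>\<^sup>+t. ennreal (\<nu>\<^sup>2 * \<theta>) * (N (\<lambda>k. wt \<theta> k * (norm (wave k))\<^sup>2) (\<lambda>k. u k t) * indicator {0..} t) \<partial>lborel)"
    unfolding mult.assoc[symmetric] by (intro nn_integral_mono mult_right_mono ceq) simp
  also have "\<dots> = ennreal (\<nu>\<^sup>2 * \<theta>) * (\<integral>\<^sup>+t. N (\<lambda>k. wt \<theta> k * (norm (wave k))\<^sup>2) (\<lambda>k. u k t) * indicator {0..} t \<partial>lborel)"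
    by (rule nn_integral_cmult) measurable
  also have "(\<integral>\<^sup>+t. N (\<lambda>k. wt \<theta> k * (norm (wave k))\<^sup>2) (\<lambda>k. u k t) * indicator {0..} t \<partial>lborel) = Z2 \<theta> u"
    unfolding Z2_def using goodD[OF u(1)] th by (intro N_time_integral) (auto intro!: mult_nonneg_nonneg less_imp_le[OF wt_pos])
  also have "ennreal (\<nu>\<^sup>2 * \<theta>) * Z2 \<theta> u < \<infinity>" using Z2 by (simp add: ennreal_mult_less_top)
  finally have c: "(\<integral>\<^sup>+t. ?c t * indicator {0..} t \<partial>lborel) < \<infinity>" .
  have le: "N (\<lambda>_. 1) (\<lambda>k. F k t - NL u u k t - rate k *\<^sub>R u k t) * indicator {0..} t \<le>
      4 * ?a t + (4 * (?b t * indicator {0..} t) + 2 * (?c t * indicator {0..} t))" for t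
  proof (cases "t \<in> {0..}")
    case True
    have "N (\<lambda>_. 1) (\<lambda>k. F k t - NL u u k t - rate k *\<^sub>R u k t) \<le> 2 * N (\<lambda>_. 1) (\<lambda>k. F k t - NL u u k t) + 2 * ?c t"
      by (rule N_diff_le) simp
    also have "\<dots> \<le> 2 * (2 * ?a t + 2 * ?b t) + 2 * ?c t"
      by (intro add_right_mono mult_left_mono N_diff_le) auto
    also have "\<dots> = 4 * ?a t + (4 * ?b t + 2 * ?c t)" by (simp add: distrib_left mult.assoc[symmetric] add.assoc)
    finally show ?thesis using True by simp
  qed simp
  have "(\<integral>\<^sup>+t. N (\<lambda>_. 1) (\<lambda>k. F k t - NL u u k t - rate k *\<^sub>R u k t) * indicator {0..} t \<partial>lborel) \<le>
      (\<integral>\<^sup>+t. 4 * ?a t + (4 * (?b t * indicator {0..} t) + 2 * (?c t * indicator {0..} t)) \<partial>lborel)"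
    by (intro nn_integral_mono le)
  also have "\<dots> = 4 * (\<integral>\<^sup>+t. ?a t \<partial>lborel) + (4 * (\<integral>\<^sup>+t. ?b t * indicator {0..} t \<partial>lborel) + 2 * (\<integral>\<^sup>+t. ?c t * indicator {0..} t \<partial>lborel))"
    by (simp add: nn_integral_add nn_integral_cmult)
  also have "\<dots> < \<infinity>" using Ffin b c by (simp add: ennreal_mult_less_top)
  finally show ?thesis .
qed

section \<open>A mild solution is the strong solution\<close>

context
  fixes u F \<theta> u0 U
  assumes u: "good u" "Z \<theta> u < \<infinity>" and th: "0 < \<theta>" and F: "good F"
    and Ffin: "(\<integral>\<^sup>+t. N (\<lambda>_. 1) (\<lambda>k. F k t) \<partial>lborel) < \<infinity>"
    and u0: "u0 \<in> V_space L 1"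
    and mild: "\<And>k t. 0 \<le> t \<Longrightarrow> u k t = exp (- rate k * t) *\<^sub>R vcoef u0 k + duh (rate k) (\<lambda>s. F k s - NL u u k s) t"
    and U: "\<And>t. 0 \<le> t \<Longrightarrow> U t \<in> L2_per L" "\<And>t k. 0 \<le> t \<Longrightarrow> vcoef (U t) k = u k t"
begin

lemma force_integrable: "set_integrable lborel {0..t} (F k)"
  by (rule L2t_set_integrable[OF goodD[OF F]], rule le_less_trans[OF L2t_le_N[OF goodD[OF F]] Ffin])

lemma mild_V_0: "0 \<le> t \<Longrightarrow> U t \<in> V_space L 0"
  using U good_solenoidal[OF u(1), of t] by (simp add: V_0_iff solenoidal_def)

lemma mild_Linf_time: "U \<in> Linf_time L 1 {0..T}"
proof -
  have I: "{0..T} \<in> sets borel" by simp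
  obtain A where A: "0 \<le> A" "\<And>k. swt 1 k \<le> A * wt \<theta> k" by (rule swt_1_le_wt[OF th]) blast
  have Z1: "Z1 \<theta> u < \<infinity>" using u(2) by (auto simp: Z_def)
  have le: "N (swt 1) (\<lambda>k. u k t) \<le> ennreal A * Z1 \<theta> u" if "0 \<le> t" for t
  proof -
    have "N (swt 1) (\<lambda>k. u k t) \<le> N (\<lambda>k. A * wt \<theta> k) (\<lambda>k. u k t)" by (rule N_mono) (rule A)
    also have "\<dots> = ennreal A * N (wt \<theta>) (\<lambda>k. u k t)"
      using A(1) th by (intro N_cmult) (auto intro: less_imp_le wt_pos)
    also have "\<dots> \<le> ennreal A * Z1 \<theta> u" using that th by (intro mult_left_mono N_le_Z1) auto
    finally show ?thesis .
  qed
  have V: "U t \<in> V_space L 1" if "0 \<le> t" for t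
  proof -
    have "N (swt 1) (\<lambda>k. u k t) < \<infinity>" using le[OF that] Z1 by (auto simp: ennreal_mult_less_top intro: le_less_trans)
    from N_finite_integrable[OF this swt_nonneg] show ?thesis
      using U[OF that] mild_V_0[OF that] by (simp add: V_space_iff V_0_iff)
  qed
  have "bochner_measurable L 1 {0..T} U"
  proof (rule bochner_measurable_of_vcoef)
    show "AE t in lebesgue_on {0..T}. U t \<in> V_space L 1" unfolding AE_lebesgue_on_iff[OF I] using V by auto
    show "(\<lambda>t. vcoef (U t) k) \<in> borel_measurable (lebesgue_on {0..T})" for k
      by (rule coefs_measurable[where c=u, OF I goodD[OF u(1)]]) (use U in auto)
  qed
  moreover have "sobolev_norm L 1 (U t) \<le> sqrt (enn2real (ennreal vol * (ennreal A * Z1 \<theta> u)))" if t: "t \<in> {0..T}" for t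
  proof (rule real_le_rsqrt)
    have t0: "0 \<le> t" using t by simp
    have c: "vcoef (U t) = (\<lambda>k. u k t)" using U(2)[OF t0] by auto
    have "ennreal ((sobolev_norm L 1 (U t))\<^sup>2) \<le> ennreal vol * (ennreal A * Z1 \<theta> u)"
      unfolding sobolev_norm_nn[OF V_space_sobolev[OF V[OF t0]]] c by (intro mult_left_mono le t0) simp
    then have "enn2real (ennreal ((sobolev_norm L 1 (U t))\<^sup>2)) \<le> enn2real (ennreal vol * (ennreal A * Z1 \<theta> u))"
      using Z1 by (intro enn2real_mono) (auto simp: ennreal_mult_less_top)
    then show "(sobolev_norm L 1 (U t))\<^sup>2 \<le> enn2real (ennreal vol * (ennreal A * Z1 \<theta> u))" by simp
  qed
  ultimately show ?thesis unfolding Linf_time_def AE_lebesgue_on_iff[OF I] by blast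
qed

lemma mild_N_swt_2: "(\<integral>\<^sup>+t. N (swt 2) (\<lambda>k. u k t) * indicator {0..} t \<partial>lborel) < \<infinity>"
proof -
  note [measurable] = goodD[OF u(1)]
  obtain A where A: "0 \<le> A" "\<And>k. k \<noteq> 0 \<Longrightarrow> swt 2 k \<le> A * (wt \<theta> k * (norm (wave k))\<^sup>2)" by (rule swt_2_le_wt[OF th]) blast
  have w: "0 \<le> wt \<theta> k * (norm (wave k))\<^sup>2" for k using wt_pos[OF th, of k] by simp
  have "N (swt 2) (\<lambda>k. u k t) \<le> ennreal A * N (\<lambda>k. wt \<theta> k * (norm (wave k))\<^sup>2) (\<lambda>k. u k t)" for t
  proof -
    have "N (swt 2) (\<lambda>k. u k t) \<le> N (\<lambda>k. A * (wt \<theta> k * (norm (wave k))\<^sup>2)) (\<lambda>k. u k t)"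
      unfolding N_def
    proof (intro nn_integral_mono ennreal_leI)
      fix k show "swt 2 k * (norm (u k t))\<^sup>2 \<le> A * (wt \<theta> k * (norm (wave k))\<^sup>2) * (norm (u k t))\<^sup>2"
        using A(2)[of k] good_0[OF u(1), of t] by (cases "k = 0") (auto intro: mult_right_mono)
    qed
    also have "\<dots> = ennreal A * N (\<lambda>k. wt \<theta> k * (norm (wave k))\<^sup>2) (\<lambda>k. u k t)" by (rule N_cmult[OF A(1) w])
    finally show ?thesis .
  qed
  then have "(\<integral>\<^sup>+t. N (swt 2) (\<lambda>k. u k t) * indicator {0..} t \<partial>lborel) \<le>
      (\<integral>\<^sup>+t. ennreal A * (N (\<lambda>k. wt \<theta> k * (norm (wave k))\<^sup>2) (\<lambda>k. u k t) * indicator {0..} t) \<partial>lborel)"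
    unfolding mult.assoc[symmetric] by (intro nn_integral_mono mult_right_mono) auto
  also have "\<dots> = ennreal A * (\<integral>\<^sup>+t. N (\<lambda>k. wt \<theta> k * (norm (wave k))\<^sup>2) (\<lambda>k. u k t) * indicator {0..} t \<partial>lborel)"
    by (rule nn_integral_cmult) measurable
  also have "(\<integral>\<^sup>+t. N (\<lambda>k. wt \<theta> k * (norm (wave k))\<^sup>2) (\<lambda>k. u k t) * indicator {0..} t \<partial>lborel) = Z2 \<theta> u"
    unfolding Z2_def using goodD[OF u(1)] w by (intro N_time_integral) auto
  also have "ennreal A * Z2 \<theta> u < \<infinity>" using u(2) by (auto simp: Z_def ennreal_mult_less_top)
  finally show ?thesis .
qed

lemma mild_V_2: "AE t in lborel. t \<in> {0..} \<longrightarrow> U t \<in> V_space L 2"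
proof -
  note [measurable] = goodD[OF u(1)]
  have "AE t in lborel. t \<in> {0..} \<longrightarrow> N (swt 2) (\<lambda>k. u k t) < \<infinity>"
    by (rule AE_finite_time[OF _ mild_N_swt_2]) auto
  then show ?thesis
  proof eventually_elim
    case (elim t)
    show ?case
    proof
      assume t: "t \<in> {0..}"
      then have "integrable modes (\<lambda>k. swt 2 k * (norm (u k t))\<^sup>2)" using elim by (intro N_finite_integrable swt_nonneg) auto
      then show "U t \<in> V_space L 2" using U[of t] mild_V_0[of t] t by (simp add: V_space_iff V_0_iff)
    qed
  qed
qed

lemma mild_L2_time: "U \<in> L2_time L 2 {0..T}"
proof (rule L2_time_of_coefs[OF _ goodD[OF u(1)]])
  show "AE t in lborel. t \<in> {0..T} \<longrightarrow> U t \<in> V_space L 2 \<and> (\<forall>k. vcoef (U t) k = u k t)"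
    using mild_V_2 by eventually_elim (use U in auto)
  have "(\<integral>\<^sup>+t. N (swt 2) (\<lambda>k. u k t) * indicator {0..T} t \<partial>lborel) \<le> (\<integral>\<^sup>+t. N (swt 2) (\<lambda>k. u k t) * indicator {0..} t \<partial>lborel)"
    by (intro nn_integral_mono mult_left_mono) (auto simp: indicator_def)
  also note mild_N_swt_2
  finally show "(\<integral>\<^sup>+t. N (swt 2) (\<lambda>k. u k t) * indicator {0..T} t \<partial>lborel) < \<infinity>" .
qed simp

theorem mild_strong_solution:
  assumes f: "AE t in lborel. t \<in> {0..T} \<longrightarrow> f t \<in> V_space L 0 \<and> (\<forall>k. vcoef (f t) k = F k t)"
  shows "strong_solution L \<nu> f u0 T U"
proof -
  let ?I = "{0..T}"
  have I: "?I \<in> sets borel" by simp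
  define g where "g k t = F k t - NL u u k t - rate k *\<^sub>R u k t" for k t
  note [measurable] = goodD[OF u(1)] goodD[OF F] goodD[OF good_NL[OF u(1) u(1)]]
  have gm [measurable]: "g k \<in> borel_measurable borel" for k unfolding g_def by measurable
  have gfin: "(\<integral>\<^sup>+t. N (\<lambda>_. 1) (\<lambda>k. g k t) * indicator {0..} t \<partial>lborel) < \<infinity>"
    unfolding g_def by (rule derivative_coefs_square_integrable[OF u th F Ffin])
  have gfin': "(\<integral>\<^sup>+s. N (\<lambda>_. 1) (\<lambda>k. g k s) * indicator {0..t} s \<partial>lborel) < \<infinity>" for t
    by (rule le_less_trans[OF _ gfin]) (intro nn_integral_mono mult_left_mono, auto simp: indicator_def)
  have gg: "solenoidal (\<lambda>k. g k t)" "hermitian (\<lambda>k. g k t)" for t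
  proof -
    have "good (\<lambda>k t. rate k *\<^sub>R u k t)"
      unfolding good_def
    proof (intro conjI allI)
      show "(\<lambda>t. rate k *\<^sub>R u k t) \<in> borel_measurable borel" for k by measurable
      show "solenoidal (\<lambda>k. rate k *\<^sub>R u k t)" "hermitian (\<lambda>k. rate k *\<^sub>R u k t)" for t
        using good_solenoidal[OF u(1), of t] good_hermitian[OF u(1), of t]
        by (simp_all add: solenoidal_def hermitian_def rdot_scaleR rate_def wave_minus cnjv_def vec_eq_iff)
    qed
    then have "good g" unfolding g_def by (intro good_diff F good_NL u(1))
    then show "solenoidal (\<lambda>k. g k t)" "hermitian (\<lambda>k. g k t)" by (rule good_solenoidal, rule good_hermitian)
  qed
  have gi: "set_integrable lborel {0..t} (g k)" for t k
  proof (rule L2t_set_integrable[OF gm])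
    have "L2t (g k) \<le> (\<integral>\<^sup>+t. N (\<lambda>_. 1) (\<lambda>k. g k t) * indicator {0..} t \<partial>lborel)"
      unfolding L2t_def using N_point[of "\<lambda>_. 1" k "\<lambda>k. g k _"] by (intro nn_integral_mono mult_right_mono) auto
    then show "L2t (g k) < \<infinity>" using gfin by (rule le_less_trans)
  qed
  \<comment> \<open>Only at these times are the coefficients of the derivative those of a field.
    Elsewhere, on a null set of the half line, the choice of \<open>U'\<close> is arbitrary.\<close>
  define E where "E = {t. 0 \<le> t \<and> N (\<lambda>_. 1) (\<lambda>k. g k t) < \<infinity>}"
  obtain U' where U': "\<And>t. t \<in> E \<Longrightarrow> U' t \<in> L2_per L" "\<And>t k. t \<in> E \<Longrightarrow> vcoef (U' t) k = g k t"
    by (rule fields_of_coefficients[of E g, OF _ gg(2)]) (auto simp: E_def intro: that)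
  have AE_E: "AE t in lborel. t \<in> {0..} \<longrightarrow> t \<in> E"
  proof -
    have "AE t in lborel. t \<in> {0..} \<longrightarrow> N (\<lambda>_. 1) (\<lambda>k. g k t) < \<infinity>" by (rule AE_finite_time[OF _ gfin]) auto
    then show ?thesis by eventually_elim (simp add: E_def)
  qed
  have U'V: "U' t \<in> V_space L 0" if "t \<in> E" for t
    using U'[OF that] gg(1)[of t] by (simp add: V_0_iff solenoidal_def)
  have d: "has_time_derivative L T U U'"
    unfolding has_time_derivative_def
  proof (intro conjI ballI)
    show "U' \<in> L2_time L 0 ?I"
    proof (rule L2_time_of_coefs[OF I gm])
      show "AE t in lborel. t \<in> ?I \<longrightarrow> U' t \<in> V_space L 0 \<and> (\<forall>k. vcoef (U' t) k = g k t)"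
        using AE_E by eventually_elim (use U'V U' in auto)
      have "swt 0 = (\<lambda>_. 1)" by (simp add: swt_0 fun_eq_iff)
      then show "(\<integral>\<^sup>+t. N (swt 0) (\<lambda>k. g k t) * indicator ?I t \<partial>lborel) < \<infinity>" using gfin' by simp
    qed
    fix t assume "t \<in> ?I"
    then have t: "0 \<le> t" by simp
    show "U t \<in> V_space L 0" by (rule mild_V_0[OF t])
    fix v assume v: "v \<in> V_space L 0"
    then have vL: "v \<in> L2_per L" by (simp add: V_0_iff)
    let ?a = "vcoef v"
    have a: "N (\<lambda>_. 1) ?a < \<infinity>"
    proof -
      have "ennreal vol * N (\<lambda>_. 1) ?a < \<infinity>" unfolding L2_norm_nn[OF vL, symmetric] by simp
      then show ?thesis using vol_pos by (auto simp: ennreal_mult_less_top)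
    qed
    have eq: "u k t = u k 0 + (LINT s|lborel. indicator {0..t} s *\<^sub>R g k s)" for k
    proof -
      have "u k 0 = vcoef u0 k" using mild[of 0 k] by (simp add: duh_0)
      moreover have "u k t = vcoef u0 k + (LINT s|lborel. indicator {0..t} s *\<^sub>R (F k s - NL u u k s - rate k *\<^sub>R u k s))"
      proof (rule mild_integral_equation[OF _ _ rate_nonneg t])
        show "set_integrable lborel {0..t} (\<lambda>s. F k s - NL u u k s)"
          by (intro set_integral_diff force_integrable NL_set_integrable[OF u(1) u(1) th u(2) u(2)])
      qed (use mild in auto)
      ultimately show ?thesis by (simp add: g_def)
    qed
    have i: "integrable modes (\<lambda>k. u k s \<bullet> ?a k)" and p: "L2_inner L (U s) v = vol * (LINT k|modes. u k s \<bullet> ?a k)" if "0 \<le> s" for s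
      using L2_inner_parseval[OF U(1)[OF that] vL] by (simp_all add: U(2)[OF that])
    have ae: "AE s in lebesgue_on {0..t}. vol * (LINT k|modes. g k s \<bullet> ?a k) = L2_inner L (U' s) v"
    proof -
      have "AE s in lborel. s \<in> {0..t} \<longrightarrow> vol * (LINT k|modes. g k s \<bullet> ?a k) = L2_inner L (U' s) v"
        using AE_E by eventually_elim (use L2_inner_parseval(2)[OF U'(1) vL] U'(2) in auto)
      then show ?thesis by (subst AE_lebesgue_on_iff) auto
    qed
    have m: "(\<lambda>s. LINT k|modes. g k s \<bullet> ?a k) \<in> borel_measurable borel"
    proof -
      have "case_prod (\<lambda>k s. g k s \<bullet> ?a k) \<in> borel_measurable (modes \<Otimes>\<^sub>M borel)"
        by (rule measurable_pair_measure_countable1) auto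
      from measurable_pair_swap[OF this]
      have "case_prod (\<lambda>s k. g k s \<bullet> ?a k) \<in> borel_measurable (borel \<Otimes>\<^sub>M modes)" by (simp add: split_beta')
      then show ?thesis
        by (rule sigma_finite_measure.borel_measurable_lebesgue_integral[OF sigma_finite_measure_count_space_countable, rotated]) simp
    qed
    have "(LINT s|lebesgue_on {0..t}. L2_inner L (U' s) v) = (LINT s|lebesgue_on {0..t}. vol * (LINT k|modes. g k s \<bullet> ?a k))"
    proof (rule integral_cong_AE[symmetric])
      show m': "(\<lambda>s. vol * (LINT k|modes. g k s \<bullet> ?a k)) \<in> borel_measurable (lebesgue_on {0..t})"
        using m by (intro borel_lebesgue_on) measurable
      show "(\<lambda>s. L2_inner L (U' s) v) \<in> borel_measurable (lebesgue_on {0..t})"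
        by (rule measurable_cong_AE_lebesgue_on[OF _ m' ae]) simp
    qed (rule ae)
    also have "\<dots> = (LINT s|lborel. vol * (indicator {0..t} s *\<^sub>R (LINT k|modes. g k s \<bullet> ?a k)))"
      using m by (subst integral_lebesgue_on_borel) (auto simp: mult_ac)
    also have "\<dots> = vol * (LINT s|lborel. indicator {0..t} s *\<^sub>R (LINT k|modes. g k s \<bullet> ?a k))"
      by (rule integral_mult_right_zero)
    also have "(LINT s|lborel. indicator {0..t} s *\<^sub>R (LINT k|modes. g k s \<bullet> ?a k)) =
        (LINT k|modes. (LINT s|lborel. indicator {0..t} s *\<^sub>R g k s) \<bullet> ?a k)"
      by (rule time_integral_inner[OF gm a gfin' gi])
    also have "\<dots> = (LINT k|modes. (u k t \<bullet> ?a k - u k 0 \<bullet> ?a k))"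
      by (intro Bochner_Integration.integral_cong refl) (subst eq, simp add: inner_add_left)
    also have "\<dots> = (LINT k|modes. u k t \<bullet> ?a k) - (LINT k|modes. u k 0 \<bullet> ?a k)"
      by (rule Bochner_Integration.integral_diff[OF i[OF t] i]) simp
    finally show "L2_inner L (U t) v = L2_inner L (U 0) v + (LINT s|lebesgue_on {0..t}. L2_inner L (U' s) v)"
      by (simp add: p t algebra_simps)
  qed
  have eq: "AE t in lebesgue_on ?I. AE x in \<mu>. U' t x + \<nu> *\<^sub>R stokes L (U t) x + leray_proj L (advection L (U t) (U t)) x = f t x"
    unfolding AE_lebesgue_on_iff[OF I] using f AE_E mild_V_2 AE_W_finite[OF u(1) th u(2)]
  proof eventually_elim
    case (elim t)
    show ?case
    proof
      assume t: "t \<in> ?I"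
      then have e: "t \<in> E" "0 \<le> t" "f t \<in> V_space L 0" "U t \<in> V_space L 2" using elim by auto
      have c: "vcoef (U t) = (\<lambda>k. u k t)" using U(2)[OF e(2)] by auto
      have Wf: "W (vcoef (U t)) < \<infinity>" using elim e by (simp add: c)
      have fc: "vcoef (f t) k = F k t" for k using elim t by blast
      show "AE x in \<mu>. U' t x + \<nu> *\<^sub>R stokes L (U t) x + leray_proj L (advection L (U t) (U t)) x = f t x"
        using e by (subst vcoef_equation[OF e(4) Wf U'(1)]) (auto simp: V_0_iff fc U'(2) c g_def NL_def)
    qed
  qed
  have "AE x in \<mu>. U 0 x = u0 x"
    by (rule AE_eq_of_vcoef_eq[OF U(1)]) (use u0 mild[of 0] in \<open>auto simp: V_space_iff U(2) duh_0\<close>)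
  then show ?thesis
    unfolding strong_solution_def using mild_Linf_time mild_L2_time d eq by blast
qed

text \<open>Strong regularity places the cut-off coefficients of \<open>v\<close> in
  \<open>energy_class\<close>, and finiteness of \<open>Z\<close> does so for \<open>u\<close>. Both
  satisfy the same mild equation on \<open>{0..S}\<close>, so the linear parts cancel in the
  difference.\<close>

theorem mild_unique_strong_solution:
  assumes f: "AE t in lborel. t \<in> {0..S} \<longrightarrow> f t \<in> V_space L 0 \<and> (\<forall>k. vcoef (f t) k = F k t)"
    and S: "0 < S" and v: "strong_solution L \<nu> f u0 S v" and t: "t \<in> {0..S}"
  shows "AE x in \<mu>. v t x = U t x"
proof -
  let ?c = "\<lambda>k t. if t \<in> {0..S} then vcoef (v t) k else 0"
  note sc = strong_solution_coefs[OF v S F force_integrable f u0]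
  have eu: "energy_class u"
    unfolding energy_class_def
  proof (intro conjI exI[of _ "ennreal (1 / \<theta>) * Z1 \<theta> u"])
    show "(\<integral>\<^sup>+t. (W (\<lambda>k. u k t))\<^sup>2 * indicator {0..} t \<partial>lborel) < \<infinity>"
      by (rule le_less_trans[OF W_time_integral[OF u(1) th]]) (use u(2) in \<open>auto simp: Z_def ennreal_mult_less_top\<close>)
    show "ennreal (1 / \<theta>) * Z1 \<theta> u < \<infinity>" using u(2) by (auto simp: Z_def ennreal_mult_less_top)
    have "N (\<lambda>_. 1) (\<lambda>k. u k t) \<le> ennreal (1 / \<theta>) * Z1 \<theta> u" if "0 \<le> t" for t
      by (rule order_trans[OF N_1_le[OF th]]) (intro mult_left_mono N_le_Z1 that th, simp)
    then show "AE t in lborel. t \<in> {0..} \<longrightarrow> N (\<lambda>_. 1) (\<lambda>k. u k t) \<le> ennreal (1 / \<theta>) * Z1 \<theta> u" by simp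
  qed (rule u(1))
  have eq: "u k t - ?c k t = - (duh (rate k) (NL u u k) t - duh (rate k) (NL ?c ?c k) t)" if t: "t \<in> {0..S}" for k t
  proof -
    have "u k t = exp (- rate k * t) *\<^sub>R vcoef u0 k + (duh (rate k) (F k) t - duh (rate k) (NL u u k) t)"
      using mild[of t k] t by (simp only: duh_diff[OF force_integrable energy_class_NL_integrable[OF eu] rate_nonneg] atLeastAtMost_iff)
    moreover have "?c k t = exp (- rate k * t) *\<^sub>R vcoef u0 k + (duh (rate k) (F k) t - duh (rate k) (NL ?c ?c k) t)"
      using sc(2)[OF t, of k] by (simp only: duh_diff[OF force_integrable energy_class_NL_integrable[OF sc(1)] rate_nonneg])
    ultimately show ?thesis by (simp only:) simp
  qed
  have "u k t = ?c k t" for k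
    by (rule mild_unique_energy[OF eu sc(1) eq t])
  then have "vcoef (v t) k = vcoef (U t) k" for k using t U(2) by simp
  moreover have "v t \<in> L2_per L" using v t by (auto simp: strong_solution_def has_time_derivative_def V_0_iff)
  moreover have "U t \<in> L2_per L" using U(1) t by simp
  ultimately show ?thesis by (intro AE_eq_of_vcoef_eq)
qed

end

end

context torus begin

section \<open>Norms and force spaces of the statement\<close>

lemma sobolev_norm_0:
  assumes "u \<in> V_space L 0" shows "(sobolev_norm L 0 u)\<^sup>2 = (L2_norm L u)\<^sup>2"
proof -
  have "swt 0 = (\<lambda>_. 1)" by (simp add: swt_0 fun_eq_iff)
  then have "ennreal ((sobolev_norm L 0 u)\<^sup>2) = ennreal ((L2_norm L u)\<^sup>2)"
    using sobolev_norm_nn[OF V_space_sobolev[OF assms]] L2_norm_nn[of u] assms by (simp add: V_0_iff)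
  then show ?thesis by simp
qed

lemma integral_L2_norm:
  assumes I: "I \<in> sets borel" and f: "f \<in> L2_time L 0 I"
  shows "(LINT t|lebesgue_on I. (L2_norm L (f t))\<^sup>2) = (LINT t|lebesgue_on I. (sobolev_norm L 0 (f t))\<^sup>2)"
proof -
  have V: "AE t in lebesgue_on I. f t \<in> V_space L 0" and i: "integrable (lebesgue_on I) (\<lambda>t. (sobolev_norm L 0 (f t))\<^sup>2)"
    using f by (auto simp: L2_time_def bochner_measurable_def)
  have ae: "AE t in lebesgue_on I. (sobolev_norm L 0 (f t))\<^sup>2 = (L2_norm L (f t))\<^sup>2"
    using V by eventually_elim (rule sobolev_norm_0)
  have "(\<lambda>t. (L2_norm L (f t))\<^sup>2) \<in> borel_measurable (lebesgue_on I)"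
    by (rule measurable_cong_AE_lebesgue_on[OF _ borel_measurable_integrable[OF i] ae]) (use I in \<open>simp add: sets_completionI_sets\<close>)
  then show ?thesis using i ae by (intro integral_cong_AE[symmetric]) auto
qed

lemma const_L2_time:
  assumes f: "f \<in> V_space L 0"
  shows "(\<lambda>_. f) \<in> L2_time L 0 {0..T}"
proof -
  have "bochner_measurable L 0 {0..T} (\<lambda>_. f)"
    by (rule bochner_measurable_of_vcoef) (use f in auto)
  moreover have "integrable (lebesgue_on {0..T}) (\<lambda>t. (sobolev_norm L 0 f)\<^sup>2)"
    by (rule finite_measure.integrable_const) (auto intro!: finite_measureI simp: emeasure_restrict_space emeasure_lborel_Icc_eq)
  ultimately show ?thesis by (simp add: L2_time_def)
qed

end

context navier begin

text \<open>\<open>U\<close> is fixed before \<open>T\<close>: the force coefficients vanish outside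
  \<open>I\<close>, the mild solution exists on the half line, and each horizon inside
  \<open>I\<close> merely restricts it.\<close>

theorem the_strong_solution_exists:
  assumes u0: "u0 \<in> V_space L 1" and I: "I \<in> sets borel" and f: "f \<in> L2_time L 0 I"
    and small: "CS * ((L2_norm L u0)\<^sup>2 + (LINT t|lebesgue_on I. (L2_norm L (f t))\<^sup>2)) + arctan ((sobolev_norm L 1 u0)\<^sup>2) < pi / 2"
  obtains U where "\<And>T. 0 < T \<Longrightarrow> {0..T} \<subseteq> I \<Longrightarrow> the_strong_solution L \<nu> f u0 T U"
proof -
  obtain F where F: "AE t in lborel. t \<in> I \<longrightarrow> f t \<in> V_space L 0 \<and> (\<forall>k. vcoef (f t) k = F k t)"
    "(\<integral>\<^sup>+t. N (\<lambda>_. 1) (\<lambda>k. F k t) \<partial>lborel) = ennreal ((1 / vol) * (LINT t|lebesgue_on I. (sobolev_norm L 0 (f t))\<^sup>2))"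
    "good F"
    by (rule L2_time_coefs[OF f I]) (rule that)
  define J where "J = (LINT t|lebesgue_on I. (L2_norm L (f t))\<^sup>2)"
  have J0: "0 \<le> J" unfolding J_def by (rule Bochner_Integration.integral_nonneg) simp
  have FJ: "(\<integral>\<^sup>+t. N (\<lambda>_. 1) (\<lambda>k. F k t) \<partial>lborel) \<le> ennreal (J / vol)"
    unfolding F(2) J_def integral_L2_norm[OF I f] by simp
  then have Ffin: "(\<integral>\<^sup>+t. N (\<lambda>_. 1) (\<lambda>k. F k t) \<partial>lborel) < \<infinity>" by (rule le_less_trans) simp
  obtain u \<theta> where u: "0 < \<theta>" "good u" "Z \<theta> u < \<infinity>"
    "\<And>k t. 0 \<le> t \<Longrightarrow> u k t = exp (- rate k * t) *\<^sub>R vcoef u0 k + duh (rate k) (\<lambda>s. F k s - NL u u k s) t"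
    by (rule small_data_mild_solution[OF u0 F(3) FJ J0 small[folded J_def]]) (rule that)
  obtain U where U: "\<And>t. t \<in> {0..} \<Longrightarrow> U t \<in> L2_per L" "\<And>t k. t \<in> {0..} \<Longrightarrow> vcoef (U t) k = u k t"
    by (rule fields_of_coefficients[of "{0..}" u, OF N_1_finite[OF _ u(1,3)] good_hermitian[OF u(2)]]) (auto intro: that)
  have U': "\<And>t. 0 \<le> t \<Longrightarrow> U t \<in> L2_per L" "\<And>t k. 0 \<le> t \<Longrightarrow> vcoef (U t) k = u k t" using U by auto
  have Fsub: "AE t in lborel. t \<in> {0..S} \<longrightarrow> f t \<in> V_space L 0 \<and> (\<forall>k. vcoef (f t) k = F k t)" if "{0..S} \<subseteq> I" for S
    using F(1) by eventually_elim (use that in auto)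
  note ctx = u(2,3,1) F(3) Ffin u0 u(4) U'
  show thesis
  proof (rule that[of U])
    fix T :: real assume T: "0 < T" "{0..T} \<subseteq> I"
    show "the_strong_solution L \<nu> f u0 T U"
      unfolding the_strong_solution_def
    proof (intro conjI allI impI ballI)
      show "strong_solution L \<nu> f u0 T U" by (rule mild_strong_solution[OF ctx Fsub[OF T(2)]])
      fix S v t assume S: "0 < S \<and> S \<le> T \<and> strong_solution L \<nu> f u0 S v" and t: "t \<in> {0..S}"
      then have "{0..S} \<subseteq> I" using T(2) by auto
      from mild_unique_strong_solution[OF ctx Fsub[OF this] _ _ t] S
      show "AE x in \<mu>. v t x = U t x" by blast
    qed
  qed
qed

end

theorem theorem3p3:
  fixes L :: "real^3" and \<nu> :: real
  assumes "\<And>i. 0 < L $ i" and "0 < \<nu>"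
  shows "\<exists>c8 c9 c10 c11 :: real. 0 < c8 \<and> 0 < c9 \<and> 0 < c10 \<and> 0 < c11 \<and>
    (\<forall>u\<^sub>0 \<in> V_space L 1.
      (\<forall>(T::real) f. 0 < T \<longrightarrow> f \<in> V_space L 0 \<longrightarrow>
         c8 * T * (L2_norm L f)\<^sup>2 + c9 * (L2_norm L u\<^sub>0)\<^sup>2 + arctan ((sobolev_norm L 1 u\<^sub>0)\<^sup>2) < pi / 2 \<longrightarrow>
         (\<exists>u. the_strong_solution L \<nu> (\<lambda>t. f) u\<^sub>0 T u)) \<and>
      (\<forall>(T::ereal) f. 0 < T \<longrightarrow> f \<in> L2_time L 0 (time_interval T) \<longrightarrow>
         c10 * (LINT s|lebesgue_on (time_interval T). (L2_norm L (f s))\<^sup>2)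
           + c11 * (L2_norm L u\<^sub>0)\<^sup>2 + arctan ((sobolev_norm L 1 u\<^sub>0)\<^sup>2) < pi / 2 \<longrightarrow>
         (\<exists>u. \<forall>T'::real. 0 < T' \<and> ereal T' \<le> T \<longrightarrow> the_strong_solution L \<nu> f u\<^sub>0 T' u)))"
proof -
  interpret navier L \<nu> by unfold_locales (use assms in auto)
  \<comment> \<open>One constant serves for all four. A time-independent force is an element of
    \<open>L2_time\<close> on \<open>{0..T}\<close> whose squared norm integrates to
    \<open>T\<close> times that of \<open>f\<close>, so the first case is an instance of the same
    existence result.\<close>
  have CS0: "0 < CS" using CS(1) by simp
  show ?thesis
  proof (rule exI[of _ CS], rule exI[of _ CS], rule exI[of _ CS], rule exI[of _ CS], intro conjI CS0 ballI allI impI)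
    fix u0 assume u0: "u0 \<in> V_space L 1"
    {
      fix T :: real and f
      assume T: "0 < T" and f: "f \<in> V_space L 0"
        and small: "CS * T * (L2_norm L f)\<^sup>2 + CS * (L2_norm L u0)\<^sup>2 + arctan ((sobolev_norm L 1 u0)\<^sup>2) < pi / 2"
      have int: "(LINT t|lebesgue_on {0..T}. (L2_norm L f)\<^sup>2) = T * (L2_norm L f)\<^sup>2"
        using T by (simp add: measure_restrict_space)
      have "CS * ((L2_norm L u0)\<^sup>2 + (LINT t|lebesgue_on {0..T}. (L2_norm L f)\<^sup>2)) + arctan ((sobolev_norm L 1 u0)\<^sup>2) < pi / 2"
        unfolding int using small by (simp add: algebra_simps)
      then obtain U where "\<And>S. 0 < S \<Longrightarrow> {0..S} \<subseteq> {0..T} \<Longrightarrow> the_strong_solution L \<nu> (\<lambda>_. f) u0 S U"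
        by (rule the_strong_solution_exists[OF u0 _ const_L2_time[OF f], rotated]) (auto intro: that)
      then show "\<exists>u. the_strong_solution L \<nu> (\<lambda>t. f) u0 T u" using T by blast
    next
      fix T :: ereal and f
      assume T: "0 < T" and f: "f \<in> L2_time L 0 (time_interval T)"
        and small: "CS * (LINT s|lebesgue_on (time_interval T). (L2_norm L (f s))\<^sup>2)
           + CS * (L2_norm L u0)\<^sup>2 + arctan ((sobolev_norm L 1 u0)\<^sup>2) < pi / 2"
      have "time_interval T = {t \<in> space borel. 0 \<le> t \<and> ereal t \<le> T}" by (simp add: time_interval_def)
      also have "\<dots> \<in> sets borel" by measurable
      finally have I: "time_interval T \<in> sets borel" .
      obtain U where U: "\<And>S. 0 < S \<Longrightarrow> {0..S} \<subseteq> time_interval T \<Longrightarrow> the_strong_solution L \<nu> f u0 S U"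
        by (rule the_strong_solution_exists[OF u0 I f]) (use small in \<open>auto simp: algebra_simps intro: that\<close>)
      have "{0..S} \<subseteq> time_interval T" if "ereal S \<le> T" for S
        using that by (auto simp: time_interval_def intro: order_trans[of "ereal _" "ereal S"])
      then show "\<exists>u. \<forall>T'::real. 0 < T' \<and> ereal T' \<le> T \<longrightarrow> the_strong_solution L \<nu> f u0 T' u"
        using U by blast
    }
  qed
qed

end
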